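(* Let $0\leq q\in\mathbb{Z}$ and $\varphi\in\mathcal{M}$. Then the condition $$\int_1^\infty\frac{dt}{t\,\varphi^2(t)}<\infty$$ is equivalent to the property that the identity mapping $u\mapsto u$, with $u\in C^\infty(\Gamma,V)$, extends uniquely to a continuous embedding $H^{q+n/2,\varphi}(\Gamma,V)\hookrightarrow C^q(\Gamma,V)$. Moreover, this embedding is compact.
   Context: **Class $\mathcal{M}$.** $\mathcal{M}$ is the set of all Borel measurable functions $\varphi:[1,\infty)\to(0,\infty)$ such that (i) $\varphi$ and $1/\varphi$ are bounded on each interval $[1,b]$ with $1<b<\infty$; (ii) $\lim_{t\to\infty}\varphi(\lambda t)/\varphi(t)=1$ for every $\lambda>0$. **Spaces on $\mathbb{R}^n$.** Let $\langle\xi\rangle=(1+|\xi|^2)^{1/2}$. For $s\in\mathbb{R}$, $\varphi\in\mathcal{M}$, $H^{s,\varphi}(\mathbb{R}^n)$ is the Hilbert space of all tempered distributions $w$ on $\mathbb{R}^n$ whose Fourier transform $\widehat w$ is locally integrable and satisfies $\|w\|_{s,\varphi;\mathbb{R}^n}^2:=\int_{\mathbb{R}^n}\langle\xi\rangle^{2s}\varphi^2(\langle\xi\rangle)|\widehat w(\xi)|^2\,d\xi<\infty$. **Spaces on a vector bundle.** $\Gamma$ is a closed (compact, without boundary) infinitely smooth real manifold of dimension $n\ge1$ with a given $C^\infty$-density $dx$, and $\pi:V\to\Gamma$ is an infinitely smooth complex vector bundle of rank $p\ge1$; $C^\infty(\Gamma,V)$ is the space of its smooth sections. Choose a finite atlas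 of local charts (smooth diffeomorphisms) $\alpha_j:\mathbb{R}^n\leftrightarrow\Gamma_j$, $j=1,\dots,\varkappa$, where the open sets $\Gamma_j$ cover $\Gamma$, local trivializations $\beta_j:\pi^{-1}(\Gamma_j)\leftrightarrow\Gamma_j\times\mathbb{C}^p$, and real-valued $\chi_j\in C^\infty(\Gamma)$ with $\mathrm{supp}\,\chi_j\subset\Gamma_j$ forming a partition of unity on $\Gamma$. Let $\Pi_k:(x,a)\mapsto a_k$ for $x\in\Gamma$, $a=(a_1,\dots,a_p)\in\mathbb{C}^p$, and for a section $u$ put $u_{j,k}:=\Pi_k(\beta_j\circ(\chi_ju)\circ\alpha_j)$, a function on $\mathbb{R}^n$. $H^{s,\varphi}(\Gamma,V)$ is the completion of $C^\infty(\Gamma,V)$ in the Hilbert norm $$\|u\|_{s,\varphi;\Gamma,V}:=\Bigl(\sum_{j=1}^{\varkappa}\sum_{k=1}^{p}\|u_{j,k}\|^2_{s,\varphi;\mathbb{R}^n}\Bigr)^{1/2}.$$ **The space $C^q(\Gamma,V)$** is the Banach space of all $q$ times continuously differentiable sections $u:\Gamma\to V$ with norm $\sum_{j=1}^{\varkappa}\sum_{k=1}^p\|u_{j,k}\|_{(q);\mathbb{R}^n}$, where $\|w\|_{(q);\mathbb{R}^n}$ is the sum, over all partial derivatives of $w$ of order $\le q$, of their suprema of absolute value on $\mathbb{R}^n$. A continuous embedding is an injective bounded linear operator. *)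

theory Defs
  imports "HOL-Analysis.Analysis" "HOL-Library.Multiset" "HOL-Library.FuncSet"
begin

section \<open>Differentiability classes on Euclidean space\<close>

text \<open>Only used for open \<open>S\<close>.\<close>

primrec Ck_on :: "nat \<Rightarrow> 'a::euclidean_space set \<Rightarrow> ('a \<Rightarrow> 'b::real_normed_vector) \<Rightarrow> bool" where
  "Ck_on 0 S f \<longleftrightarrow> continuous_on S f"
| "Ck_on (Suc k) S f \<longleftrightarrow> (\<forall>x\<in>S. f differentiable (at x)) \<and>
     (\<forall>v. Ck_on k S (\<lambda>x. frechet_derivative f (at x) v))"

definition smooth_on :: "'a::euclidean_space set \<Rightarrow> ('a \<Rightarrow> 'b::real_normed_vector) \<Rightarrow> bool" where
  "smooth_on S f \<longleftrightarrow> (\<forall>k. Ck_on k S f)"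

primrec pderivs :: "'n::finite list \<Rightarrow> (real^'n \<Rightarrow> 'b::real_normed_vector) \<Rightarrow> real^'n \<Rightarrow> 'b" where
  "pderivs [] f = f"
| "pderivs (i # is) f = (\<lambda>x. frechet_derivative (pderivs is f) (at x) (axis i 1))"

text \<open>A multi-index is a multiset of coordinate indices, its order is the size of the multiset.
  The order in which the differentiations are carried out is immaterial for the functions
  of class \<open>C\<^sup>k\<close>, \<open>k \<ge> size \<mu>\<close>, to which this is applied.\<close>

definition pderiv_multi :: "'n::finite multiset \<Rightarrow> (real^'n \<Rightarrow> 'b::real_normed_vector) \<Rightarrow> real^'n \<Rightarrow> 'b" where
  "pderiv_multi \<mu> f = pderivs (SOME is. mset is = \<mu>) f"

definition Cq_norm_Rn :: "nat \<Rightarrow> (real^'n::finite \<Rightarrow> complex) \<Rightarrow> real" where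
  "Cq_norm_Rn q w = (\<Sum>\<mu> | size \<mu> \<le> q. SUP x. cmod (pderiv_multi \<mu> w x))"

section \<open>Complex normed spaces with a carrier; completion; operators\<close>

record 'x cnspace =
  vecs :: "'x set"
  vadd :: "'x \<Rightarrow> 'x \<Rightarrow> 'x"
  vscale :: "complex \<Rightarrow> 'x \<Rightarrow> 'x"
  vnorm :: "'x \<Rightarrow> real"

text \<open>The value 0 off the carrier only serves the locale \<open>Metric_space\<close>, which
  asks for nonnegativity and symmetry on the whole type.\<close>

definition ndist :: "'x cnspace \<Rightarrow> 'x \<Rightarrow> 'x \<Rightarrow> real" where
  "ndist X x y =
     (if x \<in> vecs X \<and> y \<in> vecs X then vnorm X (vadd X x (vscale X (- 1) y)) else 0)"

abbreviation ntopology :: "'x cnspace \<Rightarrow> 'x topology" where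
  "ntopology X \<equiv> Metric_space.mtopology (vecs X) (ndist X)"

definition cauchy_seqs :: "'x cnspace \<Rightarrow> (nat \<Rightarrow> 'x) set" where
  "cauchy_seqs X = {a. Metric_space.MCauchy (vecs X) (ndist X) a}"

definition coterminal :: "'x cnspace \<Rightarrow> ((nat \<Rightarrow> 'x) \<times> (nat \<Rightarrow> 'x)) set" where
  "coterminal X = {(a, b). a \<in> cauchy_seqs X \<and> b \<in> cauchy_seqs X \<and>
     (\<lambda>i. ndist X (a i) (b i)) \<longlonglongrightarrow> 0}"

definition completion :: "'x cnspace \<Rightarrow> (nat \<Rightarrow> 'x) set cnspace" where
  "completion X = \<lparr>
     vecs = cauchy_seqs X // coterminal X,
     vadd = (\<lambda>A B. \<Union>a\<in>A. \<Union>b\<in>B. coterminal X `` {\<lambda>i. vadd X (a i) (b i)}),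
     vscale = (\<lambda>c A. \<Union>a\<in>A. coterminal X `` {\<lambda>i. vscale X c (a i)}),
     vnorm = (\<lambda>A. lim (\<lambda>i. vnorm X ((SOME a. a \<in> A) i))) \<rparr>"

definition to_completion :: "'x cnspace \<Rightarrow> 'x \<Rightarrow> (nat \<Rightarrow> 'x) set" where
  "to_completion X x = coterminal X `` {\<lambda>_. x}"

definition linear_operator :: "'x cnspace \<Rightarrow> 'y cnspace \<Rightarrow> ('x \<Rightarrow> 'y) \<Rightarrow> bool" where
  "linear_operator X Y T \<longleftrightarrow> T \<in> vecs X \<rightarrow> vecs Y \<and>
     (\<forall>x\<in>vecs X. \<forall>y\<in>vecs X. T (vadd X x y) = vadd Y (T x) (T y)) \<and>
     (\<forall>c. \<forall>x\<in>vecs X. T (vscale X c x) = vscale Y c (T x))"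

definition continuous_embedding :: "'x cnspace \<Rightarrow> 'y cnspace \<Rightarrow> ('x \<Rightarrow> 'y) \<Rightarrow> bool" where
  "continuous_embedding X Y T \<longleftrightarrow> linear_operator X Y T \<and> inj_on T (vecs X) \<and>
     (\<exists>C. \<forall>x\<in>vecs X. vnorm Y (T x) \<le> C * vnorm X x)"

definition compact_operator :: "'x cnspace \<Rightarrow> 'y cnspace \<Rightarrow> ('x \<Rightarrow> 'y) \<Rightarrow> bool" where
  "compact_operator X Y T \<longleftrightarrow> linear_operator X Y T \<and>
     (\<forall>B \<subseteq> vecs X. (\<exists>r. \<forall>x\<in>B. vnorm X x \<le> r) \<longrightarrow>
        compactin (ntopology Y) (ntopology Y closure_of (T ` B)))"

section \<open>The class M and the spaces on R^n\<close>

definition class_M :: "(real \<Rightarrow> real) set" where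
  "class_M = {\<phi>. \<phi> \<in> borel_measurable (restrict_space borel {1..}) \<and>
     (\<forall>t\<ge>1. \<phi> t > 0) \<and>
     (\<forall>b>1. bounded (\<phi> ` {1..b}) \<and> bounded ((\<lambda>t. 1 / \<phi> t) ` {1..b})) \<and>
     (\<forall>r>0. ((\<lambda>t. \<phi> (r * t) / \<phi> t) \<longlongrightarrow> 1) at_top)}"

definition schwartz :: "(real^'n::finite \<Rightarrow> complex) set" where
  "schwartz = {\<psi>. smooth_on UNIV \<psi> \<and>
     (\<forall>m is. bounded (range (\<lambda>x. (1 + norm x) ^ m * cmod (pderivs is \<psi> x))))}"

definition test_functions :: "(real^'n::finite \<Rightarrow> complex) set" where
  "test_functions = {\<psi>. smooth_on UNIV \<psi> \<and> compact (closure {x. \<psi> x \<noteq> 0})}"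

text \<open>A distribution is a functional on \<open>schwartz\<close>, extended by \<open>undefined\<close>.\<close>

definition tempered_distribution :: "((real^'n::finite \<Rightarrow> complex) \<Rightarrow> complex) \<Rightarrow> bool" where
  "tempered_distribution w \<longleftrightarrow> w \<in> extensional schwartz \<and>
     (\<forall>\<psi>\<in>schwartz. \<forall>\<eta>\<in>schwartz. w (\<lambda>x. \<psi> x + \<eta> x) = w \<psi> + w \<eta>) \<and>
     (\<forall>c. \<forall>\<psi>\<in>schwartz. w (\<lambda>x. c * \<psi> x) = c * w \<psi>) \<and>
     (\<exists>C m. \<forall>\<psi>\<in>schwartz. cmod (w \<psi>) \<le>
        C * (\<Sum>\<mu> | size \<mu> \<le> m. SUP x. (1 + norm x) ^ m * cmod (pderiv_multi \<mu> \<psi> x)))"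

definition regular_distribution ::
    "(real^'n::finite \<Rightarrow> complex) \<Rightarrow> (real^'n \<Rightarrow> complex) \<Rightarrow> complex" where
  "regular_distribution f = (\<lambda>\<psi>\<in>schwartz. LINT x|lebesgue. f x * \<psi> x)"

text \<open>Another normalising constant would merely multiply the norms below by a constant.\<close>

definition fourier :: "(real^'n::finite \<Rightarrow> complex) \<Rightarrow> real^'n \<Rightarrow> complex" where
  "fourier \<psi> \<xi> = (LINT x|lebesgue. cis (- (x \<bullet> \<xi>)) * \<psi> x)"

text \<open>The Fourier transform of \<open>w\<close>, that is \<open>\<psi> \<mapsto> w (fourier \<psi>)\<close>, is the locally integrable
  function \<open>g\<close>. Only compactly supported \<open>\<psi>\<close> are tested, since for a locally integrable \<open>g\<close> the
  integral of \<open>g \<psi>\<close> need not converge absolutely for every Schwartz function \<open>\<psi>\<close>; as the test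
  functions are dense in the Schwartz space, this determines the transform, and \<open>g\<close> almost
  everywhere.\<close>

definition has_fourier_function ::
    "((real^'n::finite \<Rightarrow> complex) \<Rightarrow> complex) \<Rightarrow> (real^'n \<Rightarrow> complex) \<Rightarrow> bool" where
  "has_fourier_function w g \<longleftrightarrow>
     (\<forall>K. compact K \<longrightarrow> g absolutely_integrable_on K) \<and>
     (\<forall>\<psi>\<in>test_functions. w (fourier \<psi>) = (LINT \<xi>|lebesgue. g \<xi> * \<psi> \<xi>))"

definition bracket :: "real^'n::finite \<Rightarrow> real" where
  "bracket \<xi> = sqrt (1 + (norm \<xi>)\<^sup>2)"

definition sobolev_integrand ::
    "real \<Rightarrow> (real \<Rightarrow> real) \<Rightarrow> (real^'n::finite \<Rightarrow> complex) \<Rightarrow> real^'n \<Rightarrow> real" where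
  "sobolev_integrand s \<phi> g \<xi> =
     bracket \<xi> powr (2 * s) * (\<phi> (bracket \<xi>))\<^sup>2 * (cmod (g \<xi>))\<^sup>2"

definition H_Rn ::
    "real \<Rightarrow> (real \<Rightarrow> real) \<Rightarrow> ((real^'n::finite \<Rightarrow> complex) \<Rightarrow> complex) cnspace" where
  "H_Rn s \<phi> = \<lparr>
     vecs = {w. tempered_distribution w \<and>
       (\<exists>g. has_fourier_function w g \<and> integrable lebesgue (sobolev_integrand s \<phi> g))},
     vadd = (\<lambda>v w. \<lambda>\<psi>\<in>schwartz. v \<psi> + w \<psi>),
     vscale = (\<lambda>c w. \<lambda>\<psi>\<in>schwartz. c * w \<psi>),
     vnorm = (\<lambda>w. sqrt (LINT \<xi>|lebesgue.
       sobolev_integrand s \<phi> (SOME g. has_fourier_function w g) \<xi>)) \<rparr>"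

section \<open>Smooth manifolds\<close>

text \<open>A chart is an open set together with a coordinate map on it; the manifold is the whole
  type \<open>'m\<close>, and its dimension is that of the model space \<open>'e\<close>.\<close>

type_synonym ('m, 'e) charts = "('m set \<times> ('m \<Rightarrow> 'e)) set"

definition smooth_atlas :: "('m::topological_space, 'e::euclidean_space) charts \<Rightarrow> bool" where
  "smooth_atlas A \<longleftrightarrow> (\<Union>(U, f)\<in>A. U) = UNIV \<and>
     (\<forall>(U, f)\<in>A. open U \<and> open (f ` U) \<and> (\<exists>g. homeomorphism U (f ` U) f g)) \<and>
     (\<forall>(U, f)\<in>A. \<forall>(W, g)\<in>A. smooth_on (f ` (U \<inter> W)) (g \<circ> inv_into U f))"

definition std_atlas :: "('e, 'e::euclidean_space) charts" where
  "std_atlas = {(UNIV, id)}"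

definition prod_atlas ::
    "('m, 'e::euclidean_space) charts \<Rightarrow> ('m \<times> 'f, 'e \<times> 'f::euclidean_space) charts" where
  "prod_atlas A = (\<lambda>(U, f). (U \<times> UNIV, \<lambda>(x, a). (f x, a))) ` A"

definition Ck_map_on :: "nat \<Rightarrow> ('m::topological_space, 'e::euclidean_space) charts \<Rightarrow>
    ('l::topological_space, 'f::euclidean_space) charts \<Rightarrow> 'm set \<Rightarrow> ('m \<Rightarrow> 'l) \<Rightarrow> bool" where
  "Ck_map_on k A B S h \<longleftrightarrow> continuous_on S h \<and>
     (\<forall>(U, f)\<in>A. \<forall>(W, g)\<in>B. Ck_on k (f ` (S \<inter> U \<inter> h -` W)) (g \<circ> h \<circ> inv_into U f))"

definition smooth_map_on :: "('m::topological_space, 'e::euclidean_space) charts \<Rightarrow>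
    ('l::topological_space, 'f::euclidean_space) charts \<Rightarrow> 'm set \<Rightarrow> ('m \<Rightarrow> 'l) \<Rightarrow> bool" where
  "smooth_map_on A B S h \<longleftrightarrow> (\<forall>k. Ck_map_on k A B S h)"

definition diffeo :: "('m::topological_space, 'e::euclidean_space) charts \<Rightarrow>
    ('l::topological_space, 'f::euclidean_space) charts \<Rightarrow>
    'm set \<Rightarrow> 'l set \<Rightarrow> ('m \<Rightarrow> 'l) \<Rightarrow> bool" where
  "diffeo A B S T h \<longleftrightarrow> open S \<and> open T \<and> bij_betw h S T \<and>
     smooth_map_on A B S h \<and> smooth_map_on B A T (inv_into S h)"

definition smooth_density :: "('m::topological_space, 'e::euclidean_space) charts \<Rightarrow>
    'm measure \<Rightarrow> bool" where
  "smooth_density A M \<longleftrightarrow> sets M = sets borel \<and>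
     (\<forall>(U, f)\<in>A. \<exists>\<rho>. smooth_on (f ` U) \<rho> \<and> (\<forall>y\<in>f ` U. \<rho> y > 0) \<and>
        (\<forall>B\<in>sets borel. B \<subseteq> U \<longrightarrow> emeasure M B = (\<integral>\<^sup>+ y\<in>f ` B. ennreal (\<rho> y) \<partial>lborel)))"

section \<open>Smooth complex vector bundles\<close>

record ('m, 'v, 'n, 'p) vbundle =
  base_atlas :: "('m, real^'n) charts"
  total_atlas :: "('v, (real^'n) \<times> (complex^'p)) charts"
  proj :: "'v \<Rightarrow> 'm"
  fadd :: "'v \<Rightarrow> 'v \<Rightarrow> 'v"
  fscale :: "complex \<Rightarrow> 'v \<Rightarrow> 'v"

definition local_trivialization ::
    "('m::topological_space, 'v::topological_space, 'n::finite, 'p::finite) vbundle \<Rightarrow>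
     'm set \<Rightarrow> ('v \<Rightarrow> 'm \<times> (complex^'p)) \<Rightarrow> bool" where
  "local_trivialization E U \<beta> \<longleftrightarrow>
     diffeo (total_atlas E) (prod_atlas (base_atlas E)) (proj E -` U) (U \<times> UNIV) \<beta> \<and>
     (\<forall>v\<in>proj E -` U. fst (\<beta> v) = proj E v) \<and>
     (\<forall>v\<in>proj E -` U. \<forall>w\<in>proj E -` U. proj E v = proj E w \<longrightarrow>
        snd (\<beta> (fadd E v w)) = snd (\<beta> v) + snd (\<beta> w)) \<and>
     (\<forall>c. \<forall>v\<in>proj E -` U. snd (\<beta> (fscale E c v)) = c *s snd (\<beta> v))"

text \<open>\<open>fadd\<close> and \<open>fscale\<close> are the operations of the fibres; \<open>fadd\<close> is only meaningful for two
  elements of the same fibre. That each fibre is a complex vector space of dimension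
  \<open>CARD('p)\<close> is not stated separately: it is transported from \<open>complex^'p\<close> by the trivializations.\<close>

definition smooth_vector_bundle ::
    "('m::topological_space, 'v::topological_space, 'n::finite, 'p::finite) vbundle \<Rightarrow> bool" where
  "smooth_vector_bundle E \<longleftrightarrow>
     smooth_atlas (base_atlas E) \<and> smooth_atlas (total_atlas E) \<and>
     smooth_map_on (total_atlas E) (base_atlas E) UNIV (proj E) \<and>
     (\<forall>v w. proj E v = proj E w \<longrightarrow> proj E (fadd E v w) = proj E v) \<and>
     (\<forall>c v. proj E (fscale E c v) = proj E v) \<and>
     (\<forall>x. \<exists>U \<beta>. x \<in> U \<and> open U \<and> local_trivialization E U \<beta>)"

definition Ck_sections ::
    "('m::topological_space, 'v::topological_space, 'n::finite, 'p::finite) vbundle \<Rightarrow>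
     nat \<Rightarrow> ('m \<Rightarrow> 'v) set" where
  "Ck_sections E k = {u. (\<forall>x. proj E (u x) = x) \<and>
     Ck_map_on k (base_atlas E) (total_atlas E) UNIV u}"

definition smooth_sections ::
    "('m::topological_space, 'v::topological_space, 'n::finite, 'p::finite) vbundle \<Rightarrow>
     ('m \<Rightarrow> 'v) set" where
  "smooth_sections E = {u. (\<forall>x. proj E (u x) = x) \<and>
     smooth_map_on (base_atlas E) (total_atlas E) UNIV u}"

section \<open>The spaces on a vector bundle\<close>

text \<open>The auxiliary choices: \<open>\<kappa>\<close> charts, trivializations and cut-off functions, indexed by
  \<open>1, \<dots>, \<kappa>\<close>. The coordinate patch with number \<open>j\<close> is \<open>range (chart L j)\<close>.\<close>

record ('m, 'v, 'n, 'p) localization =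
  num :: nat
  chart :: "nat \<Rightarrow> real^'n \<Rightarrow> 'm"
  triv :: "nat \<Rightarrow> 'v \<Rightarrow> 'm \<times> (complex^'p)"
  cutoff :: "nat \<Rightarrow> 'm \<Rightarrow> real"

definition admissible_localization ::
    "('m::topological_space, 'v::topological_space, 'n::finite, 'p::finite) vbundle \<Rightarrow>
     ('m, 'v, 'n, 'p) localization \<Rightarrow> bool" where
  "admissible_localization E L \<longleftrightarrow>
     (\<forall>j\<in>{1..num L}.
        diffeo std_atlas (base_atlas E) UNIV (range (chart L j)) (chart L j) \<and>
        local_trivialization E (range (chart L j)) (triv L j) \<and>
        smooth_map_on (base_atlas E) std_atlas UNIV (cutoff L j) \<and>
        (\<forall>x. cutoff L j x \<ge> 0) \<and>
        closure {x. cutoff L j x \<noteq> 0} \<subseteq> range (chart L j)) \<and>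
     (\<Union>j\<in>{1..num L}. range (chart L j)) = UNIV \<and>
     (\<forall>x. (\<Sum>j=1..num L. cutoff L j x) = 1)"

definition local_part ::
    "('m, 'v, 'n::finite, 'p::finite) vbundle \<Rightarrow> ('m, 'v, 'n, 'p) localization \<Rightarrow>
     nat \<Rightarrow> 'p \<Rightarrow> ('m \<Rightarrow> 'v) \<Rightarrow> real^'n \<Rightarrow> complex" where
  "local_part E L j k u y =
     snd (triv L j (fscale E (complex_of_real (cutoff L j (chart L j y))) (u (chart L j y)))) $ k"

definition Cq_bundle ::
    "('m::topological_space, 'v::topological_space, 'n::finite, 'p::finite) vbundle \<Rightarrow>
     ('m, 'v, 'n, 'p) localization \<Rightarrow> nat \<Rightarrow> ('m \<Rightarrow> 'v) cnspace" where
  "Cq_bundle E L q = \<lparr>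
     vecs = Ck_sections E q,
     vadd = (\<lambda>u v x. fadd E (u x) (v x)),
     vscale = (\<lambda>c u x. fscale E c (u x)),
     vnorm = (\<lambda>u. \<Sum>j=1..num L. \<Sum>k\<in>UNIV. Cq_norm_Rn q (local_part E L j k u)) \<rparr>"

definition smooth_sections_H ::
    "('m::topological_space, 'v::topological_space, 'n::finite, 'p::finite) vbundle \<Rightarrow>
     ('m, 'v, 'n, 'p) localization \<Rightarrow> real \<Rightarrow> (real \<Rightarrow> real) \<Rightarrow> ('m \<Rightarrow> 'v) cnspace" where
  "smooth_sections_H E L s \<phi> = \<lparr>
     vecs = smooth_sections E,
     vadd = (\<lambda>u v x. fadd E (u x) (v x)),
     vscale = (\<lambda>c u x. fscale E c (u x)),
     vnorm = (\<lambda>u. sqrt (\<Sum>j=1..num L. \<Sum>k\<in>UNIV.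
        (vnorm (H_Rn s \<phi>) (regular_distribution (local_part E L j k u)))\<^sup>2)) \<rparr>"

definition H_bundle ::
    "('m::topological_space, 'v::topological_space, 'n::finite, 'p::finite) vbundle \<Rightarrow>
     ('m, 'v, 'n, 'p) localization \<Rightarrow> real \<Rightarrow> (real \<Rightarrow> real) \<Rightarrow> (nat \<Rightarrow> 'm \<Rightarrow> 'v) set cnspace" where
  "H_bundle E L s \<phi> = completion (smooth_sections_H E L s \<phi>)"

text \<open>\<open>T\<close> is a continuous embedding that extends the identity mapping on the smooth sections;
  \<open>extensional\<close> makes \<open>T\<close> a function on the space, so that uniqueness can be stated.\<close>

definition embedding_extending_identity ::
    "('m::topological_space, 'v::topological_space, 'n::finite, 'p::finite) vbundle \<Rightarrow>
     ('m, 'v, 'n, 'p) localization \<Rightarrow> real \<Rightarrow> (real \<Rightarrow> real) \<Rightarrow> nat \<Rightarrow>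
     ((nat \<Rightarrow> 'm \<Rightarrow> 'v) set \<Rightarrow> 'm \<Rightarrow> 'v) \<Rightarrow> bool" where
  "embedding_extending_identity E L s \<phi> q T \<longleftrightarrow>
     T \<in> extensional (vecs (H_bundle E L s \<phi>)) \<and>
     continuous_embedding (H_bundle E L s \<phi>) (Cq_bundle E L q) T \<and>
     (\<forall>u\<in>smooth_sections E. T (to_completion (smooth_sections_H E L s \<phi>) u) = u)"

end

(* Put b_k = phi(2^k). Slow variation makes phi comparable to b_k on [2^k, 2^(k+1)], so the
   integral condition says that the series of b_k^(-2) converges, or equivalently that
   <xi>^(-n) phi(<xi>)^(-2) is integrable over R^n.

   If it converges, Fourier inversion and the Cauchy-Schwarz inequality bound every derivative
   of order at most q of a localized part of a section by the norm of order q + n/2. Under a bound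
   on that norm the contribution of large frequencies is uniformly small, and on a ball the Fourier
   transforms of functions with a common compact support are equicontinuous; this gives compactness.
   Injectivity on the completion follows from Fatou's lemma.

   Conversely, superpose in one chart the functions b_k^(-2) 2^(-kq) psi(2^k (y - y0)), k <= N, with
   psi(x) = x_i^q rho(x). Seen in any other chart, the k-th piece still has its frequencies
   concentrated around 2^k, so the pieces are almost orthogonal and the square of the norm of the
   sum is at most a constant times A_N, the sum of b_k^(-2) over k <= N. Its q-th derivative in the
   direction i at y0 is a positive multiple of A_N. An embedding therefore forces
   A_N <= const sqrt(A_N), so the series converges. *)
theory Submission
  imports Defs
    "HOL-Probability.Characteristic_Functions"
    "HOL-Complex_Analysis.Great_Picard"
begin

section \<open>Differentiability classes\<close>

text \<open>The norm of a section sees it through every chart, cut-off and frame at once, and the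
  Sobolev norm on R^n is phrased with a merely chosen Fourier function. For smooth sections the
  local parts are test functions, and for these the chosen function is almost everywhere the
  classical transform; so every later estimate concerns test functions. Limits are taken in C^q:
  they are uniform limits of local parts, glued back by the partition of unity.

  The coefficients b_k^(-2) balance the two norms: the k-th piece contributes about b_k^2 b_k^(-4) =
  b_k^(-2) to the squared Sobolev norm, and a multiple of b_k^(-2) to the derivative at y0, where
  the factor x_i^q prevents cancellation. Almost orthogonality is a Schur test: piece k meets shell
  l with strength 2^(-|k-l|), slow variation lets b_l^2 / b_k^2 grow at most like (3/2)^|k-l|, and
  the product (3/4)^|k-l| is summable. The embedding enters the converse as an inequality between
  norms of smooth sections.\<close>

lemma has_derivative_imp_frechet:
  "(f has_derivative f') (at x) \<Longrightarrow> frechet_derivative f (at x) = f'"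
  using frechet_derivative_at by metis

text \<open>The derivative is a choice from the predicate \<open>has_derivative\<close>, and that
  predicate depends on the germ at \<open>x\<close> alone. The equality therefore also covers points
  where neither function is differentiable.\<close>

lemma frechet_derivative_cong_open:
  assumes "open S" "x \<in> S" "\<And>y. y \<in> S \<Longrightarrow> f y = g y"
  shows "frechet_derivative f (at x) = frechet_derivative g (at x)"
proof -
  have "(f has_derivative D) (at x) \<longleftrightarrow> (g has_derivative D) (at x)" for D
    using has_derivative_transform_within_open[OF _ assms(1,2), of f D UNIV g]
      has_derivative_transform_within_open[OF _ assms(1,2), of g D UNIV f] assms(3) by auto
  then show ?thesis by (simp add: frechet_derivative_def)
qed

lemma differentiable_cong_open:
  assumes "open S" "x \<in> S" "\<And>y. y \<in> S \<Longrightarrow> f y = g y" "f differentiable (at x)"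
  shows "g differentiable (at x)"
  using assms has_derivative_transform_within_open unfolding differentiable_def by metis

lemma Ck_on_cong_imp:
  assumes "open S" "\<And>x. x \<in> S \<Longrightarrow> f x = g x" "Ck_on k S f"
  shows "Ck_on k S g"
  using assms(2,3)
proof (induction k arbitrary: f g)
  case 0
  then show ?case by (simp cong: continuous_on_cong)
next
  case (Suc k)
  have 1: "g differentiable (at x)" if "x \<in> S" for x
    using differentiable_cong_open[OF assms(1) that Suc.prems(1)] Suc.prems(2) that by simp
  have 2: "Ck_on k S (\<lambda>x. frechet_derivative g (at x) v)" for v
    using Suc.IH[of "\<lambda>x. frechet_derivative f (at x) v"]
      frechet_derivative_cong_open[OF assms(1) _ Suc.prems(1)] Suc.prems(2) by force
  show ?case using 1 2 by simp
qed

lemma Ck_on_subset: "Ck_on k S f \<Longrightarrow> T \<subseteq> S \<Longrightarrow> Ck_on k T f"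
  by (induction k arbitrary: f) (auto intro: continuous_on_subset)

lemma Ck_on_imp_continuous_on: "Ck_on k S f \<Longrightarrow> continuous_on S f"
  by (cases k) (auto intro!: differentiable_imp_continuous_within continuous_at_imp_continuous_on)

lemma Ck_on_SucD: "Ck_on (Suc k) S f \<Longrightarrow> Ck_on k S f"
proof (induction k arbitrary: f)
  case 0
  then show ?case using Ck_on_imp_continuous_on[OF 0] by simp
next
  case (Suc k)
  show ?case using Suc.prems Suc.IH unfolding Ck_on.simps(2)[of "Suc k"] Ck_on.simps(2)[of k] by blast
qed

lemma Ck_on_mono: "Ck_on k S f \<Longrightarrow> l \<le> k \<Longrightarrow> Ck_on l S f"
  by (induction k) (auto simp del: Ck_on.simps simp: le_Suc_eq dest: Ck_on_SucD)

text \<open>\<open>Ck_on\<close> refers to derivatives at \<open>x\<close> in the full space, never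
  to derivatives within \<open>S\<close>, so it is a condition on germs. This is the gluing
  principle behind extension by zero and behind the passage between charts.\<close>

lemma Ck_on_local:
  assumes "\<And>x. x \<in> S \<Longrightarrow> \<exists>T. open T \<and> x \<in> T \<and> Ck_on k T f"
  shows "Ck_on k S f"
  using assms
proof (induction k arbitrary: f)
  case 0
  then show ?case
    by (auto intro!: continuous_at_imp_continuous_on simp: continuous_on_eq_continuous_at)
      (metis continuous_on_eq_continuous_at)
next
  case (Suc k)
  have 1: "f differentiable (at x)" if "x \<in> S" for x using Suc.prems[OF that] by auto
  have 2: "Ck_on k S (\<lambda>x. frechet_derivative f (at x) v)" for v
    by (rule Suc.IH) (use Suc.prems in fastforce)
  show ?case using 1 2 by simp
qed

lemma Ck_on_const [simp]: "Ck_on k S (\<lambda>x. c)"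
  by (induction k arbitrary: c) (auto simp: has_derivative_imp_frechet[OF has_derivative_const])

text \<open>The form used by the smoothness inductions below: the derivative is exhibited by a
  formula, to whose terms the induction hypothesis applies, instead of being read off
  \<open>frechet_derivative\<close>.\<close>

lemma Ck_on_SucI:
  assumes "\<And>x. x \<in> S \<Longrightarrow> (f has_derivative f' x) (at x)" "\<And>v. Ck_on k S (\<lambda>x. f' x v)" "open S"
  shows "Ck_on (Suc k) S f"
proof -
  have "Ck_on k S (\<lambda>x. frechet_derivative f (at x) v)" for v
    by (rule Ck_on_cong_imp[OF assms(3) _ assms(2)[of v]])
       (simp add: has_derivative_imp_frechet[OF assms(1)])
  then show ?thesis using assms(1) by (auto simp: differentiable_def)
qed

lemma Ck_on_Suc_has_derivative:
  assumes "Ck_on (Suc k) S f" "x \<in> S"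
  shows "(f has_derivative frechet_derivative f (at x)) (at x)"
  using assms by (simp add: frechet_derivative_works[symmetric])

lemma Ck_on_Suc_frechet: "Ck_on (Suc k) S f \<Longrightarrow> Ck_on k S (\<lambda>x. frechet_derivative f (at x) v)"
  by simp

lemma Ck_on_add:
  assumes "open S" "Ck_on k S f" "Ck_on k S g"
  shows "Ck_on k S (\<lambda>x. f x + g x)"
  using assms(2,3)
proof (induction k arbitrary: f g)
  case 0
  then show ?case by (auto intro: continuous_intros)
next
  case (Suc k)
  show ?case
    by (rule Ck_on_SucI[where f'="\<lambda>x v. frechet_derivative f (at x) v + frechet_derivative g (at x) v"])
      (auto intro!: has_derivative_add Ck_on_Suc_has_derivative[OF Suc.prems(1)]
        Ck_on_Suc_has_derivative[OF Suc.prems(2)] Suc.IH Ck_on_Suc_frechet[OF Suc.prems(1)]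
        Ck_on_Suc_frechet[OF Suc.prems(2)] assms(1))
qed

lemma Ck_on_sum:
  assumes "open S" "\<And>i. i \<in> I \<Longrightarrow> Ck_on k S (f i)"
  shows "Ck_on k S (\<lambda>x. \<Sum>i\<in>I. f i x)"
  using assms(2)
  by (induction I rule: infinite_finite_induct) (auto intro!: Ck_on_add assms(1))

lemma Ck_on_bounded_linear_compose:
  assumes "open S" "bounded_linear L" "Ck_on k S f"
  shows "Ck_on k S (\<lambda>x. L (f x))"
  using assms(3)
proof (induction k arbitrary: f)
  case 0
  then show ?case
    using bounded_linear.continuous_on[OF assms(2)] by auto
next
  case (Suc k)
  show ?case
    by (rule Ck_on_SucI[where f'="\<lambda>x v. L (frechet_derivative f (at x) v)"])
      (auto intro!: bounded_linear.has_derivative[OF assms(2)] Ck_on_Suc_has_derivative[OF Suc.prems]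
        Suc.IH Ck_on_Suc_frechet[OF Suc.prems] assms(1))
qed

lemma Ck_on_bounded_linear:
  assumes "open S" "bounded_linear L"
  shows "Ck_on k S L"
proof (cases k)
  case 0
  then show ?thesis using bounded_linear.continuous_on[OF assms(2) continuous_on_id] by auto
next
  case (Suc l)
  show ?thesis unfolding Suc
    by (rule Ck_on_SucI[where f'="\<lambda>x v. L v"])
      (auto intro!: bounded_linear_imp_has_derivative assms)
qed

lemma Ck_on_bilinear:
  assumes "open S" "bounded_bilinear B" "Ck_on k S f" "Ck_on k S g"
  shows "Ck_on k S (\<lambda>x. B (f x) (g x))"
  using assms(3,4)
proof (induction k arbitrary: f g)
  case 0
  then show ?case
    using bounded_bilinear.continuous_on[OF assms(2)] by auto
next
  case (Suc k)
  show ?case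
    by (rule Ck_on_SucI[where f'="\<lambda>x v. B (f x) (frechet_derivative g (at x) v) + B (frechet_derivative f (at x) v) (g x)"])
      (auto intro!: bounded_bilinear.FDERIV[OF assms(2)] Ck_on_add[OF assms(1)] Ck_on_Suc_has_derivative[OF Suc.prems(1)]
        Ck_on_Suc_has_derivative[OF Suc.prems(2)] Suc.IH Ck_on_Suc_frechet[OF Suc.prems(1)]
        Ck_on_Suc_frechet[OF Suc.prems(2)] assms(1) Ck_on_SucD[OF Suc.prems(1)] Ck_on_SucD[OF Suc.prems(2)])
qed

lemmas Ck_on_mult = Ck_on_bilinear[OF _ bounded_bilinear_mult]
lemmas Ck_on_scaleR = Ck_on_bilinear[OF _ bounded_bilinear_scaleR]

lemma Ck_on_compose:
  fixes f :: "'a::euclidean_space \<Rightarrow> 'b::euclidean_space" and g :: "'b \<Rightarrow> 'c::real_normed_vector"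
  assumes "open S" "open T" "f ` S \<subseteq> T" "Ck_on k S f" "Ck_on k T g"
  shows "Ck_on k S (\<lambda>x. g (f x))"
  using assms(4,5)
proof (induction k arbitrary: g)
  case 0
  then show ?case using continuous_on_compose2[of T g S f] assms(3) by auto
next
  case (Suc k)
  let ?f' = "\<lambda>x v. frechet_derivative f (at x) v"
  let ?g' = "\<lambda>y v. frechet_derivative g (at y) v"
  \<comment> \<open>Expanding the inner derivative in the basis separates the two occurrences of
    \<open>x\<close>: each summand is a scalar function of class k times a composition with
    \<open>f\<close>, which the induction hypothesis covers.\<close>
  have eq: "?g' (f x) (?f' x v) = (\<Sum>b\<in>Basis. (?f' x v \<bullet> b) *\<^sub>R ?g' (f x) b)" if "x \<in> S" for x v
  proof -
    have "linear (?g' (f x))"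
      using Ck_on_Suc_has_derivative[OF Suc.prems(2), of "f x"] that assms(3)
      by (auto intro: has_derivative_linear)
    then have "?g' (f x) (\<Sum>b\<in>Basis. (?f' x v \<bullet> b) *\<^sub>R b) = (\<Sum>b\<in>Basis. (?f' x v \<bullet> b) *\<^sub>R ?g' (f x) b)"
      by (simp add: linear_sum linear_cmul)
    then show ?thesis by (simp add: euclidean_representation)
  qed
  show ?case
  proof (rule Ck_on_SucI[where f'="\<lambda>x v. ?g' (f x) (?f' x v)"])
    fix x assume "x \<in> S"
    then have "((\<lambda>x. g (f x)) has_derivative (\<lambda>v. ?g' (f x) (?f' x v))) (at x)"
      using assms(3) by (intro has_derivative_compose[OF Ck_on_Suc_has_derivative[OF Suc.prems(1)]
        Ck_on_Suc_has_derivative[OF Suc.prems(2)]]) auto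
    then show "((\<lambda>x. g (f x)) has_derivative (\<lambda>v. ?g' (f x) (?f' x v))) (at x)" .
  next
    fix v
    have "Ck_on k S (\<lambda>x. \<Sum>b\<in>Basis. (?f' x v \<bullet> b) *\<^sub>R ?g' (f x) b)"
    proof (intro Ck_on_sum Ck_on_scaleR assms(1))
      fix b :: 'b
      show "Ck_on k S (\<lambda>x. ?f' x v \<bullet> b)"
        by (rule Ck_on_bounded_linear_compose[OF assms(1) bounded_linear_inner_left])
          (rule Ck_on_Suc_frechet[OF Suc.prems(1)])
      show "Ck_on k S (\<lambda>x. ?g' (f x) b)"
        by (rule Suc.IH[OF Ck_on_SucD[OF Suc.prems(1)]]) (rule Ck_on_Suc_frechet[OF Suc.prems(2)])
    qed
    then show "Ck_on k S (\<lambda>x. ?g' (f x) (?f' x v))"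
      by (rule Ck_on_cong_imp[OF assms(1), rotated]) (simp add: eq)
  qed (rule assms(1))
qed

lemma Ck_on_Pair:
  fixes f :: "'a::euclidean_space \<Rightarrow> 'b::real_normed_vector" and g :: "'a \<Rightarrow> 'c::real_normed_vector"
  assumes "open S" "Ck_on k S f" "Ck_on k S g"
  shows "Ck_on k S (\<lambda>x. (f x, g x))"
proof -
  have 1: "bounded_linear (\<lambda>x::'b. (x, 0::'c))" and 2: "bounded_linear (\<lambda>x::'c. (0::'b, x))"
    by (auto intro!: bounded_linear_Pair bounded_linear_ident bounded_linear_zero)
  show ?thesis
    using Ck_on_add[OF assms(1) Ck_on_bounded_linear_compose[OF assms(1) 1 assms(2)]
        Ck_on_bounded_linear_compose[OF assms(1) 2 assms(3)]] by simp
qed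

lemma bounded_linear_axis: "bounded_linear (axis i :: 'b::euclidean_space \<Rightarrow> 'b^'n)"
  by (intro linear_conv_bounded_linear[THEN iffD1] linearI) (auto simp: axis_def vec_eq_iff)

lemma sum_axis_nth: "(\<Sum>i\<in>UNIV. axis i (v $ i)) = (v :: 'b::euclidean_space^'n)"
  by (simp add: vec_eq_iff axis_def if_distrib sum.delta cong: if_cong)

lemma Ck_on_vec_iff:
  fixes f :: "'a::euclidean_space \<Rightarrow> 'b::euclidean_space^'n"
  assumes "open S"
  shows "Ck_on k S f \<longleftrightarrow> (\<forall>i. Ck_on k S (\<lambda>x. f x $ i))"
proof safe
  fix i assume "Ck_on k S f"
  then show "Ck_on k S (\<lambda>x. f x $ i)"
    by (rule Ck_on_bounded_linear_compose[OF assms bounded_linear_vec_nth])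
next
  assume *: "\<forall>i. Ck_on k S (\<lambda>x. f x $ i)"
  have "Ck_on k S (\<lambda>x. \<Sum>i\<in>UNIV. axis i (f x $ i))"
    by (intro Ck_on_sum assms Ck_on_bounded_linear_compose[OF assms bounded_linear_axis] *[rule_format])
  then show "Ck_on k S f" by (simp add: sum_axis_nth)
qed

lemma smooth_on_imp_Ck: "smooth_on S f \<Longrightarrow> Ck_on k S f"
  by (simp add: smooth_on_def)

lemma smooth_on_has_derivative:
  "smooth_on S f \<Longrightarrow> x \<in> S \<Longrightarrow> (f has_derivative frechet_derivative f (at x)) (at x)"
  by (meson Ck_on_Suc_has_derivative smooth_on_def)

lemma smooth_on_subset: "smooth_on S f \<Longrightarrow> T \<subseteq> S \<Longrightarrow> smooth_on T f"
  unfolding smooth_on_def using Ck_on_subset by blast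

lemma smooth_on_const: "smooth_on S (\<lambda>x. c)"
  by (simp add: smooth_on_def)

lemma smooth_on_add:
  "open S \<Longrightarrow> smooth_on S f \<Longrightarrow> smooth_on S g \<Longrightarrow> smooth_on S (\<lambda>x. f x + g x)"
  unfolding smooth_on_def by (auto intro!: Ck_on_add)

lemma smooth_on_sum:
  "open S \<Longrightarrow> (\<And>i. i \<in> I \<Longrightarrow> smooth_on S (f i)) \<Longrightarrow> smooth_on S (\<lambda>x. \<Sum>i\<in>I. f i x)"
  unfolding smooth_on_def by (auto intro!: Ck_on_sum)

lemma smooth_on_mult:
  fixes f g :: "'a::euclidean_space \<Rightarrow> 'b::real_normed_algebra"
  shows "open S \<Longrightarrow> smooth_on S f \<Longrightarrow> smooth_on S g \<Longrightarrow> smooth_on S (\<lambda>x. f x * g x)"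
  unfolding smooth_on_def by (auto intro!: Ck_on_mult)

lemma smooth_on_prod:
  fixes f :: "'i \<Rightarrow> 'a::euclidean_space \<Rightarrow> 'b::real_normed_field"
  assumes "open S" "\<And>i. i \<in> I \<Longrightarrow> smooth_on S (f i)"
  shows "smooth_on S (\<lambda>x. \<Prod>i\<in>I. f i x)"
  using assms(2)
  by (induction I rule: infinite_finite_induct) (auto intro!: smooth_on_mult smooth_on_const assms(1))

lemma smooth_on_power:
  fixes f :: "'a::euclidean_space \<Rightarrow> 'b::real_normed_field"
  assumes "open S" "smooth_on S f"
  shows "smooth_on S (\<lambda>x. f x ^ m)"
  by (induction m) (auto intro!: smooth_on_mult smooth_on_const assms)

lemma smooth_on_bounded_linear_compose:
  "open S \<Longrightarrow> bounded_linear L \<Longrightarrow> smooth_on S f \<Longrightarrow> smooth_on S (\<lambda>x. L (f x))"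
  unfolding smooth_on_def using Ck_on_bounded_linear_compose[of S L _ f] by auto

lemma smooth_on_bounded_linear: "open S \<Longrightarrow> bounded_linear L \<Longrightarrow> smooth_on S L"
  unfolding smooth_on_def using Ck_on_bounded_linear[of S L] by auto

lemma smooth_on_compose:
  fixes f :: "'a::euclidean_space \<Rightarrow> 'b::euclidean_space" and g :: "'b \<Rightarrow> 'c::real_normed_vector"
  assumes "open S" "open T" "f ` S \<subseteq> T" "smooth_on S f" "smooth_on T g"
  shows "smooth_on S (\<lambda>x. g (f x))"
  using assms(4,5) Ck_on_compose[OF assms(1-3), of _ g] unfolding smooth_on_def by simp

section \<open>Iterated partial derivatives and multi-indices\<close>

lemma pderivs_append: "pderivs (xs @ ys) f = pderivs xs (pderivs ys f)"
  by (induction xs) auto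

lemma Ck_on_pderivs: "Ck_on (k + length is) S f \<Longrightarrow> Ck_on k S (pderivs is f)"
proof (induction "is" arbitrary: k)
  case (Cons i "is")
  have "Ck_on (Suc k) S (pderivs is f)" by (rule Cons.IH) (use Cons.prems in simp)
  then show ?case by (simp del: Ck_on.simps add: Ck_on_Suc_frechet)
qed simp

lemma smooth_on_pderivs: "smooth_on S f \<Longrightarrow> smooth_on S (pderivs is f)"
  unfolding smooth_on_def by (auto intro!: Ck_on_pderivs)

lemma pderivs_cong_open:
  assumes "open S" "x \<in> S" "\<And>y. y \<in> S \<Longrightarrow> f y = g y"
  shows "pderivs is f x = pderivs is g x"
  using assms(2)
proof (induction "is" arbitrary: x)
  case (Cons i "is")
  show ?case
    using frechet_derivative_cong_open[OF assms(1) Cons.prems Cons.IH] by simp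
qed (simp add: assms(3))

lemma pderivs_add:
  assumes "open S" "Ck_on (length is) S f" "Ck_on (length is) S g" "x \<in> S"
  shows "pderivs is (\<lambda>x. f x + g x) x = pderivs is f x + pderivs is g x"
  using assms(2-)
proof (induction "is" arbitrary: x)
  case (Cons i "is")
  have eq: "pderivs is (\<lambda>x. f x + g x) y = pderivs is f y + pderivs is g y" if "y \<in> S" for y
    by (rule Cons.IH) (use Cons.prems that Ck_on_SucD in auto)
  have 1: "Ck_on (Suc 0) S (pderivs is f)" "Ck_on (Suc 0) S (pderivs is g)"
    by (auto simp del: Ck_on.simps intro!: Ck_on_pderivs) (use Cons.prems in auto)
  have "frechet_derivative (pderivs is (\<lambda>x. f x + g x)) (at x) =
      frechet_derivative (\<lambda>y. pderivs is f y + pderivs is g y) (at x)"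
    by (rule frechet_derivative_cong_open[OF assms(1)]) (use Cons.prems eq in auto)
  also have "\<dots> = (\<lambda>v. frechet_derivative (pderivs is f) (at x) v + frechet_derivative (pderivs is g) (at x) v)"
    by (intro has_derivative_imp_frechet has_derivative_add Ck_on_Suc_has_derivative[OF 1(1)]
       Ck_on_Suc_has_derivative[OF 1(2)]) (use Cons.prems in auto)
  finally show ?case by simp
qed simp

lemma pderivs_bounded_linear:
  assumes "open S" "bounded_linear L" "Ck_on (length is) S f" "x \<in> S"
  shows "pderivs is (\<lambda>x. L (f x)) x = L (pderivs is f x)"
  using assms(3-)
proof (induction "is" arbitrary: x)
  case (Cons i "is")
  have eq: "pderivs is (\<lambda>x. L (f x)) y = L (pderivs is f y)" if "y \<in> S" for y
    by (rule Cons.IH) (use Cons.prems that Ck_on_SucD in auto)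
  have 1: "Ck_on (Suc 0) S (pderivs is f)"
    by (auto simp del: Ck_on.simps intro!: Ck_on_pderivs) (use Cons.prems in auto)
  have "frechet_derivative (pderivs is (\<lambda>x. L (f x))) (at x) =
      frechet_derivative (\<lambda>y. L (pderivs is f y)) (at x)"
    by (rule frechet_derivative_cong_open[OF assms(1)]) (use Cons.prems eq in auto)
  also have "\<dots> = (\<lambda>v. L (frechet_derivative (pderivs is f) (at x) v))"
    by (intro has_derivative_imp_frechet bounded_linear.has_derivative[OF assms(2)] Ck_on_Suc_has_derivative[OF 1(1)])
      (use Cons.prems in auto)
  finally show ?case by simp
qed simp

lemma pderivs_cmult:
  fixes f :: "real^'n::finite \<Rightarrow> 'b::real_normed_algebra"
  assumes "open S" "Ck_on (length is) S f" "x \<in> S"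
  shows "pderivs is (\<lambda>x. c * f x) x = c * pderivs is f x"
  by (rule pderivs_bounded_linear[OF assms(1) bounded_linear_mult_right assms(2,3)])

lemma pderivs_zero [simp]: "pderivs is (\<lambda>x. 0) = (\<lambda>x. 0)"
  by (induction "is") (auto simp: has_derivative_imp_frechet[OF has_derivative_const])

lemma pderivs_sum:
  assumes "open S" "\<And>i. i \<in> I \<Longrightarrow> Ck_on (length is) S (f i)" "x \<in> S"
  shows "pderivs is (\<lambda>x. \<Sum>i\<in>I. f i x) x = (\<Sum>i\<in>I. pderivs is (f i) x)"
  using assms(2)
proof (induction I rule: infinite_finite_induct)
  case (insert a I)
  then show ?case
    using pderivs_add[OF assms(1) _ _ assms(3), of "is" "f a" "\<lambda>x. \<Sum>i\<in>I. f i x"]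
    by (simp add: Ck_on_sum[OF assms(1)])
qed auto

lemma pderivs_eq_0_outside_closure:
  assumes "x \<notin> closure {x. f x \<noteq> 0}"
  shows "pderivs is f x = 0"
proof -
  have "pderivs is f x = pderivs is (\<lambda>x. 0) x"
    by (rule pderivs_cong_open[of "- closure {x. f x \<noteq> 0}"])
      (use assms closure_subset[of "{x. f x \<noteq> 0}"] in auto)
  then show ?thesis by simp
qed

lemma frechet_eq_sum_pderivs:
  fixes f :: "real^'n::finite \<Rightarrow> 'b::real_normed_vector"
  assumes "f differentiable (at x)"
  shows "frechet_derivative f (at x) v = (\<Sum>i\<in>UNIV. v $ i *\<^sub>R pderivs [i] f x)"
proof -
  have lin: "linear (frechet_derivative f (at x))"
    using assms linear_frechet_derivative by blast
  have "v = (\<Sum>i\<in>UNIV. v $ i *\<^sub>R axis i 1)"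
    using basis_expansion[of v] by (simp add: scalar_mult_eq_scaleR)
  then have "frechet_derivative f (at x) v = frechet_derivative f (at x) (\<Sum>i\<in>UNIV. v $ i *\<^sub>R axis i 1)"
    by simp
  then show ?thesis by (simp add: linear_sum[OF lin] linear_cmul[OF lin])
qed

lemma Ck_on_Suc_pderivI:
  fixes f :: "real^'n::finite \<Rightarrow> 'b::real_normed_vector"
  assumes "open S" "\<And>x. x \<in> S \<Longrightarrow> f differentiable (at x)" "\<And>i. Ck_on k S (pderivs [i] f)"
  shows "Ck_on (Suc k) S f"
proof (rule Ck_on_SucI[where f'="\<lambda>x v. \<Sum>i\<in>UNIV. v $ i *\<^sub>R pderivs [i] f x"])
  fix x assume "x \<in> S"
  then show "(f has_derivative (\<lambda>v. \<Sum>i\<in>UNIV. v $ i *\<^sub>R pderivs [i] f x)) (at x)"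
    using assms(2)[of x] frechet_eq_sum_pderivs[of f x] frechet_derivative_works[of f "at x"]
    by (metis (no_types, lifting) ext)
next
  fix v :: "real^'n"
  show "Ck_on k S (\<lambda>x. \<Sum>i\<in>UNIV. v $ i *\<^sub>R pderivs [i] f x)"
    by (intro Ck_on_sum assms(1) Ck_on_scaleR assms(3) Ck_on_const)
qed (rule assms(1))

text \<open>The enumeration is chosen from \<mu> alone, hence is the same for all functions. This
  lets the linearity of \<open>pderivs\<close> pass to \<open>pderiv_multi\<close> without any
  symmetry of mixed derivatives.\<close>

lemma pderiv_multi_eq_pderivs:
  obtains "is" where "mset is = \<mu>" "length is = size \<mu>" "\<And>f. pderiv_multi \<mu> f = pderivs is f"
proof -
  have "\<exists>is. mset is = \<mu>" by (rule ex_mset)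
  then have "mset (SOME is. mset is = \<mu>) = \<mu>" by (rule someI_ex)
  then show ?thesis using that[of "SOME is. mset is = \<mu>"] unfolding pderiv_multi_def
    by (metis size_mset)
qed

text \<open>A multiset with a single repeated element has exactly one enumeration, so here the
  choice in \<open>pderiv_multi\<close> is determined.\<close>

lemma pderiv_multi_replicate: "pderiv_multi (replicate_mset q i) f = pderivs (replicate q i) f"
proof -
  have "is = replicate q i" if "mset is = replicate_mset q i" for "is"
  proof (rule replicate_eqI)
    show "length is = q" by (metis size_mset size_replicate_mset that)
    show "y = i" if "y \<in> set is" for y
      using that \<open>mset is = replicate_mset q i\<close>
      by (metis in_replicate_mset set_mset_mset)
  qed
  then have "(SOME is. mset is = replicate_mset q i) = replicate q i"
    by (intro some_equality) auto
  then show ?thesis by (simp add: pderiv_multi_def)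
qed

lemma finite_multisets_le: "finite {\<mu> :: 'n::finite multiset. size \<mu> \<le> q}"
proof -
  have "{\<mu> :: 'n multiset. size \<mu> \<le> q} \<subseteq> mset ` {xs. set xs \<subseteq> UNIV \<and> length xs \<le> q}"
  proof
    fix \<mu> :: "'n multiset" assume "\<mu> \<in> {\<mu>. size \<mu> \<le> q}"
    moreover obtain xs where "mset xs = \<mu>" using ex_mset by blast
    ultimately show "\<mu> \<in> mset ` {xs. set xs \<subseteq> UNIV \<and> length xs \<le> q}" by force
  qed
  then show ?thesis by (rule finite_subset) (intro finite_imageI finite_lists_length_le finite)
qed

section \<open>Test functions\<close>

text \<open>The classical function exp(-1/t), together with its products by t^(-m): differentiation
  maps this family into its own linear span, so one induction over all m proves smoothness.\<close>

definition bump :: "nat \<Rightarrow> real \<Rightarrow> real" where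
  "bump m t = (if t > 0 then (1 / t) ^ m * exp (- (1 / t)) else 0)"

lemma bump_tendsto_0: "(bump m \<longlongrightarrow> 0) (at_right 0)"
proof -
  have "((\<lambda>t. inverse t ^ m / exp (inverse t)) \<longlongrightarrow> (0::real)) (at_right 0)"
    by (rule filterlim_compose[OF tendsto_power_div_exp_0 filterlim_inverse_at_top_right])
  moreover have "\<forall>\<^sub>F t in at_right 0. inverse t ^ m / exp (inverse t) = bump m t"
    by (auto simp: eventually_at_right_field bump_def exp_minus divide_inverse intro!: exI[of _ 1])
  ultimately show ?thesis using tendsto_cong by fast
qed

lemma bump_has_derivative:
  "(bump m has_derivative (\<lambda>v. v * (bump (m + 2) t - real m * bump (m + 1) t))) (at t)"
proof -
  have "(bump m has_real_derivative (bump (m + 2) t - real m * bump (m + 1) t)) (at t)"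
  proof (cases "t = 0")
    case True
    \<comment> \<open>At the origin the difference quotient vanishes from the left and equals
      \<open>bump (Suc m)\<close> from the right, which again tends to 0.\<close>
    have "((\<lambda>h. (bump m (0 + h) - bump m 0) / h) \<longlongrightarrow> 0) (at 0)"
    proof (rule filterlim_split_at)
      show "((\<lambda>h. (bump m (0 + h) - bump m 0) / h) \<longlongrightarrow> 0) (at_left 0)"
        by (rule tendsto_eventually) (auto simp: eventually_at_left_field bump_def intro!: exI[of _ "-1"])
      have "\<forall>\<^sub>F h in at_right 0. bump (Suc m) h = (bump m (0 + h) - bump m 0) / h"
        by (auto simp: eventually_at_right_field bump_def intro!: exI[of _ 1])
      then show "((\<lambda>h. (bump m (0 + h) - bump m 0) / h) \<longlongrightarrow> 0) (at_right 0)"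
        using bump_tendsto_0[of "Suc m"] tendsto_cong by fast
    qed
    then show ?thesis unfolding DERIV_def True by (simp add: bump_def)
  next
    case False
    show ?thesis
    proof (cases "t > 0")
      case True
      have "((\<lambda>t. (1 / t) ^ m * exp (- (1 / t))) has_real_derivative
          (1 / t) ^ (m + 2) * exp (- (1 / t)) - real m * ((1 / t) ^ (m + 1) * exp (- (1 / t)))) (at t)"
      proof -
        have pw: "((\<lambda>t. (1 / t) ^ m) has_real_derivative (- (real m * (1 / t) ^ (m + 1)))) (at t)"
        proof (induction m)
          case (Suc m)
          have inv: "((\<lambda>t. 1 / t) has_real_derivative (- ((1 / t) ^ 2))) (at t)"
            using True by (auto intro!: derivative_eq_intros simp: power2_eq_square)
          have "((\<lambda>t. 1 / t * (1 / t) ^ m) has_real_derivative (- (real (Suc m) * (1 / t) ^ (Suc m + 1)))) (at t)"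
            by (rule DERIV_cong[OF DERIV_mult[OF inv Suc]]) (simp add: power2_eq_square algebra_simps add_divide_distrib)
          then show ?case by simp
        qed simp
        have "((\<lambda>t. exp (- (1 / t))) has_real_derivative (1 / t) ^ 2 * exp (- (1 / t))) (at t)"
          using True by (auto intro!: derivative_eq_intros simp: power2_eq_square)
        from DERIV_mult[OF pw this] show ?thesis
          by (rule DERIV_cong) (simp add: power2_eq_square power_add algebra_simps)
      qed
      then have "(bump m has_real_derivative
          (1 / t) ^ (m + 2) * exp (- (1 / t)) - real m * ((1 / t) ^ (m + 1) * exp (- (1 / t)))) (at t)"
        by (rule has_field_derivative_transform_within_open[of _ _ _ "{0<..}"])
          (use True in \<open>auto simp: bump_def\<close>)
      then show ?thesis using True by (simp add: bump_def)
    next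
      case nt: False
      have "((\<lambda>t. 0) has_real_derivative 0) (at t)" by simp
      then have "(bump m has_real_derivative 0) (at t)"
        by (rule has_field_derivative_transform_within_open[of _ _ _ "{..<0}"])
          (use nt False in \<open>auto simp: bump_def\<close>)
      then show ?thesis using nt by (simp add: bump_def)
    qed
  qed
  then show ?thesis
    by (rule has_derivative_eq_rhs[OF has_field_derivative_imp_has_derivative]) (auto simp: mult.commute)
qed

lemma smooth_on_bump: "smooth_on UNIV (bump m)"
  unfolding smooth_on_def
proof
  fix k show "Ck_on k UNIV (bump m)"
  proof (induction k arbitrary: m)
    case 0
    then show ?case
      using bump_has_derivative by (auto intro!: continuous_at_imp_continuous_on has_derivative_continuous)
  next
    case (Suc k)
    show ?case
    proof (rule Ck_on_SucI[OF bump_has_derivative])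
      fix v
      have "Ck_on k UNIV (\<lambda>t. v * (bump (m + 2) t + (- real m) * bump (m + 1) t))"
        by (intro Ck_on_mult Ck_on_add Ck_on_const open_UNIV Suc.IH)
      then show "Ck_on k UNIV (\<lambda>t. v * (bump (m + 2) t - real m * bump (m + 1) t))" by simp
    qed simp
  qed
qed

lemma bump0_bounds: "0 \<le> bump 0 t" "bump 0 t \<le> 1" "0 < bump 0 t \<longleftrightarrow> 0 < t" "t \<le> 0 \<Longrightarrow> bump 0 t = 0"
  by (auto simp: bump_def)

text \<open>A bump positive exactly on an open box and bounded by 1. Boxes are preferred to balls
  because they form an intersection-stable generator of the Borel sets.\<close>

definition box_bump :: "real^'n::finite \<Rightarrow> real^'n \<Rightarrow> real^'n \<Rightarrow> real" where
  "box_bump a b x = (\<Prod>i\<in>UNIV. bump 0 (x $ i - a $ i) * bump 0 (b $ i - x $ i))"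

lemma box_bump_nonneg: "0 \<le> box_bump a b x"
  unfolding box_bump_def by (intro prod_nonneg) (auto simp: bump0_bounds)

lemma box_bump_le_1: "box_bump a b x \<le> 1"
  unfolding box_bump_def by (intro prod_le_1) (auto simp: bump0_bounds intro!: mult_le_one)

lemma box_bump_pos_iff: "0 < box_bump a b x \<longleftrightarrow> x \<in> box a b"
proof
  assume "0 < box_bump a b x"
  then have "\<forall>i. bump 0 (x $ i - a $ i) * bump 0 (b $ i - x $ i) \<noteq> 0"
    by (auto simp: box_bump_def less_le)
  then have "a $ i < x $ i \<and> x $ i < b $ i" for i
    by (metis bump0_bounds(4) diff_gt_0_iff_gt linorder_not_less mult_eq_0_iff)
  then show "x \<in> box a b" by (simp add: mem_box_cart)
next
  assume "x \<in> box a b"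
  then show "0 < box_bump a b x"
    unfolding box_bump_def by (intro prod_pos) (auto simp: mem_box_cart bump0_bounds)
qed

lemma box_bump_eq_0: "x \<notin> box a b \<Longrightarrow> box_bump a b x = 0"
  using box_bump_pos_iff[of a b x] box_bump_nonneg[of a b x] by linarith

lemma smooth_on_box_bump: "smooth_on UNIV (box_bump a b)"
proof -
  have aff: "smooth_on UNIV (\<lambda>x::real^'n. x $ i + c)" "smooth_on UNIV (\<lambda>x::real^'n. c + - (x $ i))" for i c
    by (intro smooth_on_add smooth_on_const open_UNIV smooth_on_bounded_linear bounded_linear_vec_nth
        bounded_linear_minus)+
  have "smooth_on UNIV (\<lambda>x. bump 0 (x $ i + - a $ i))" "smooth_on UNIV (\<lambda>x. bump 0 (b $ i + - (x $ i)))" for i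
    by (rule smooth_on_compose[OF open_UNIV open_UNIV _ aff(1) smooth_on_bump]
      smooth_on_compose[OF open_UNIV open_UNIV _ aff(2) smooth_on_bump]; simp)+
  then have "smooth_on UNIV (\<lambda>x. \<Prod>i\<in>UNIV. bump 0 (x $ i + - a $ i) * bump 0 (b $ i + - (x $ i)))"
    by (intro smooth_on_prod smooth_on_mult open_UNIV)
  moreover have "(\<lambda>x. \<Prod>i\<in>UNIV. bump 0 (x $ i + - a $ i) * bump 0 (b $ i + - (x $ i))) = box_bump a b"
    by (auto simp: box_bump_def)
  ultimately show ?thesis by simp
qed

lemma test_functionsI:
  assumes "smooth_on UNIV f" "compact K" "\<And>x. x \<notin> K \<Longrightarrow> f x = 0"
  shows "f \<in> test_functions"
proof -
  have "closure {x. f x \<noteq> 0} \<subseteq> K"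
    using assms by (intro closure_minimal) (auto simp: compact_imp_closed)
  then have "compact (closure {x. f x \<noteq> 0})"
    using compact_Int_closed[OF assms(2) closed_closure[of "{x. f x \<noteq> 0}"]]
    by (simp add: Int_absorb1 del: compact_closure)
  then show ?thesis using assms(1) by (simp add: test_functions_def)
qed

lemma test_smooth: "f \<in> test_functions \<Longrightarrow> smooth_on UNIV f"
  by (simp add: test_functions_def)

lemma test_support:
  assumes "f \<in> test_functions"
  obtains K where "compact K" "\<And>x. x \<notin> K \<Longrightarrow> f x = 0"
proof (rule that)
  show "compact (closure {x. f x \<noteq> 0})" using assms by (simp add: test_functions_def)
  show "f x = 0" if "x \<notin> closure {x. f x \<noteq> 0}" for x
    using that closure_subset[of "{x. f x \<noteq> 0}"] by auto
qed

lemma test_support_ball: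
  assumes "f \<in> test_functions"
  obtains R where "R > 0" "\<And>x. norm x > R \<Longrightarrow> f x = 0"
proof -
  obtain K where K: "compact K" "\<And>x. x \<notin> K \<Longrightarrow> f x = 0" using test_support[OF assms] by blast
  obtain R where "R > 0" "\<And>x. x \<in> K \<Longrightarrow> norm x \<le> R"
    using K(1) compact_imp_bounded bounded_pos by metis
  then show ?thesis using that[of R] K(2) by (meson linorder_not_le)
qed

lemma test_smooth_mult:
  assumes "f \<in> test_functions" "smooth_on UNIV g"
  shows "(\<lambda>x. g x * f x) \<in> test_functions"
proof -
  obtain K where K: "compact K" "\<And>x. x \<notin> K \<Longrightarrow> f x = 0" using test_support[OF assms(1)] by blast
  show ?thesis by (rule test_functionsI[OF _ K(1)])
    (auto intro!: smooth_on_mult[OF open_UNIV assms(2) test_smooth[OF assms(1)]] simp: K(2))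
qed

lemma test_cmult: "f \<in> test_functions \<Longrightarrow> (\<lambda>x. c * f x) \<in> test_functions"
  by (rule test_smooth_mult[OF _ smooth_on_const])

lemma test_add:
  assumes "f \<in> test_functions" "g \<in> test_functions"
  shows "(\<lambda>x. f x + g x) \<in> test_functions"
proof -
  obtain K where K: "compact K" "\<And>x. x \<notin> K \<Longrightarrow> f x = 0" using test_support[OF assms(1)] by blast
  obtain L where L: "compact L" "\<And>x. x \<notin> L \<Longrightarrow> g x = 0" using test_support[OF assms(2)] by blast
  show ?thesis by (rule test_functionsI[OF _ compact_Un[OF K(1) L(1)]])
    (auto intro!: smooth_on_add[OF open_UNIV test_smooth[OF assms(1)] test_smooth[OF assms(2)]] simp: K(2) L(2))
qed

lemma test_zero: "(\<lambda>x. 0) \<in> test_functions"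
  by (rule test_functionsI[of _ "{}"]) (auto intro: smooth_on_const)

lemma test_sum:
  assumes "\<And>i. i \<in> I \<Longrightarrow> f i \<in> test_functions"
  shows "(\<lambda>x. \<Sum>i\<in>I. f i x) \<in> test_functions"
  using assms
proof (induction I rule: infinite_finite_induct)
  case (insert a I)
  then show ?case using test_add[of "f a" "\<lambda>x. \<Sum>i\<in>I. f i x"] by simp
qed (simp_all add: test_zero)

lemma test_diff:
  assumes "f \<in> test_functions" "g \<in> test_functions"
  shows "(\<lambda>x. f x - g x) \<in> test_functions"
  using test_add[OF assms(1) test_cmult[OF assms(2), of "-1"]] by simp

lemma test_pderivs:
  assumes "f \<in> test_functions"
  shows "pderivs is f \<in> test_functions"
proof (rule test_functionsI)
  show "compact (closure {x. f x \<noteq> 0})" using assms by (simp add: test_functions_def)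
qed (auto intro: smooth_on_pderivs test_smooth assms pderivs_eq_0_outside_closure)

lemma test_box_bump: "(\<lambda>x. complex_of_real (box_bump a b x)) \<in> test_functions"
proof (rule test_functionsI)
  show "compact (cbox a b)" by (rule compact_cbox)
  show "complex_of_real (box_bump a b x) = 0" if "x \<notin> cbox a b" for x
    using that box_bump_eq_0[of x a b] box_subset_cbox[of a b] by auto
qed (rule smooth_on_bounded_linear_compose[OF open_UNIV bounded_linear_of_real smooth_on_box_bump])

lemma test_continuous: "f \<in> test_functions \<Longrightarrow> continuous_on UNIV f"
  using Ck_on_imp_continuous_on[OF smooth_on_imp_Ck[OF test_smooth]] .

lemma test_borel: "f \<in> test_functions \<Longrightarrow> f \<in> borel_measurable borel"
  using borel_measurable_continuous_onI test_continuous by blast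

lemma test_bounded:
  assumes "f \<in> test_functions"
  obtains B where "B > 0" "\<And>x. cmod (f x) \<le> B"
proof -
  obtain K where K: "compact K" "\<And>x. x \<notin> K \<Longrightarrow> f x = 0" using test_support[OF assms] by blast
  have "compact (f ` K)"
    by (rule compact_continuous_image[OF continuous_on_subset[OF test_continuous[OF assms]] K(1)]) simp
  then obtain B where "B > 0" "\<forall>y\<in>f ` K. norm y \<le> B" using compact_imp_bounded bounded_pos by metis
  then show ?thesis using that[of B] K(2) by (metis image_eqI less_imp_le norm_zero)
qed

lemma test_integrable:
  assumes "f \<in> test_functions"
  shows "integrable lborel f"
proof -
  obtain K where K: "compact K" "\<And>x. x \<notin> K \<Longrightarrow> f x = 0" using test_support[OF assms] by blast
  have "set_integrable lborel K f"
    unfolding set_integrable_def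
    using borel_integrable_compact[OF K(1) continuous_on_subset[OF test_continuous[OF assms]]]
    by (auto simp: indicator_scaleR_eq_if)
  moreover have "(\<lambda>x. indicator K x *\<^sub>R f x) = f" using K(2) by (auto simp: indicator_def)
  ultimately show ?thesis by (simp add: set_integrable_def)
qed

section \<open>Integrals of test functions under translations and dilations\<close>

lemma lebesgue_eq_lborel_integral:
  fixes f :: "'a::euclidean_space \<Rightarrow> 'b::{banach, second_countable_topology}"
  shows "f \<in> borel_measurable borel \<Longrightarrow> integral\<^sup>L lebesgue f = integral\<^sup>L lborel f"
  by (rule integral_completion) simp

lemma lborel_integral_translate:
  fixes f :: "'a::euclidean_space \<Rightarrow> 'b::{banach, second_countable_topology}"
  assumes "f \<in> borel_measurable borel"
  shows "integral\<^sup>L lborel (\<lambda>x. f (a + x)) = integral\<^sup>L lborel f"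
proof -
  have "integral\<^sup>L lborel f = integral\<^sup>L (distr lborel borel (\<lambda>x. a + x)) f"
    using lborel_distr_plus[of a] by simp
  also have "\<dots> = integral\<^sup>L lborel (\<lambda>x. f (a + x))"
    by (rule integral_distr) (use assms in auto)
  finally show ?thesis by simp
qed

lemma lborel_integral_affine:
  fixes f :: "'a::euclidean_space \<Rightarrow> 'b::{banach, second_countable_topology}"
  assumes "f \<in> borel_measurable borel" "c \<noteq> 0"
  shows "integral\<^sup>L lborel f = (\<bar>c\<bar> ^ DIM('a)) *\<^sub>R integral\<^sup>L lborel (\<lambda>x. f (t + c *\<^sub>R x))"
proof -
  have "integral\<^sup>L lborel f
     = integral\<^sup>L (density (distr lborel borel (\<lambda>x. t + c *\<^sub>R x)) (\<lambda>_. ennreal (\<bar>c\<bar>^DIM('a)))) f"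
    by (rule arg_cong[where f="\<lambda>M. integral\<^sup>L M f"]) (rule lborel_affine, use assms in auto)
  also have "\<dots> = integral\<^sup>L (distr lborel borel (\<lambda>x. t + c *\<^sub>R x)) (\<lambda>x. \<bar>c\<bar>^DIM('a) *\<^sub>R f x)"
    by (rule integral_density) (use assms in auto)
  also have "\<dots> = integral\<^sup>L lborel (\<lambda>x. \<bar>c\<bar>^DIM('a) *\<^sub>R f (t + c *\<^sub>R x))"
    by (rule integral_distr) (use assms in auto)
  finally show ?thesis by simp
qed

lemma test_affine:
  fixes f :: "real^'n::finite \<Rightarrow> complex"
  assumes "f \<in> test_functions" "c \<noteq> 0"
  shows "(\<lambda>z. f (t + c *\<^sub>R z)) \<in> test_functions"
proof -
  obtain K where K: "compact K" "\<And>x. x \<notin> K \<Longrightarrow> f x = 0" using test_support[OF assms(1)] by blast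
  show ?thesis
  proof (rule test_functionsI)
    have "smooth_on UNIV (\<lambda>z::real^'n. t + c *\<^sub>R z)"
      by (intro smooth_on_add smooth_on_const open_UNIV smooth_on_bounded_linear bounded_linear_scaleR_right)
    then show "smooth_on UNIV (\<lambda>z. f (t + c *\<^sub>R z))"
      by (rule smooth_on_compose[OF open_UNIV open_UNIV _ _ test_smooth[OF assms(1)], rotated]) simp
    show "compact ((\<lambda>y. (1 / c) *\<^sub>R (y - t)) ` K)"
      by (intro compact_continuous_image continuous_intros K(1))
    fix z assume "z \<notin> (\<lambda>y. (1 / c) *\<^sub>R (y - t)) ` K"
    moreover have "z = (1 / c) *\<^sub>R ((t + c *\<^sub>R z) - t)" using assms(2) by simp
    ultimately have "t + c *\<^sub>R z \<notin> K" by blast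
    then show "f (t + c *\<^sub>R z) = 0" by (rule K(2))
  qed
qed

text \<open>Differentiating the translation invariance of the integral avoids iterated integrals.\<close>

lemma integral_pderiv_eq_0:
  fixes f :: "real^'n::finite \<Rightarrow> complex"
  assumes "f \<in> test_functions"
  shows "integral\<^sup>L lborel (pderivs [i] f) = 0"
proof -
  define e :: "real^'n" where "e = axis i 1"
  have ne: "norm e = 1" by (simp add: e_def)
  have df: "pderivs [i] f \<in> test_functions" by (rule test_pderivs[OF assms])
  obtain B where B: "B > 0" "\<And>x. cmod (pderivs [i] f x) \<le> B" using test_bounded[OF df] by blast
  obtain R where R: "R > 0" "\<And>x. norm x > R \<Longrightarrow> f x = 0" using test_support_ball[OF assms] by blast
  define t where "t k = 1 / real (Suc k)" for k
  have t: "t k > 0" "t k \<le> 1" for k by (auto simp: t_def)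
  have tlim: "t \<longlonglongrightarrow> 0" unfolding t_def by (rule LIMSEQ_Suc[OF lim_1_over_n])
  have der: "((\<lambda>s. f (x + s *\<^sub>R e)) has_derivative (\<lambda>h. h *\<^sub>R pderivs [i] f (x + s *\<^sub>R e))) (at s within A)" for x s A
  proof -
    have 1: "(f has_derivative frechet_derivative f (at (x + s *\<^sub>R e))) (at (x + s *\<^sub>R e))"
      by (rule smooth_on_has_derivative[OF test_smooth[OF assms]]) simp
    have 2: "((\<lambda>s. x + s *\<^sub>R e) has_derivative (\<lambda>h. h *\<^sub>R e)) (at s within A)"
      by (auto intro!: derivative_eq_intros)
    have "((\<lambda>s. f (x + s *\<^sub>R e)) has_derivative (\<lambda>h. frechet_derivative f (at (x + s *\<^sub>R e)) (h *\<^sub>R e))) (at s within A)"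
      by (rule has_derivative_compose[OF 2 1])
    moreover have "linear (frechet_derivative f (at (x + s *\<^sub>R e)))"
      by (rule linear_frechet_derivative)
        (metis UNIV_I assms differentiable_def smooth_on_has_derivative test_smooth)
    ultimately show ?thesis by (simp add: linear_cmul e_def)
  qed
  have lip: "cmod (f (x + s *\<^sub>R e) - f x) \<le> B * \<bar>s\<bar>" for x s
  proof -
    have "cmod (f (x + s *\<^sub>R e) - f (x + 0 *\<^sub>R e)) \<le> B * norm (s - 0)"
    proof (rule differentiable_bound[where S=UNIV])
      fix u show "onorm (\<lambda>h. h *\<^sub>R pderivs [i] f (x + u *\<^sub>R e)) \<le> B"
        by (rule onorm_bound) (use B in \<open>auto simp: mult.commute[of B] intro!: mult_left_mono\<close>)
    qed (use der in auto)
    then show ?thesis by simp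
  qed
  define s where "s k x = (f (x + t k *\<^sub>R e) - f x) / t k" for k x
  have fm: "f \<in> borel_measurable borel" by (rule test_borel[OF assms])
  have "integral\<^sup>L lborel (s k) = 0" for k
  proof -
    have tr: "(\<lambda>x. f (x + t k *\<^sub>R e)) = (\<lambda>x. f (t k *\<^sub>R e + x))" by (simp add: add.commute)
    have "integrable lborel (\<lambda>x. f (t k *\<^sub>R e + x))"
    proof -
      have "integrable (distr lborel borel (\<lambda>x. t k *\<^sub>R e + x)) f"
        using test_integrable[OF assms] lborel_distr_plus[of "t k *\<^sub>R e"] by simp
      then show ?thesis by (subst (asm) integrable_distr_eq) (use fm in auto)
    qed
    then have I: "integrable lborel (\<lambda>x. f (x + t k *\<^sub>R e))" unfolding tr .
    have "integral\<^sup>L lborel (\<lambda>x. f (x + t k *\<^sub>R e)) = integral\<^sup>L lborel f"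
      unfolding tr by (rule lborel_integral_translate[OF fm])
    then show ?thesis unfolding s_def using I test_integrable[OF assms] by simp
  qed
  moreover have "(\<lambda>k. integral\<^sup>L lborel (s k)) \<longlonglongrightarrow> integral\<^sup>L lborel (pderivs [i] f)"
  \<comment> \<open>The quotients are bounded by the supremum \<open>B\<close> of the derivative,
    and a step of length at most 1 enlarges the support, contained in a ball of radius
    \<open>R\<close>, by at most 1.\<close>
  proof (rule integral_dominated_convergence[where w="\<lambda>x. B * indicator (cball 0 (R + 1)) x"])
    show "pderivs [i] f \<in> borel_measurable lborel" using test_borel[OF df] by simp
    show "s k \<in> borel_measurable lborel" for k unfolding s_def using fm by simp
    show "integrable lborel (\<lambda>x. B * indicator (cball 0 (R + 1)) x)"
      by (intro integrable_mult_right integrable_real_indicator emeasure_bounded_finite) auto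
    show "AE x in lborel. (\<lambda>k. s k x) \<longlonglongrightarrow> pderivs [i] f x"
    proof (rule AE_I2)
      fix x
      define D where "D = pderivs [i] f x"
      have "((\<lambda>u. norm (f (x + u *\<^sub>R e) - f x - u *\<^sub>R D) / norm u) \<longlongrightarrow> 0) (at 0)"
        using der[of x 0 UNIV] unfolding has_derivative_at D_def[symmetric] by (simp del: pderivs.simps add: D_def[symmetric])
      moreover have "\<forall>\<^sub>F u in at (0::real). norm (f (x + u *\<^sub>R e) - f x - u *\<^sub>R D) / norm u
          = norm ((f (x + u *\<^sub>R e) - f x) /\<^sub>R u - D)"
      proof (unfold eventually_at_filter, intro always_eventually allI impI)
        fix u :: real assume "u \<noteq> 0"
        then have "(f (x + u *\<^sub>R e) - f x) /\<^sub>R u - D = (f (x + u *\<^sub>R e) - f x - u *\<^sub>R D) /\<^sub>R u"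
          by (simp add: scaleR_diff_right)
        then show "norm (f (x + u *\<^sub>R e) - f x - u *\<^sub>R D) / norm u
          = norm ((f (x + u *\<^sub>R e) - f x) /\<^sub>R u - D)"
          by (simp only: norm_scaleR) (simp add: divide_inverse mult.commute)
      qed
      ultimately have "((\<lambda>u. norm ((f (x + u *\<^sub>R e) - f x) /\<^sub>R u - D)) \<longlongrightarrow> 0) (at 0)"
        by (rule Lim_transform_eventually)
      then have "((\<lambda>u. (f (x + u *\<^sub>R e) - f x) /\<^sub>R u) \<longlongrightarrow> pderivs [i] f x) (at 0)"
        unfolding tendsto_norm_zero_iff D_def by (rule LIM_zero_cancel)
      then have "(\<lambda>k. (f (x + t k *\<^sub>R e) - f x) /\<^sub>R t k) \<longlonglongrightarrow> pderivs [i] f x"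
        by (rule filterlim_compose) (use tlim t in \<open>auto simp: filterlim_at less_imp_neq[THEN not_sym]\<close>)
      then show "(\<lambda>k. s k x) \<longlonglongrightarrow> pderivs [i] f x"
        by (simp add: s_def scaleR_conv_of_real divide_inverse mult.commute del: pderivs.simps)
    qed
    show "AE x in lborel. norm (s k x) \<le> B * indicator (cball 0 (R + 1)) x" for k
    proof (rule AE_I2)
      fix x
      show "norm (s k x) \<le> B * indicator (cball 0 (R + 1)) x"
      proof (cases "norm x \<le> R + 1")
        case True
        then show ?thesis using lip[of x "t k"] t[of k] by (simp add: s_def norm_divide field_simps)
      next
        case False
        have "norm (x + t k *\<^sub>R e) \<ge> norm x - norm (t k *\<^sub>R e)"
          using norm_triangle_ineq2[of x "- (t k *\<^sub>R e)"] by simp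
        moreover have "norm (t k *\<^sub>R e) \<le> 1" using t[of k] ne by simp
        ultimately have "norm (x + t k *\<^sub>R e) > R" using False by linarith
        then show ?thesis using False R by (simp add: s_def)
      qed
    qed
  qed
  ultimately have "(\<lambda>k. 0) \<longlonglongrightarrow> integral\<^sup>L lborel (pderivs [i] f)" by (simp only:)
  then show ?thesis by (simp only: LIMSEQ_const_iff)
qed

section \<open>The Fourier transform of test functions\<close>

lemma smooth_on_cis: "smooth_on UNIV cis"
  unfolding smooth_on_def
proof
  have der: "(cis has_derivative (\<lambda>h. of_real h * (\<i> * cis x))) (at x)" for x
    using has_derivative_cis[OF has_derivative_ident, of x UNIV] by (simp add: scaleR_conv_of_real)
  fix k show "Ck_on k UNIV cis"
  proof (induction k)
    case 0
    then show ?case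
      using der by (auto intro!: continuous_at_imp_continuous_on has_derivative_continuous)
  next
    case (Suc k)
    show ?case
      by (rule Ck_on_SucI[OF der]) (intro Ck_on_mult Ck_on_const open_UNIV Suc.IH)+
  qed
qed

lemma smooth_on_character: "smooth_on UNIV (\<lambda>x::real^'n::finite. cis (- (x \<bullet> \<xi>)))"
proof (rule smooth_on_compose[OF open_UNIV open_UNIV _ _ smooth_on_cis])
  show "smooth_on UNIV (\<lambda>x::real^'n. - (x \<bullet> \<xi>))"
    by (rule smooth_on_bounded_linear[OF open_UNIV bounded_linear_minus[OF bounded_linear_inner_left]])
qed simp

lemma integrable_cis_mult:
  fixes f :: "real^'n::finite \<Rightarrow> complex"
  assumes "integrable lborel f" "g \<in> borel_measurable borel"
  shows "integrable lborel (\<lambda>x. cis (g x) * f x)"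
proof (rule Bochner_Integration.integrable_bound[OF assms(1)])
  have "(\<lambda>x. cis (g x)) \<in> borel_measurable borel"
    using borel_measurable_continuous_onI[OF Ck_on_imp_continuous_on[OF smooth_on_imp_Ck[OF smooth_on_cis]]]
    by (rule measurable_compose[OF assms(2)])
  then show "(\<lambda>x. cis (g x) * f x) \<in> borel_measurable lborel"
    using borel_measurable_integrable[OF assms(1)] by simp
qed (simp add: norm_mult)

lemma integrable_character_mult:
  fixes f :: "real^'n::finite \<Rightarrow> complex"
  assumes "integrable lborel f"
  shows "integrable lborel (\<lambda>x. cis (- (x \<bullet> \<xi>)) * f x)"
  by (rule integrable_cis_mult[OF assms]) simp

lemma fourier_lborel:
  fixes f :: "real^'n::finite \<Rightarrow> complex"
  assumes "integrable lborel f"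
  shows "fourier f \<xi> = (LINT x|lborel. cis (- (x \<bullet> \<xi>)) * f x)"
  unfolding fourier_def
  by (rule lebesgue_eq_lborel_integral)
    (use borel_measurable_integrable[OF integrable_character_mult[OF assms, of \<xi>]] in simp)

lemma norm_fourier_le:
  fixes f :: "real^'n::finite \<Rightarrow> complex"
  assumes "integrable lborel f"
  shows "cmod (fourier f \<xi>) \<le> (LINT x|lborel. cmod (f x))"
  unfolding fourier_lborel[OF assms]
  using integral_norm_bound[of lborel "\<lambda>x. cis (- (x \<bullet> \<xi>)) * f x"] by (simp add: norm_mult)

lemma fourier_add:
  fixes f g :: "real^'n::finite \<Rightarrow> complex"
  assumes "integrable lborel f" "integrable lborel g"
  shows "fourier (\<lambda>x. f x + g x) \<xi> = fourier f \<xi> + fourier g \<xi>"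
  using assms integrable_character_mult[OF assms(1), of \<xi>] integrable_character_mult[OF assms(2), of \<xi>]
  by (simp add: fourier_lborel algebra_simps)

lemma fourier_cmult: "fourier (\<lambda>x. c * f x) \<xi> = c * fourier f \<xi>"
  unfolding fourier_def by (simp add: mult.left_commute)

lemma fourier_diff:
  fixes f g :: "real^'n::finite \<Rightarrow> complex"
  assumes "integrable lborel f" "integrable lborel g"
  shows "fourier (\<lambda>x. f x - g x) \<xi> = fourier f \<xi> - fourier g \<xi>"
  using assms integrable_character_mult[OF assms(1), of \<xi>] integrable_character_mult[OF assms(2), of \<xi>]
  by (simp add: fourier_lborel algebra_simps)

lemma fourier_sum:
  fixes f :: "'i \<Rightarrow> real^'n::finite \<Rightarrow> complex"
  assumes "\<And>i. i \<in> I \<Longrightarrow> integrable lborel (f i)"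
  shows "fourier (\<lambda>x. \<Sum>i\<in>I. f i x) \<xi> = (\<Sum>i\<in>I. fourier (f i) \<xi>)"
  using assms
proof (induction I rule: infinite_finite_induct)
  case (insert a I)
  then show ?case using fourier_add[of "f a" "\<lambda>x. \<Sum>i\<in>I. f i x" \<xi>] by simp
qed (simp_all add: fourier_def)

text \<open>Integration by parts: the product of \<open>f\<close> with the character is a test
  function, so its partial derivative has integral zero.\<close>

lemma fourier_pderiv:
  assumes "f \<in> test_functions"
  shows "fourier (pderivs [i] f) \<xi> = \<i> * of_real (\<xi> $ i) * fourier f \<xi>"
proof -
  let ?e = "\<lambda>x. cis (- (x \<bullet> \<xi>))"
  have dh: "pderivs [i] (\<lambda>x. ?e x * f x) x = ?e x * pderivs [i] f x + (- \<i> * of_real (\<xi> $ i)) * (?e x * f x)" for x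
  proof -
    have e': "(?e has_derivative (\<lambda>v. (- (v \<bullet> \<xi>)) *\<^sub>R (\<i> * ?e x))) (at x)"
      by (rule has_derivative_cis) (auto intro!: derivative_eq_intros)
    have f': "(f has_derivative frechet_derivative f (at x)) (at x)"
      by (rule smooth_on_has_derivative[OF test_smooth[OF assms]]) simp
    show ?thesis
      using has_derivative_imp_frechet[OF has_derivative_mult[OF e' f']]
      by (simp add: scaleR_conv_of_real inner_axis' algebra_simps)
  qed
  have "(\<lambda>x. ?e x * f x) \<in> test_functions"
    by (rule test_smooth_mult[OF assms smooth_on_character])
  then have "0 = integral\<^sup>L lborel (pderivs [i] (\<lambda>x. ?e x * f x))"
    by (simp only: integral_pderiv_eq_0)
  also have "\<dots> = (LINT x|lborel. ?e x * pderivs [i] f x + (- \<i> * of_real (\<xi> $ i)) * (?e x * f x))"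
    by (rule Bochner_Integration.integral_cong[OF refl]) (rule dh)
  also have "\<dots> = fourier (pderivs [i] f) \<xi> + (- \<i> * of_real (\<xi> $ i)) * fourier f \<xi>"
    using integrable_character_mult[OF test_integrable[OF assms], of \<xi>]
      integrable_character_mult[OF test_integrable[OF test_pderivs[OF assms, of "[i]"]], of \<xi>]
    by (simp add: fourier_lborel[OF test_integrable[OF assms]] fourier_lborel[OF test_integrable[OF test_pderivs[OF assms]]]
        del: pderivs.simps)
  finally show ?thesis by (simp add: algebra_simps)
qed

lemma fourier_pderivs:
  assumes "f \<in> test_functions"
  shows "fourier (pderivs is f) \<xi> = prod_list (map (\<lambda>i. \<i> * of_real (\<xi> $ i)) is) * fourier f \<xi>"
proof (induction "is")
  case (Cons i "is")
  have "pderivs (i # is) f = pderivs [i] (pderivs is f)" by simp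
  then show ?case using fourier_pderiv[OF test_pderivs[OF assms], of i "is"] Cons.IH
    by (simp add: mult.assoc)
qed simp

lemma norm_prod_list_coords: "cmod (prod_list (map (\<lambda>i. \<i> * of_real (\<xi> $ i)) is)) \<le> norm \<xi> ^ length is"
  by (induction "is") (auto simp: norm_mult intro!: mult_mono component_le_norm_cart)

lemma fourier_coord_decay:
  assumes "f \<in> test_functions"
  shows "\<bar>\<xi> $ i\<bar> ^ m * cmod (fourier f \<xi>) \<le> (LINT x|lborel. cmod (pderivs (replicate m i) f x))"
proof -
  have "fourier (pderivs (replicate m i) f) \<xi> = (\<i> * of_real (\<xi> $ i)) ^ m * fourier f \<xi>"
    using fourier_pderivs[OF assms, of "replicate m i"] by (simp add: prod_list_replicate)
  then have "cmod (fourier (pderivs (replicate m i) f) \<xi>) = \<bar>\<xi> $ i\<bar> ^ m * cmod (fourier f \<xi>)"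
    by (simp add: norm_mult norm_power)
  then show ?thesis
    using norm_fourier_le[OF test_integrable[OF test_pderivs[OF assms]]] by metis
qed

text \<open>The coordinate of largest modulus controls the norm of \<xi> up to the factor n, so pure
  derivatives in one direction are enough. The bound is kept explicit in L^1 norms because it will
  be applied uniformly to families of functions.\<close>

lemma fourier_decay:
  fixes f :: "real^'n::finite \<Rightarrow> complex"
  assumes "f \<in> test_functions"
  shows "(1 + norm \<xi>) ^ m * cmod (fourier f \<xi>) \<le> 2 ^ m * ((LINT x|lborel. cmod (f x)) +
    real CARD('n) ^ m * (\<Sum>i\<in>UNIV. LINT x|lborel. cmod (pderivs (replicate m i) f x)))"
proof -
  obtain i where i: "\<And>j. \<bar>\<xi> $ j\<bar> \<le> \<bar>\<xi> $ i\<bar>"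
  proof -
    have "Max (range (\<lambda>j. \<bar>\<xi> $ j\<bar>)) \<in> range (\<lambda>j. \<bar>\<xi> $ j\<bar>)" by (intro Max_in) auto
    then obtain i where "Max (range (\<lambda>j. \<bar>\<xi> $ j\<bar>)) = \<bar>\<xi> $ i\<bar>" by (elim imageE) auto
    then show ?thesis using that[of i] Max_ge[of "range (\<lambda>j. \<bar>\<xi> $ j\<bar>)"] by auto
  qed
  have "norm \<xi> \<le> (\<Sum>j\<in>UNIV. \<bar>\<xi> $ j\<bar>)" by (rule norm_le_l1_cart)
  also have "\<dots> \<le> real CARD('n) * \<bar>\<xi> $ i\<bar>" using sum_bounded_above[of UNIV "\<lambda>j. \<bar>\<xi> $ j\<bar>" "\<bar>\<xi> $ i\<bar>"] i by simp
  finally have n: "norm \<xi> \<le> real CARD('n) * \<bar>\<xi> $ i\<bar>" .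
  let ?F = "cmod (fourier f \<xi>)"
  have "(1 + norm \<xi>) ^ m \<le> 2 ^ m * (1 + (real CARD('n) * \<bar>\<xi> $ i\<bar>) ^ m)"
  proof (cases "norm \<xi> \<le> 1")
    case True
    then have "(1 + norm \<xi>) ^ m \<le> 2 ^ m" by (intro power_mono) auto
    moreover have "0 \<le> 2 ^ m * (real CARD('n) * \<bar>\<xi> $ i\<bar>) ^ m" by simp
    ultimately show ?thesis unfolding distrib_left by linarith
  next
    case False
    then have "(1 + norm \<xi>) ^ m \<le> (2 * norm \<xi>) ^ m" by (intro power_mono) auto
    also have "\<dots> \<le> (2 * (real CARD('n) * \<bar>\<xi> $ i\<bar>)) ^ m" using n by (intro power_mono) auto
    finally have A: "(1 + norm \<xi>) ^ m \<le> 2 ^ m * (real CARD('n) * \<bar>\<xi> $ i\<bar>) ^ m"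
      by (simp add: power_mult_distrib)
    have B: "(0::real) \<le> 2 ^ m" by simp
    show ?thesis unfolding distrib_left using A B by linarith
  qed
  then have "(1 + norm \<xi>) ^ m * ?F \<le> (2 ^ m * (1 + (real CARD('n) * \<bar>\<xi> $ i\<bar>) ^ m)) * ?F"
    by (rule mult_right_mono) simp
  also have "\<dots> = 2 ^ m * (?F + real CARD('n) ^ m * (\<bar>\<xi> $ i\<bar> ^ m * ?F))"
    by (simp add: algebra_simps power_mult_distrib)
  also have "\<dots> \<le> 2 ^ m * ((LINT x|lborel. cmod (f x)) +
    real CARD('n) ^ m * (\<Sum>i\<in>UNIV. LINT x|lborel. cmod (pderivs (replicate m i) f x)))"
  proof (intro mult_left_mono add_mono norm_fourier_le test_integrable[OF assms])
    have "\<bar>\<xi> $ i\<bar> ^ m * ?F \<le> (LINT x|lborel. cmod (pderivs (replicate m i) f x))"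
      by (rule fourier_coord_decay[OF assms])
    also have "\<dots> \<le> (\<Sum>i\<in>UNIV. LINT x|lborel. cmod (pderivs (replicate m i) f x))"
      by (rule member_le_sum) auto
    finally show "\<bar>\<xi> $ i\<bar> ^ m * ?F \<le> (\<Sum>i\<in>UNIV. LINT x|lborel. cmod (pderivs (replicate m i) f x))" .
  qed auto
  finally show ?thesis .
qed

lemma cis_second_order: "cmod (cis (a + h) - cis a - of_real h * (\<i> * cis a)) \<le> h\<^sup>2"
proof -
  have "cmod (cis h - 1 - of_real h * \<i>) \<le> h\<^sup>2"
  proof -
    have "cmod (exp (\<i> * of_real h) - (\<Sum>k\<le>1. (\<i> * of_real h) ^ k / fact k)) \<le> \<bar>h\<bar> ^ 2 / 2"
      using iexp_approx1[of h 1] by (simp add: numeral_2_eq_2)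
    also have "\<dots> \<le> h\<^sup>2" by simp
    finally show ?thesis by (simp add: cis_conv_exp algebra_simps)
  qed
  moreover have "cis (a + h) - cis a - of_real h * (\<i> * cis a) = cis a * (cis h - 1 - of_real h * \<i>)"
    by (simp add: cis_mult algebra_simps)
  ultimately show ?thesis by (simp add: norm_mult)
qed

text \<open>The remainder is estimated directly: \<open>cis_second_order\<close> bounds it by a
  constant times the square of the norm of \<open>v\<close>, the constant being
  \<open>R\<^sup>2\<close> times the L^1 norm of \<open>f\<close>. No theorem on differentiation
  under the integral sign is invoked.\<close>

lemma fourier_has_derivative:
  fixes f :: "real^'n::finite \<Rightarrow> complex"
  assumes "f \<in> test_functions"
  shows "(fourier f has_derivative (\<lambda>v. \<Sum>i\<in>UNIV. of_real (v $ i) * fourier (\<lambda>x. - \<i> * of_real (x $ i) * f x) \<xi>)) (at \<xi>)"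
proof -
  have sm: "smooth_on UNIV (\<lambda>x::real^'n. - \<i> * of_real (x $ i))" for i
    by (intro smooth_on_mult smooth_on_const open_UNIV smooth_on_bounded_linear
      bounded_linear_compose[OF bounded_linear_of_real bounded_linear_vec_nth])
  have tst: "(\<lambda>x. - \<i> * of_real (x $ i) * f x) \<in> test_functions" for i
    by (rule test_smooth_mult[OF assms sm])
  let ?D = "\<lambda>v. \<Sum>i\<in>UNIV. of_real (v $ i) * fourier (\<lambda>x. - \<i> * of_real (x $ i) * f x) \<xi>"
  have D: "?D v = (LINT x|lborel. cis (- (x \<bullet> \<xi>)) * (- \<i> * of_real (x \<bullet> v) * f x))"
    and Di: "integrable lborel (\<lambda>x. cis (- (x \<bullet> \<xi>)) * (- \<i> * of_real (x \<bullet> v) * f x))" for v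
  proof -
    have eq: "- \<i> * of_real (x \<bullet> v) * f x = (\<Sum>i\<in>UNIV. of_real (v $ i) * (- \<i> * of_real (x $ i) * f x))" for x
      by (simp add: inner_vec_def sum_distrib_left sum_distrib_right mult_ac sum_negf)
    have I: "integrable lborel (\<lambda>x. of_real (v $ i) * (- \<i> * of_real (x $ i) * f x))" for i
      by (intro integrable_mult_right test_integrable tst)
    have I2: "integrable lborel (\<lambda>x. \<Sum>i\<in>UNIV. of_real (v $ i) * (- \<i> * of_real (x $ i) * f x))"
      by (intro Bochner_Integration.integrable_sum I)
    have "?D v = fourier (\<lambda>x. \<Sum>i\<in>UNIV. of_real (v $ i) * (- \<i> * of_real (x $ i) * f x)) \<xi>"
      by (simp only: fourier_sum[OF I] fourier_cmult)
    also have "\<dots> = (LINT x|lborel. cis (- (x \<bullet> \<xi>)) * (- \<i> * of_real (x \<bullet> v) * f x))"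
      by (simp only: fourier_lborel[OF I2] eq)
    finally show "?D v = (LINT x|lborel. cis (- (x \<bullet> \<xi>)) * (- \<i> * of_real (x \<bullet> v) * f x))" .
    show "integrable lborel (\<lambda>x. cis (- (x \<bullet> \<xi>)) * (- \<i> * of_real (x \<bullet> v) * f x))"
      unfolding eq by (rule integrable_character_mult[OF I2])
  qed
  obtain R where R: "R > 0" "\<And>x. norm x > R \<Longrightarrow> f x = 0" using test_support_ball[OF assms] by blast
  define C where "C = R\<^sup>2 * (LINT x|lborel. cmod (f x))"
  have bound: "cmod (fourier f (\<xi> + v) - fourier f \<xi> - ?D v) \<le> C * (norm v)\<^sup>2" for v
  proof -
    let ?g = "\<lambda>x. cis (- (x \<bullet> (\<xi> + v))) * f x - cis (- (x \<bullet> \<xi>)) * f x - cis (- (x \<bullet> \<xi>)) * (- \<i> * of_real (x \<bullet> v) * f x)"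
    have Ig: "integrable lborel ?g"
      by (intro Bochner_Integration.integrable_diff integrable_character_mult test_integrable assms Di)
    have eq: "fourier f (\<xi> + v) - fourier f \<xi> - ?D v = integral\<^sup>L lborel ?g"
      unfolding D fourier_lborel[OF test_integrable[OF assms]]
      by (simp only: Bochner_Integration.integral_diff Bochner_Integration.integrable_diff
          integrable_character_mult test_integrable[OF assms] Di)
    have "cmod (integral\<^sup>L lborel ?g) \<le> (LINT x|lborel. cmod (?g x))" by (rule integral_norm_bound)
    also have "\<dots> \<le> (LINT x|lborel. (R\<^sup>2 * (norm v)\<^sup>2) * cmod (f x))"
    proof (rule integral_mono)
      show "integrable lborel (\<lambda>x. cmod (?g x))" using Ig by (rule integrable_norm)
      show "integrable lborel (\<lambda>x. (R\<^sup>2 * (norm v)\<^sup>2) * cmod (f x))"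
        using integrable_norm[OF test_integrable[OF assms]] by simp
      fix x
      have g: "?g x = (cis (- (x \<bullet> \<xi>) + - (x \<bullet> v)) - cis (- (x \<bullet> \<xi>)) - of_real (- (x \<bullet> v)) * (\<i> * cis (- (x \<bullet> \<xi>)))) * f x"
        by (simp add: inner_add_right algebra_simps)
      show "cmod (?g x) \<le> (R\<^sup>2 * (norm v)\<^sup>2) * cmod (f x)"
      proof (cases "norm x > R")
        case False
        have "\<bar>x \<bullet> v\<bar> \<le> norm x * norm v" by (rule Cauchy_Schwarz_ineq2)
        also have "\<dots> \<le> R * norm v" using False by (intro mult_right_mono) auto
        finally have "(- (x \<bullet> v))\<^sup>2 \<le> (R * norm v)\<^sup>2" by (simp add: abs_le_square_iff[symmetric] R(1) less_imp_le abs_mult)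
        with cis_second_order[of "- (x \<bullet> \<xi>)" "- (x \<bullet> v)"]
        have "cmod (cis (- (x \<bullet> \<xi>) + - (x \<bullet> v)) - cis (- (x \<bullet> \<xi>)) - of_real (- (x \<bullet> v)) * (\<i> * cis (- (x \<bullet> \<xi>)))) \<le> R\<^sup>2 * (norm v)\<^sup>2"
          by (simp add: power_mult_distrib del: of_real_minus)
        then show ?thesis unfolding g norm_mult by (rule mult_right_mono) simp
      qed (simp add: R)
    qed
    also have "\<dots> = C * (norm v)\<^sup>2" by (simp add: C_def)
    finally show ?thesis unfolding eq .
  qed
  have C: "C \<ge> 0" by (simp add: C_def)
  show ?thesis
    unfolding has_derivative_at
  proof
    show "bounded_linear ?D"
      by (intro bounded_linear_sum bounded_linear_mult_const bounded_linear_compose[OF bounded_linear_of_real bounded_linear_vec_nth])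
    have "((\<lambda>v. C * norm v) \<longlongrightarrow> 0) (at 0)" by (auto intro!: tendsto_eq_intros)
    then show "((\<lambda>v. cmod (fourier f (\<xi> + v) - fourier f \<xi> - ?D v) / norm v) \<longlongrightarrow> 0) (at 0)"
    proof (rule Lim_null_comparison[rotated])
      have "norm (cmod (fourier f (\<xi> + v) - fourier f \<xi> - ?D v) / norm v) \<le> C * norm v" for v
        using bound[of v] C by (cases "v = 0") (auto simp: divide_simps power2_eq_square mult_ac)
      then show "\<forall>\<^sub>F v in at 0. norm (cmod (fourier f (\<xi> + v) - fourier f \<xi> - ?D v) / norm v) \<le> C * norm v"
        by (intro always_eventually allI)
    qed
  qed
qed

text \<open>Each derivative of the transform is the transform of \<open>f\<close> times a
  coordinate, again a test function. Decay of all derivatives thus reduces to decay of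
  transforms.\<close>

lemma fourier_pderivs_of_fourier:
  fixes f :: "real^'n::finite \<Rightarrow> complex"
  assumes "f \<in> test_functions"
  obtains g where "g \<in> test_functions" "pderivs is (fourier f) = fourier g"
proof -
  have "\<exists>g\<in>test_functions. pderivs is (fourier f) = fourier g"
  proof (induction "is")
    case (Cons i "is")
    then obtain g where g: "g \<in> test_functions" "pderivs is (fourier f) = fourier g" by blast
    have sm: "smooth_on UNIV (\<lambda>x::real^'n. - \<i> * of_real (x $ i))"
      by (intro smooth_on_mult smooth_on_const open_UNIV smooth_on_bounded_linear
        bounded_linear_compose[OF bounded_linear_of_real bounded_linear_vec_nth])
    have "pderivs (i # is) (fourier f) = fourier (\<lambda>x. - \<i> * of_real (x $ i) * g x)"
      using has_derivative_imp_frechet[OF fourier_has_derivative[OF g(1)]]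
      by (auto simp: g(2) axis_def if_distrib[of of_real] if_distrib[of "\<lambda>c. c * _"] cong: if_cong)
    then show ?case using test_smooth_mult[OF g(1) sm] by blast
  qed (use assms in auto)
  then show ?thesis using that by blast
qed

lemma smooth_on_fourier:
  fixes f :: "real^'n::finite \<Rightarrow> complex"
  assumes "f \<in> test_functions"
  shows "smooth_on UNIV (fourier f)"
  unfolding smooth_on_def
proof
  have sm: "smooth_on UNIV (\<lambda>x::real^'n. - \<i> * of_real (x $ i))" for i
    by (intro smooth_on_mult smooth_on_const open_UNIV smooth_on_bounded_linear
      bounded_linear_compose[OF bounded_linear_of_real bounded_linear_vec_nth])
  fix k show "Ck_on k UNIV (fourier f)" using assms
  proof (induction k arbitrary: f)
    case 0
    then show ?case
      using fourier_has_derivative by (auto intro!: continuous_at_imp_continuous_on has_derivative_continuous)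
  next
    case (Suc k)
    show ?case
    proof (rule Ck_on_SucI[OF fourier_has_derivative[OF Suc.prems]])
      fix v :: "real^'n"
      show "Ck_on k UNIV (\<lambda>\<xi>. \<Sum>i\<in>UNIV. of_real (v $ i) * fourier (\<lambda>x. - \<i> * of_real (x $ i) * f x) \<xi>)"
        by (intro Ck_on_sum Ck_on_mult Ck_on_const open_UNIV Suc.IH test_smooth_mult[OF Suc.prems sm])
    qed simp
  qed
qed

text \<open>Distributions are specified on \<open>schwartz\<close> only; this is what allows a
  regular distribution to be evaluated at the transform of a test function.\<close>

lemma fourier_schwartz:
  fixes f :: "real^'n::finite \<Rightarrow> complex"
  assumes "f \<in> test_functions"
  shows "fourier f \<in> schwartz"
proof -
  have "bounded (range (\<lambda>x. (1 + norm x) ^ m * cmod (pderivs is (fourier f) x)))" for m "is"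
  proof -
    obtain g where g: "g \<in> test_functions" "pderivs is (fourier f) = fourier g"
      using fourier_pderivs_of_fourier[OF assms] by blast
    show ?thesis unfolding g(2) bounded_iff
      by (rule exI) (use fourier_decay[OF g(1), where m=m] in \<open>auto simp: norm_mult norm_power\<close>)
  qed
  then show ?thesis using smooth_on_fourier[OF assms] by (simp add: schwartz_def)
qed

section \<open>The bracket and its dyadic shells\<close>

lemma bracket_ge_1: "1 \<le> bracket \<xi>"
  by (simp add: bracket_def)

lemma norm_le_bracket: "norm \<xi> \<le> bracket \<xi>"
  unfolding bracket_def by (rule real_le_rsqrt) simp

lemma bracket_le: "bracket \<xi> \<le> 1 + norm \<xi>"
  unfolding bracket_def by (rule real_le_lsqrt) (auto simp: power2_eq_square algebra_simps)

lemma bracket_borel [measurable]: "bracket \<in> borel_measurable borel"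
  unfolding bracket_def[abs_def] by measurable

text \<open>The shells are cut by the bracket rather than by the norm: since the bracket is at least
  1 they cover the whole space, origin included, and on the k-th one the weight is comparable to its
  value at 2^k.\<close>

definition shell :: "nat \<Rightarrow> (real^'n::finite) set" where
  "shell k = {\<xi>. 2 ^ k \<le> bracket \<xi> \<and> bracket \<xi> < 2 ^ Suc k}"

lemma shell_sets [measurable]: "shell k \<in> sets borel"
  unfolding shell_def by measurable

lemma ex_dyadic:
  assumes "1 \<le> (x::real)"
  obtains k where "2 ^ k \<le> x" "x < 2 ^ Suc k"
proof -
  obtain N where N: "x < 2 ^ N" using real_arch_pow[of 2 x] by auto
  define m where "m = (LEAST N. x < 2 ^ N)"
  have m: "x < 2 ^ m" unfolding m_def by (rule LeastI[of _ N]) (rule N)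
  have "m \<noteq> 0" using m assms by (cases m) auto
  then obtain k where k: "m = Suc k" using not0_implies_Suc by blast
  have "\<not> x < 2 ^ k" using not_less_Least[of k "\<lambda>N. x < 2 ^ N"] k unfolding m_def by simp
  then show ?thesis using that[of k] m k by simp
qed

lemma dyadic_unique:
  assumes "2 ^ k \<le> x" "x < (2::real) ^ Suc k" "2 ^ l \<le> x" "x < 2 ^ Suc l"
  shows "k = l"
proof -
  have "(2::real) ^ k < 2 ^ Suc l" "(2::real) ^ l < 2 ^ Suc k" using assms by linarith+
  then have "k < Suc l" "l < Suc k" by (metis one_less_numeral_iff power_strict_increasing_iff semiring_norm(76))+
  then show ?thesis by simp
qed

lemma disjoint_family_shell: "disjoint_family shell"
  unfolding disjoint_family_on_def shell_def using dyadic_unique by blast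

lemma ex_shell: obtains k where "\<xi> \<in> shell k"
  using ex_dyadic[OF bracket_ge_1[of \<xi>]] that by (auto simp: shell_def)

lemma nn_integral_shells:
  fixes F :: "real^'n::finite \<Rightarrow> ennreal"
  assumes [measurable]: "F \<in> borel_measurable borel"
  shows "(\<integral>\<^sup>+x. F x \<partial>lborel) = (\<Sum>k. \<integral>\<^sup>+x. F x * indicator (shell k) x \<partial>lborel)"
proof -
  have "F x = (\<Sum>k. F x * indicator (shell k) x)" for x
  proof -
    obtain k where "x \<in> shell k" by (rule ex_shell)
    then show ?thesis
      using suminf_cmult_indicator[OF disjoint_family_shell, of x k "\<lambda>_. F x"] by simp
  qed
  then have "(\<integral>\<^sup>+x. F x \<partial>lborel) = (\<integral>\<^sup>+x. (\<Sum>k. F x * indicator (shell k) x) \<partial>lborel)"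
    by (simp cong: nn_integral_cong)
  also have "\<dots> = (\<Sum>k. \<integral>\<^sup>+x. F x * indicator (shell k) x \<partial>lborel)"
    by (rule nn_integral_suminf) measurable
  finally show ?thesis .
qed

lemma emeasure_shell_le:
  "emeasure lborel (shell k :: (real^'n::finite) set) \<le>
    ennreal (unit_ball_vol (real CARD('n)) * (2 ^ Suc k) ^ CARD('n))"
proof -
  have "(shell k :: (real^'n) set) \<subseteq> ball 0 (2 ^ Suc k)"
  proof
    fix x :: "real^'n" assume "x \<in> shell k"
    then show "x \<in> ball 0 (2 ^ Suc k)"
      using le_less_trans[OF norm_le_bracket[of x], of "2 ^ Suc k"] by (simp add: shell_def)
  qed
  then have "emeasure lborel (shell k :: (real^'n) set) \<le> emeasure lborel (ball 0 (2 ^ Suc k) :: (real^'n) set)"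
    by (rule emeasure_mono) simp
  also have "\<dots> = ennreal (unit_ball_vol (real CARD('n)) * (2 ^ Suc k) ^ CARD('n))"
    by (subst emeasure_ball) auto
  finally show ?thesis .
qed

lemma nn_integral_shell_le:
  fixes F :: "real^'n::finite \<Rightarrow> ennreal"
  assumes "\<And>x. x \<in> shell k \<Longrightarrow> F x \<le> ennreal c" "0 \<le> c"
  shows "(\<integral>\<^sup>+x. F x * indicator (shell k) x \<partial>lborel) \<le>
    ennreal (unit_ball_vol (real CARD('n)) * 2 ^ CARD('n) * (c * (2 ^ k) ^ CARD('n)))"
proof -
  have "(\<integral>\<^sup>+x. F x * indicator (shell k) x \<partial>lborel) \<le> integral\<^sup>N lborel (\<lambda>x::real^'n. ennreal c * indicator (shell k) x)"
    by (rule nn_integral_mono) (auto simp: assms indicator_def)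
  also have "\<dots> = ennreal c * emeasure lborel (shell k :: (real^'n) set)"
    by (rule nn_integral_cmult_indicator) simp
  also have "\<dots> \<le> ennreal c * ennreal (unit_ball_vol (real CARD('n)) * (2 ^ Suc k) ^ CARD('n))"
    by (rule mult_left_mono[OF emeasure_shell_le]) simp
  also have "\<dots> = ennreal (unit_ball_vol (real CARD('n)) * 2 ^ CARD('n) * (c * (2 ^ k) ^ CARD('n)))"
    by (subst ennreal_mult'[symmetric]) (auto simp: assms power_mult_distrib mult_ac)
  finally show ?thesis .
qed

text \<open>On the k-th shell the integrand is at most 2^(-k(n+1)) and the volume is at most a
  constant times 2^(kn), which leaves a geometric series.\<close>

lemma integrable_inverse_power:
  "integrable lborel (\<lambda>\<xi>::real^'n::finite. (1 / (1 + norm \<xi>)) ^ Suc CARD('n))"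
proof (rule integrableI_bounded)
  let ?n = "CARD('n)" and ?V = "unit_ball_vol (real CARD('n)) * 2 ^ CARD('n)"
  let ?F = "\<lambda>x::real^'n. ennreal (norm ((1 / (1 + norm x)) ^ Suc CARD('n)))"
  have "(\<integral>\<^sup>+x. ?F x \<partial>lborel) = (\<Sum>k. \<integral>\<^sup>+x. ?F x * indicator (shell k) x \<partial>lborel)"
    by (rule nn_integral_shells) measurable
  also have "\<dots> \<le> (\<Sum>k. ennreal (?V * ((1 / 2 ^ k) ^ Suc ?n * (2 ^ k) ^ ?n)))"
  proof (intro suminf_le nn_integral_shell_le)
    fix k and x :: "real^'n" assume "x \<in> shell k"
    then have "2 ^ k \<le> 1 + norm x" using bracket_le[of x] by (simp add: shell_def)
    then have "(1 / (1 + norm x)) ^ Suc ?n \<le> (1 / 2 ^ k) ^ Suc ?n"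
      by (intro power_mono divide_left_mono) (auto intro!: mult_pos_pos add_pos_nonneg)
    then show "ennreal (norm ((1 / (1 + norm x)) ^ Suc ?n)) \<le> ennreal ((1 / 2 ^ k) ^ Suc ?n)"
      by (auto intro!: ennreal_leI)
  qed auto
  also have "\<dots> = (\<Sum>k. ennreal (?V * (1 / 2) ^ k))"
    by (simp add: power_divide divide_simps)
  also have "\<dots> < \<infinity>"
    by (subst suminf_ennreal2) (auto intro!: summable_mult summable_geometric)
  finally show "(\<integral>\<^sup>+x. ?F x \<partial>lborel) < \<infinity>" .
qed measurable

section \<open>Integrability of transforms, the multiplication formula and inversion\<close>

lemma fourier_borel:
  fixes f :: "real^'n::finite \<Rightarrow> complex"
  shows "f \<in> test_functions \<Longrightarrow> fourier f \<in> borel_measurable borel"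
  by (intro borel_measurable_continuous_onI Ck_on_imp_continuous_on[OF smooth_on_imp_Ck] smooth_on_fourier)

lemma fourier_moment_integrable:
  fixes f :: "real^'n::finite \<Rightarrow> complex"
  assumes "f \<in> test_functions"
  shows "integrable lborel (\<lambda>\<xi>. (1 + norm \<xi>) ^ m * cmod (fourier f \<xi>))"
proof -
  obtain C where C: "\<And>\<xi>. (1 + norm \<xi>) ^ (m + Suc CARD('n)) * cmod (fourier f \<xi>) \<le> C"
    using fourier_decay[OF assms, where m="m + Suc CARD('n)"] by blast
  have [measurable]: "fourier f \<in> borel_measurable borel" by (rule fourier_borel[OF assms])
  show ?thesis
  proof (rule Bochner_Integration.integrable_bound)
    show "integrable lborel (\<lambda>\<xi>::real^'n. C * (1 / (1 + norm \<xi>)) ^ Suc CARD('n))"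
      by (intro integrable_mult_right integrable_inverse_power)
    show "AE \<xi> in lborel. norm ((1 + norm \<xi>) ^ m * cmod (fourier f \<xi>)) \<le>
        norm (C * (1 / (1 + norm \<xi>)) ^ Suc CARD('n))"
    proof (rule AE_I2)
      fix \<xi> :: "real^'n"
      have p: "0 < 1 + norm \<xi>" by (simp add: add_pos_nonneg)
      have C0: "0 \<le> C" using C[of 0] order_trans[OF _ C[of 0]] by (simp del: power_Suc)
      have "(1 + norm \<xi>) ^ m * cmod (fourier f \<xi>) * (1 + norm \<xi>) ^ Suc CARD('n) \<le> C"
        using C[of \<xi>] by (simp add: power_add mult_ac)
      then have "(1 + norm \<xi>) ^ m * cmod (fourier f \<xi>) \<le> C / (1 + norm \<xi>) ^ Suc CARD('n)"
        using p by (simp add: pos_le_divide_eq del: power_Suc)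
      then show "norm ((1 + norm \<xi>) ^ m * cmod (fourier f \<xi>)) \<le> norm (C * (1 / (1 + norm \<xi>)) ^ Suc CARD('n))"
        using C0 p by (simp add: abs_mult power_divide del: power_Suc)
    qed
  qed measurable
qed

lemma fourier_integrable:
  fixes f :: "real^'n::finite \<Rightarrow> complex"
  assumes "f \<in> test_functions"
  shows "integrable lborel (fourier f)"
  using fourier_moment_integrable[OF assms, of 0] fourier_borel[OF assms] integrable_norm_iff[of "fourier f" lborel]
  by simp

lemma cis_borel [measurable]: "cis \<in> borel_measurable borel"
  by (intro borel_measurable_continuous_onI Ck_on_imp_continuous_on[OF smooth_on_imp_Ck[OF smooth_on_cis]])

lemma fourier_swap:
  fixes f h :: "real^'n::finite \<Rightarrow> complex"
  assumes f: "integrable lborel f" and h: "integrable lborel h"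
  shows "(LINT \<xi>|lborel. fourier f \<xi> * h \<xi>) = (LINT x|lborel. f x * fourier h x)"
proof -
  have [measurable]: "f \<in> borel_measurable borel" "h \<in> borel_measurable borel"
    using f h borel_measurable_integrable by auto
  let ?k = "\<lambda>(x, \<xi>). cis (- (x \<bullet> \<xi>)) * f x * h \<xi>"
  have int: "integrable (lborel \<Otimes>\<^sub>M lborel) ?k"
  proof (rule lborel_pair.Fubini_integrable)
    show "?k \<in> borel_measurable (lborel \<Otimes>\<^sub>M lborel)" by measurable
    have "integrable lborel (\<lambda>x. cmod (f x) * (LINT \<xi>|lborel. cmod (h \<xi>)))"
      using f by (intro integrable_mult_left) (rule integrable_norm)
    then show "integrable lborel (\<lambda>x. LINT y|lborel. norm (?k (x, y)))"
      by (simp add: norm_mult)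
    show "AE x in lborel. integrable lborel (\<lambda>y. ?k (x, y))"
    proof (rule AE_I2)
      fix x
      have "integrable lborel (\<lambda>y. f x * (cis (- (y \<bullet> x)) * h y))"
        by (intro integrable_mult_right integrable_character_mult h)
      then show "integrable lborel (\<lambda>y. ?k (x, y))"
        by (simp add: inner_commute mult_ac)
    qed
  qed
  have "(LINT \<xi>|lborel. fourier f \<xi> * h \<xi>) = (LINT \<xi>|lborel. (LINT x|lborel. ?k (x, \<xi>)))"
    unfolding fourier_lborel[OF f] by (simp add: mult.assoc[symmetric])
  also have "\<dots> = (LINT x|lborel. (LINT \<xi>|lborel. ?k (x, \<xi>)))"
    using lborel_pair.Fubini_integral[OF int] by simp
  also have "\<dots> = (LINT x|lborel. f x * fourier h x)"
    unfolding fourier_lborel[OF h] by (simp add: mult_ac inner_commute cong: Bochner_Integration.integral_cong)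
  finally show ?thesis .
qed

text \<open>The inversion integral without a normalising factor; the factor appears as the
  unspecified constant of \<open>fourier_inversion\<close>.\<close>

definition inv_fourier :: "(real^'n::finite \<Rightarrow> complex) \<Rightarrow> real^'n \<Rightarrow> complex" where
  "inv_fourier f x = (LINT \<xi>|lborel. cis (x \<bullet> \<xi>) * f \<xi>)"

lemma fourier_rescale:
  fixes f :: "real^'n::finite \<Rightarrow> complex"
  assumes "f \<in> test_functions" "\<epsilon> > 0"
  shows "\<epsilon> ^ CARD('n) *\<^sub>R fourier (\<lambda>z. f (x + \<epsilon> *\<^sub>R z)) \<zeta>
    = cis (x \<bullet> \<zeta> / \<epsilon>) * fourier f ((1 / \<epsilon>) *\<^sub>R \<zeta>)"
proof -
  have ne: "\<epsilon> \<noteq> 0" using assms(2) by simp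
  let ?g = "\<lambda>y. cis (- ((y - x) \<bullet> \<zeta>) / \<epsilon>) * f y"
  have [measurable]: "f \<in> borel_measurable borel" by (rule test_borel[OF assms(1)])
  have "integral\<^sup>L lborel ?g = (\<bar>\<epsilon>\<bar> ^ CARD('n)) *\<^sub>R integral\<^sup>L lborel (\<lambda>z. ?g (x + \<epsilon> *\<^sub>R z))"
    using lborel_integral_affine[of ?g \<epsilon> x] ne by simp
  also have "(\<lambda>z. ?g (x + \<epsilon> *\<^sub>R z)) = (\<lambda>z. cis (- (z \<bullet> \<zeta>)) * f (x + \<epsilon> *\<^sub>R z))"
    using ne by (auto simp: fun_eq_iff)
  also have "integral\<^sup>L lborel \<dots> = fourier (\<lambda>z. f (x + \<epsilon> *\<^sub>R z)) \<zeta>"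
    by (rule fourier_lborel[symmetric]) (rule test_integrable[OF test_affine[OF assms(1) ne]])
  also have "?g = (\<lambda>y. cis (x \<bullet> \<zeta> / \<epsilon>) * (cis (- (y \<bullet> ((1 / \<epsilon>) *\<^sub>R \<zeta>))) * f y))"
    by (auto simp: fun_eq_iff cis_mult inner_diff_left diff_divide_distrib mult.assoc[symmetric])
  also have "integral\<^sup>L lborel \<dots> = cis (x \<bullet> \<zeta> / \<epsilon>) * fourier f ((1 / \<epsilon>) *\<^sub>R \<zeta>)"
    unfolding fourier_lborel[OF test_integrable[OF assms(1)]] by simp
  finally show ?thesis using assms(2) by simp
qed

text \<open>The mollified inversion integral: no explicit Fourier pair (such as the Gaussian) is needed.\<close>

lemma inv_fourier_exchange:
  fixes f G :: "real^'n::finite \<Rightarrow> complex"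
  assumes f: "f \<in> test_functions" and G: "G \<in> test_functions"
  shows "G 0 * inv_fourier (fourier f) x = f x * inv_fourier (fourier G) 0"
proof -
  have [measurable]: "f \<in> borel_measurable borel" "G \<in> borel_measurable borel"
      "fourier f \<in> borel_measurable borel" "fourier G \<in> borel_measurable borel"
    using test_borel fourier_borel f G by auto
  \<comment> \<open>The multiplication formula for \<open>G\<close> and the dilate of
    \<open>f\<close>, followed by the substitution \<zeta> = \<epsilon> \<eta>, moves the dilation
    onto \<open>G\<close>. As \<epsilon> tends to 0, \<open>f\<close> freezes at \<open>x\<close> on
    the left and \<open>G\<close> at 0 on the right.\<close>
  have eq: "(LINT \<zeta>|lborel. fourier G \<zeta> * f (x + \<epsilon> *\<^sub>R \<zeta>))
      = (LINT \<eta>|lborel. G (\<epsilon> *\<^sub>R \<eta>) * (cis (x \<bullet> \<eta>) * fourier f \<eta>))" if "\<epsilon> > 0" for \<epsilon>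
  proof -
    have ne: "\<epsilon> \<noteq> 0" using that by simp
    let ?c = "complex_of_real (\<epsilon> ^ CARD('n))"
    let ?fe = "\<lambda>z. f (x + \<epsilon> *\<^sub>R z)"
    let ?h = "\<lambda>\<zeta>. G \<zeta> * (cis (x \<bullet> \<zeta> / \<epsilon>) * fourier f ((1 / \<epsilon>) *\<^sub>R \<zeta>))"
    have "(LINT \<zeta>|lborel. fourier G \<zeta> * ?fe \<zeta>) = (LINT z|lborel. G z * fourier ?fe z)"
      by (rule fourier_swap[OF test_integrable[OF G] test_integrable[OF test_affine[OF f ne]]])
    then have "?c * (LINT \<zeta>|lborel. fourier G \<zeta> * ?fe \<zeta>) = (LINT z|lborel. ?c * (G z * fourier ?fe z))"
      by (simp only: integral_mult_right_zero)
    also have "\<dots> = (LINT z|lborel. G z * (?c * fourier ?fe z))"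
      by (simp only: mult.left_commute)
    also have "\<dots> = integral\<^sup>L lborel ?h"
      using fourier_rescale[OF f that, of x] by (simp add: scaleR_conv_of_real)
    also have "\<dots> = (\<bar>\<epsilon>\<bar> ^ CARD('n)) *\<^sub>R integral\<^sup>L lborel (\<lambda>z. ?h (0 + \<epsilon> *\<^sub>R z))"
      using lborel_integral_affine[of ?h \<epsilon> 0] ne by simp
    also have "(\<lambda>z. ?h (0 + \<epsilon> *\<^sub>R z)) = (\<lambda>z. G (\<epsilon> *\<^sub>R z) * (cis (x \<bullet> z) * fourier f z))"
      using ne by (auto simp: fun_eq_iff)
    finally show ?thesis using that ne by (simp add: scaleR_conv_of_real)
  qed
  define e where "e k = 1 / real (Suc k)" for k
  have e: "e k > 0" for k by (simp add: e_def)
  have elim: "e \<longlonglongrightarrow> 0" unfolding e_def by (rule LIMSEQ_Suc[OF lim_1_over_n])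
  have cf: "isCont f y" and cG: "isCont G y" for y
    using test_continuous[OF f] test_continuous[OF G] continuous_on_eq_continuous_at[OF open_UNIV] by auto
  obtain B where B: "B > 0" "\<And>x. cmod (f x) \<le> B" using test_bounded[OF f] by blast
  obtain B' where B': "B' > 0" "\<And>x. cmod (G x) \<le> B'" using test_bounded[OF G] by blast
  have 1: "(\<lambda>k. LINT \<zeta>|lborel. fourier G \<zeta> * f (x + e k *\<^sub>R \<zeta>)) \<longlonglongrightarrow> (LINT \<zeta>|lborel. fourier G \<zeta> * f x)"
  proof (rule integral_dominated_convergence[where w="\<lambda>\<zeta>. B * cmod (fourier G \<zeta>)"])
    show "integrable lborel (\<lambda>\<zeta>. B * cmod (fourier G \<zeta>))"
      by (intro integrable_mult_right integrable_norm fourier_integrable G)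
    show "AE \<zeta> in lborel. (\<lambda>k. fourier G \<zeta> * f (x + e k *\<^sub>R \<zeta>)) \<longlonglongrightarrow> fourier G \<zeta> * f x"
    proof (rule AE_I2)
      fix \<zeta> :: "real^'n"
      have "(\<lambda>k. x + e k *\<^sub>R \<zeta>) \<longlonglongrightarrow> x + 0 *\<^sub>R \<zeta>" by (intro tendsto_intros elim)
      then show "(\<lambda>k. fourier G \<zeta> * f (x + e k *\<^sub>R \<zeta>)) \<longlonglongrightarrow> fourier G \<zeta> * f x"
        by (intro tendsto_mult tendsto_const isCont_tendsto_compose[OF cf]) simp
    qed
    show "AE \<zeta> in lborel. norm (fourier G \<zeta> * f (x + e k *\<^sub>R \<zeta>)) \<le> B * cmod (fourier G \<zeta>)" for k
      using B by (intro AE_I2) (simp add: norm_mult mult.commute[of B] mult_left_mono)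
  qed measurable
  have 2: "(\<lambda>k. LINT \<eta>|lborel. G (e k *\<^sub>R \<eta>) * (cis (x \<bullet> \<eta>) * fourier f \<eta>))
      \<longlonglongrightarrow> (LINT \<eta>|lborel. G 0 * (cis (x \<bullet> \<eta>) * fourier f \<eta>))"
  proof (rule integral_dominated_convergence[where w="\<lambda>\<eta>. B' * cmod (fourier f \<eta>)"])
    show "integrable lborel (\<lambda>\<zeta>. B' * cmod (fourier f \<zeta>))"
      by (intro integrable_mult_right integrable_norm fourier_integrable f)
    show "AE \<eta> in lborel. (\<lambda>k. G (e k *\<^sub>R \<eta>) * (cis (x \<bullet> \<eta>) * fourier f \<eta>)) \<longlonglongrightarrow> G 0 * (cis (x \<bullet> \<eta>) * fourier f \<eta>)"
    proof (rule AE_I2)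
      fix \<eta> :: "real^'n"
      have "(\<lambda>k. e k *\<^sub>R \<eta>) \<longlonglongrightarrow> 0 *\<^sub>R \<eta>" by (intro tendsto_intros elim)
      then show "(\<lambda>k. G (e k *\<^sub>R \<eta>) * (cis (x \<bullet> \<eta>) * fourier f \<eta>)) \<longlonglongrightarrow> G 0 * (cis (x \<bullet> \<eta>) * fourier f \<eta>)"
        by (intro tendsto_mult tendsto_const isCont_tendsto_compose[OF cG]) simp
    qed
    show "AE \<eta> in lborel. norm (G (e k *\<^sub>R \<eta>) * (cis (x \<bullet> \<eta>) * fourier f \<eta>)) \<le> B' * cmod (fourier f \<eta>)" for k
      using B' by (intro AE_I2) (simp add: norm_mult mult_right_mono)
  qed measurable
  have "(LINT \<zeta>|lborel. fourier G \<zeta> * f x) = (LINT \<eta>|lborel. G 0 * (cis (x \<bullet> \<eta>) * fourier f \<eta>))"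
    by (rule LIMSEQ_unique[OF 1]) (use 2 eq[OF e] in simp)
  then show ?thesis by (simp add: inv_fourier_def mult.commute)
qed

lemma AE_lborel_open_contradiction:
  fixes S :: "'a::euclidean_space set"
  assumes "open S" "S \<noteq> {}" "AE x in lborel. x \<notin> S"
  shows False
proof -
  have "S \<in> null_sets lborel"
    using assms(1,3) by (subst AE_iff_null_sets) auto
  then have "negligible S" by (metis null_sets_completionI negligible_iff_null_sets)
  then show False using open_not_negligible[OF assms(1,2)] by blast
qed

text \<open>Comparison with one fixed bump shows that the inversion integral reproduces
  \<open>f\<close> up to a constant independent of \<open>f\<close>. What has to be proved is that
  this constant is not zero; its value is never computed, since the later estimates hold up to
  constants.\<close>

lemma fourier_inversion:
  obtains c where "\<And>f x. f \<in> test_functions \<Longrightarrow> f x = c * inv_fourier (fourier f) (x :: real^'n::finite)"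
proof -
  define \<rho> where "\<rho> = (\<lambda>x::real^'n. complex_of_real (box_bump (\<chi> i. -1) (\<chi> i. 1) x))"
  have \<rho>: "\<rho> \<in> test_functions" unfolding \<rho>_def by (rule test_box_bump)
  have [measurable]: "fourier \<rho> \<in> borel_measurable borel" by (rule fourier_borel[OF \<rho>])
  have box0: "(0::real^'n) \<in> box (\<chi> i. -1) (\<chi> i. 1)" by (simp add: mem_box_cart)
  have \<rho>0: "\<rho> 0 \<noteq> 0" using box_bump_pos_iff[THEN iffD2, OF box0] by (simp add: \<rho>_def)
  define c where "c = inv_fourier (fourier \<rho>) 0 / \<rho> 0"
  have L: "inv_fourier (fourier f) x = c * f x" if "f \<in> test_functions" for f :: "real^'n \<Rightarrow> complex" and x
    using inv_fourier_exchange[OF that \<rho>, of x] \<rho>0 by (simp add: c_def field_simps)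
  have "c \<noteq> 0"
  proof
    assume "c = 0"
    \<comment> \<open>As \<rho> is real, \<open>?h\<close> is the conjugate of its transform. If the
      constant vanished, the multiplication formula would make the integral of |fourier \<rho>|^2
      zero, hence fourier \<rho> = 0; but its value at 0 is the positive integral of \<rho>.\<close>
    let ?h = "\<lambda>\<xi>. fourier \<rho> (- \<xi>)"
    have cnj: "?h \<xi> = cnj (fourier \<rho> \<xi>)" for \<xi>
    proof -
      have "cnj (fourier \<rho> \<xi>) = (LINT x|lborel. cnj (cis (- (x \<bullet> \<xi>)) * \<rho> x))"
        unfolding fourier_lborel[OF test_integrable[OF \<rho>]] by (simp only: Bochner_Integration.integral_cnj)
      also have "\<dots> = ?h \<xi>"
        unfolding fourier_lborel[OF test_integrable[OF \<rho>]] by (simp add: cis_cnj \<rho>_def)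
      finally show ?thesis by simp
    qed
    have hi: "integrable lborel ?h" unfolding cnj using fourier_integrable[OF \<rho>] by simp
    have "fourier ?h x = 0" for x
    proof -
      have "fourier ?h x = (LINT \<xi>|lborel. cis (- (\<xi> \<bullet> x)) * ?h \<xi>)" by (rule fourier_lborel[OF hi])
      also have "\<dots> = (LINT \<xi>|lborel. cis (- ((0 + (-1) *\<^sub>R \<xi>) \<bullet> x)) * ?h (0 + (-1) *\<^sub>R \<xi>))"
        using lborel_integral_affine[of "\<lambda>\<xi>. cis (- (\<xi> \<bullet> x)) * ?h \<xi>" "-1" 0] by simp
      also have "\<dots> = inv_fourier (fourier \<rho>) x" by (simp add: inv_fourier_def inner_commute)
      finally show ?thesis using L[OF \<rho>] \<open>c = 0\<close> by simp
    qed
    then have "(LINT \<xi>|lborel. fourier \<rho> \<xi> * ?h \<xi>) = 0"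
      using fourier_swap[OF test_integrable[OF \<rho>] hi] by simp
    then have "complex_of_real (LINT \<xi>|lborel. (cmod (fourier \<rho> \<xi>))\<^sup>2) = 0"
      unfolding cnj complex_norm_square[symmetric] by (simp del: of_real_power)
    then have z: "(LINT \<xi>|lborel. (cmod (fourier \<rho> \<xi>))\<^sup>2) = 0" by simp
    have "integrable lborel (\<lambda>\<xi>. (cmod (fourier \<rho> \<xi>))\<^sup>2)"
    proof (rule Bochner_Integration.integrable_bound)
      show "integrable lborel (\<lambda>\<xi>. (LINT x|lborel. cmod (\<rho> x)) * cmod (fourier \<rho> \<xi>))"
        by (intro integrable_mult_right integrable_norm fourier_integrable \<rho>)
      show "AE x in lborel. norm ((cmod (fourier \<rho> x))\<^sup>2) \<le> norm ((LINT x|lborel. cmod (\<rho> x)) * cmod (fourier \<rho> x))"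
        using norm_fourier_le[OF test_integrable[OF \<rho>]]
        by (intro AE_I2) (auto simp: power2_eq_square abs_mult intro!: mult_right_mono)
    qed measurable
    then have "AE \<xi> in lborel. (cmod (fourier \<rho> \<xi>))\<^sup>2 = 0"
      using z integral_nonneg_eq_0_iff_AE[of lborel "\<lambda>\<xi>. (cmod (fourier \<rho> \<xi>))\<^sup>2"] by simp
    then have AE: "AE \<xi> in lborel. \<xi> \<notin> {\<xi>. fourier \<rho> \<xi> \<noteq> 0}" by simp
    have op: "open {\<xi>. fourier \<rho> \<xi> \<noteq> 0}"
      using continuous_open_preimage[of UNIV "fourier \<rho>" "- {0}"]
        Ck_on_imp_continuous_on[OF smooth_on_imp_Ck[OF smooth_on_fourier[OF \<rho>]]]
      by (simp add: vimage_def open_Compl)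
    have "{\<xi>. fourier \<rho> \<xi> \<noteq> 0} = {}" using AE_lborel_open_contradiction[OF op _ AE] by blast
    then have "fourier \<rho> 0 = 0" by blast
    then have "complex_of_real (LINT x|lborel. box_bump (\<chi> i. -1) (\<chi> i. 1) (x::real^'n)) = 0"
      unfolding fourier_lborel[OF test_integrable[OF \<rho>]] by (simp add: \<rho>_def)
    moreover have "integrable lborel (\<lambda>x::real^'n. box_bump (\<chi> i. -1) (\<chi> i. 1) x)"
      using integrable_norm[OF test_integrable[OF \<rho>]] by (simp add: \<rho>_def box_bump_nonneg)
    ultimately have "AE x::real^'n in lborel. box_bump (\<chi> i. -1) (\<chi> i. 1) x = 0"
      by (subst integral_nonneg_eq_0_iff_AE[symmetric]) (auto simp: box_bump_nonneg)
    then have "AE x::real^'n in lborel. x \<notin> box (\<chi> i. -1) (\<chi> i. 1)"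
      by (rule eventually_mono) (metis box_bump_pos_iff less_irrefl)
    then show False using AE_lborel_open_contradiction[OF open_box] box0 by blast
  qed
  then show ?thesis using that[of "1 / c"] L by simp
qed

section \<open>Regular distributions\<close>

lemma borel_measurable_imp_lebesgue:
  fixes f :: "'a::euclidean_space \<Rightarrow> 'b::topological_space"
  shows "f \<in> borel_measurable borel \<Longrightarrow> f \<in> borel_measurable lebesgue"
  by (rule measurable_completion) simp

lemma sigma_finite_lebesgue: "sigma_finite_measure (lebesgue :: 'a::euclidean_space measure)"
proof
  show "\<exists>A. countable A \<and> A \<subseteq> sets (lebesgue :: 'a measure) \<and> \<Union>A = space lebesgue \<and> (\<forall>a\<in>A. emeasure lebesgue a \<noteq> \<infinity>)"
  proof (intro exI conjI ballI)
    show "countable (range (\<lambda>n. cball (0::'a) (real n)))" by simp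
    show "range (\<lambda>n. cball (0::'a) (real n)) \<subseteq> sets lebesgue" by auto
    have "x \<in> (\<Union>n. cball (0::'a) (real n))" for x
      using real_arch_simple[of "norm x"] by auto
    then show "\<Union> (range (\<lambda>n. cball (0::'a) (real n))) = space lebesgue" by auto
    show "emeasure lebesgue a \<noteq> \<infinity>" if "a \<in> range (\<lambda>n. cball (0::'a) (real n))" for a
      using that emeasure_bounded_finite[OF bounded_cball, of 0] by (auto simp: less_top)
  qed
qed

lemma locally_integrable_borel:
  fixes g :: "real^'n::finite \<Rightarrow> complex"
  assumes "\<And>K. compact K \<Longrightarrow> g absolutely_integrable_on K"
  shows "g \<in> borel_measurable lebesgue"
proof (rule borel_measurable_LIMSEQ_metric)
  show "(\<lambda>x. indicator (cball 0 (real k)) x *\<^sub>R g x) \<in> borel_measurable lebesgue" for k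
    using assms[OF compact_cball, of 0 "real k"] unfolding set_integrable_def
    by (rule borel_measurable_integrable)
  show "(\<lambda>k. indicator (cball 0 (real k)) x *\<^sub>R g x) \<longlonglongrightarrow> g x" for x
  proof (rule tendsto_eventually, unfold eventually_sequentially)
    obtain N where "norm x \<le> real N" using real_arch_simple by blast
    then show "\<exists>N. \<forall>n\<ge>N. indicator (cball 0 (real n)) x *\<^sub>R g x = g x"
      by (intro exI[of _ N]) (auto simp: indicator_def)
  qed
qed

text \<open>For a bump b with values in [0,1] that is positive exactly on the box, 1 - (1 - b)^k
  increases to the indicator of the box: an approximation of indicators by test functions without
  mollifiers.\<close>

lemma test_box_approx: "(\<lambda>x. complex_of_real (1 - (1 - box_bump a b x) ^ k)) \<in> test_functions"
proof (rule test_functionsI)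
  show "compact (cbox a b)" by (rule compact_cbox)
  have "smooth_on UNIV (\<lambda>x. 1 + (-1) * (1 + (-1) * box_bump a b x) ^ k)"
    by (intro smooth_on_add smooth_on_mult smooth_on_power smooth_on_const open_UNIV smooth_on_box_bump)
  then have "smooth_on UNIV (\<lambda>x. 1 - (1 - box_bump a b x) ^ k)" by simp
  then show "smooth_on UNIV (\<lambda>x. complex_of_real (1 - (1 - box_bump a b x) ^ k))"
    by (rule smooth_on_bounded_linear_compose[OF open_UNIV bounded_linear_of_real])
  show "complex_of_real (1 - (1 - box_bump a b x) ^ k) = 0" if "x \<notin> cbox a b" for x
  proof -
    have "box_bump a b x = 0" using that box_bump_eq_0[of x a b] box_subset_cbox[of a b] by blast
    then show ?thesis by simp
  qed
qed

lemma box_integral_eq_0: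
  fixes g :: "real^'n::finite \<Rightarrow> complex"
  assumes loc: "\<And>K. compact K \<Longrightarrow> g absolutely_integrable_on K"
    and zero: "\<And>\<psi>. \<psi> \<in> test_functions \<Longrightarrow> (LINT \<xi>|lebesgue. g \<xi> * \<psi> \<xi>) = 0"
  shows "set_lebesgue_integral lebesgue (box a b) g = 0"
proof -
  have gm [measurable]: "g \<in> borel_measurable lebesgue" by (rule locally_integrable_borel[OF loc])
  let ?\<eta> = "\<lambda>k x. complex_of_real (1 - (1 - box_bump a b x) ^ k)"
  have \<eta>m: "?\<eta> k \<in> borel_measurable lebesgue" for k
    using test_borel[OF test_box_approx[of a b k]] by (simp add: borel_measurable_imp_lebesgue)
  have "(\<lambda>k. LINT x|lebesgue. g x * ?\<eta> k x) \<longlonglongrightarrow> (LINT x|lebesgue. indicator (box a b) x *\<^sub>R g x)"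
  proof (rule integral_dominated_convergence[where w="\<lambda>x. norm (indicator (cbox a b) x *\<^sub>R g x)"])
    show "integrable lebesgue (\<lambda>x. norm (indicator (cbox a b) x *\<^sub>R g x))"
      using loc[OF compact_cbox, of a b] unfolding set_integrable_def by (rule integrable_norm)
    show "AE x in lebesgue. (\<lambda>k. g x * ?\<eta> k x) \<longlonglongrightarrow> indicator (box a b) x *\<^sub>R g x"
    proof (rule AE_I2)
      fix x
      show "(\<lambda>k. g x * ?\<eta> k x) \<longlonglongrightarrow> indicator (box a b) x *\<^sub>R g x"
      proof (cases "x \<in> box a b")
        case True
        then have "0 < box_bump a b x" by (simp add: box_bump_pos_iff)
        then have "(\<lambda>k. (1 - box_bump a b x) ^ k) \<longlonglongrightarrow> 0"
          using box_bump_le_1[of a b x] by (intro LIMSEQ_realpow_zero) auto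
        then have "(\<lambda>k. g x * complex_of_real (1 - (1 - box_bump a b x) ^ k)) \<longlonglongrightarrow> g x * complex_of_real (1 - 0)"
          by (intro tendsto_mult tendsto_of_real tendsto_diff tendsto_const)
        then show ?thesis using True by simp
      next
        case False
        then show ?thesis by (simp add: box_bump_eq_0)
      qed
    qed
    show "AE x in lebesgue. norm (g x * ?\<eta> k x) \<le> norm (indicator (cbox a b) x *\<^sub>R g x)" for k
    proof (rule AE_I2)
      fix x
      show "norm (g x * ?\<eta> k x) \<le> norm (indicator (cbox a b) x *\<^sub>R g x)"
      proof (cases "x \<in> cbox a b")
        case True
        have "0 \<le> (1 - box_bump a b x) ^ k" "(1 - box_bump a b x) ^ k \<le> 1"
          using box_bump_le_1[of a b x] box_bump_nonneg[of a b x] by (auto intro: power_le_one)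
        then have "cmod (?\<eta> k x) \<le> 1" by (simp only: norm_of_real)
        then show ?thesis using True by (simp add: norm_mult mult_left_le del: of_real_diff of_real_power)
      next
        case False
        then have "box_bump a b x = 0" using box_bump_eq_0[of x a b] box_subset_cbox[of a b] by blast
        then show ?thesis by simp
      qed
    qed
    show "(\<lambda>x. indicator (box a b) x *\<^sub>R g x) \<in> borel_measurable lebesgue"
      by (intro borel_measurable_scaleR borel_measurable_indicator gm) simp
    show "(\<lambda>x. g x * ?\<eta> k x) \<in> borel_measurable lebesgue" for k
      by (intro borel_measurable_times gm \<eta>m)
  qed
  then show ?thesis
    by (simp add: zero[OF test_box_approx] set_lebesgue_integral_def LIMSEQ_const_iff del: of_real_diff of_real_power)
qed

text \<open>By the approximation above the integral of \<open>g\<close> over every box vanishes. A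
  Dynkin argument carries this to all Borel sets, and functions with equal integrals over all
  measurable sets agree almost everywhere. Cutting down to the cubes \<open>Q N\<close> turns local
  integrability into integrability.\<close>

lemma test_integrals_0_imp_AE_0:
  fixes g :: "real^'n::finite \<Rightarrow> complex"
  assumes loc: "\<And>K. compact K \<Longrightarrow> g absolutely_integrable_on K"
    and zero: "\<And>\<psi>. \<psi> \<in> test_functions \<Longrightarrow> (LINT \<xi>|lebesgue. g \<xi> * \<psi> \<xi>) = 0"
  shows "AE \<xi> in lebesgue. g \<xi> = 0"
proof -
  define Q :: "nat \<Rightarrow> (real^'n) set" where "Q N = box (\<chi> i. - real N) (\<chi> i. real N)" for N
  have AEN: "AE x in lebesgue. indicator (Q N) x *\<^sub>R g x = 0" for N
  proof (rule sigma_finite_measure.density_unique_banach[OF sigma_finite_lebesgue])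
    let ?f = "\<lambda>x. indicator (Q N) x *\<^sub>R g x"
    have QN: "Q N \<in> sets lebesgue" unfolding Q_def by simp
    show int: "integrable lebesgue ?f"
      using set_integrable_subset[OF loc[OF compact_cbox] QN] box_subset_cbox
      unfolding Q_def set_integrable_def by blast
    have bor: "set_lebesgue_integral lebesgue A ?f = 0" if "A \<in> sets borel" for A
    proof -
      let ?G = "range (\<lambda>(a, b). box a b :: (real^'n) set)"
      have "Int_stable ?G"
        unfolding Int_stable_def by (auto simp: box_Int_box image_iff)
      moreover have "?G \<subseteq> Pow UNIV" by simp
      moreover have "A \<in> sigma_sets UNIV ?G"
        using that by (simp add: borel_eq_box sets_measure_of)
      ultimately show ?thesis
      proof (induction rule: sigma_sets_induct_disjoint)
        case (basic A)
        then obtain a b where A: "A = box a b" by auto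
        obtain c d where cd: "box a b \<inter> Q N = box c d" unfolding Q_def by (simp add: box_Int_box)
        have "set_lebesgue_integral lebesgue A ?f = set_lebesgue_integral lebesgue (box c d) g"
          unfolding set_lebesgue_integral_def cd[symmetric] A by (simp add: indicator_inter_arith)
        then show ?case using box_integral_eq_0[OF loc zero] by simp
      next
        case empty
        then show ?case by (simp add: set_lebesgue_integral_def)
      next
        case (compl A)
        have "A \<in> sets lebesgue"
          using compl(1) by (simp add: borel_eq_box sets_measure_of sets_completionI_sets)
        then have i: "integrable lebesgue (\<lambda>x. indicator A x *\<^sub>R ?f x)"
          by (rule integrable_mult_indicator[OF _ int])
        have "set_lebesgue_integral lebesgue (UNIV - A) ?f = (LINT x|lebesgue. ?f x - indicator A x *\<^sub>R ?f x)"
          unfolding set_lebesgue_integral_def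
          by (intro Bochner_Integration.integral_cong refl) (auto simp: indicator_def)
        also have "\<dots> = set_lebesgue_integral lebesgue (Q N) g - set_lebesgue_integral lebesgue A ?f"
          using Bochner_Integration.integral_diff[OF int i] by (simp add: set_lebesgue_integral_def)
        finally show ?case using compl(2) box_integral_eq_0[OF loc zero] by (simp add: Q_def)
      next
        case (union A)
        have m: "A i \<in> sets lebesgue" for i
        proof -
          have "A i \<in> sigma_sets UNIV ?G" using union(2) by auto
          then show ?thesis by (simp add: borel_eq_box sets_measure_of sets_completionI_sets)
        qed
        have "set_integrable lebesgue (\<Union>i. A i) ?f"
          unfolding set_integrable_def by (rule integrable_mult_indicator[OF _ int]) (use m in auto)
        then have "set_lebesgue_integral lebesgue (\<Union>i. A i) ?f = (\<Sum>i. set_lebesgue_integral lebesgue (A i) ?f)"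
          by (intro lebesgue_integral_countable_add m)
            (use union(1) in \<open>auto simp: disjoint_family_on_def\<close>)
        then show ?case using union(3) by simp
      qed
    qed
    show "set_lebesgue_integral lebesgue A ?f = set_lebesgue_integral lebesgue A (\<lambda>x. 0)" if A: "A \<in> sets lebesgue" for A
    proof -
      \<comment> \<open>A Lebesgue set is a Borel set up to a null set, which the integral
        ignores.\<close>
      obtain S M M' where S: "A = S \<union> M" "M \<subseteq> M'" "M' \<in> null_sets lborel" "S \<in> sets lborel"
        using sets_completionE[OF A] by blast
      have Sl: "S \<in> sets lebesgue" using S(4) by (rule sets_completionI_sets)
      have n: "AE x in lebesgue. x \<notin> M'"
        by (rule AE_not_in) (use S(3) null_sets_completionI in blast)
      have "set_lebesgue_integral lebesgue A ?f = set_lebesgue_integral lebesgue S ?f"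
        unfolding set_lebesgue_integral_def
      proof (rule integral_cong_AE)
        show "(\<lambda>x. indicat_real A x *\<^sub>R ?f x) \<in> borel_measurable lebesgue"
          "(\<lambda>x. indicat_real S x *\<^sub>R ?f x) \<in> borel_measurable lebesgue"
          using borel_measurable_integrable[OF integrable_mult_indicator[OF A int]]
            borel_measurable_integrable[OF integrable_mult_indicator[OF Sl int]] by auto
        show "AE x in lebesgue. indicat_real A x *\<^sub>R ?f x = indicat_real S x *\<^sub>R ?f x"
          using n by (rule eventually_mono) (use S in \<open>auto simp: indicator_def\<close>)
      qed
      then show ?thesis using bor[of S] S(4) by (simp add: set_lebesgue_integral_def)
    qed
  qed simp
  have "AE x in lebesgue. \<forall>N. indicator (Q N) x *\<^sub>R g x = 0"
    unfolding AE_all_countable using AEN by blast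
  then show ?thesis
  proof (rule eventually_mono)
    fix x assume *: "\<forall>N. indicator (Q N) x *\<^sub>R g x = 0"
    obtain N where N: "norm x < real N" using reals_Archimedean2 by blast
    have "- real N < x $ i \<and> x $ i < real N" for i
      using component_le_norm_cart[of x i] N by linarith
    then have "x \<in> Q N" by (simp add: Q_def mem_box_cart)
    then show "g x = 0" using *[rule_format, of N] by simp
  qed
qed

lemma integrable_imp_absolutely_integrable_on:
  fixes f :: "real^'n::finite \<Rightarrow> complex"
  assumes "integrable lborel f" "compact K"
  shows "f absolutely_integrable_on K"
proof -
  have "integrable lebesgue f"
    using assms(1) borel_measurable_integrable[OF assms(1)] integrable_completion[of f lborel] by simp
  then show ?thesis unfolding set_integrable_def
    by (intro integrable_mult_indicator) (use assms(2) compact_imp_closed lmeasurable_compact in auto)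
qed

lemma has_fourier_function_regular:
  fixes f :: "real^'n::finite \<Rightarrow> complex"
  assumes f: "f \<in> test_functions"
  shows "has_fourier_function (regular_distribution f) (fourier f)"
  unfolding has_fourier_function_def
proof (intro conjI allI impI ballI)
  show "fourier f absolutely_integrable_on K" if "compact K" for K
    by (rule integrable_imp_absolutely_integrable_on[OF fourier_integrable[OF f] that])
  fix \<psi> :: "real^'n \<Rightarrow> complex" assume \<psi>: "\<psi> \<in> test_functions"
  have [measurable]: "f \<in> borel_measurable borel" "\<psi> \<in> borel_measurable borel"
      "fourier f \<in> borel_measurable borel" "fourier \<psi> \<in> borel_measurable borel"
    using test_borel fourier_borel f \<psi> by auto
  have "regular_distribution f (fourier \<psi>) = (LINT x|lebesgue. f x * fourier \<psi> x)"
    using fourier_schwartz[OF \<psi>] by (simp add: regular_distribution_def)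
  also have "\<dots> = (LINT x|lborel. f x * fourier \<psi> x)"
    by (rule lebesgue_eq_lborel_integral) measurable
  also have "\<dots> = (LINT \<xi>|lborel. fourier f \<xi> * \<psi> \<xi>)"
    by (rule fourier_swap[symmetric]) (intro test_integrable f \<psi>)+
  also have "\<dots> = (LINT \<xi>|lebesgue. fourier f \<xi> * \<psi> \<xi>)"
    by (rule lebesgue_eq_lborel_integral[symmetric]) measurable
  finally show "regular_distribution f (fourier \<psi>) = (LINT \<xi>|lebesgue. fourier f \<xi> * \<psi> \<xi>)" .
qed

text \<open>The norm of \<open>H_Rn\<close> picks some Fourier function of the distribution; the
  uniqueness makes its value independent of that choice.\<close>

lemma has_fourier_function_unique:
  fixes g h :: "real^'n::finite \<Rightarrow> complex"
  assumes g: "has_fourier_function w g" and h: "has_fourier_function w h"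
  shows "AE \<xi> in lebesgue. g \<xi> = h \<xi>"
proof -
  have lg: "\<And>K. compact K \<Longrightarrow> g absolutely_integrable_on K" and lh: "\<And>K. compact K \<Longrightarrow> h absolutely_integrable_on K"
    using g h by (auto simp: has_fourier_function_def)
  have prod: "integrable lebesgue (\<lambda>\<xi>. k \<xi> * \<psi> \<xi>)"
    if lk: "\<And>K. compact K \<Longrightarrow> k absolutely_integrable_on K" and \<psi>: "\<psi> \<in> test_functions" for k \<psi> :: "real^'n \<Rightarrow> complex"
  proof -
    obtain K where K: "compact K" "\<And>x. x \<notin> K \<Longrightarrow> \<psi> x = 0" using test_support[OF \<psi>] by blast
    obtain B where B: "B > 0" "\<And>x. cmod (\<psi> x) \<le> B" using test_bounded[OF \<psi>] by blast
    show ?thesis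
    proof (rule Bochner_Integration.integrable_bound)
      show "integrable lebesgue (\<lambda>x. B * norm (indicator K x *\<^sub>R k x))"
        using lk[OF K(1)] unfolding set_integrable_def by (intro integrable_mult_right integrable_norm)
      show "(\<lambda>\<xi>. k \<xi> * \<psi> \<xi>) \<in> borel_measurable lebesgue"
        by (intro borel_measurable_times locally_integrable_borel[OF lk])
          (simp_all add: borel_measurable_imp_lebesgue test_borel[OF \<psi>])
      show "AE x in lebesgue. norm (k x * \<psi> x) \<le> norm (B * norm (indicator K x *\<^sub>R k x))"
      proof (rule AE_I2)
        fix x show "norm (k x * \<psi> x) \<le> norm (B * norm (indicator K x *\<^sub>R k x))"
          using B K(2)[of x] by (cases "x \<in> K") (auto simp: norm_mult mult.commute[of B] intro!: mult_left_mono)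
      qed
    qed
  qed
  have "AE \<xi> in lebesgue. g \<xi> - h \<xi> = 0"
  proof (rule test_integrals_0_imp_AE_0)
    show "(\<lambda>\<xi>. g \<xi> - h \<xi>) absolutely_integrable_on K" if "compact K" for K
      by (rule set_integral_diff(1)[OF lg[OF that] lh[OF that]])
    fix \<psi> :: "real^'n \<Rightarrow> complex" assume \<psi>: "\<psi> \<in> test_functions"
    have "(LINT \<xi>|lebesgue. g \<xi> * \<psi> \<xi>) = (LINT \<xi>|lebesgue. h \<xi> * \<psi> \<xi>)"
      using g h \<psi> by (metis has_fourier_function_def)
    then show "(LINT \<xi>|lebesgue. (g \<xi> - h \<xi>) * \<psi> \<xi>) = 0"
      using Bochner_Integration.integral_diff[OF prod[OF lg \<psi>] prod[OF lh \<psi>]] by (simp add: algebra_simps)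
  qed
  then show ?thesis by simp
qed

lemma phi_bracket_borel:
  assumes "\<phi> \<in> class_M"
  shows "(\<lambda>\<xi>. \<phi> (bracket \<xi>)) \<in> borel_measurable borel"
proof (rule measurable_compose[of bracket borel "restrict_space borel {1..}" \<phi> borel])
  show "\<phi> \<in> borel_measurable (restrict_space borel {1..})" using assms by (simp add: class_M_def)
  show "bracket \<in> measurable borel (restrict_space borel {1..})"
    by (rule measurable_restrict_space2) (auto simp: bracket_ge_1)
qed

lemma sobolev_integrand_borel:
  assumes "\<phi> \<in> class_M" "g \<in> borel_measurable borel"
  shows "sobolev_integrand s \<phi> g \<in> borel_measurable borel"
  using phi_bracket_borel[OF assms(1)] assms(2) unfolding sobolev_integrand_def[abs_def] by measurable

text \<open>From here on distributions disappear: the norm of a test function is a weighted L^2 norm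
  of its classical transform.\<close>

lemma vnorm_H_Rn_regular:
  fixes f :: "real^'n::finite \<Rightarrow> complex"
  assumes f: "f \<in> test_functions" and \<phi>: "\<phi> \<in> class_M"
  shows "vnorm (H_Rn s \<phi>) (regular_distribution f) = sqrt (LINT \<xi>|lborel. sobolev_integrand s \<phi> (fourier f) \<xi>)"
proof -
  let ?g = "SOME g. has_fourier_function (regular_distribution f) g"
  have g: "has_fourier_function (regular_distribution f) ?g"
    by (rule someI[of _ "fourier f"]) (rule has_fourier_function_regular[OF f])
  have AE: "AE \<xi> in lebesgue. ?g \<xi> = fourier f \<xi>"
    by (rule has_fourier_function_unique[OF g has_fourier_function_regular[OF f]])
  have gm: "?g \<in> borel_measurable lebesgue"
    by (rule locally_integrable_borel) (use g in \<open>auto simp: has_fourier_function_def\<close>)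
  have w: "(\<lambda>\<xi>::real^'n. bracket \<xi> powr (2 * s) * (\<phi> (bracket \<xi>))\<^sup>2) \<in> borel_measurable lebesgue"
    using phi_bracket_borel[OF \<phi>] by (intro borel_measurable_imp_lebesgue) measurable
  have "(LINT \<xi>|lebesgue. sobolev_integrand s \<phi> ?g \<xi>) = (LINT \<xi>|lebesgue. sobolev_integrand s \<phi> (fourier f) \<xi>)"
  proof (rule integral_cong_AE)
    show "sobolev_integrand s \<phi> ?g \<in> borel_measurable lebesgue"
      unfolding sobolev_integrand_def[abs_def] using w gm by measurable
    show "sobolev_integrand s \<phi> (fourier f) \<in> borel_measurable lebesgue"
      by (intro borel_measurable_imp_lebesgue sobolev_integrand_borel \<phi> fourier_borel f)
    show "AE \<xi> in lebesgue. sobolev_integrand s \<phi> ?g \<xi> = sobolev_integrand s \<phi> (fourier f) \<xi>"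
      using AE by (rule eventually_mono) (simp add: sobolev_integrand_def)
  qed
  also have "\<dots> = (LINT \<xi>|lborel. sobolev_integrand s \<phi> (fourier f) \<xi>)"
    by (intro lebesgue_eq_lborel_integral sobolev_integrand_borel \<phi> fourier_borel f)
  finally show ?thesis by (simp add: H_Rn_def)
qed

section \<open>Slowly varying weights\<close>

lemma class_M_pos: "\<phi> \<in> class_M \<Longrightarrow> 1 \<le> t \<Longrightarrow> 0 < \<phi> t"
  by (simp add: class_M_def)

text \<open>The measures increase to that of the union, which is 2. The threshold 3/2 is half the
  length of [0,3], the interval in which two such sets will be made to meet.\<close>

lemma exhausting_measure:
  fixes A :: "nat \<Rightarrow> real set"
  assumes "incseq A" "\<And>n. A n \<in> sets borel" "(\<Union>n. A n) = {0..2}"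
  shows "\<forall>\<^sub>F n in sequentially. 3 / 2 < measure lborel (A n)"
proof -
  have sub: "A n \<subseteq> {0..2}" for n using assms(3) by auto
  have "(\<lambda>n. measure lborel (A n)) \<longlonglongrightarrow> measure lborel (\<Union>n. A n)"
  proof (rule Lim_measure_incseq)
    show "emeasure lborel (\<Union>n. A n) \<noteq> \<infinity>" by (simp add: assms(3))
  qed (use assms in auto)
  then show ?thesis unfolding assms(3) by (intro order_tendstoD(1)[of _ "measure lborel {0..2::real}"]) auto
qed

text \<open>The reason: two subsets of an interval of length 3 whose measures exceed 3/2 meet.\<close>

lemma slowly_varying_uniform:
  fixes H :: "real \<Rightarrow> real"
  assumes [measurable]: "H \<in> borel_measurable borel"
    and lim: "\<And>u. ((\<lambda>x. H (x + u) - H x) \<longlongrightarrow> 0) at_top" and "\<delta> > 0"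
  shows "\<exists>X. \<forall>x\<ge>X. \<forall>u\<in>{0..1}. \<bar>H (x + u) - H x\<bar> < 2 * \<delta>"
proof (rule ccontr)
  assume "\<not> ?thesis"
  then have "\<forall>n::nat. \<exists>x u. x \<ge> real n \<and> u \<in> {0..1} \<and> \<not> \<bar>H (x + u) - H x\<bar> < 2 * \<delta>" by meson
  then obtain x u where xu: "\<And>n::nat. x n \<ge> real n" "\<And>n. u n \<in> {0..1}" "\<And>n. \<not> \<bar>H (x n + u n) - H (x n)\<bar> < 2 * \<delta>"
    by metis
  have small: "\<exists>n. \<forall>m\<ge>n. \<bar>H (y m + v) - H (y m)\<bar> < \<delta>" if "\<And>n::nat. y n \<ge> real n" for y v
  proof -
    have "filterlim y at_top sequentially"
      by (rule filterlim_at_top_mono[OF filterlim_real_sequentially]) (use that in simp)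
    then have "(\<lambda>n. H (y n + v) - H (y n)) \<longlonglongrightarrow> 0"
      by (rule filterlim_compose[OF lim])
    then show ?thesis using \<open>\<delta> > 0\<close> by (simp add: LIMSEQ_iff)
  qed
  \<comment> \<open>Applied to the base points \<open>x n\<close> and to the shifted ones
    \<open>x n + u n\<close>; both tend to infinity, so each shift \<open>v\<close> is eventually
    good for either sequence. Asking for all later indices makes the sets increase with n.\<close>
  have *: "\<forall>\<^sub>F n in sequentially. 3 / 2 < measure lborel {v \<in> {0..2}. \<forall>m\<ge>n. \<bar>H (y m + v) - H (y m)\<bar> < \<delta>}"
    if y: "\<And>n::nat. y n \<ge> real n" for y
  proof (rule exhausting_measure)
    show "incseq (\<lambda>n. {v \<in> {0..2}. \<forall>m\<ge>n. \<bar>H (y m + v) - H (y m)\<bar> < \<delta>})"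
      by (auto simp: incseq_def)
    show "{v \<in> {0..2}. \<forall>m\<ge>n. \<bar>H (y m + v) - H (y m)\<bar> < \<delta>} \<in> sets borel" for n by measurable
    show "(\<Union>n. {v \<in> {0..2}. \<forall>m\<ge>n. \<bar>H (y m + v) - H (y m)\<bar> < \<delta>}) = {0..2}"
      using small[OF y] by auto
  qed
  let ?U = "\<lambda>n. {v \<in> {0..2}. \<forall>m\<ge>n. \<bar>H (x m + v) - H (x m)\<bar> < \<delta>}"
  let ?V = "\<lambda>n. {v \<in> {0..2}. \<forall>m\<ge>n. \<bar>H (x m + u m + v) - H (x m + u m)\<bar> < \<delta>}"
  have "x n + u n \<ge> real n" for n using xu(1,2)[of n] by auto
  from eventually_conj[OF *[of x, OF xu(1)] *[of "\<lambda>n. x n + u n", OF this]]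
  obtain n where n: "3 / 2 < measure lborel (?U n)" "3 / 2 < measure lborel (?V n)"
    by (auto simp: eventually_sequentially)
  define W where "W = (\<lambda>v. u n + v) ` ?V n"
  have Um: "?U n \<in> sets lborel" by measurable
  have Vm: "?V n \<in> sets borel" by measurable
  have Weq: "W = (\<lambda>v. v - u n) -` ?V n \<inter> space borel"
  proof (rule set_eqI)
    fix y
    show "y \<in> W \<longleftrightarrow> y \<in> (\<lambda>v. v - u n) -` ?V n \<inter> space borel"
    proof
      assume "y \<in> (\<lambda>v. v - u n) -` ?V n \<inter> space borel"
      then have "y - u n \<in> ?V n" by simp
      then have "u n + (y - u n) \<in> W" unfolding W_def by (rule imageI)
      then show "y \<in> W" by simp
    qed (auto simp: W_def)
  qed
  have Wm: "W \<in> sets lborel" unfolding Weq using measurable_sets[OF _ Vm, of "\<lambda>v. v - u n" borel] by simp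
  have "emeasure lborel (?V n) = emeasure (distr lborel borel (\<lambda>v. - u n + v)) (?V n)"
    by (simp only: lborel_distr_plus)
  also have "\<dots> = emeasure lborel W"
    unfolding Weq by (subst emeasure_distr) (use Vm in \<open>auto intro!: arg_cong[where f="emeasure lborel"]\<close>)
  finally have WV: "measure lborel W = measure lborel (?V n)" by (simp add: measure_def)
  have sub: "?U n \<subseteq> {0..3}" "W \<subseteq> {0..3}" using xu(2)[of n] by (auto simp: W_def)
  have "?U n \<inter> W \<noteq> {}"
  proof
    assume d: "?U n \<inter> W = {}"
    have fin: "emeasure lborel (?U n) \<noteq> \<infinity>" "emeasure lborel W \<noteq> \<infinity>"
      using emeasure_bounded_finite[OF bounded_subset[OF bounded_closed_interval[of 0 3] sub(1)]]
        emeasure_bounded_finite[OF bounded_subset[OF bounded_closed_interval[of 0 3] sub(2)]] by auto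
    have "measure lborel (?U n) + measure lborel W = measure lborel (?U n \<union> W)"
      by (rule measure_Union[symmetric]) (use Um Wm d fin in auto)
    also have "\<dots> \<le> measure lborel {0..3::real}"
      by (rule measure_mono_fmeasurable) (use sub Um Wm in \<open>auto simp: fmeasurable_def\<close>)
    finally show False using n WV by simp
  qed
  \<comment> \<open>From this common point the two values \<open>H (x n)\<close> and
    \<open>H (x n + u n)\<close> are both within \<delta> of the same third value.\<close>
  then obtain v where v: "v \<in> ?V n" "u n + v \<in> ?U n" by (auto simp: W_def)
  have "\<bar>H (x n + u n + v) - H (x n + u n)\<bar> < \<delta>" "\<bar>H (x n + (u n + v)) - H (x n)\<bar> < \<delta>"
    using v by auto
  then have "\<bar>H (x n + u n) - H (x n)\<bar> < 2 * \<delta>" by (simp add: add.assoc)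
  then show False using xu(3) by blast
qed

text \<open>Taking logarithms of argument and value turns multiplicative slow variation into the
  additive kind. The admissible window [0,1] contains ln 2, hence all ratios between 1 and 2, and
  \<delta> = ln 2 / 2 yields the factor 2 for the values.\<close>

lemma class_M_uniform:
  assumes \<phi>: "\<phi> \<in> class_M"
  obtains T where "T \<ge> 1" "\<And>t \<tau>. T \<le> t \<Longrightarrow> t \<le> \<tau> \<Longrightarrow> \<tau> \<le> 2 * t \<Longrightarrow> \<phi> \<tau> \<le> 2 * \<phi> t \<and> \<phi> t \<le> 2 * \<phi> \<tau>"
proof -
  have pos: "0 < \<phi> t" if "1 \<le> t" for t using class_M_pos[OF \<phi> that] .
  \<comment> \<open>The maximum with 1 keeps the argument where \<phi> is measurable and positive,
    and so makes \<open>H\<close> Borel measurable on the whole line.\<close>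
  define H where "H x = ln (\<phi> (max 1 (exp x)))" for x
  have pm: "(\<lambda>x::real. \<phi> (max 1 (exp x))) \<in> borel_measurable borel"
  proof (rule measurable_compose[of _ borel "restrict_space borel {1..}" \<phi> borel])
    show "\<phi> \<in> borel_measurable (restrict_space borel {1..})" using \<phi> by (simp add: class_M_def)
    show "(\<lambda>x::real. max 1 (exp x)) \<in> measurable borel (restrict_space borel {1..})"
      by (rule measurable_restrict_space2) auto
  qed
  have Hm: "H \<in> borel_measurable borel"
    unfolding H_def[abs_def] using pm by measurable
  have Hlim: "((\<lambda>x. H (x + u) - H x) \<longlongrightarrow> 0) at_top" for u
  proof -
    have "((\<lambda>t. \<phi> (exp u * t) / \<phi> t) \<longlongrightarrow> 1) at_top" using \<phi> by (simp add: class_M_def)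
    then have "((\<lambda>x. \<phi> (exp u * exp x) / \<phi> (exp x)) \<longlongrightarrow> 1) at_top"
      by (rule filterlim_compose[OF _ exp_at_top])
    then have "((\<lambda>x. ln (\<phi> (exp u * exp x) / \<phi> (exp x))) \<longlongrightarrow> ln 1) at_top"
      by (rule tendsto_ln) simp
    moreover have "\<forall>\<^sub>F x in at_top. ln (\<phi> (exp u * exp x) / \<phi> (exp x)) = H (x + u) - H x"
      using eventually_ge_at_top[of "max 0 (- u)"]
    proof (rule eventually_mono)
      fix x :: real assume "max 0 (- u) \<le> x"
      then have e: "1 \<le> exp x" "1 \<le> exp u * exp x" by (auto simp: exp_add[symmetric])
      then show "ln (\<phi> (exp u * exp x) / \<phi> (exp x)) = H (x + u) - H x"
        using pos[OF e(1)] pos[OF e(2)] by (simp add: H_def ln_div exp_add mult.commute max_absorb2)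
    qed
    ultimately show ?thesis using tendsto_cong by (simp add: filterlim_cong)
  qed
  have "ln 2 / 2 > (0::real)" by simp
  from slowly_varying_uniform[OF Hm Hlim this] obtain X
    where "\<forall>x\<ge>X. \<forall>u\<in>{0..1}. \<bar>H (x + u) - H x\<bar> < 2 * (ln 2 / 2)" by blast
  then have X: "\<And>x u. x \<ge> X \<Longrightarrow> u \<in> {0..1} \<Longrightarrow> \<bar>H (x + u) - H x\<bar> < ln 2" by simp
  show ?thesis
  proof (rule that[of "max 1 (exp X)"])
    fix t \<tau> assume t: "max 1 (exp X) \<le> t" "t \<le> \<tau>" "\<tau> \<le> 2 * t"
    have t1: "1 \<le> t" "1 \<le> \<tau>" using t by auto
    have "X \<le> ln t" using t(1) t1 by (simp add: ln_ge_iff)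
    moreover have "ln (\<tau> / t) \<in> {0..1}"
    proof -
      have "\<tau> / t \<le> 2" "1 \<le> \<tau> / t" using t t1 by (auto simp: field_simps)
      then have "ln (\<tau> / t) \<le> ln 2" "0 \<le> ln (\<tau> / t)" by auto
      moreover have "ln 2 \<le> (1::real)" using ln_2_less_1 by simp
      ultimately show ?thesis by simp
    qed
    ultimately have "\<bar>H (ln t + ln (\<tau> / t)) - H (ln t)\<bar> < ln 2" by (rule X)
    then have "\<bar>ln (\<phi> \<tau>) - ln (\<phi> t)\<bar> < ln 2" using t1 by (simp add: H_def ln_div max_absorb2)
    then have "ln (\<phi> \<tau>) \<le> ln (2 * \<phi> t)" "ln (\<phi> t) \<le> ln (2 * \<phi> \<tau>)"
      using pos[OF t1(1)] pos[OF t1(2)] by (auto simp: ln_mult)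
    then show "\<phi> \<tau> \<le> 2 * \<phi> t \<and> \<phi> t \<le> 2 * \<phi> \<tau>"
      using pos[OF t1(1)] pos[OF t1(2)] by simp
  qed simp
qed

lemma class_M_dyadic_comparison:
  assumes \<phi>: "\<phi> \<in> class_M"
  obtains C where "C \<ge> 1" "\<And>k (t::real). 2 ^ k \<le> t \<Longrightarrow> t \<le> 2 ^ Suc k \<Longrightarrow> (\<phi> t)\<^sup>2 \<le> C * (\<phi> (2 ^ k))\<^sup>2"
    "\<And>k (t::real). 2 ^ k \<le> t \<Longrightarrow> t \<le> 2 ^ Suc k \<Longrightarrow> (\<phi> (2 ^ k))\<^sup>2 \<le> C * (\<phi> t)\<^sup>2"
proof -
  have pos: "0 < \<phi> t" if "1 \<le> t" for t using class_M_pos[OF \<phi> that] .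
  obtain T where T: "T \<ge> 1" "\<And>t \<tau>. T \<le> t \<Longrightarrow> t \<le> \<tau> \<Longrightarrow> \<tau> \<le> 2 * t \<Longrightarrow> \<phi> \<tau> \<le> 2 * \<phi> t \<and> \<phi> t \<le> 2 * \<phi> \<tau>"
    using class_M_uniform[OF \<phi>] by blast
  \<comment> \<open>If 2^k lies below \<open>T\<close>, then the whole dyadic interval starting at
    2^k lies in [1, 2T], where \<phi> and 1/\<phi> are bounded.\<close>
  have "bounded (\<phi> ` {1..2*T})" "bounded ((\<lambda>t. 1 / \<phi> t) ` {1..2*T})"
    using \<phi> T(1) by (auto simp: class_M_def)
  then obtain A B where A: "\<And>t. t \<in> {1..2*T} \<Longrightarrow> \<bar>\<phi> t\<bar> \<le> A" and B: "\<And>t. t \<in> {1..2*T} \<Longrightarrow> \<bar>1 / \<phi> t\<bar> \<le> B"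
    unfolding bounded_iff by (metis imageI real_norm_def)
  define D where "D = max 2 (A * B)"
  have *: "\<phi> t \<le> D * \<phi> (2 ^ k) \<and> \<phi> (2 ^ k) \<le> D * \<phi> t" if k: "2 ^ k \<le> t" "t \<le> 2 ^ Suc k" for k t
  proof (cases "T \<le> 2 ^ k")
    case True
    have p: "0 < \<phi> (2 ^ k)" "0 < \<phi> t" using k by (auto intro!: pos order_trans[OF one_le_power k(1)])
    have "\<phi> t \<le> 2 * \<phi> (2 ^ k) \<and> \<phi> (2 ^ k) \<le> 2 * \<phi> t" using T(2)[OF True k(1)] k(2) by simp
    moreover have "2 * \<phi> (2 ^ k) \<le> D * \<phi> (2 ^ k)" "2 * \<phi> t \<le> D * \<phi> t"
      using p by (auto simp: D_def intro!: mult_right_mono)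
    ultimately show ?thesis by linarith
  next
    case False
    then have r: "2 ^ k \<in> {1..2*T}" "t \<in> {1..2*T}"
      using k by (auto intro: order_trans[OF one_le_power k(1)])
    have cmp: "\<phi> a \<le> D * \<phi> b" if "a \<in> {1..2*T}" "b \<in> {1..2*T}" for a b
    proof -
      have pa: "0 < \<phi> a" "0 < \<phi> b" using that by (auto intro: pos)
      have "\<phi> a * (1 / \<phi> b) \<le> A * B"
        using A[OF that(1)] B[OF that(2)] pa by (intro mult_mono) auto
      then have "\<phi> a \<le> (A * B) * \<phi> b" using pa by (simp add: field_simps)
      also have "\<dots> \<le> D * \<phi> b" using pa by (intro mult_right_mono) (auto simp: D_def)
      finally show ?thesis .
    qed
    show ?thesis using cmp[OF r(2,1)] cmp[OF r] by simp
  qed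
  have D: "D \<ge> 1" by (simp add: D_def)
  show ?thesis
  proof (rule that[of "D\<^sup>2"])
    show "1 \<le> D\<^sup>2" using D by (simp add: one_le_power)
    fix k and t :: real assume k: "2 ^ k \<le> t" "t \<le> 2 ^ Suc k"
    have p: "0 < \<phi> (2 ^ k)" "0 < \<phi> t" using k by (auto intro!: pos order_trans[OF one_le_power k(1)])
    show "(\<phi> t)\<^sup>2 \<le> D\<^sup>2 * (\<phi> (2 ^ k))\<^sup>2" "(\<phi> (2 ^ k))\<^sup>2 \<le> D\<^sup>2 * (\<phi> t)\<^sup>2"
      using *[OF k] p by (auto simp: power_mult_distrib[symmetric] intro!: power_mono)
  qed
qed

text \<open>The distance |k - l| of natural numbers: of the two truncated differences at least one
  is zero.\<close>

definition absdiff :: "nat \<Rightarrow> nat \<Rightarrow> nat" where "absdiff k l = (k - l) + (l - k)"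

text \<open>Ratios tending to 1 end up between 2/3 and 3/2, and the initial segment is absorbed in
  the constant. The base 3/2 is a choice: a number above 1 whose product with the off-diagonal
  factor 1/2 stays below 1.\<close>

lemma dyadic_growth:
  fixes w :: "nat \<Rightarrow> real"
  assumes pos: "\<And>k. 0 < w k" and lim: "(\<lambda>k. w (Suc k) / w k) \<longlonglongrightarrow> 1"
  obtains C where "C \<ge> 1" "\<And>k l. w l \<le> C * (3 / 2) ^ absdiff k l * w k"
proof -
  have "\<forall>\<^sub>F k in sequentially. w (Suc k) / w k < 3 / 2" "\<forall>\<^sub>F k in sequentially. 2 / 3 < w (Suc k) / w k"
    by (rule order_tendstoD(2)[OF lim], simp) (rule order_tendstoD(1)[OF lim], simp)
  then have "\<forall>\<^sub>F k in sequentially. w (Suc k) / w k < 3 / 2 \<and> 2 / 3 < w (Suc k) / w k"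
    by (rule eventually_conj)
  then obtain N where N: "\<And>k. k \<ge> N \<Longrightarrow> w (Suc k) / w k < 3 / 2 \<and> 2 / 3 < w (Suc k) / w k"
    by (auto simp: eventually_sequentially)
  have step: "w (Suc k) \<le> 3 / 2 * w k" "w k \<le> 3 / 2 * w (Suc k)" if "k \<ge> N" for k
    using N[OF that] pos[of k] by (auto simp: field_simps)
  have up: "w (k + d) \<le> (3 / 2) ^ d * w k \<and> w k \<le> (3 / 2) ^ d * w (k + d)" if "k \<ge> N" for k d
  proof (induction d)
    case (Suc d)
    have "w (Suc (k + d)) \<le> 3 / 2 * w (k + d)" using step(1)[of "k + d"] that by simp
    also have "\<dots> \<le> 3 / 2 * ((3 / 2) ^ d * w k)" using Suc by (intro mult_left_mono) auto
    finally have 1: "w (k + Suc d) \<le> (3 / 2) ^ Suc d * w k" by simp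
    have "w k \<le> (3 / 2) ^ d * w (k + d)" using Suc by simp
    also have "\<dots> \<le> (3 / 2) ^ d * (3 / 2 * w (Suc (k + d)))" using step(2)[of "k + d"] that by (intro mult_left_mono) auto
    finally show ?case using 1 by simp
  qed simp
  have far: "w l \<le> (3 / 2) ^ absdiff k l * w k" if "k \<ge> N" "l \<ge> N" for k l
  proof (cases "k \<le> l")
    case True
    then show ?thesis using up[OF that(1), of "l - k"] by (simp add: absdiff_def)
  next
    case False
    then show ?thesis using up[OF that(2), of "k - l"] by (simp add: absdiff_def)
  qed
  \<comment> \<open>The worst ratio between \<open>w N\<close> and an earlier value. It is paid once
    for moving each of the two indices up to \<open>N\<close>, which explains the final constant
    \<open>c\<^sup>2\<close>.\<close>
  define c where "c = Max ((\<lambda>k. max (w k / w N) (w N / w k)) ` {..N})"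
  have c: "w k \<le> c * w N" "w N \<le> c * w k" if "k \<le> N" for k
  proof -
    have "max (w k / w N) (w N / w k) \<le> c" unfolding c_def by (rule Max_ge) (use that in auto)
    then show "w k \<le> c * w N" "w N \<le> c * w k" using pos[of k] pos[of N] by (auto simp: field_simps)
  qed
  have c1: "c \<ge> 1" using c(1)[of N] pos[of N] by simp
  have near: "w k \<le> c * w (max k N)" "w (max k N) \<le> c * w k" for k
  proof -
    have "1 * w k \<le> c * w k" using c1 pos[of k] by (intro mult_right_mono) auto
    then show "w k \<le> c * w (max k N)" "w (max k N) \<le> c * w k"
      using c[of k] by (auto simp: max_def)
  qed
  show ?thesis
  proof (rule that[of "c\<^sup>2"])
    show "1 \<le> c\<^sup>2" using c1 by (simp add: one_le_power)
    fix k l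
    have "w l \<le> c * w (max l N)" by (rule near)
    also have "\<dots> \<le> c * ((3 / 2) ^ absdiff (max k N) (max l N) * w (max k N))"
      using far[of "max k N" "max l N"] c1 by (intro mult_left_mono) auto
    also have "\<dots> \<le> c * ((3 / 2) ^ absdiff k l * w (max k N))"
    proof (intro mult_left_mono mult_right_mono power_increasing)
      show "absdiff (max k N) (max l N) \<le> absdiff k l" by (auto simp: absdiff_def max_def)
    qed (use c1 pos[of "max k N"] in auto)
    also have "\<dots> \<le> c * ((3 / 2) ^ absdiff k l * (c * w k))"
      using near(2)[of k] c1 by (intro mult_left_mono) auto
    finally show "w l \<le> c\<^sup>2 * (3 / 2) ^ absdiff k l * w k" by (simp add: power2_eq_square mult_ac)
  qed
qed

lemma class_M_dyadic_growth:
  assumes \<phi>: "\<phi> \<in> class_M"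
  obtains C where "C \<ge> 1" "\<And>k l. (\<phi> (2 ^ l))\<^sup>2 \<le> C * (3 / 2) ^ absdiff k l * (\<phi> (2 ^ k))\<^sup>2"
proof -
  have "((\<lambda>t. \<phi> (2 * t) / \<phi> t) \<longlongrightarrow> 1) at_top" using \<phi> by (simp add: class_M_def)
  moreover have "filterlim (\<lambda>k. (2::real) ^ k) at_top sequentially"
    by (rule filterlim_at_top_mono[OF filterlim_real_sequentially])
      (intro always_eventually allI less_imp_le of_nat_less_two_power)
  ultimately have "(\<lambda>k. \<phi> (2 * 2 ^ k) / \<phi> (2 ^ k)) \<longlonglongrightarrow> 1" by (rule filterlim_compose)
  then have "(\<lambda>k. (\<phi> (2 * 2 ^ k) / \<phi> (2 ^ k))\<^sup>2) \<longlonglongrightarrow> 1\<^sup>2" by (rule tendsto_power)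
  then have "(\<lambda>k. (\<phi> (2 ^ Suc k))\<^sup>2 / (\<phi> (2 ^ k))\<^sup>2) \<longlonglongrightarrow> 1" by (simp add: power_divide)
  moreover have "0 < (\<phi> (2 ^ k))\<^sup>2" for k using class_M_pos[OF \<phi>, of "2 ^ k"] by simp
  ultimately show ?thesis using dyadic_growth[of "\<lambda>k. (\<phi> (2 ^ k))\<^sup>2"] that by metis
qed

lemma nn_integral_dyadic:
  fixes F :: "real \<Rightarrow> ennreal"
  assumes [measurable]: "F \<in> borel_measurable borel"
  shows "(\<integral>\<^sup>+t\<in>{1..}. F t \<partial>lborel) = (\<Sum>k. \<integral>\<^sup>+t. F t * indicator {2 ^ k..<2 ^ Suc k} t \<partial>lborel)"
proof -
  have disj: "disjoint_family (\<lambda>k. {2 ^ k..<2 ^ Suc k} :: real set)"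
    unfolding disjoint_family_on_def
  proof (intro ballI impI equals0I)
    fix m n :: nat and x :: real
    assume "m \<noteq> n" "x \<in> {2 ^ m..<2 ^ Suc m} \<inter> {2 ^ n..<2 ^ Suc n}"
    then show False using dyadic_unique[of m x n] by (simp del: power_Suc)
  qed
  have "F t * indicator {1..} t = (\<Sum>k. F t * indicator {2 ^ k..<2 ^ Suc k} t)" for t
  proof (cases "1 \<le> t")
    case True
    then obtain k where "2 ^ k \<le> t" "t < 2 ^ Suc k" by (rule ex_dyadic)
    then show ?thesis
      using suminf_cmult_indicator[OF disj, of t k "\<lambda>_. F t"] True by simp
  next
    case False
    have "t \<notin> {2 ^ k..<2 ^ Suc k}" for k
      using False order_trans[OF one_le_power[of 2 k], of t] by auto
    then show ?thesis using False by simp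
  qed
  then have "(\<integral>\<^sup>+t\<in>{1..}. F t \<partial>lborel) = (\<integral>\<^sup>+t. (\<Sum>k. F t * indicator {2 ^ k..<2 ^ Suc k} t) \<partial>lborel)"
    by simp
  also have "\<dots> = (\<Sum>k. \<integral>\<^sup>+t. F t * indicator {2 ^ k..<2 ^ Suc k} t \<partial>lborel)"
    by (rule nn_integral_suminf) measurable
  finally show ?thesis .
qed

lemma integral_condition_iff_summable:
  assumes \<phi>: "\<phi> \<in> class_M"
  shows "(\<integral>\<^sup>+ t\<in>{1..}. ennreal (1 / (t * (\<phi> t)\<^sup>2)) \<partial>lborel) < \<infinity> \<longleftrightarrow> summable (\<lambda>k. 1 / (\<phi> (2 ^ k))\<^sup>2)"
proof -
  have pos: "0 < \<phi> t" if "1 \<le> t" for t using class_M_pos[OF \<phi> that] .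
  obtain C where C: "C \<ge> 1" "\<And>k t. 2 ^ k \<le> t \<Longrightarrow> t \<le> 2 ^ Suc k \<Longrightarrow> (\<phi> t)\<^sup>2 \<le> C * (\<phi> (2 ^ k))\<^sup>2"
    "\<And>k (t::real). 2 ^ k \<le> t \<Longrightarrow> t \<le> 2 ^ Suc k \<Longrightarrow> (\<phi> (2 ^ k))\<^sup>2 \<le> C * (\<phi> t)\<^sup>2"
    using class_M_dyadic_comparison[OF \<phi>] by blast
  define w where "w k = (\<phi> (2 ^ k))\<^sup>2" for k
  have w: "0 < w k" for k using pos[of "2 ^ k"] by (simp add: w_def)
  \<comment> \<open>Equal to the integrand on [1,\<infinity>), but Borel measurable on the whole
    line, as the dyadic decomposition of the integral asks.\<close>
  define F where "F t = ennreal (1 / (t * (\<phi> (max 1 t))\<^sup>2))" for t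
  have pm: "(\<lambda>x::real. \<phi> (max 1 x)) \<in> borel_measurable borel"
  proof (rule measurable_compose[of _ borel "restrict_space borel {1..}" \<phi> borel])
    show "\<phi> \<in> borel_measurable (restrict_space borel {1..})" using \<phi> by (simp add: class_M_def)
    show "(\<lambda>x::real. max 1 x) \<in> measurable borel (restrict_space borel {1..})"
      by (rule measurable_restrict_space2) auto
  qed
  have Fm: "F \<in> borel_measurable borel" unfolding F_def[abs_def] using pm by measurable
  have "(\<integral>\<^sup>+ t\<in>{1..}. ennreal (1 / (t * (\<phi> t)\<^sup>2)) \<partial>lborel) = (\<integral>\<^sup>+t\<in>{1..}. F t \<partial>lborel)"
    by (rule nn_integral_cong) (auto simp: F_def indicator_def max_absorb2)
  also have "\<dots> = (\<Sum>k. \<integral>\<^sup>+t. F t * indicator {2 ^ k..<2 ^ Suc k} t \<partial>lborel)"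
    by (rule nn_integral_dyadic[OF Fm])
  finally have eq: "(\<integral>\<^sup>+ t\<in>{1..}. ennreal (1 / (t * (\<phi> t)\<^sup>2)) \<partial>lborel) = \<dots>" .
  have len: "emeasure lborel {2 ^ k..<2 ^ Suc k :: real} = ennreal (2 ^ k)" for k by simp
  have bnd: "1 / (2 ^ Suc k * (C * w k)) \<le> 1 / (t * (\<phi> (max 1 t))\<^sup>2) \<and> 1 / (t * (\<phi> (max 1 t))\<^sup>2) \<le> C / (2 ^ k * w k)"
    if t: "t \<in> {2 ^ k..<2 ^ Suc k}" for k t
  proof -
    have t1: "1 \<le> t" using t order_trans[OF one_le_power[of 2 k], of t] by simp
    have pt: "0 < (\<phi> t)\<^sup>2" using pos[OF t1] by simp
    have le: "(\<phi> t)\<^sup>2 \<le> C * w k" "w k \<le> C * (\<phi> t)\<^sup>2" using C(2,3)[of k t] t by (auto simp: w_def)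
    have "t * (\<phi> t)\<^sup>2 \<le> 2 ^ Suc k * (C * w k)" using t t1 le(1) by (intro mult_mono) auto
    moreover have "2 ^ k * w k \<le> t * (C * (\<phi> t)\<^sup>2)" using t t1 le(2) w[of k] by (intro mult_mono) auto
    ultimately show ?thesis using t1 pt w[of k] C(1)
      by (auto simp: max_absorb2 divide_simps mult_ac)
  qed
  have up: "(\<integral>\<^sup>+t. F t * indicator {2 ^ k..<2 ^ Suc k} t \<partial>lborel) \<le> ennreal (C * (1 / w k))" for k
  proof -
    have "(\<integral>\<^sup>+t. F t * indicator {2 ^ k..<2 ^ Suc k} t \<partial>lborel)
        \<le> integral\<^sup>N lborel (\<lambda>t::real. ennreal (C / (2 ^ k * w k)) * indicator {2 ^ k..<2 ^ Suc k} t)"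
      using bnd by (intro nn_integral_mono) (auto simp: indicator_def F_def intro!: ennreal_leI)
    also have "\<dots> = ennreal (C / (2 ^ k * w k)) * ennreal (2 ^ k)"
      by (subst nn_integral_cmult_indicator) (simp_all only: len, simp)
    also have "\<dots> = ennreal (C * (1 / w k))"
      by (subst ennreal_mult'[symmetric]) (use w[of k] C(1) in auto)
    finally show ?thesis .
  qed
  have low: "ennreal ((1 / (2 * C)) * (1 / w k)) \<le> (\<integral>\<^sup>+t. F t * indicator {2 ^ k..<2 ^ Suc k} t \<partial>lborel)" for k
  proof -
    have "ennreal ((1 / (2 * C)) * (1 / w k)) = ennreal (1 / (2 ^ Suc k * (C * w k))) * ennreal (2 ^ k)"
      by (subst ennreal_mult'[symmetric]) (use w[of k] C(1) in auto)
    also have "\<dots> = integral\<^sup>N lborel (\<lambda>t::real. ennreal (1 / (2 ^ Suc k * (C * w k))) * indicator {2 ^ k..<2 ^ Suc k} t)"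
      by (subst nn_integral_cmult_indicator) (simp_all only: len, simp)
    also have "\<dots> \<le> (\<integral>\<^sup>+t. F t * indicator {2 ^ k..<2 ^ Suc k} t \<partial>lborel)"
      using bnd by (intro nn_integral_mono) (auto simp: indicator_def F_def intro!: ennreal_leI)
    finally show ?thesis .
  qed
  show ?thesis unfolding eq w_def[symmetric]
  proof
    assume fin: "(\<Sum>k. \<integral>\<^sup>+t. F t * indicator {2 ^ k..<2 ^ Suc k} t \<partial>lborel) < \<infinity>"
    have "(\<Sum>k. ennreal ((1 / (2 * C)) * (1 / w k))) \<le> (\<Sum>k. \<integral>\<^sup>+t. F t * indicator {2 ^ k..<2 ^ Suc k} t \<partial>lborel)"
      by (intro suminf_le low) auto
    with fin have "(\<Sum>k. ennreal ((1 / (2 * C)) * (1 / w k))) \<noteq> top"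
      by (metis infinity_ennreal_def le_less_trans less_irrefl)
    then have "summable (\<lambda>k. (1 / (2 * C)) * (1 / w k))"
      by (intro summable_suminf_not_top) (use w C(1) in \<open>auto simp: less_imp_le\<close>)
    then show "summable (\<lambda>k. 1 / w k)"
      by (rule summable_mult_D) (use C(1) in auto)
  next
    assume s: "summable (\<lambda>k. 1 / w k)"
    have "(\<Sum>k. \<integral>\<^sup>+t. F t * indicator {2 ^ k..<2 ^ Suc k} t \<partial>lborel) \<le> (\<Sum>k. ennreal (C * (1 / w k)))"
      by (intro suminf_le up) auto
    also have "\<dots> = ennreal (\<Sum>k. C * (1 / w k))"
      by (rule suminf_ennreal2) (use summable_mult[OF s, of C] w C(1) in \<open>auto simp: less_imp_le\<close>)
    also have "\<dots> < \<infinity>" by simp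
    finally show "(\<Sum>k. \<integral>\<^sup>+t. F t * indicator {2 ^ k..<2 ^ Suc k} t \<partial>lborel) < \<infinity>" .
  qed
qed

section \<open>Sobolev norms of test functions\<close>

text \<open>The right-hand side is smallest at t = sqrt(Y/X); the shift by e/2 allows X or Y to
  vanish. It yields the triangle inequality for the norms from a pointwise quadratic inequality that
  can be integrated and summed termwise.\<close>

lemma sqrt_le_add_if_quadratic:
  fixes X Y Z :: real
  assumes "\<And>t. t > 0 \<Longrightarrow> Z \<le> (1 + t) * X + (1 + 1 / t) * Y" "0 \<le> X" "0 \<le> Y"
  shows "sqrt Z \<le> sqrt X + sqrt Y"
proof (rule field_le_epsilon)
  fix e :: real assume "e > 0"
  define a where "a = sqrt X + e / 2"
  define b where "b = sqrt Y + e / 2"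
  have ab: "a > 0" "b > 0" using \<open>e > 0\<close> assms(2,3) by (auto simp: a_def b_def add_nonneg_pos)
  have "X \<le> a\<^sup>2" "Y \<le> b\<^sup>2"
    using \<open>e > 0\<close> assms(2,3) by (auto simp: a_def b_def intro!: sqrt_le_D)
  then have "Z \<le> (1 + b / a) * a\<^sup>2 + (1 + 1 / (b / a)) * b\<^sup>2"
    using assms(1)[of "b / a"] ab
    by (smt (verit, ccfv_SIG) divide_pos_pos mult_left_mono zero_less_divide_1_iff)
  also have "\<dots> = (a + b)\<^sup>2" using ab by (simp add: power2_eq_square field_simps)
  finally have "sqrt Z \<le> a + b" using ab by (intro real_le_lsqrt) auto
  then show "sqrt Z \<le> sqrt X + sqrt Y + e" by (simp add: a_def b_def)
qed

text \<open>The multiplicative form of the same optimisation over t; it turns an integrated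
  quadratic inequality into the Cauchy-Schwarz inequality.\<close>

lemma le_sqrt_mult_if_quadratic:
  fixes X Y Z :: real
  assumes "\<And>t. t > 0 \<Longrightarrow> Z \<le> (t * X + Y / t) / 2" "0 \<le> X" "0 \<le> Y"
  shows "Z \<le> sqrt X * sqrt Y"
proof -
  have *: "Z \<le> (sqrt X + e) * (sqrt Y + e)" if "e > 0" for e
  proof -
    define a where "a = sqrt X + e"
    define b where "b = sqrt Y + e"
    have ab: "a > 0" "b > 0" using \<open>e > 0\<close> assms(2,3) by (auto simp: a_def b_def add_nonneg_pos)
    have "X \<le> a\<^sup>2" "Y \<le> b\<^sup>2"
      using \<open>e > 0\<close> assms(2,3) by (auto simp: a_def b_def intro!: sqrt_le_D)
    then have "(b / a * X + Y / (b / a)) / 2 \<le> (b / a * a\<^sup>2 + b\<^sup>2 / (b / a)) / 2"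
      using ab by (intro divide_right_mono add_mono mult_left_mono) auto
    also have "\<dots> = a * b" using ab by (simp add: power2_eq_square field_simps)
    finally show ?thesis using assms(1)[of "b / a"] ab by (simp add: a_def b_def)
  qed
  have "((\<lambda>e. (sqrt X + e) * (sqrt Y + e)) \<longlongrightarrow> (sqrt X + 0) * (sqrt Y + 0)) (at_right 0)"
    by (intro tendsto_intros)
  then show ?thesis
    by (intro tendsto_lowerbound[of "\<lambda>e. (sqrt X + e) * (sqrt Y + e)" _ "at_right 0"])
      (auto simp: eventually_at_right_field * intro!: exI[of _ 1])
qed

lemma cauchy_schwarz_integral:
  fixes a b :: "'a \<Rightarrow> real"
  assumes [measurable]: "a \<in> borel_measurable M" "b \<in> borel_measurable M"
    and a2: "integrable M (\<lambda>x. (a x)\<^sup>2)" and b2: "integrable M (\<lambda>x. (b x)\<^sup>2)"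
  shows "integrable M (\<lambda>x. a x * b x)"
    "(\<integral>x. \<bar>a x * b x\<bar> \<partial>M) \<le> sqrt (\<integral>x. (a x)\<^sup>2 \<partial>M) * sqrt (\<integral>x. (b x)\<^sup>2 \<partial>M)"
proof -
  have pt: "\<bar>u * v\<bar> \<le> (t * u\<^sup>2 + v\<^sup>2 / t) / 2" if "t > 0" for t u v :: real
  proof -
    have "0 \<le> (t * \<bar>u\<bar> - \<bar>v\<bar>)\<^sup>2 / t" using that by simp
    also have "\<dots> = t * u\<^sup>2 + v\<^sup>2 / t - 2 * \<bar>u * v\<bar>"
      using that by (simp add: power2_eq_square field_simps abs_mult)
    finally show ?thesis by simp
  qed
  show i: "integrable M (\<lambda>x. a x * b x)"
  proof (rule Bochner_Integration.integrable_bound)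
    show "integrable M (\<lambda>x. (a x)\<^sup>2 + (b x)\<^sup>2)" using a2 b2 by simp
    show "AE x in M. norm (a x * b x) \<le> norm ((a x)\<^sup>2 + (b x)\<^sup>2)"
    proof (rule AE_I2)
      fix x
      have "\<bar>a x * b x\<bar> \<le> (1 * (a x)\<^sup>2 + (b x)\<^sup>2 / 1) / 2" by (rule pt) simp
      then show "norm (a x * b x) \<le> norm ((a x)\<^sup>2 + (b x)\<^sup>2)" by simp
    qed
  qed measurable
  show "(\<integral>x. \<bar>a x * b x\<bar> \<partial>M) \<le> sqrt (\<integral>x. (a x)\<^sup>2 \<partial>M) * sqrt (\<integral>x. (b x)\<^sup>2 \<partial>M)"
  proof (rule le_sqrt_mult_if_quadratic)
    fix t :: real assume "t > 0"
    have "(\<integral>x. \<bar>a x * b x\<bar> \<partial>M) \<le> (\<integral>x. (t * (a x)\<^sup>2 + (b x)\<^sup>2 / t) / 2 \<partial>M)"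
      using i a2 b2 by (intro integral_mono pt \<open>t > 0\<close>) auto
    also have "\<dots> = (t * (\<integral>x. (a x)\<^sup>2 \<partial>M) + (\<integral>x. (b x)\<^sup>2 \<partial>M) / t) / 2" using a2 b2 by simp
    finally show "(\<integral>x. \<bar>a x * b x\<bar> \<partial>M) \<le> (t * (\<integral>x. (a x)\<^sup>2 \<partial>M) + (\<integral>x. (b x)\<^sup>2 \<partial>M) / t) / 2" .
  qed auto
qed

section \<open>The squared weighted norm and its control of derivatives\<close>

definition Hsq :: "real \<Rightarrow> (real \<Rightarrow> real) \<Rightarrow> (real^'n::finite \<Rightarrow> complex) \<Rightarrow> real" where
  "Hsq s \<phi> f = (LINT \<xi>|lborel. sobolev_integrand s \<phi> (fourier f) \<xi>)"

lemma Hsq_nonneg: "0 \<le> Hsq s \<phi> f"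
  unfolding Hsq_def sobolev_integrand_def by (intro integral_nonneg_AE AE_I2) simp

text \<open>The type argument \<open>nt\<close> carries the dimension n. Since 2s = 2q + n is a
  natural number, the real powers of the bracket become ordinary ones
  (\<open>bracket_powr\<close>).\<close>

locale weight =
  fixes \<phi> :: "real \<Rightarrow> real" and q :: nat and s :: real and nt :: "'n::finite itself"
  assumes \<phi>: "\<phi> \<in> class_M" and s: "s = real q + real CARD('n) / 2"
begin

lemma bracket_powr: "bracket (\<xi>::real^'n) powr (2 * s) = bracket \<xi> ^ (2 * q + CARD('n))"
proof -
  have "2 * s = real (2 * q + CARD('n))" by (simp add: s)
  then show ?thesis using bracket_ge_1[of \<xi>] by (simp only: powr_realpow)
qed

lemma integrand_eq:
  "sobolev_integrand s \<phi> g (\<xi>::real^'n) = bracket \<xi> ^ (2 * q + CARD('n)) * (\<phi> (bracket \<xi>))\<^sup>2 * (cmod (g \<xi>))\<^sup>2"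
  by (simp add: sobolev_integrand_def bracket_powr)

lemma phi_pos: "0 < \<phi> (bracket \<xi>)"
  by (rule class_M_pos[OF \<phi> bracket_ge_1])

text \<open>Dyadic growth of order (3/2)^k is at most 2^k, hence at most the bracket on the k-th
  shell. The bound is crude, but enough for the norms of test functions to be finite.\<close>

lemma phi_linear_bound:
  obtains C where "C > 0" "\<And>\<xi>::real^'n. (\<phi> (bracket \<xi>))\<^sup>2 \<le> C * bracket \<xi>"
proof -
  obtain A where A: "A \<ge> 1" "\<And>k t. 2 ^ k \<le> t \<Longrightarrow> t \<le> 2 ^ Suc k \<Longrightarrow> (\<phi> t)\<^sup>2 \<le> A * (\<phi> (2 ^ k))\<^sup>2"
    using class_M_dyadic_comparison[OF \<phi>] by metis
  obtain B where B: "B \<ge> 1" "\<And>k l. (\<phi> (2 ^ l))\<^sup>2 \<le> B * (3 / 2) ^ absdiff k l * (\<phi> (2 ^ k))\<^sup>2"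
    using class_M_dyadic_growth[OF \<phi>] by blast
  have p1: "0 < (\<phi> 1)\<^sup>2" using class_M_pos[OF \<phi>, of 1] by simp
  show ?thesis
  proof (rule that[of "A * B * (\<phi> 1)\<^sup>2"])
    show "0 < A * B * (\<phi> 1)\<^sup>2" using A(1) B(1) p1 by simp
    fix \<xi> :: "real^'n"
    obtain k where "\<xi> \<in> shell k" by (rule ex_shell)
    then have k: "2 ^ k \<le> bracket \<xi>" "bracket \<xi> \<le> 2 ^ Suc k" by (auto simp: shell_def)
    have "(\<phi> (bracket \<xi>))\<^sup>2 \<le> A * (\<phi> (2 ^ k))\<^sup>2" by (rule A(2)[OF k])
    also have "\<dots> \<le> A * (B * (3 / 2) ^ k * (\<phi> 1)\<^sup>2)"
      using B(2)[of k 0] A(1) by (intro mult_left_mono) (auto simp: absdiff_def)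
    also have "\<dots> \<le> A * (B * 2 ^ k * (\<phi> 1)\<^sup>2)"
      using A(1) B(1) by (intro mult_left_mono mult_right_mono power_mono) auto
    also have "\<dots> \<le> A * (B * bracket \<xi> * (\<phi> 1)\<^sup>2)"
      using A(1) B(1) k(1) by (intro mult_left_mono mult_right_mono) auto
    finally show "(\<phi> (bracket \<xi>))\<^sup>2 \<le> A * B * (\<phi> 1)\<^sup>2 * bracket \<xi>" by (simp add: mult_ac)
  qed
qed

lemma bracket_pow_le: "bracket (\<xi>::real^'n) ^ m \<le> (1 + norm \<xi>) ^ m"
  using bracket_le[of \<xi>] bracket_ge_1[of \<xi>] by (intro power_mono) auto

lemma integrand_integrable:
  fixes f :: "real^'n \<Rightarrow> complex"
  assumes f: "f \<in> test_functions"
  shows "integrable lborel (sobolev_integrand s \<phi> (fourier f))"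
proof -
  obtain C where C: "C > 0" "\<And>\<xi>::real^'n. (\<phi> (bracket \<xi>))\<^sup>2 \<le> C * bracket \<xi>" using phi_linear_bound by blast
  define B where "B = (LINT x|lborel. cmod (f x))"
  have B: "cmod (fourier f \<xi>) \<le> B" for \<xi> unfolding B_def by (rule norm_fourier_le[OF test_integrable[OF f]])
  have B0: "0 \<le> B" by (simp add: B_def)
  let ?m = "Suc (2 * q + CARD('n))"
  show ?thesis
  proof (rule Bochner_Integration.integrable_bound)
    show "integrable lborel (\<lambda>\<xi>::real^'n. C * B * ((1 + norm \<xi>) ^ ?m * cmod (fourier f \<xi>)))"
      by (intro integrable_mult_right fourier_moment_integrable f)
    show "sobolev_integrand s \<phi> (fourier f) \<in> borel_measurable lborel"
      using sobolev_integrand_borel[OF \<phi> fourier_borel[OF f]] by simp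
    show "AE \<xi> in lborel. norm (sobolev_integrand s \<phi> (fourier f) \<xi>) \<le>
        norm (C * B * ((1 + norm \<xi>) ^ ?m * cmod (fourier f \<xi>)))"
    proof (rule AE_I2)
      fix \<xi> :: "real^'n"
      have "bracket \<xi> ^ (2 * q + CARD('n)) * (\<phi> (bracket \<xi>))\<^sup>2 * (cmod (fourier f \<xi>))\<^sup>2
          \<le> bracket \<xi> ^ (2 * q + CARD('n)) * (C * bracket \<xi>) * (B * cmod (fourier f \<xi>))"
        using C(2)[of \<xi>] B[of \<xi>] bracket_ge_1[of \<xi>] B0 C(1)
        by (intro mult_mono) (auto simp: power2_eq_square intro!: mult_right_mono)
      also have "\<dots> = C * B * (bracket \<xi> ^ ?m * cmod (fourier f \<xi>))" by (simp add: mult_ac)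
      also have "\<dots> \<le> C * B * ((1 + norm \<xi>) ^ ?m * cmod (fourier f \<xi>))"
        using C(1) B0 by (intro mult_left_mono mult_right_mono bracket_pow_le) auto
      finally have "sobolev_integrand s \<phi> (fourier f) \<xi> \<le> C * B * ((1 + norm \<xi>) ^ ?m * cmod (fourier f \<xi>))"
        by (simp only: integrand_eq)
      moreover have "0 \<le> sobolev_integrand s \<phi> (fourier f) \<xi>" by (simp add: sobolev_integrand_def)
      ultimately show "norm (sobolev_integrand s \<phi> (fourier f) \<xi>) \<le>
          norm (C * B * ((1 + norm \<xi>) ^ ?m * cmod (fourier f \<xi>)))" by simp
    qed
  qed
qed

lemma vnorm_eq_Hsq:
  fixes f :: "real^'n \<Rightarrow> complex"
  assumes "f \<in> test_functions"
  shows "(vnorm (H_Rn s \<phi>) (regular_distribution f))\<^sup>2 = Hsq s \<phi> f"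
  unfolding vnorm_H_Rn_regular[OF assms \<phi>] Hsq_def[symmetric] using Hsq_nonneg by simp

lemma Hsq_cmult: "Hsq s \<phi> (\<lambda>x. c * f x) = (cmod c)\<^sup>2 * Hsq s \<phi> (f :: real^'n \<Rightarrow> complex)"
  unfolding Hsq_def sobolev_integrand_def fourier_cmult
  by (simp add: norm_mult power_mult_distrib mult_ac)

lemma Hsq_add_le:
  fixes f g :: "real^'n \<Rightarrow> complex"
  assumes f: "f \<in> test_functions" and g: "g \<in> test_functions" and "t > 0"
  shows "Hsq s \<phi> (\<lambda>x. f x + g x) \<le> (1 + t) * Hsq s \<phi> f + (1 + 1 / t) * Hsq s \<phi> g"
proof -
  have pt: "(cmod (a + b))\<^sup>2 \<le> (1 + t) * (cmod a)\<^sup>2 + (1 + 1 / t) * (cmod b)\<^sup>2" for a b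
  proof -
    have "(cmod (a + b))\<^sup>2 \<le> (cmod a + cmod b)\<^sup>2" by (intro power_mono norm_triangle_ineq) simp
    also have "\<dots> = (1 + t) * (cmod a)\<^sup>2 + (1 + 1 / t) * (cmod b)\<^sup>2 - (t * cmod a - cmod b)\<^sup>2 / t"
      using \<open>t > 0\<close> by (simp add: power2_eq_square field_simps)
    also have "\<dots> \<le> (1 + t) * (cmod a)\<^sup>2 + (1 + 1 / t) * (cmod b)\<^sup>2" using \<open>t > 0\<close> by simp
    finally show ?thesis .
  qed
  have "Hsq s \<phi> (\<lambda>x. f x + g x) \<le>
      (LINT \<xi>|lborel. (1 + t) * sobolev_integrand s \<phi> (fourier f) \<xi> + (1 + 1 / t) * sobolev_integrand s \<phi> (fourier g) \<xi>)"
    unfolding Hsq_def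
  proof (rule integral_mono)
    show "integrable lborel (sobolev_integrand s \<phi> (fourier (\<lambda>x. f x + g x)))"
      by (rule integrand_integrable[OF test_add[OF f g]])
    show "integrable lborel (\<lambda>\<xi>. (1 + t) * sobolev_integrand s \<phi> (fourier f) \<xi> + (1 + 1 / t) * sobolev_integrand s \<phi> (fourier g) \<xi>)"
      by (intro Bochner_Integration.integrable_add integrable_mult_right integrand_integrable f g)
    fix \<xi> :: "real^'n"
    let ?w = "bracket \<xi> powr (2 * s) * (\<phi> (bracket \<xi>))\<^sup>2"
    have "?w * (cmod (fourier f \<xi> + fourier g \<xi>))\<^sup>2 \<le>
        ?w * ((1 + t) * (cmod (fourier f \<xi>))\<^sup>2 + (1 + 1 / t) * (cmod (fourier g \<xi>))\<^sup>2)"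
      by (rule mult_left_mono[OF pt]) simp
    then show "sobolev_integrand s \<phi> (fourier (\<lambda>x. f x + g x)) \<xi> \<le>
        (1 + t) * sobolev_integrand s \<phi> (fourier f) \<xi> + (1 + 1 / t) * sobolev_integrand s \<phi> (fourier g) \<xi>"
      unfolding sobolev_integrand_def fourier_add[OF test_integrable[OF f] test_integrable[OF g]]
      by (simp add: distrib_left mult_ac)
  qed
  also have "\<dots> = (1 + t) * Hsq s \<phi> f + (1 + 1 / t) * Hsq s \<phi> g"
    unfolding Hsq_def using integrand_integrable[OF f] integrand_integrable[OF g] by simp
  finally show ?thesis .
qed

lemma Hsq_eq_0_imp:
  fixes f :: "real^'n \<Rightarrow> complex"
  assumes f: "f \<in> test_functions" and z: "Hsq s \<phi> f = 0"
  shows "f x = 0"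
proof -
  have "AE \<xi> in lborel. sobolev_integrand s \<phi> (fourier f) \<xi> = 0"
    using z integral_nonneg_eq_0_iff_AE[OF integrand_integrable[OF f]]
    unfolding Hsq_def by (simp add: sobolev_integrand_def)
  then have AE: "AE \<xi> in lborel. fourier f \<xi> = 0"
  proof (rule eventually_mono)
    fix \<xi> assume "sobolev_integrand s \<phi> (fourier f) \<xi> = 0"
    then show "fourier f \<xi> = 0"
      using phi_pos[of \<xi>] bracket_ge_1[of \<xi>] by (simp add: sobolev_integrand_def)
  qed
  obtain c where c: "\<And>f x. f \<in> test_functions \<Longrightarrow> f x = c * inv_fourier (fourier f) (x :: real^'n)"
    using fourier_inversion by blast
  have "inv_fourier (fourier f) x = (LINT \<xi>::real^'n|lborel. 0)"
    unfolding inv_fourier_def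
    by (rule integral_cong_AE) (use AE fourier_borel[OF f] in auto)
  then show ?thesis using c[OF f, of x] by simp
qed

text \<open>The link between the two norms: Fourier inversion bounds the derivatives of order at
  most q by this moment, and the Cauchy-Schwarz inequality bounds the moment by \<open>Hsq\<close>.
  Compactness is therefore proved for the moment.\<close>

definition fourier_moment :: "(real^'n \<Rightarrow> complex) \<Rightarrow> real" where
  "fourier_moment f = (LINT \<xi>|lborel. bracket \<xi> ^ q * cmod (fourier f \<xi>))"

lemma moment_integrand_integrable:
  fixes f :: "real^'n \<Rightarrow> complex"
  assumes f: "f \<in> test_functions"
  shows "integrable lborel (\<lambda>\<xi>. bracket \<xi> ^ q * cmod (fourier f \<xi>))"
proof (rule Bochner_Integration.integrable_bound[OF fourier_moment_integrable[OF f, of q]])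
  show "(\<lambda>\<xi>. bracket \<xi> ^ q * cmod (fourier f \<xi>)) \<in> borel_measurable lborel"
    using fourier_borel[OF f] by measurable
  show "AE \<xi> in lborel. norm (bracket \<xi> ^ q * cmod (fourier f \<xi>)) \<le> norm ((1 + norm \<xi>) ^ q * cmod (fourier f \<xi>))"
  proof (rule AE_I2)
    fix \<xi> :: "real^'n"
    have "bracket \<xi> ^ q * cmod (fourier f \<xi>) \<le> (1 + norm \<xi>) ^ q * cmod (fourier f \<xi>)"
      by (intro mult_right_mono bracket_pow_le) simp
    then show "norm (bracket \<xi> ^ q * cmod (fourier f \<xi>)) \<le> norm ((1 + norm \<xi>) ^ q * cmod (fourier f \<xi>))"
      using bracket_ge_1[of \<xi>] by simp
  qed
qed

lemma pderivs_le_moment: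
  obtains C where "C \<ge> 0" "\<And>(f :: real^'n \<Rightarrow> complex) is x. f \<in> test_functions \<Longrightarrow> length is \<le> q \<Longrightarrow>
    cmod (pderivs is f x) \<le> C * fourier_moment f"
proof -
  obtain c where c: "\<And>f x. f \<in> test_functions \<Longrightarrow> f x = c * inv_fourier (fourier f) (x :: real^'n)"
    using fourier_inversion by blast
  show ?thesis
  proof (rule that[of "cmod c"])
    fix f :: "real^'n \<Rightarrow> complex" and "is" :: "'n list" and x
    assume f: "f \<in> test_functions" and l: "length is \<le> q"
    let ?g = "fourier (pderivs is f)"
    have "cmod (inv_fourier ?g x) \<le> (LINT \<xi>|lborel. cmod (cis (x \<bullet> \<xi>) * ?g \<xi>))"
      unfolding inv_fourier_def by (rule integral_norm_bound)
    also have "\<dots> \<le> fourier_moment f" unfolding fourier_moment_def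
    proof (rule integral_mono)
      show "integrable lborel (\<lambda>\<xi>. cmod (cis (x \<bullet> \<xi>) * ?g \<xi>))"
        using integrable_norm[OF fourier_integrable[OF test_pderivs[OF f]]] by (simp add: norm_mult)
      show "integrable lborel (\<lambda>\<xi>. bracket \<xi> ^ q * cmod (fourier f \<xi>))" by (rule moment_integrand_integrable[OF f])
      fix \<xi> :: "real^'n"
      have "cmod (prod_list (map (\<lambda>i. \<i> * of_real (\<xi> $ i)) is)) \<le> norm \<xi> ^ length is"
        by (rule norm_prod_list_coords)
      also have "\<dots> \<le> bracket \<xi> ^ length is" by (intro power_mono norm_le_bracket) simp
      also have "\<dots> \<le> bracket \<xi> ^ q" using l bracket_ge_1 by (intro power_increasing) auto
      finally show "cmod (cis (x \<bullet> \<xi>) * ?g \<xi>) \<le> bracket \<xi> ^ q * cmod (fourier f \<xi>)"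
        by (simp add: norm_mult fourier_pderivs[OF f] mult_right_mono)
    qed
    finally have "cmod c * cmod (inv_fourier ?g x) \<le> cmod c * fourier_moment f" by (rule mult_left_mono) simp
    then show "cmod (pderivs is f x) \<le> cmod c * fourier_moment f"
      using c[OF test_pderivs[OF f], of "is" x] by (simp add: norm_mult)
  qed simp
qed

text \<open>The quotient of the squared moment weight, the bracket to the power 2q, by the Sobolev
  weight; its integrability is the analytic form of the integral condition.\<close>

definition inverse_weight :: "real^'n \<Rightarrow> real" where
  "inverse_weight \<xi> = 1 / (bracket \<xi> ^ CARD('n) * (\<phi> (bracket \<xi>))\<^sup>2)"

lemma inverse_weight_borel [measurable]: "inverse_weight \<in> borel_measurable borel"
  unfolding inverse_weight_def[abs_def] using phi_bracket_borel[OF \<phi>] by measurable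

lemma inverse_weight_nonneg: "0 \<le> inverse_weight \<xi>"
  unfolding inverse_weight_def using bracket_ge_1[of \<xi>] by simp

lemma inverse_weight_integrable:
  assumes sum: "summable (\<lambda>k. 1 / (\<phi> (2 ^ k))\<^sup>2)"
  shows "integrable lborel inverse_weight"
proof (rule integrableI_bounded)
  show "inverse_weight \<in> borel_measurable lborel" by simp
  obtain A where A: "A \<ge> 1" "\<And>k t. 2 ^ k \<le> t \<Longrightarrow> t \<le> 2 ^ Suc k \<Longrightarrow> (\<phi> (2 ^ k))\<^sup>2 \<le> A * (\<phi> t)\<^sup>2"
    using class_M_dyadic_comparison[OF \<phi>] by metis
  let ?V = "unit_ball_vol (real CARD('n)) * 2 ^ CARD('n)"
  have pw: "0 < (\<phi> (2 ^ k))\<^sup>2" for k using class_M_pos[OF \<phi>, of "2 ^ k"] by simp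
  have "(\<integral>\<^sup>+x. ennreal (norm (inverse_weight x)) \<partial>lborel) = (\<Sum>k. \<integral>\<^sup>+x. ennreal (norm (inverse_weight x)) * indicator (shell k) x \<partial>lborel)"
    by (rule nn_integral_shells) measurable
  also have "\<dots> \<le> (\<Sum>k. ennreal (?V * (A / ((2 ^ k) ^ CARD('n) * (\<phi> (2 ^ k))\<^sup>2) * (2 ^ k) ^ CARD('n))))"
  proof (intro suminf_le nn_integral_shell_le)
    fix k and x :: "real^'n" assume "x \<in> shell k"
    then have k: "2 ^ k \<le> bracket x" "bracket x \<le> 2 ^ Suc k" by (auto simp: shell_def)
    have "(2 ^ k) ^ CARD('n) * (\<phi> (2 ^ k))\<^sup>2 \<le> bracket x ^ CARD('n) * (A * (\<phi> (bracket x))\<^sup>2)"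
      using k A by (intro mult_mono power_mono A(2)) auto
    then have "inverse_weight x \<le> A / ((2 ^ k) ^ CARD('n) * (\<phi> (2 ^ k))\<^sup>2)"
      unfolding inverse_weight_def using pw[of k] phi_pos[of x] bracket_ge_1[of x] A(1) by (simp add: divide_simps mult_ac)
    then show "ennreal (norm (inverse_weight x)) \<le> ennreal (A / ((2 ^ k) ^ CARD('n) * (\<phi> (2 ^ k))\<^sup>2))"
      using inverse_weight_nonneg[of x] by (auto intro!: ennreal_leI)
  qed (use A(1) in auto)
  also have "\<dots> = (\<Sum>k. ennreal (?V * A * (1 / (\<phi> (2 ^ k))\<^sup>2)))"
    by (simp add: mult_ac)
  also have "\<dots> = ennreal (\<Sum>k. ?V * A * (1 / (\<phi> (2 ^ k))\<^sup>2))"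
    by (rule suminf_ennreal2) (use summable_mult[OF sum, of "?V * A"] A(1) in auto)
  also have "\<dots> < \<infinity>" by simp
  finally show "(\<integral>\<^sup>+x. ennreal (norm (inverse_weight x)) \<partial>lborel) < \<infinity>" .
qed

text \<open>The moment integrand is the product of the square roots of \<open>inverse_weight\<close>
  and of the Sobolev integrand. The indicator lets one estimate serve both the whole space and the
  high frequencies, where the first factor is small.\<close>

lemma moment_cauchy_schwarz:
  fixes f :: "real^'n \<Rightarrow> complex"
  assumes sum: "summable (\<lambda>k. 1 / (\<phi> (2 ^ k))\<^sup>2)" and f: "f \<in> test_functions" and A: "A \<in> sets borel"
  shows "(LINT \<xi>|lborel. indicator A \<xi> * (bracket \<xi> ^ q * cmod (fourier f \<xi>))) \<le>
    sqrt (LINT \<xi>|lborel. indicator A \<xi> * inverse_weight \<xi>) * sqrt (Hsq s \<phi> f)"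
proof -
  let ?a = "\<lambda>\<xi>. indicator A \<xi> * sqrt (inverse_weight \<xi>)"
  let ?b = "\<lambda>\<xi>. sqrt (sobolev_integrand s \<phi> (fourier f) \<xi>)"
  have a2: "(?a \<xi>)\<^sup>2 = indicator A \<xi> * inverse_weight \<xi>" for \<xi> using inverse_weight_nonneg[of \<xi>] by (auto simp: indicator_def)
  have b2: "(?b \<xi>)\<^sup>2 = sobolev_integrand s \<phi> (fourier f) \<xi>" for \<xi> by (simp add: sobolev_integrand_def)
  have eq: "\<bar>?a \<xi> * ?b \<xi>\<bar> = indicator A \<xi> * (bracket \<xi> ^ q * cmod (fourier f \<xi>))" for \<xi>
  proof -
    have br: "0 < bracket \<xi>" using bracket_ge_1[of \<xi>] by simp
    have "inverse_weight \<xi> * sobolev_integrand s \<phi> (fourier f) \<xi> = (bracket \<xi> ^ q * cmod (fourier f \<xi>))\<^sup>2"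
      unfolding inverse_weight_def integrand_eq using br phi_pos[of \<xi>]
      by (simp add: field_simps power_add power_mult power_even_eq power2_eq_square)
    then have "sqrt (inverse_weight \<xi>) * ?b \<xi> = bracket \<xi> ^ q * cmod (fourier f \<xi>)"
      using br by (simp add: real_sqrt_mult[symmetric])
    then show ?thesis using br by (auto simp: indicator_def mult.assoc)
  qed
  have ai: "integrable lborel (\<lambda>\<xi>. (?a \<xi>)\<^sup>2)"
    unfolding a2 using integrable_mult_indicator[OF _ inverse_weight_integrable[OF sum], of A] A by simp
  have bi: "integrable lborel (\<lambda>\<xi>. (?b \<xi>)\<^sup>2)"
    unfolding b2 by (rule integrand_integrable[OF f])
  have "?a \<in> borel_measurable lborel" using A by simp
  moreover have "?b \<in> borel_measurable lborel"
    using sobolev_integrand_borel[OF \<phi> fourier_borel[OF f]] by simp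
  ultimately show ?thesis
    using cauchy_schwarz_integral(2)[OF _ _ ai bi] unfolding eq a2 b2 Hsq_def by blast
qed

lemma moment_le_Hsq:
  fixes f :: "real^'n \<Rightarrow> complex"
  assumes sum: "summable (\<lambda>k. 1 / (\<phi> (2 ^ k))\<^sup>2)" and f: "f \<in> test_functions"
  shows "fourier_moment f \<le> sqrt (LINT \<xi>|lborel. inverse_weight \<xi>) * sqrt (Hsq s \<phi> f)"
  using moment_cauchy_schwarz[OF sum f, of UNIV] by (simp add: fourier_moment_def)

lemma pderivs_le_Hsq:
  assumes sum: "summable (\<lambda>k. 1 / (\<phi> (2 ^ k))\<^sup>2)"
  obtains C where "C \<ge> 0" "\<And>(f :: real^'n \<Rightarrow> complex) is x. f \<in> test_functions \<Longrightarrow> length is \<le> q \<Longrightarrow>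
    cmod (pderivs is f x) \<le> C * sqrt (Hsq s \<phi> f)"
proof -
  obtain C where C: "C \<ge> 0" "\<And>(f :: real^'n \<Rightarrow> complex) is x. f \<in> test_functions \<Longrightarrow> length is \<le> q \<Longrightarrow>
    cmod (pderivs is f x) \<le> C * fourier_moment f" using pderivs_le_moment by blast
  show ?thesis
  proof (rule that[of "C * sqrt (LINT \<xi>|lborel. inverse_weight \<xi>)"])
    show "0 \<le> C * sqrt (LINT \<xi>|lborel. inverse_weight \<xi>)"
      using C(1) by (intro mult_nonneg_nonneg real_sqrt_ge_zero integral_nonneg_AE AE_I2 inverse_weight_nonneg)
    fix f :: "real^'n \<Rightarrow> complex" and "is" :: "'n list" and x
    assume f: "f \<in> test_functions" and l: "length is \<le> q"
    show "cmod (pderivs is f x) \<le> C * sqrt (LINT \<xi>|lborel. inverse_weight \<xi>) * sqrt (Hsq s \<phi> f)"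
      using order_trans[OF C(2)[OF f l] mult_left_mono[OF moment_le_Hsq[OF sum f] C(1)]]
      by (simp add: mult.assoc)
  qed
qed

end

section \<open>Equicontinuity of transforms and compactness\<close>

lemma cis_lipschitz: "cmod (cis a - cis b) \<le> \<bar>a - b\<bar>"
proof -
  have "cmod (cis (a - b) - 1) \<le> \<bar>a - b\<bar>"
    using iexp_approx1[of "a - b" 0] by (simp add: cis_conv_exp)
  moreover have "cis a - cis b = cis b * (cis (a - b) - 1)" by (simp add: algebra_simps cis_mult)
  ultimately show ?thesis by (simp add: norm_mult)
qed

lemma integral_norm_le_ball:
  fixes f :: "real^'n::finite \<Rightarrow> complex"
  assumes f: "f \<in> test_functions" and supp: "\<And>x. norm x > R \<Longrightarrow> f x = 0" and S: "\<And>x. cmod (f x) \<le> S"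
  shows "(LINT x|lborel. cmod (f x)) \<le> S * measure lborel (cball 0 R :: (real^'n) set)"
proof -
  have S0: "0 \<le> S" using order_trans[OF norm_ge_zero S] .
  have fin: "emeasure lborel (cball 0 R :: (real^'n) set) < \<infinity>" by (rule emeasure_bounded_finite) simp
  have "(LINT x|lborel. cmod (f x)) \<le> (LINT x|lborel. S * indicator (cball (0::real^'n) R) x)"
  proof (rule integral_mono)
    show "integrable lborel (\<lambda>x. S * indicator (cball (0::real^'n) R) x)"
      by (intro integrable_mult_right integrable_real_indicator fin) simp
    show "cmod (f x) \<le> S * indicator (cball 0 R) x" for x
      using S[of x] supp[of x] by (cases "norm x \<le> R") auto
  qed (use integrable_norm[OF test_integrable[OF f]] in simp)
  also have "\<dots> = S * measure lborel (cball 0 R :: (real^'n) set)" by simp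
  finally show ?thesis .
qed

lemma fourier_lipschitz:
  fixes f :: "real^'n::finite \<Rightarrow> complex"
  assumes f: "f \<in> test_functions" and supp: "\<And>x. norm x > R \<Longrightarrow> f x = 0"
  shows "cmod (fourier f \<xi> - fourier f \<eta>) \<le> R * norm (\<xi> - \<eta>) * (LINT x|lborel. cmod (f x))"
proof -
  note i = integrable_character_mult[OF test_integrable[OF f]]
  have "fourier f \<xi> - fourier f \<eta> = (LINT x|lborel. cis (- (x \<bullet> \<xi>)) * f x - cis (- (x \<bullet> \<eta>)) * f x)"
    unfolding fourier_lborel[OF test_integrable[OF f]] by (rule Bochner_Integration.integral_diff[symmetric, OF i i])
  also have "cmod \<dots> \<le> (LINT x|lborel. cmod (cis (- (x \<bullet> \<xi>)) * f x - cis (- (x \<bullet> \<eta>)) * f x))"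
    by (rule integral_norm_bound)
  also have "\<dots> \<le> (LINT x|lborel. R * norm (\<xi> - \<eta>) * cmod (f x))"
  proof (rule integral_mono)
    show "integrable lborel (\<lambda>x. cmod (cis (- (x \<bullet> \<xi>)) * f x - cis (- (x \<bullet> \<eta>)) * f x))"
      by (intro integrable_norm Bochner_Integration.integrable_diff i)
    show "integrable lborel (\<lambda>x. R * norm (\<xi> - \<eta>) * cmod (f x))"
      using integrable_norm[OF test_integrable[OF f]] by simp
    fix x
    show "cmod (cis (- (x \<bullet> \<xi>)) * f x - cis (- (x \<bullet> \<eta>)) * f x) \<le> R * norm (\<xi> - \<eta>) * cmod (f x)"
    proof (cases "norm x > R")
      case False
      have "cmod (cis (- (x \<bullet> \<xi>)) - cis (- (x \<bullet> \<eta>))) \<le> \<bar>- (x \<bullet> \<xi>) - - (x \<bullet> \<eta>)\<bar>" by (rule cis_lipschitz)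
      also have "\<dots> = \<bar>x \<bullet> (\<xi> - \<eta>)\<bar>" by (simp add: inner_diff_right)
      also have "\<dots> \<le> norm x * norm (\<xi> - \<eta>)" by (rule Cauchy_Schwarz_ineq2)
      also have "\<dots> \<le> R * norm (\<xi> - \<eta>)" using False by (intro mult_right_mono) auto
      finally have "cmod ((cis (- (x \<bullet> \<xi>)) - cis (- (x \<bullet> \<eta>))) * f x) \<le> R * norm (\<xi> - \<eta>) * cmod (f x)"
        unfolding norm_mult by (rule mult_right_mono) simp
      then show ?thesis by (simp add: left_diff_distrib)
    qed (simp add: supp)
  qed
  finally show ?thesis by simp
qed

context weight
begin

lemma inverse_weight_tail:
  assumes sum: "summable (\<lambda>k. 1 / (\<phi> (2 ^ k))\<^sup>2)" and "\<epsilon> > 0"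
  obtains r where "r > 0" "(LINT \<xi>|lborel. indicator (- ball 0 r) \<xi> * inverse_weight \<xi>) < \<epsilon>"
proof -
  have "(\<lambda>n. LINT \<xi>|lborel. indicator (- ball 0 (real n)) \<xi> * inverse_weight \<xi>) \<longlonglongrightarrow> (LINT \<xi>::real^'n|lborel. 0)"
  proof (rule integral_dominated_convergence[where w=inverse_weight])
    show "integrable lborel inverse_weight" by (rule inverse_weight_integrable[OF sum])
    show "AE \<xi> in lborel. (\<lambda>n. indicator (- ball 0 (real n)) \<xi> * inverse_weight \<xi>) \<longlonglongrightarrow> 0"
    proof (rule AE_I2)
      fix \<xi> :: "real^'n"
      obtain N where N: "norm \<xi> < real N" using reals_Archimedean2 by blast
      show "(\<lambda>n. indicator (- ball 0 (real n)) \<xi> * inverse_weight \<xi>) \<longlonglongrightarrow> 0"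
        by (rule tendsto_eventually, unfold eventually_sequentially, rule exI[of _ N])
          (use N in \<open>auto simp: indicator_def\<close>)
    qed
    show "AE \<xi> in lborel. norm (indicator (- ball 0 (real n)) \<xi> * inverse_weight \<xi>) \<le> inverse_weight \<xi>" for n
      using inverse_weight_nonneg by (intro AE_I2) (auto simp: indicator_def)
  qed measurable
  then have "\<forall>\<^sub>F n in sequentially. (LINT \<xi>|lborel. indicator (- ball 0 (real n)) \<xi> * inverse_weight \<xi>) < \<epsilon>"
    using \<open>\<epsilon> > 0\<close> by (intro order_tendstoD(2)) auto
  then obtain N where "\<And>n. n \<ge> N \<Longrightarrow> (LINT \<xi>|lborel. indicator (- ball 0 (real n)) \<xi> * inverse_weight \<xi>) < \<epsilon>"
    by (auto simp: eventually_sequentially)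
  then show ?thesis using that[of "real (Suc N)"] by (metis le_SucI of_nat_0_less_iff order_refl zero_less_Suc)
qed

lemma Hsq_diff_le:
  fixes f g :: "real^'n \<Rightarrow> complex"
  assumes f: "f \<in> test_functions" and g: "g \<in> test_functions"
  shows "Hsq s \<phi> (\<lambda>x. f x - g x) \<le> 2 * Hsq s \<phi> f + 2 * Hsq s \<phi> g"
  using Hsq_add_le[OF f test_cmult[OF g, of "-1"], of 1] Hsq_cmult[of "-1" g] by simp

text \<open>The functions are uniformly bounded by the embedding inequality and have a common
  support, so their transforms are uniformly bounded and Lipschitz with one constant. A diagonal
  subsequence at a dense set of frequencies then converges everywhere, and the tail of
  \<open>inverse_weight\<close> takes care of infinity.\<close>

lemma test_sequence_compact:
  fixes f :: "nat \<Rightarrow> 'a \<Rightarrow> real^'n \<Rightarrow> complex"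
  assumes sum: "summable (\<lambda>k. 1 / (\<phi> (2 ^ k))\<^sup>2)" and fin: "finite A"
    and f: "\<And>i a. a \<in> A \<Longrightarrow> f i a \<in> test_functions"
    and supp: "\<And>i a x. a \<in> A \<Longrightarrow> norm x > R \<Longrightarrow> f i a x = 0"
    and B: "\<And>i a. a \<in> A \<Longrightarrow> Hsq s \<phi> (f i a) \<le> B"
  obtains \<sigma> :: "nat \<Rightarrow> nat" where "strict_mono \<sigma>" "\<And>a \<epsilon>. a \<in> A \<Longrightarrow> \<epsilon> > 0 \<Longrightarrow>
    \<exists>N. \<forall>i\<ge>N. \<forall>j\<ge>N. fourier_moment (\<lambda>x. f (\<sigma> i) a x - f (\<sigma> j) a x) < \<epsilon>"
proof -
  obtain C where C: "C \<ge> 0" "\<And>(f :: real^'n \<Rightarrow> complex) is x. f \<in> test_functions \<Longrightarrow> length is \<le> q \<Longrightarrow>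
    cmod (pderivs is f x) \<le> C * sqrt (Hsq s \<phi> f)" using pderivs_le_Hsq[OF sum] by blast
  \<comment> \<open>When \<open>A\<close> is empty nothing forces \<open>B\<close> to be
    nonnegative; the maximum makes its square root usable.\<close>
  define B0 where "B0 = max B 0"
  have B0: "B0 \<ge> 0" "\<And>i a. a \<in> A \<Longrightarrow> Hsq s \<phi> (f i a) \<le> B0"
    using B by (auto simp: B0_def le_max_iff_disj)
  define S where "S = C * sqrt B0"
  have S: "cmod (f i a x) \<le> S" if "a \<in> A" for i a x
  proof -
    have "cmod (f i a x) \<le> C * sqrt (Hsq s \<phi> (f i a))" using C(2)[OF f[OF that], of "[]"] by simp
    also have "\<dots> \<le> S" unfolding S_def using C(1) B0(2)[OF that] by (intro mult_left_mono) auto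
    finally show ?thesis .
  qed
  define R0 where "R0 = max R 0"
  have supp0: "f i a x = 0" if "a \<in> A" "norm x > R0" for i a x
    using supp[OF that(1), of x] that(2) by (simp add: R0_def)
  define I where "I = S * measure lborel (cball 0 R0 :: (real^'n) set)"
  have I: "(LINT x|lborel. cmod (f i a x)) \<le> I" if "a \<in> A" for i a
    unfolding I_def by (rule integral_norm_le_ball[OF f[OF that] supp0[OF that] S[OF that]])
  have fb: "cmod (fourier (f i a) \<xi>) \<le> I" if "a \<in> A" for i a \<xi>
    using norm_fourier_le[OF test_integrable[OF f[OF that]], of i \<xi>] I[OF that, of i] by linarith
  obtain D :: "(real^'n) set" where D: "countable D" "\<And>X. open X \<Longrightarrow> X \<noteq> {} \<Longrightarrow> \<exists>d\<in>D. d \<in> X"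
    using countable_dense_exists by metis
  \<comment> \<open>One subsequence has to serve all members of \<open>A\<close> and all dense
    frequencies simultaneously, so the diagonal argument runs over pairs.\<close>
  have "countable (A \<times> D)" using fin D(1) by (simp add: countable_finite)
  then obtain \<sigma> where \<sigma>: "strict_mono (\<sigma>::nat\<Rightarrow>nat)"
    "\<And>p. p \<in> A \<times> D \<Longrightarrow> \<exists>l. (\<lambda>n. fourier (f (\<sigma> n) (fst p)) (snd p)) \<longlonglongrightarrow> l"
  proof (rule function_convergent_subsequence[where f="\<lambda>n p. fourier (f n (fst p)) (snd p)" and M=I])
    show "norm (fourier (f n (fst p)) (snd p)) \<le> I" if "p \<in> A \<times> D" for n p
      using fb that by auto
  qed auto
  define F where "F n a = fourier (f (\<sigma> n) a)" for n a
  have lip: "cmod (F n a \<xi> - F n a \<eta>) \<le> R0 * norm (\<xi> - \<eta>) * I" if "a \<in> A" for n a \<xi> \<eta>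
  proof -
    have "cmod (F n a \<xi> - F n a \<eta>) \<le> R0 * norm (\<xi> - \<eta>) * (LINT x|lborel. cmod (f (\<sigma> n) a x))"
      unfolding F_def by (rule fourier_lipschitz[OF f[OF that] supp0[OF that]])
    also have "\<dots> \<le> R0 * norm (\<xi> - \<eta>) * I" by (intro mult_left_mono I that) (simp add: R0_def)
    finally show ?thesis .
  qed
  have "\<exists>l. (\<lambda>n. F n a \<xi>) \<longlonglongrightarrow> l" if a: "a \<in> A" for a \<xi>
  proof -
    have "Cauchy (\<lambda>n. F n a \<xi>)"
    proof (rule CauchyI)
      fix e :: real assume "e > 0"
      have I0: "I \<ge> 0" using order_trans[OF norm_ge_zero fb[OF a]] .
      have L0: "0 \<le> R0 * I" using I0 by (simp add: R0_def)
      \<comment> \<open>A frequency closer than \<open>d\<close> changes every transform by less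
        than e/3; the summand 1 covers a vanishing Lipschitz constant.\<close>
      define d where "d = e / (3 * (R0 * I + 1))"
      have "d > 0" using \<open>e > 0\<close> L0 by (simp add: d_def)
      then have "\<exists>\<eta>\<in>D. \<eta> \<in> ball \<xi> d" by (intro D(2)) auto
      then obtain \<eta> where \<eta>: "\<eta> \<in> D" "norm (\<xi> - \<eta>) < d" by (auto simp: dist_norm)
      have close: "cmod (F n a \<xi> - F n a \<eta>) < e / 3" for n
      proof -
        have "cmod (F n a \<xi> - F n a \<eta>) \<le> (R0 * I) * norm (\<xi> - \<eta>)" using lip[OF a] by (simp add: mult_ac)
        also have "\<dots> \<le> (R0 * I) * d" using \<eta>(2) L0 by (intro mult_left_mono) auto
        also have "\<dots> < (R0 * I + 1) * d" using \<open>d > 0\<close> by (intro mult_strict_right_mono) auto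
        also have "\<dots> = e / 3"
        proof -
          have "u \<noteq> 0 \<Longrightarrow> u * (e / (3 * u)) = e / 3" for u :: real by simp
          from this[of "R0 * I + 1"] show ?thesis unfolding d_def using L0 by linarith
        qed
        finally show ?thesis .
      qed
      obtain l where "(\<lambda>n. F n a \<eta>) \<longlonglongrightarrow> l" using \<sigma>(2)[of "(a, \<eta>)"] a \<eta>(1) by (auto simp: F_def)
      then have "Cauchy (\<lambda>n. F n a \<eta>)" by (rule LIMSEQ_imp_Cauchy)
      then obtain M where M: "\<And>m n. m \<ge> M \<Longrightarrow> n \<ge> M \<Longrightarrow> norm (F m a \<eta> - F n a \<eta>) < e / 3"
        using CauchyD[of "\<lambda>n. F n a \<eta>" "e / 3"] \<open>e > 0\<close> by auto
      show "\<exists>M. \<forall>m\<ge>M. \<forall>n\<ge>M. norm (F m a \<xi> - F n a \<xi>) < e"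
      proof (intro exI allI impI)
        fix m n assume mn: "M \<le> m" "M \<le> n"
        have "F m a \<xi> - F n a \<xi> = (F m a \<xi> - F m a \<eta>) + ((F m a \<eta> - F n a \<eta>) - (F n a \<xi> - F n a \<eta>))" by simp
        also have "norm \<dots> \<le> norm (F m a \<xi> - F m a \<eta>) + (norm (F m a \<eta> - F n a \<eta>) + norm (F n a \<xi> - F n a \<eta>))"
          by (intro order_trans[OF norm_triangle_ineq] add_left_mono norm_triangle_ineq4)
        also have "\<dots> < e" using close[of m] close[of n] M[OF mn] by linarith
        finally show "norm (F m a \<xi> - F n a \<xi>) < e" .
      qed
    qed
    then show ?thesis by (simp add: convergent_eq_Cauchy)
  qed
  then obtain g where g: "\<And>a \<xi>. a \<in> A \<Longrightarrow> (\<lambda>n. F n a \<xi>) \<longlonglongrightarrow> g a \<xi>" by metis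
  show ?thesis
  proof (rule that[OF \<sigma>(1)])
    fix a and \<epsilon> :: real assume a: "a \<in> A" and \<epsilon>: "\<epsilon> > 0"
    have Fm [measurable]: "F n a \<in> borel_measurable borel" for n
      unfolding F_def by (rule fourier_borel[OF f[OF a]])
    have gm [measurable]: "g a \<in> borel_measurable borel"
      by (rule borel_measurable_LIMSEQ_metric[OF Fm g[OF a]])
    have gb: "cmod (g a \<xi>) \<le> I" for \<xi>
      by (rule LIMSEQ_le_const2[OF tendsto_norm[OF g[OF a, of \<xi>]]]) (use fb[OF a] in \<open>auto simp: F_def\<close>)
    have Fb: "cmod (F n a \<xi>) \<le> I" for n \<xi> unfolding F_def by (rule fb[OF a])
    have I0: "I \<ge> 0" using order_trans[OF norm_ge_zero fb[OF a]] .
    \<comment> \<open>The squared norm of a difference is at most 4 \<open>B0\<close>, so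
      \<open>2 * sqrt B0\<close> bounds the norm; the summand 1 keeps \<open>K\<close> positive,
      since it is divided by.\<close>
    define K where "K = 2 * sqrt B0 + 1"
    have K: "K > 0" using B0(1) by (simp add: K_def add_nonneg_pos)
    have diff_t: "(\<lambda>x. f (\<sigma> i) a x - f (\<sigma> j) a x) \<in> test_functions" for i j
      by (intro test_diff f a)
    have HK: "sqrt (Hsq s \<phi> (\<lambda>x. f (\<sigma> i) a x - f (\<sigma> j) a x)) \<le> K" for i j
    proof -
      have "Hsq s \<phi> (\<lambda>x. f (\<sigma> i) a x - f (\<sigma> j) a x) \<le> 2 * Hsq s \<phi> (f (\<sigma> i) a) + 2 * Hsq s \<phi> (f (\<sigma> j) a)"
        by (intro Hsq_diff_le f a)
      also have "\<dots> \<le> 4 * B0" using B0(2)[OF a, of "\<sigma> i"] B0(2)[OF a, of "\<sigma> j"] by linarith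
      finally have "sqrt (Hsq s \<phi> (\<lambda>x. f (\<sigma> i) a x - f (\<sigma> j) a x)) \<le> sqrt (4 * B0)" by simp
      then show ?thesis by (simp add: K_def real_sqrt_mult)
    qed
    obtain r where r: "r > 0" "(LINT \<xi>|lborel. indicator (- ball 0 r) \<xi> * inverse_weight \<xi>) < (\<epsilon> / (3 * K))\<^sup>2"
      using inverse_weight_tail[OF sum, of "(\<epsilon> / (3 * K))\<^sup>2"] \<epsilon> K by auto
    have tail: "(LINT \<xi>|lborel. indicator (- ball 0 r) \<xi> * (bracket \<xi> ^ q * cmod (F i a \<xi> - F j a \<xi>))) \<le> \<epsilon> / 3" for i j
    proof -
      have "(LINT \<xi>|lborel. indicator (- ball 0 r) \<xi> * (bracket \<xi> ^ q * cmod (F i a \<xi> - F j a \<xi>)))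
        \<le> sqrt (LINT \<xi>|lborel. indicator (- ball 0 r) \<xi> * inverse_weight \<xi>) * sqrt (Hsq s \<phi> (\<lambda>x. f (\<sigma> i) a x - f (\<sigma> j) a x))"
        using moment_cauchy_schwarz[OF sum diff_t, of "- ball 0 r" i j]
        by (simp add: F_def fourier_diff[OF test_integrable[OF f[OF a]] test_integrable[OF f[OF a]]])
      also have "\<dots> \<le> (\<epsilon> / (3 * K)) * K"
      proof (rule mult_mono[OF _ HK])
        show "sqrt (LINT \<xi>|lborel. indicator (- ball 0 r) \<xi> * inverse_weight \<xi>) \<le> \<epsilon> / (3 * K)"
          using r(2) \<epsilon> K by (intro real_le_lsqrt) auto
      qed (use \<epsilon> K Hsq_nonneg in auto)
      also have "\<dots> = \<epsilon> / 3" using K by simp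
      finally show ?thesis .
    qed
    \<comment> \<open>The low frequencies are compared with the pointwise limit \<open>g\<close>.
      Bounded transforms on a ball of finite measure give an integrable majorant.\<close>
    let ?G = "\<lambda>n \<xi>. indicator (ball 0 r) \<xi> * (bracket \<xi> ^ q * cmod (F n a \<xi> - g a \<xi>))"
    have wint: "integrable lborel (\<lambda>\<xi>::real^'n. ((1 + r) ^ q * (2 * I)) * indicator (ball 0 r) \<xi>)"
      by (intro integrable_mult_right integrable_real_indicator emeasure_bounded_finite) auto
    have Gle: "norm (?G n \<xi>) \<le> ((1 + r) ^ q * (2 * I)) * indicator (ball 0 r) \<xi>" for n \<xi>
    proof (cases "\<xi> \<in> ball 0 r")
      case True
      have "cmod (F n a \<xi> - g a \<xi>) \<le> 2 * I" using norm_triangle_ineq4[of "F n a \<xi>" "g a \<xi>"] Fb[of n \<xi>] gb[of \<xi>] by linarith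
      moreover have "bracket \<xi> ^ q \<le> (1 + r) ^ q"
        using True bracket_le[of \<xi>] bracket_ge_1[of \<xi>] by (intro power_mono) auto
      ultimately have "bracket \<xi> ^ q * cmod (F n a \<xi> - g a \<xi>) \<le> (1 + r) ^ q * (2 * I)"
        using r(1) by (intro mult_mono) auto
      then show ?thesis using True bracket_ge_1[of \<xi>] by simp
    qed simp
    have cm: "(\<lambda>\<xi>. cmod (F n a \<xi> - g a \<xi>)) \<in> borel_measurable borel" for n
      using Fm[of n] gm by simp
    have Gm: "?G n \<in> borel_measurable lborel" for n
      by (intro borel_measurable_times borel_measurable_indicator borel_measurable_power)
        (simp_all add: cm bracket_borel)
    have Gi: "integrable lborel (?G n)" for n
    proof (rule Bochner_Integration.integrable_bound[OF wint])
      show "?G n \<in> borel_measurable lborel" by (rule Gm)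
      show "AE \<xi> in lborel. norm (?G n \<xi>) \<le> norm (((1 + r) ^ q * (2 * I)) * indicator (ball 0 r) \<xi>)"
        by (intro AE_I2 order_trans[OF Gle]) simp
    qed
    have "(\<lambda>n. LINT \<xi>|lborel. ?G n \<xi>) \<longlonglongrightarrow> (LINT \<xi>::real^'n|lborel. 0)"
    proof (rule integral_dominated_convergence[OF _ _ wint])
      show "AE \<xi> in lborel. (\<lambda>n. ?G n \<xi>) \<longlonglongrightarrow> 0"
      proof (rule AE_I2)
        fix \<xi> :: "real^'n"
        have "(\<lambda>n. ?G n \<xi>) \<longlonglongrightarrow> indicator (ball 0 r) \<xi> * (bracket \<xi> ^ q * cmod (g a \<xi> - g a \<xi>))"
          by (intro tendsto_intros g a)
        then show "(\<lambda>n. ?G n \<xi>) \<longlonglongrightarrow> 0" by simp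
      qed
      show "AE \<xi> in lborel. norm (?G n \<xi>) \<le> ((1 + r) ^ q * (2 * I)) * indicator (ball 0 r) \<xi>" for n
        using Gle by (intro AE_I2)
    qed (rule borel_measurable_const Gm)+
    then have "\<forall>\<^sub>F n in sequentially. (LINT \<xi>|lborel. ?G n \<xi>) < \<epsilon> / 3"
      using \<epsilon> by (intro order_tendstoD(2)) auto
    then obtain N where N: "\<And>n. n \<ge> N \<Longrightarrow> (LINT \<xi>|lborel. ?G n \<xi>) < \<epsilon> / 3"
      by (auto simp: eventually_sequentially)
    show "\<exists>N. \<forall>i\<ge>N. \<forall>j\<ge>N. fourier_moment (\<lambda>x. f (\<sigma> i) a x - f (\<sigma> j) a x) < \<epsilon>"
    proof (intro exI allI impI)
      fix i j assume ij: "N \<le> i" "N \<le> j"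
      have fe: "fourier (\<lambda>x. f (\<sigma> i) a x - f (\<sigma> j) a x) \<xi> = F i a \<xi> - F j a \<xi>" for \<xi>
        unfolding F_def by (rule fourier_diff[OF test_integrable[OF f[OF a]] test_integrable[OF f[OF a]]])
      have Mi: "integrable lborel (\<lambda>\<xi>. bracket \<xi> ^ q * cmod (F i a \<xi> - F j a \<xi>))"
        using moment_integrand_integrable[OF diff_t, of i j] by (simp add: fe)
      have Ti: "integrable lborel (\<lambda>\<xi>. indicator (- ball 0 r) \<xi> * (bracket \<xi> ^ q * cmod (F i a \<xi> - F j a \<xi>)))"
        using integrable_mult_indicator[OF _ Mi, of "- ball 0 r"] by simp
      have "fourier_moment (\<lambda>x. f (\<sigma> i) a x - f (\<sigma> j) a x) = (LINT \<xi>|lborel. bracket \<xi> ^ q * cmod (F i a \<xi> - F j a \<xi>))"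
        by (simp add: fourier_moment_def fe)
      \<comment> \<open>High frequencies plus two low-frequency errors, each contributing at most
        \<epsilon>/3.\<close>
      also have "\<dots> \<le> (LINT \<xi>|lborel. indicator (- ball 0 r) \<xi> * (bracket \<xi> ^ q * cmod (F i a \<xi> - F j a \<xi>)) + (?G i \<xi> + ?G j \<xi>))"
      proof (rule integral_mono[OF Mi])
        show "integrable lborel (\<lambda>\<xi>. indicator (- ball 0 r) \<xi> * (bracket \<xi> ^ q * cmod (F i a \<xi> - F j a \<xi>)) + (?G i \<xi> + ?G j \<xi>))"
          by (intro Bochner_Integration.integrable_add Ti Gi)
        fix \<xi> :: "real^'n"
        have "cmod (F i a \<xi> - F j a \<xi>) \<le> cmod (F i a \<xi> - g a \<xi>) + cmod (F j a \<xi> - g a \<xi>)"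
          using norm_triangle_ineq4[of "F i a \<xi> - g a \<xi>" "F j a \<xi> - g a \<xi>"] by simp
        then have "bracket \<xi> ^ q * cmod (F i a \<xi> - F j a \<xi>) \<le> bracket \<xi> ^ q * (cmod (F i a \<xi> - g a \<xi>) + cmod (F j a \<xi> - g a \<xi>))"
          using bracket_ge_1[of \<xi>] by (intro mult_left_mono) auto
        then show "bracket \<xi> ^ q * cmod (F i a \<xi> - F j a \<xi>) \<le>
            indicator (- ball 0 r) \<xi> * (bracket \<xi> ^ q * cmod (F i a \<xi> - F j a \<xi>)) + (?G i \<xi> + ?G j \<xi>)"
          by (cases "\<xi> \<in> ball 0 r") (auto simp: distrib_left)
      qed
      also have "\<dots> = (LINT \<xi>|lborel. indicator (- ball 0 r) \<xi> * (bracket \<xi> ^ q * cmod (F i a \<xi> - F j a \<xi>)))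
          + ((LINT \<xi>|lborel. ?G i \<xi>) + (LINT \<xi>|lborel. ?G j \<xi>))"
        using Ti Gi[of i] Gi[of j] by (simp only: Bochner_Integration.integral_add Bochner_Integration.integrable_add)
      also have "\<dots> < \<epsilon>" using tail[of i j] N[OF ij(1)] N[OF ij(2)] by linarith
      finally show "fourier_moment (\<lambda>x. f (\<sigma> i) a x - f (\<sigma> j) a x) < \<epsilon>" .
    qed
  qed
qed

text \<open>Fatou's lemma replaces the completeness of the weighted \<open>L\<^sup>2\<close> space.\<close>

lemma Hsq_Cauchy_null:
  fixes f :: "nat \<Rightarrow> real^'n \<Rightarrow> complex"
  assumes f: "\<And>i. f i \<in> test_functions" and supp: "\<And>i x. norm x > R \<Longrightarrow> f i x = 0"
    and null: "\<And>e. e > 0 \<Longrightarrow> \<exists>N. \<forall>i\<ge>N. \<forall>x. cmod (f i x) \<le> e"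
    and close: "\<And>j. j \<ge> N \<Longrightarrow> Hsq s \<phi> (\<lambda>x. f i x - f j x) \<le> \<epsilon>"
  shows "Hsq s \<phi> (f i) \<le> \<epsilon>"
proof -
  have lim: "(\<lambda>j. fourier (f j) \<xi>) \<longlonglongrightarrow> 0" for \<xi>
  proof (rule LIMSEQ_I)
    fix r :: real assume "r > 0"
    define m where "m = measure lborel (cball 0 R :: (real^'n) set) + 1"
    have m: "m > 0" by (simp add: m_def add_nonneg_pos)
    obtain N where N: "\<And>i x. i \<ge> N \<Longrightarrow> cmod (f i x) \<le> r / (2 * m)"
      using null[of "r / (2 * m)"] \<open>r > 0\<close> m by auto
    have "cmod (fourier (f j) \<xi>) < r" if "j \<ge> N" for j
    proof -
      have "cmod (fourier (f j) \<xi>) \<le> (LINT x|lborel. cmod (f j x))" by (rule norm_fourier_le[OF test_integrable[OF f]])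
      also have "\<dots> \<le> r / (2 * m) * measure lborel (cball 0 R :: (real^'n) set)"
        by (rule integral_norm_le_ball[OF f supp N[OF that]])
      also have "\<dots> \<le> r / (2 * m) * m" using \<open>r > 0\<close> m by (intro mult_left_mono) (auto simp: m_def)
      also have "\<dots> < r" using \<open>r > 0\<close> m by simp
      finally show ?thesis .
    qed
    then show "\<exists>no. \<forall>n\<ge>no. norm (fourier (f n) \<xi> - 0) < r" by auto
  qed
  define h where "h j \<xi> = sobolev_integrand s \<phi> (fourier (\<lambda>x. f i x - f j x)) \<xi>" for j and \<xi> :: "real^'n"
  have hi: "integrable lborel (h j)" for j unfolding h_def[abs_def] by (intro integrand_integrable test_diff f)
  have h0: "0 \<le> h j \<xi>" for j \<xi> by (simp add: h_def sobolev_integrand_def)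
  have hlim: "(\<lambda>j. h j \<xi>) \<longlonglongrightarrow> sobolev_integrand s \<phi> (fourier (f i)) \<xi>" for \<xi>
  proof -
    have "(\<lambda>j. bracket \<xi> powr (2 * s) * (\<phi> (bracket \<xi>))\<^sup>2 * (cmod (fourier (f i) \<xi> - fourier (f j) \<xi>))\<^sup>2)
      \<longlonglongrightarrow> bracket \<xi> powr (2 * s) * (\<phi> (bracket \<xi>))\<^sup>2 * (cmod (fourier (f i) \<xi> - 0))\<^sup>2"
      by (intro tendsto_mult tendsto_const tendsto_power tendsto_norm tendsto_diff lim)
    then show ?thesis
      by (simp add: h_def sobolev_integrand_def fourier_diff[OF test_integrable[OF f] test_integrable[OF f]])
  qed
  have \<epsilon>0: "0 \<le> \<epsilon>" using order_trans[OF Hsq_nonneg close[of N]] by simp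
  \<comment> \<open>With \<open>i\<close> fixed and \<open>j\<close> tending to infinity, the
    transforms of \<open>f j\<close> vanish pointwise, so the integrand for \<open>f i - f j\<close>
    tends to that for \<open>f i\<close>.\<close>
  have "(\<integral>\<^sup>+\<xi>. ennreal (sobolev_integrand s \<phi> (fourier (f i)) \<xi>) \<partial>lborel) = (\<integral>\<^sup>+\<xi>. liminf (\<lambda>j. ennreal (h j \<xi>)) \<partial>lborel)"
  proof (rule nn_integral_cong)
    fix \<xi> :: "real^'n"
    have "(\<lambda>j. ennreal (h j \<xi>)) \<longlonglongrightarrow> ennreal (sobolev_integrand s \<phi> (fourier (f i)) \<xi>)"
      by (intro tendsto_ennrealI hlim)
    then show "ennreal (sobolev_integrand s \<phi> (fourier (f i)) \<xi>) = liminf (\<lambda>j. ennreal (h j \<xi>))"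
      using lim_imp_Liminf[OF trivial_limit_sequentially] by metis
  qed
  also have "\<dots> \<le> liminf (\<lambda>j. \<integral>\<^sup>+\<xi>. ennreal (h j \<xi>) \<partial>lborel)"
    by (rule nn_integral_liminf) (use borel_measurable_integrable[OF hi] in measurable)
  also have "\<dots> \<le> ennreal \<epsilon>"
  proof (rule Liminf_le)
    show "\<forall>\<^sub>F j in sequentially. (\<integral>\<^sup>+\<xi>. ennreal (h j \<xi>) \<partial>lborel) \<le> ennreal \<epsilon>"
      unfolding eventually_sequentially
    proof (intro exI allI impI)
      fix j assume "N \<le> j"
      have "(\<integral>\<^sup>+\<xi>. ennreal (h j \<xi>) \<partial>lborel) = ennreal (Hsq s \<phi> (\<lambda>x. f i x - f j x))"
        unfolding Hsq_def h_def[symmetric] by (rule nn_integral_eq_integral[OF hi]) (simp add: h0)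
      then show "(\<integral>\<^sup>+\<xi>. ennreal (h j \<xi>) \<partial>lborel) \<le> ennreal \<epsilon>" using close[OF \<open>N \<le> j\<close>] by (simp add: ennreal_leI)
    qed
  qed simp
  finally have "(\<integral>\<^sup>+\<xi>. ennreal (sobolev_integrand s \<phi> (fourier (f i)) \<xi>) \<partial>lborel) \<le> ennreal \<epsilon>" .
  moreover have "(\<integral>\<^sup>+\<xi>. ennreal (sobolev_integrand s \<phi> (fourier (f i)) \<xi>) \<partial>lborel) = ennreal (Hsq s \<phi> (f i))"
    unfolding Hsq_def by (rule nn_integral_eq_integral[OF integrand_integrable[OF f]]) (simp add: sobolev_integrand_def)
  ultimately show ?thesis using \<epsilon>0 by simp
qed

end

section \<open>Completions and embeddings\<close>

text \<open>The injective linear map \<open>R\<close> into functions transports the vector space laws, so that none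
  of them has to be assumed.\<close>

locale cnorm_space =
  fixes X :: "'x cnspace" and R :: "'x \<Rightarrow> 'i \<Rightarrow> complex"
  assumes add_closed: "x \<in> vecs X \<Longrightarrow> y \<in> vecs X \<Longrightarrow> vadd X x y \<in> vecs X"
    and scale_closed: "x \<in> vecs X \<Longrightarrow> vscale X c x \<in> vecs X"
    and R_add: "x \<in> vecs X \<Longrightarrow> y \<in> vecs X \<Longrightarrow> R (vadd X x y) i = R x i + R y i"
    and R_scale: "x \<in> vecs X \<Longrightarrow> R (vscale X c x) i = c * R x i"
    and R_inj: "x \<in> vecs X \<Longrightarrow> y \<in> vecs X \<Longrightarrow> (\<And>i. R x i = R y i) \<Longrightarrow> x = y"
    and norm_triangle: "x \<in> vecs X \<Longrightarrow> y \<in> vecs X \<Longrightarrow> vnorm X (vadd X x y) \<le> vnorm X x + vnorm X y"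
    and norm_scale: "x \<in> vecs X \<Longrightarrow> vnorm X (vscale X c x) = cmod c * vnorm X x"
    and norm_0: "x \<in> vecs X \<Longrightarrow> vnorm X x = 0 \<Longrightarrow> R x i = 0"
begin

abbreviation "sub x y \<equiv> vadd X x (vscale X (- 1) y)"

lemma sub_closed: "x \<in> vecs X \<Longrightarrow> y \<in> vecs X \<Longrightarrow> sub x y \<in> vecs X"
  by (intro add_closed scale_closed)

lemma R_sub: "x \<in> vecs X \<Longrightarrow> y \<in> vecs X \<Longrightarrow> R (sub x y) i = R x i - R y i"
  by (simp add: R_add R_scale scale_closed)

lemma ndist_eq: "x \<in> vecs X \<Longrightarrow> y \<in> vecs X \<Longrightarrow> ndist X x y = vnorm X (sub x y)"
  by (simp add: ndist_def)

text \<open>The record has no zero vector. A vector with vanishing image under \<open>R\<close>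
  equals its own multiple by the scalar 0, so homogeneity forces norm 0.\<close>

lemma R_0_imp_norm_0:
  assumes "x \<in> vecs X" "\<And>i. R x i = 0"
  shows "vnorm X x = 0"
proof -
  have "x = vscale X 0 x" by (rule R_inj) (auto simp: assms scale_closed R_scale)
  then have "vnorm X x = vnorm X (vscale X 0 x)" by (rule arg_cong)
  then show ?thesis by (simp add: norm_scale assms(1))
qed

lemma norm_nonneg: "x \<in> vecs X \<Longrightarrow> 0 \<le> vnorm X x"
proof -
  assume x: "x \<in> vecs X"
  have "vnorm X (sub x x) = 0" by (rule R_0_imp_norm_0) (auto simp: x R_sub sub_closed)
  moreover have "vnorm X (sub x x) \<le> vnorm X x + vnorm X x"
    using norm_triangle[OF x scale_closed[OF x, of "-1"]] by (simp add: norm_scale x)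
  ultimately show ?thesis by simp
qed

lemma norm_sub_commute:
  assumes "x \<in> vecs X" "y \<in> vecs X"
  shows "vnorm X (sub x y) = vnorm X (sub y x)"
proof -
  have "sub x y = vscale X (- 1) (sub y x)"
    by (rule R_inj) (auto simp: assms sub_closed scale_closed R_sub R_scale)
  then show ?thesis by (simp add: norm_scale assms sub_closed)
qed

lemma metric: "Metric_space (vecs X) (ndist X)"
proof
  show "0 \<le> ndist X x y" for x y by (simp add: ndist_def norm_nonneg sub_closed)
  show "ndist X x y = ndist X y x" for x y by (simp add: ndist_def norm_sub_commute)
  show "ndist X x y = 0 \<longleftrightarrow> x = y" if "x \<in> vecs X" "y \<in> vecs X" for x y
  proof
    assume "ndist X x y = 0"
    then have "R (sub x y) i = 0" for i using that by (intro norm_0) (auto simp: ndist_eq sub_closed)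
    then have "R x i = R y i" for i using that by (simp add: R_sub)
    then show "x = y" using that by (intro R_inj)
  next
    assume "x = y"
    then show "ndist X x y = 0" using that by (simp add: ndist_eq R_0_imp_norm_0 R_sub sub_closed)
  qed
  show "ndist X x z \<le> ndist X x y + ndist X y z" if "x \<in> vecs X" "y \<in> vecs X" "z \<in> vecs X" for x y z
  proof -
    have "sub x z = vadd X (sub x y) (sub y z)"
      by (rule R_inj) (auto simp: that sub_closed add_closed R_sub R_add)
    then show ?thesis using that norm_triangle[OF sub_closed sub_closed] by (simp add: ndist_eq)
  qed
qed

sublocale M: Metric_space "vecs X" "ndist X" by (rule metric)

lemma norm_diff_le_ndist:
  assumes "x \<in> vecs X" "y \<in> vecs X"
  shows "\<bar>vnorm X x - vnorm X y\<bar> \<le> ndist X x y"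
proof -
  have *: "vnorm X u \<le> ndist X u v + vnorm X v" if "u \<in> vecs X" "v \<in> vecs X" for u v
  proof -
    have "u = vadd X (sub u v) v"
      by (rule R_inj) (auto simp: that sub_closed add_closed R_sub R_add)
    then have "vnorm X u = vnorm X (vadd X (sub u v) v)" by (rule arg_cong)
    then show ?thesis using norm_triangle[OF sub_closed[OF that] that(2)] by (simp add: ndist_eq that)
  qed
  show ?thesis using *[OF assms] *[OF assms(2,1)] M.commute[of x y] by simp
qed

lemma ndist_add_le:
  assumes "x \<in> vecs X" "y \<in> vecs X" "x' \<in> vecs X" "y' \<in> vecs X"
  shows "ndist X (vadd X x y) (vadd X x' y') \<le> ndist X x x' + ndist X y y'"
proof -
  have "sub (vadd X x y) (vadd X x' y') = vadd X (sub x x') (sub y y')"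
    by (rule R_inj) (auto simp: assms sub_closed add_closed R_sub R_add)
  then show ?thesis using assms norm_triangle[OF sub_closed sub_closed] by (simp add: ndist_eq add_closed)
qed

lemma ndist_scale:
  assumes "x \<in> vecs X" "y \<in> vecs X"
  shows "ndist X (vscale X c x) (vscale X c y) = cmod c * ndist X x y"
proof -
  have "sub (vscale X c x) (vscale X c y) = vscale X c (sub x y)"
    by (rule R_inj) (auto simp: assms sub_closed scale_closed R_sub R_scale algebra_simps)
  then show ?thesis by (simp add: assms ndist_eq scale_closed norm_scale sub_closed)
qed

lemma cauchy_iff: "a \<in> cauchy_seqs X \<longleftrightarrow> (\<forall>i. a i \<in> vecs X) \<and>
    (\<forall>e>0. \<exists>N. \<forall>i\<ge>N. \<forall>j\<ge>N. ndist X (a i) (a j) < e)"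
  by (simp add: cauchy_seqs_def M.MCauchy_def image_subset_iff)

lemma cauchy_in: "a \<in> cauchy_seqs X \<Longrightarrow> a i \<in> vecs X"
  by (simp add: cauchy_iff)

lemma cauchyD:
  assumes "a \<in> cauchy_seqs X" "e > 0"
  obtains N where "\<And>i j. i \<ge> N \<Longrightarrow> j \<ge> N \<Longrightarrow> ndist X (a i) (a j) < e"
proof -
  have "\<exists>N. \<forall>i\<ge>N. \<forall>j\<ge>N. ndist X (a i) (a j) < e" using assms by (simp add: cauchy_iff)
  then show ?thesis using that by auto
qed

lemma cauchy_const: "x \<in> vecs X \<Longrightarrow> (\<lambda>i. x) \<in> cauchy_seqs X"
  by (simp add: cauchy_iff)

lemma cauchy_add:
  assumes "a \<in> cauchy_seqs X" "b \<in> cauchy_seqs X"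
  shows "(\<lambda>i. vadd X (a i) (b i)) \<in> cauchy_seqs X"
  unfolding cauchy_iff
proof (intro conjI allI impI)
  show "vadd X (a i) (b i) \<in> vecs X" for i using assms by (intro add_closed cauchy_in)
  fix e :: real assume "e > 0"
  then have e2: "e / 2 > 0" by simp
  obtain N where N: "\<And>i j. i \<ge> N \<Longrightarrow> j \<ge> N \<Longrightarrow> ndist X (a i) (a j) < e / 2" using cauchyD[OF assms(1) e2] by blast
  obtain M where M: "\<And>i j. i \<ge> M \<Longrightarrow> j \<ge> M \<Longrightarrow> ndist X (b i) (b j) < e / 2" using cauchyD[OF assms(2) e2] by blast
  show "\<exists>N. \<forall>i\<ge>N. \<forall>j\<ge>N. ndist X (vadd X (a i) (b i)) (vadd X (a j) (b j)) < e"
  proof (intro exI[of _ "max N M"] allI impI)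
    fix i j assume "max N M \<le> i" "max N M \<le> j"
    then have "ndist X (a i) (a j) < e / 2" "ndist X (b i) (b j) < e / 2" using N M by auto
    then show "ndist X (vadd X (a i) (b i)) (vadd X (a j) (b j)) < e"
      using ndist_add_le[of "a i" "b i" "a j" "b j"] assms by (simp add: cauchy_in)
  qed
qed

lemma cauchy_scale:
  assumes "a \<in> cauchy_seqs X"
  shows "(\<lambda>i. vscale X c (a i)) \<in> cauchy_seqs X"
  unfolding cauchy_iff
proof (intro conjI allI impI)
  show "vscale X c (a i) \<in> vecs X" for i using assms by (intro scale_closed cauchy_in)
  fix e :: real assume "e > 0"
  then have e2: "e / (cmod c + 1) > 0" by (simp add: add_nonneg_pos)
  obtain N where N: "\<And>i j. i \<ge> N \<Longrightarrow> j \<ge> N \<Longrightarrow> ndist X (a i) (a j) < e / (cmod c + 1)" using cauchyD[OF assms e2] by blast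
  show "\<exists>N. \<forall>i\<ge>N. \<forall>j\<ge>N. ndist X (vscale X c (a i)) (vscale X c (a j)) < e"
  proof (intro exI[of _ N] allI impI)
    fix i j assume "N \<le> i" "N \<le> j"
    then have "ndist X (a i) (a j) < e / (cmod c + 1)" using N by auto
    then have "(cmod c + 1) * ndist X (a i) (a j) < e" by (simp add: pos_less_divide_eq add_nonneg_pos mult.commute)
    moreover have "cmod c * ndist X (a i) (a j) \<le> (cmod c + 1) * ndist X (a i) (a j)"
      by (intro mult_right_mono) auto
    ultimately show "ndist X (vscale X c (a i)) (vscale X c (a j)) < e"
      using assms by (simp add: ndist_scale cauchy_in)
  qed
qed

lemma coterminal_iff: "(a, b) \<in> coterminal X \<longleftrightarrow>
    a \<in> cauchy_seqs X \<and> b \<in> cauchy_seqs X \<and> (\<lambda>i. ndist X (a i) (b i)) \<longlonglongrightarrow> 0"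
  by (simp add: coterminal_def)

lemma equiv_coterminal: "equiv (cauchy_seqs X) (coterminal X)"
proof (rule equivI)
  show "coterminal X \<subseteq> cauchy_seqs X \<times> cauchy_seqs X" by (auto simp: coterminal_iff)
  show "refl_on (cauchy_seqs X) (coterminal X)"
    by (rule refl_onI) (auto simp: coterminal_iff cauchy_in)
  show "sym (coterminal X)" by (rule symI) (auto simp: coterminal_iff M.commute)
  show "trans (coterminal X)"
  proof (rule transI)
    fix a b c assume *: "(a, b) \<in> coterminal X" "(b, c) \<in> coterminal X"
    then have lim: "(\<lambda>i. ndist X (a i) (b i) + ndist X (b i) (c i)) \<longlonglongrightarrow> 0"
      using tendsto_add[of "\<lambda>i. ndist X (a i) (b i)" 0 sequentially "\<lambda>i. ndist X (b i) (c i)" 0]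
      by (simp add: coterminal_iff)
    have "(\<lambda>i. ndist X (a i) (c i)) \<longlonglongrightarrow> 0"
      by (rule Lim_null_comparison[OF _ lim])
        (use * in \<open>auto simp: coterminal_iff cauchy_in intro!: always_eventually M.triangle\<close>)
    then show "(a, c) \<in> coterminal X" using * by (simp add: coterminal_iff)
  qed
qed

abbreviation "cls a \<equiv> coterminal X `` {a}"

lemma cls_eq_iff:
  assumes "a \<in> cauchy_seqs X" "b \<in> cauchy_seqs X"
  shows "cls a = cls b \<longleftrightarrow> (\<lambda>i. ndist X (a i) (b i)) \<longlonglongrightarrow> 0"
  using eq_equiv_class_iff[OF equiv_coterminal assms] assms by (simp add: coterminal_iff)

lemma vecs_completion: "vecs (completion X) = {cls a | a. a \<in> cauchy_seqs X}"
  by (auto simp: completion_def quotient_def)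

lemma cls_mem: "a \<in> cauchy_seqs X \<Longrightarrow> a \<in> cls a"
  by (simp add: coterminal_iff cauchy_in)

text \<open>The definition takes a union over all representatives. All classes in this union
  coincide, because addition is Lipschitz in both arguments, and so the union is a single
  class.\<close>

lemma vadd_completion:
  assumes "a \<in> cauchy_seqs X" "b \<in> cauchy_seqs X"
  shows "vadd (completion X) (cls a) (cls b) = cls (\<lambda>i. vadd X (a i) (b i))"
proof -
  have "cls (\<lambda>i. vadd X (a' i) (b' i)) = cls (\<lambda>i. vadd X (a i) (b i))" if "a' \<in> cls a" "b' \<in> cls b" for a' b'
  proof -
    have *: "a' \<in> cauchy_seqs X" "b' \<in> cauchy_seqs X" "(\<lambda>i. ndist X (a i) (a' i)) \<longlonglongrightarrow> 0" "(\<lambda>i. ndist X (b i) (b' i)) \<longlonglongrightarrow> 0"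
      using that by (auto simp: coterminal_iff)
    have lim: "(\<lambda>i. ndist X (a i) (a' i) + ndist X (b i) (b' i)) \<longlonglongrightarrow> 0"
      using tendsto_add[OF *(3,4)] by simp
    have "(\<lambda>i. ndist X (vadd X (a' i) (b' i)) (vadd X (a i) (b i))) \<longlonglongrightarrow> 0"
    proof (rule Lim_null_comparison[OF _ lim])
      show "\<forall>\<^sub>F i in sequentially. norm (ndist X (vadd X (a' i) (b' i)) (vadd X (a i) (b i))) \<le> ndist X (a i) (a' i) + ndist X (b i) (b' i)"
      proof (intro always_eventually allI)
        fix i
        have "ndist X (vadd X (a i) (b i)) (vadd X (a' i) (b' i)) \<le> ndist X (a i) (a' i) + ndist X (b i) (b' i)"
          by (intro ndist_add_le cauchy_in assms *)
        then show "norm (ndist X (vadd X (a' i) (b' i)) (vadd X (a i) (b i))) \<le> ndist X (a i) (a' i) + ndist X (b i) (b' i)"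
          using M.commute[of "vadd X (a' i) (b' i)" "vadd X (a i) (b i)"] by simp
      qed
    qed
    then show ?thesis by (simp add: cls_eq_iff cauchy_add * assms)
  qed
  then have "(\<Union>a'\<in>cls a. \<Union>b'\<in>cls b. cls (\<lambda>i. vadd X (a' i) (b' i))) = (\<Union>a'\<in>cls a. \<Union>b'\<in>cls b. cls (\<lambda>i. vadd X (a i) (b i)))"
    by (intro SUP_cong refl)
  also have "\<dots> = cls (\<lambda>i. vadd X (a i) (b i))" using cls_mem[OF assms(1)] cls_mem[OF assms(2)] by blast
  finally show ?thesis by (simp add: completion_def)
qed

lemma vscale_completion:
  assumes "a \<in> cauchy_seqs X"
  shows "vscale (completion X) c (cls a) = cls (\<lambda>i. vscale X c (a i))"
proof -
  have "cls (\<lambda>i. vscale X c (a' i)) = cls (\<lambda>i. vscale X c (a i))" if "a' \<in> cls a" for a'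
  proof -
    have *: "a' \<in> cauchy_seqs X" "(\<lambda>i. ndist X (a i) (a' i)) \<longlonglongrightarrow> 0"
      using that by (auto simp: coterminal_iff)
    have "(\<lambda>i. ndist X (vscale X c (a' i)) (vscale X c (a i))) \<longlonglongrightarrow> 0"
    proof -
      have "ndist X (vscale X c (a' i)) (vscale X c (a i)) = cmod c * ndist X (a i) (a' i)" for i
        using M.commute[of "a i" "a' i"] by (simp add: ndist_scale cauchy_in * assms)
      then show ?thesis using tendsto_mult_right_zero[OF *(2), of "cmod c"] by simp
    qed
    then show ?thesis by (simp add: cls_eq_iff cauchy_scale * assms)
  qed
  then have "(\<Union>a'\<in>cls a. cls (\<lambda>i. vscale X c (a' i))) = (\<Union>a'\<in>cls a. cls (\<lambda>i. vscale X c (a i)))"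
    by (intro SUP_cong refl)
  also have "\<dots> = cls (\<lambda>i. vscale X c (a i))" using cls_mem[OF assms(1)] by blast
  finally show ?thesis by (simp add: completion_def)
qed

lemma norm_cauchy_convergent:
  assumes "a \<in> cauchy_seqs X"
  shows "convergent (\<lambda>i. vnorm X (a i))"
proof (rule Cauchy_convergent, rule CauchyI)
  fix e :: real assume "e > 0"
  obtain N where N: "\<And>i j. i \<ge> N \<Longrightarrow> j \<ge> N \<Longrightarrow> ndist X (a i) (a j) < e" using cauchyD[OF assms \<open>e > 0\<close>] by blast
  show "\<exists>M. \<forall>m\<ge>M. \<forall>n\<ge>M. norm (vnorm X (a m) - vnorm X (a n)) < e"
    using N norm_diff_le_ndist[OF cauchy_in[OF assms] cauchy_in[OF assms]]
    by (metis le_less_trans real_norm_def)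
qed

text \<open>The norm on the completion is computed from a chosen representative; a coterminal
  sequence has the same limit of norms, so any representative may be used.\<close>

lemma norm_completion:
  assumes "a \<in> cauchy_seqs X"
  shows "(\<lambda>i. vnorm X (a i)) \<longlonglongrightarrow> vnorm (completion X) (cls a)"
proof -
  define b where "b = (SOME b. b \<in> cls a)"
  have "b \<in> cls a" unfolding b_def by (rule someI[of _ a]) (rule cls_mem[OF assms])
  then have b: "b \<in> cauchy_seqs X" "(\<lambda>i. ndist X (a i) (b i)) \<longlonglongrightarrow> 0" by (auto simp: coterminal_iff)
  have "(\<lambda>i. vnorm X (a i) - vnorm X (b i)) \<longlonglongrightarrow> 0"
    by (rule Lim_null_comparison[OF _ b(2)])
      (auto intro!: always_eventually norm_diff_le_ndist cauchy_in assms b)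
  moreover have "(\<lambda>i. vnorm X (b i)) \<longlonglongrightarrow> lim (\<lambda>i. vnorm X (b i))"
    using norm_cauchy_convergent[OF b(1)] by (simp add: convergent_LIMSEQ_iff)
  ultimately have "(\<lambda>i. (vnorm X (a i) - vnorm X (b i)) + vnorm X (b i)) \<longlonglongrightarrow> 0 + lim (\<lambda>i. vnorm X (b i))"
    by (rule tendsto_add)
  then show ?thesis by (simp add: completion_def b_def)
qed

lemma norm_to_completion: "x \<in> vecs X \<Longrightarrow> vnorm (completion X) (to_completion X x) = vnorm X x"
  unfolding to_completion_def using LIMSEQ_unique[OF norm_completion[OF cauchy_const] tendsto_const] by blast

lemma to_completion_in: "x \<in> vecs X \<Longrightarrow> to_completion X x \<in> vecs (completion X)"
  unfolding to_completion_def vecs_completion using cauchy_const by blast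

end

section \<open>Extending the identity to the completion\<close>

locale cnorm_embedding = X: cnorm_space X R + Y: cnorm_space Y R
  for X Y :: "'x cnspace" and R :: "'x \<Rightarrow> 'i \<Rightarrow> complex" +
  assumes subset: "vecs X \<subseteq> vecs Y" and vadd_eq: "vadd Y = vadd X" and vscale_eq: "vscale Y = vscale X"
begin

definition extends_identity :: "((nat \<Rightarrow> 'x) set \<Rightarrow> 'x) \<Rightarrow> bool" where
  "extends_identity T \<longleftrightarrow> T \<in> extensional (vecs (completion X)) \<and>
     continuous_embedding (completion X) Y T \<and> (\<forall>u\<in>vecs X. T (to_completion X u) = u)"

text \<open>\<open>to_completion\<close> preserves norms, so the bound for \<open>T\<close> descends
  to the original vectors. This inequality is all that the converse direction takes from the
  embedding.\<close>

lemma extends_identity_bound: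
  assumes "extends_identity T"
  obtains C where "\<And>u. u \<in> vecs X \<Longrightarrow> vnorm Y u \<le> C * vnorm X u"
proof -
  obtain C where "\<And>x. x \<in> vecs (completion X) \<Longrightarrow> vnorm Y (T x) \<le> C * vnorm (completion X) x"
    using assms by (auto simp: extends_identity_def continuous_embedding_def)
  then have "vnorm Y u \<le> C * vnorm X u" if "u \<in> vecs X" for u
    using that assms X.to_completion_in[OF that] X.norm_to_completion[OF that]
    by (metis extends_identity_def)
  then show ?thesis using that by blast
qed

abbreviation ylim :: "(nat \<Rightarrow> 'x) \<Rightarrow> 'x \<Rightarrow> bool" where
  "ylim a u \<equiv> u \<in> vecs Y \<and> (\<lambda>i. ndist Y (a i) u) \<longlonglongrightarrow> 0"

lemma ylim_unique:
  assumes "\<And>i. a i \<in> vecs Y" "ylim a u" "ylim a v"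
  shows "u = v"
proof -
  have "(\<lambda>i. ndist Y (a i) u + ndist Y (a i) v) \<longlonglongrightarrow> 0"
    using tendsto_add[of "\<lambda>i. ndist Y (a i) u" 0 sequentially "\<lambda>i. ndist Y (a i) v" 0] assms by simp
  then have "(\<lambda>i. ndist Y u v) \<longlonglongrightarrow> 0"
  proof (rule Lim_null_comparison[rotated])
    show "\<forall>\<^sub>F i in sequentially. norm (ndist Y u v) \<le> ndist Y (a i) u + ndist Y (a i) v"
    proof (intro always_eventually allI)
      fix i
      have "ndist Y u v \<le> ndist Y u (a i) + ndist Y (a i) v"
        by (rule Y.M.triangle) (use assms in auto)
      then show "norm (ndist Y u v) \<le> ndist Y (a i) u + ndist Y (a i) v"
        using Y.M.commute[of u "a i"] by simp
    qed
  qed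
  then have "ndist Y u v = 0" by (simp add: LIMSEQ_const_iff)
  then show ?thesis using assms by simp
qed

text \<open>The difference T(cls a) - a_i is the image of the class of the sequence (a_j - a_i)_j,
  whose norm is the limit of the distances of a_j and a_i. Hence every extension is given by limits
  in \<open>Y\<close>, which yields uniqueness and also reduces compactness to sequences in
  \<open>X\<close>.\<close>

lemma extends_identity_ylim:
  assumes T: "extends_identity T" and a: "a \<in> cauchy_seqs X"
  shows "ylim a (T (X.cls a))"
proof -
  obtain C where C: "\<And>x. x \<in> vecs (completion X) \<Longrightarrow> vnorm Y (T x) \<le> C * vnorm (completion X) x"
    using T by (auto simp: extends_identity_def continuous_embedding_def)
  have lin: "linear_operator (completion X) Y T"
    using T by (simp add: extends_identity_def continuous_embedding_def)
  have clsin: "X.cls b \<in> vecs (completion X)" if "b \<in> cauchy_seqs X" for b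
    using that by (auto simp: X.vecs_completion)
  have TY: "T (X.cls a) \<in> vecs Y" using lin clsin[OF a] by (auto simp: linear_operator_def)
  have aX: "a i \<in> vecs X" for i by (rule X.cauchy_in[OF a])
  have aY: "a i \<in> vecs Y" for i using aX subset by blast
  \<comment> \<open>The sign of \<open>C\<close> is unknown; a nonnegative constant is needed to
    multiply inequalities.\<close>
  define D where "D = max C 0"
  have D0: "D \<ge> 0" by (simp add: D_def)
  have bnd: "ndist Y (T (X.cls a)) (a i) \<le> D * lim (\<lambda>j. ndist X (a j) (a i))"
    and cv: "(\<lambda>j. ndist X (a j) (a i)) \<longlonglongrightarrow> lim (\<lambda>j. ndist X (a j) (a i))" for i
  proof -
    let ?c = "\<lambda>j. vadd X (a j) (vscale X (- 1) (a i))"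
    have sc: "(\<lambda>j. vscale X (- 1) (a i)) \<in> cauchy_seqs X" by (intro X.cauchy_const X.scale_closed aX)
    have c: "?c \<in> cauchy_seqs X" by (rule X.cauchy_add[OF a sc])
    have "T (X.cls ?c) = vadd Y (T (X.cls a)) (vscale Y (- 1) (T (X.cls (\<lambda>j. a i))))"
      using lin clsin[OF a] clsin[OF sc] clsin[OF X.cauchy_const[OF aX]]
      by (simp add: linear_operator_def X.vadd_completion[OF a sc, symmetric]
          X.vscale_completion[OF X.cauchy_const[OF aX], symmetric])
    also have "T (X.cls (\<lambda>j. a i)) = a i"
      using T aX by (simp add: extends_identity_def to_completion_def)
    finally have e1: "ndist Y (T (X.cls a)) (a i) = vnorm Y (T (X.cls ?c))"
      using TY aY by (simp add: Y.ndist_eq)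
    have n: "(\<lambda>j. ndist X (a j) (a i)) \<longlonglongrightarrow> vnorm (completion X) (X.cls ?c)"
      using X.norm_completion[OF c] aX by (simp add: X.ndist_eq)
    have "0 \<le> vnorm (completion X) (X.cls ?c)"
      by (rule LIMSEQ_le_const[OF n]) auto
    then have "C * vnorm (completion X) (X.cls ?c) \<le> D * vnorm (completion X) (X.cls ?c)"
      by (intro mult_right_mono) (auto simp: D_def)
    then show "ndist Y (T (X.cls a)) (a i) \<le> D * lim (\<lambda>j. ndist X (a j) (a i))"
      using C[OF clsin[OF c]] limI[OF n] by (simp add: e1)
    show "(\<lambda>j. ndist X (a j) (a i)) \<longlonglongrightarrow> lim (\<lambda>j. ndist X (a j) (a i))" using n limI[OF n] by simp
  qed
  have "(\<lambda>i. ndist Y (a i) (T (X.cls a))) \<longlonglongrightarrow> 0"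
  proof (rule LIMSEQ_I)
    fix r :: real assume "r > 0"
    then have e: "r / (2 * (D + 1)) > 0" using D0 by simp
    obtain N where N: "\<And>i j. i \<ge> N \<Longrightarrow> j \<ge> N \<Longrightarrow> ndist X (a i) (a j) < r / (2 * (D + 1))"
      using X.cauchyD[OF a e] by blast
    have "norm (ndist Y (a i) (T (X.cls a)) - 0) < r" if "i \<ge> N" for i
    proof -
      have "lim (\<lambda>j. ndist X (a j) (a i)) \<le> r / (2 * (D + 1))"
        by (rule LIMSEQ_le_const2[OF cv]) (use N that in \<open>auto intro!: exI[of _ N] less_imp_le\<close>)
      then have "D * lim (\<lambda>j. ndist X (a j) (a i)) \<le> (D + 1) * (r / (2 * (D + 1)))"
        using D0 \<open>r > 0\<close> e by (intro mult_mono) (auto intro: LIMSEQ_le_const[OF cv])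
      also have "\<dots> = r / 2" using D0 by (simp add: divide_simps)
      finally show ?thesis using bnd[of i] \<open>r > 0\<close> by (simp add: Y.M.commute)
    qed
    then show "\<exists>no. \<forall>n\<ge>no. norm (ndist Y (a n) (T (X.cls a)) - 0) < r" by blast
  qed
  then show ?thesis using TY by simp
qed

context
  fixes C :: real
  assumes bound: "\<And>u. u \<in> vecs X \<Longrightarrow> vnorm Y u \<le> C * vnorm X u"
    and inj: "\<And>a. a \<in> cauchy_seqs X \<Longrightarrow> (\<lambda>i. vnorm Y (a i)) \<longlonglongrightarrow> 0 \<Longrightarrow> (\<lambda>i. vnorm X (a i)) \<longlonglongrightarrow> 0"
    and comp: "\<And>a B. (\<And>i. a i \<in> vecs X) \<Longrightarrow> (\<And>i. vnorm X (a i) \<le> B) \<Longrightarrow>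
      \<exists>\<sigma> u. strict_mono (\<sigma> :: nat \<Rightarrow> nat) \<and> ylim (a \<circ> \<sigma>) u"
begin

lemma ndist_bound: "x \<in> vecs X \<Longrightarrow> y \<in> vecs X \<Longrightarrow> ndist Y x y \<le> C * ndist X x y"
  using bound[OF X.sub_closed[of x y]] subset X.ndist_eq Y.ndist_eq
  by (metis (no_types, lifting) subsetD vadd_eq vscale_eq)

text \<open>The hypothesis \<open>comp\<close> stands in for completeness of \<open>Y\<close>: a
  Cauchy sequence of \<open>X\<close> is bounded, so a subsequence converges in \<open>Y\<close>,
  and by \<open>bound\<close> the whole sequence is Cauchy there and follows it.\<close>

lemma cauchy_ylim:
  assumes a: "a \<in> cauchy_seqs X"
  shows "\<exists>u. ylim a u"
proof -
  have aX: "a i \<in> vecs X" for i by (rule X.cauchy_in[OF a])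
  have aY: "a i \<in> vecs Y" for i using aX subset by blast
  obtain B where B: "\<And>i. norm (vnorm X (a i)) \<le> B"
    using convergent_imp_Bseq[OF X.norm_cauchy_convergent[OF a]] by (metis BseqE)
  have "vnorm X (a i) \<le> B" for i using B[of i] by simp
  then have "\<exists>\<sigma> u. strict_mono (\<sigma> :: nat \<Rightarrow> nat) \<and> ylim (a \<circ> \<sigma>) u"
    by (rule comp[OF aX])
  then obtain \<sigma> u where \<sigma>: "strict_mono (\<sigma> :: nat \<Rightarrow> nat)" and u: "ylim (a \<circ> \<sigma>) u" by blast
  define D where "D = max C 1"
  have D: "D \<ge> 1" by (simp add: D_def)
  have "(\<lambda>i. ndist Y (a i) u) \<longlonglongrightarrow> 0"
  proof (rule LIMSEQ_I)
    fix r :: real assume "r > 0"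
    then have e: "r / (2 * D) > 0" using D by simp
    obtain N where N: "\<And>i j. i \<ge> N \<Longrightarrow> j \<ge> N \<Longrightarrow> ndist X (a i) (a j) < r / (2 * D)"
      using X.cauchyD[OF a e] by blast
    obtain M where M: "\<And>j. j \<ge> M \<Longrightarrow> ndist Y (a (\<sigma> j)) u < r / 2"
      using LIMSEQ_D[OF conjunct2[OF u], of "r / 2"] \<open>r > 0\<close> by auto
    have "norm (ndist Y (a i) u - 0) < r" if "i \<ge> N" for i
    proof -
      define j where "j = max N M"
      have j: "\<sigma> j \<ge> N" using seq_suble[OF \<sigma>, of j] by (simp add: j_def)
      have "ndist Y (a i) (a (\<sigma> j)) \<le> C * ndist X (a i) (a (\<sigma> j))" by (rule ndist_bound[OF aX aX])
      also have "\<dots> \<le> D * ndist X (a i) (a (\<sigma> j))" by (intro mult_right_mono) (auto simp: D_def)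
      also have "\<dots> < D * (r / (2 * D))" using N[OF that j] D by (intro mult_strict_left_mono) auto
      also have "\<dots> = r / 2" using D by simp
      finally have "ndist Y (a i) (a (\<sigma> j)) < r / 2" .
      moreover have "ndist Y (a i) u \<le> ndist Y (a i) (a (\<sigma> j)) + ndist Y (a (\<sigma> j)) u"
        by (rule Y.M.triangle) (use aY u in auto)
      ultimately show ?thesis using M[of j] by (simp add: j_def)
    qed
    then show "\<exists>no. \<forall>n\<ge>no. norm (ndist Y (a n) u - 0) < r" by blast
  qed
  then show ?thesis using u by blast
qed

lemma extends_identity_exists: "\<exists>T. extends_identity T"
proof -
  have "\<exists>t. \<forall>a. a \<in> cauchy_seqs X \<longrightarrow> ylim a (t a)"
    using cauchy_ylim by metis
  then obtain t where t: "\<And>a. a \<in> cauchy_seqs X \<Longrightarrow> ylim a (t a)" by blast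
  define T where "T = (\<lambda>A\<in>vecs (completion X). t (SOME a. a \<in> A))"
  have aY: "a i \<in> vecs Y" if "a \<in> cauchy_seqs X" for a i using X.cauchy_in[OF that] subset by blast
  have clsin: "X.cls b \<in> vecs (completion X)" if "b \<in> cauchy_seqs X" for b
    using that by (auto simp: X.vecs_completion)
  \<comment> \<open>Independence of the representative: two representatives differ by a null
    sequence in \<open>X\<close>, which \<open>bound\<close> makes null in \<open>Y\<close> as
    well.\<close>
  have T: "T (X.cls a) = u" if a: "a \<in> cauchy_seqs X" and u: "ylim a u" for a u
  proof -
    define b where "b = (SOME b. b \<in> X.cls a)"
    have "b \<in> X.cls a" unfolding b_def by (rule someI[of _ a]) (rule X.cls_mem[OF a])
    then have b: "b \<in> cauchy_seqs X" "(\<lambda>i. ndist X (a i) (b i)) \<longlonglongrightarrow> 0" by (auto simp: X.coterminal_iff)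
    have lim: "(\<lambda>i. C * ndist X (a i) (b i) + ndist Y (b i) (t b)) \<longlonglongrightarrow> 0"
      using tendsto_add[OF tendsto_mult_right_zero[OF b(2), of C] conjunct2[OF t[OF b(1)]]] by simp
    have "ylim a (t b)"
    proof
      show "t b \<in> vecs Y" using t[OF b(1)] by simp
      show "(\<lambda>i. ndist Y (a i) (t b)) \<longlonglongrightarrow> 0"
      proof (rule Lim_null_comparison[OF always_eventually[OF allI] lim])
        fix i
        have "ndist Y (a i) (t b) \<le> ndist Y (a i) (b i) + ndist Y (b i) (t b)"
          by (rule Y.M.triangle) (use aY[OF a] aY[OF b(1)] t[OF b(1)] in auto)
        then show "norm (ndist Y (a i) (t b)) \<le> C * ndist X (a i) (b i) + ndist Y (b i) (t b)"
          using ndist_bound[OF X.cauchy_in[OF a] X.cauchy_in[OF b(1)], of i i] by simp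
      qed
    qed
    then have "t b = u" by (rule ylim_unique[OF aY[OF a] _ u])
    then show ?thesis using clsin[OF a] by (simp add: T_def b_def)
  qed
  have Tin: "T (X.cls a) \<in> vecs Y" if "a \<in> cauchy_seqs X" for a using T[OF that t[OF that]] t[OF that] by simp
  have ylT: "ylim a (T (X.cls a))" if "a \<in> cauchy_seqs X" for a using T[OF that t[OF that]] t[OF that] by simp
  have lin: "linear_operator (completion X) Y T"
    unfolding linear_operator_def
  proof (intro conjI ballI allI)
    show "T \<in> vecs (completion X) \<rightarrow> vecs Y" using Tin by (auto simp: X.vecs_completion)
    fix A assume "A \<in> vecs (completion X)"
    then obtain a where a: "a \<in> cauchy_seqs X" "A = X.cls a" by (auto simp: X.vecs_completion)
    {
      fix B assume "B \<in> vecs (completion X)"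
      then obtain b where b: "b \<in> cauchy_seqs X" "B = X.cls b" by (auto simp: X.vecs_completion)
      have "ylim (\<lambda>i. vadd X (a i) (b i)) (vadd Y (T A) (T B))"
      proof
        show "vadd Y (T A) (T B) \<in> vecs Y" using Tin a b by (intro Y.add_closed) auto
        have lim: "(\<lambda>i. ndist Y (a i) (T A) + ndist Y (b i) (T B)) \<longlonglongrightarrow> 0"
          using tendsto_add[OF conjunct2[OF ylT[OF a(1)]] conjunct2[OF ylT[OF b(1)]]] a b by simp
        show "(\<lambda>i. ndist Y (vadd X (a i) (b i)) (vadd Y (T A) (T B))) \<longlonglongrightarrow> 0"
        proof (rule Lim_null_comparison[OF always_eventually[OF allI] lim])
          fix i
          show "norm (ndist Y (vadd X (a i) (b i)) (vadd Y (T A) (T B))) \<le> ndist Y (a i) (T A) + ndist Y (b i) (T B)"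
            using Y.ndist_add_le[OF aY[OF a(1)] aY[OF b(1)] Tin[OF a(1)] Tin[OF b(1)], of i i] a b by (simp add: vadd_eq)
        qed
      qed
      then show "T (vadd (completion X) A B) = vadd Y (T A) (T B)"
        using T[OF X.cauchy_add[OF a(1) b(1)]] X.vadd_completion[OF a(1) b(1)] a b by simp
    }
    fix c
    have "ylim (\<lambda>i. vscale X c (a i)) (vscale Y c (T A))"
    proof
      show "vscale Y c (T A) \<in> vecs Y" using Tin a by (intro Y.scale_closed) auto
      show "(\<lambda>i. ndist Y (vscale X c (a i)) (vscale Y c (T A))) \<longlonglongrightarrow> 0"
        using tendsto_mult_right_zero[OF conjunct2[OF ylT[OF a(1)]], of "cmod c"]
        by (simp add: vscale_eq[symmetric] Y.ndist_scale aY[OF a(1)] Tin[OF a(1)] a(2))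
    qed
    then show "T (vscale (completion X) c A) = vscale Y c (T A)"
      using T[OF X.cauchy_scale[OF a(1)]] X.vscale_completion[OF a(1)] a by simp
  qed
  have normlim: "(\<lambda>i. vnorm Y (a i)) \<longlonglongrightarrow> vnorm Y (T (X.cls a))" if a: "a \<in> cauchy_seqs X" for a
  proof (rule LIM_zero_cancel, rule Lim_null_comparison[OF always_eventually[OF allI] conjunct2[OF ylT[OF a]]])
    show "norm (vnorm Y (a i) - vnorm Y (T (X.cls a))) \<le> ndist Y (a i) (T (X.cls a))" for i
      using Y.norm_diff_le_ndist[OF aY[OF a] Tin[OF a]] by simp
  qed
  have bnd: "vnorm Y (T A) \<le> C * vnorm (completion X) A" if A: "A \<in> vecs (completion X)" for A
  proof -
    obtain a where a: "a \<in> cauchy_seqs X" "A = X.cls a" using A by (auto simp: X.vecs_completion)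
    show ?thesis unfolding a(2)
      by (rule LIMSEQ_le[OF normlim[OF a(1)] tendsto_mult_left[OF X.norm_completion[OF a(1)]]])
        (use bound X.cauchy_in[OF a(1)] in auto)
  qed
  \<comment> \<open>If two classes have the same image, the difference of their representatives is a
    Cauchy sequence that is null in \<open>Y\<close>; by \<open>inj\<close> it is null in
    \<open>X\<close>, so the classes agree.\<close>
  have injT: "inj_on T (vecs (completion X))"
  proof (rule inj_onI)
    fix A B assume "A \<in> vecs (completion X)" "B \<in> vecs (completion X)" and eq: "T A = T B"
    then obtain a b where a: "a \<in> cauchy_seqs X" "A = X.cls a" and b: "b \<in> cauchy_seqs X" "B = X.cls b"
      by (auto simp: X.vecs_completion)
    let ?c = "\<lambda>i. vadd X (a i) (vscale X (- 1) (b i))"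
    have c: "?c \<in> cauchy_seqs X" by (intro X.cauchy_add X.cauchy_scale a b)
    have nc: "vnorm X (?c i) = ndist X (a i) (b i)" for i
      by (simp add: X.ndist_eq X.cauchy_in[OF a(1)] X.cauchy_in[OF b(1)])
    have ncY: "vnorm Y (?c i) = ndist Y (a i) (b i)" for i
      by (simp add: Y.ndist_eq aY[OF a(1)] aY[OF b(1)] vadd_eq vscale_eq)
    have lim: "(\<lambda>i. ndist Y (a i) (T A) + ndist Y (b i) (T B)) \<longlonglongrightarrow> 0"
      using tendsto_add[OF conjunct2[OF ylT[OF a(1)]] conjunct2[OF ylT[OF b(1)]]] a b by simp
    have "(\<lambda>i. vnorm Y (?c i)) \<longlonglongrightarrow> 0"
    proof (rule Lim_null_comparison[OF always_eventually[OF allI] lim])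
      fix i
      have "ndist Y (a i) (b i) \<le> ndist Y (a i) (T A) + ndist Y (T A) (b i)"
        by (rule Y.M.triangle) (use aY[OF a(1)] aY[OF b(1)] Tin[OF a(1)] a in auto)
      then show "norm (vnorm Y (?c i)) \<le> ndist Y (a i) (T A) + ndist Y (b i) (T B)"
        by (simp add: ncY eq Y.M.commute)
    qed
    then have "(\<lambda>i. vnorm X (?c i)) \<longlonglongrightarrow> 0" by (rule inj[OF c])
    then show "A = B" by (simp add: a b nc X.cls_eq_iff)
  qed
  have "T (to_completion X u) = u" if "u \<in> vecs X" for u
    unfolding to_completion_def using that subset by (intro T X.cauchy_const) auto
  then have "extends_identity T"
    unfolding extends_identity_def continuous_embedding_def using lin injT bnd by (auto simp: T_def)
  then show ?thesis by blast
qed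

lemma extends_identity_ex1: "\<exists>!T. extends_identity T"
proof -
  obtain T where T: "extends_identity T" using extends_identity_exists by blast
  show ?thesis
  proof (rule ex1I[where a=T])
    show "extends_identity T" by (rule T)
    fix S assume S: "extends_identity S"
    show "S = T"
    proof (rule extensionalityI)
      show "S \<in> extensional (vecs (completion X))" "T \<in> extensional (vecs (completion X))"
        using S T by (auto simp: extends_identity_def)
      fix A assume "A \<in> vecs (completion X)"
      then obtain a where a: "a \<in> cauchy_seqs X" "A = X.cls a" by (auto simp: X.vecs_completion)
      show "S A = T A"
        using ylim_unique[OF _ extends_identity_ylim[OF S a(1)] extends_identity_ylim[OF T a(1)]]
          X.cauchy_in[OF a(1)] subset a(2) by blast
    qed
  qed
qed

text \<open>In the Bolzano-Weierstrass form, an infinite set of images has to accumulate. Its points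
  are approximated, with errors tending to 0, by vectors of \<open>X\<close> of norm at most r + 1,
  to which \<open>comp\<close> applies.\<close>

lemma extends_identity_compact:
  assumes T: "extends_identity T"
  shows "compact_operator (completion X) Y T"
  unfolding compact_operator_def
proof (intro conjI allI impI)
  show lin: "linear_operator (completion X) Y T"
    using T by (simp add: extends_identity_def continuous_embedding_def)
  fix B assume B: "B \<subseteq> vecs (completion X)" and "\<exists>r. \<forall>x\<in>B. vnorm (completion X) x \<le> r"
  then obtain r where r: "\<And>x. x \<in> B \<Longrightarrow> vnorm (completion X) x \<le> r" by blast
  have approx: "\<exists>x\<in>vecs X. vnorm X x \<le> r + 1 \<and> ndist Y x (T A) < e" if A: "A \<in> B" and "e > 0" for A e
  proof -
    obtain a where a: "a \<in> cauchy_seqs X" "A = X.cls a" using A B by (auto simp: X.vecs_completion)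
    have "\<forall>\<^sub>F i in sequentially. vnorm X (a i) < r + 1"
      using X.norm_completion[OF a(1)] by (rule order_tendstoD) (use r[OF A] a in auto)
    moreover have "\<forall>\<^sub>F i in sequentially. ndist Y (a i) (T A) < e"
      using extends_identity_ylim[OF T a(1)] a(2) \<open>e > 0\<close> by (auto intro: order_tendstoD)
    ultimately have "\<forall>\<^sub>F i in sequentially. vnorm X (a i) < r + 1 \<and> ndist Y (a i) (T A) < e"
      by (rule eventually_conj)
    then obtain i where "vnorm X (a i) < r + 1 \<and> ndist Y (a i) (T A) < e"
      by (auto simp: eventually_sequentially)
    then show ?thesis using X.cauchy_in[OF a(1)] by (intro bexI[of _ "a i"]) auto
  qed
  show "compactin (ntopology Y) (ntopology Y closure_of (T ` B))"
    unfolding Y.M.compact_closure_of_eq_Bolzano_Weierstrass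
  proof (intro allI impI)
    fix S assume S: "infinite S \<and> S \<subseteq> T ` B \<and> S \<subseteq> vecs Y"
    then obtain f :: "nat \<Rightarrow> 'x" where f: "inj f" "range f \<subseteq> S"
      using infinite_countable_subset by blast
    have fY: "f i \<in> vecs Y" for i using f(2) S by blast
    have "\<exists>x\<in>vecs X. vnorm X x \<le> r + 1 \<and> ndist Y x (f i) < 1 / real (Suc i)" for i
    proof -
      have "f i \<in> T ` B" using f(2) S by blast
      then obtain A where "A \<in> B" "f i = T A" by blast
      then show ?thesis using approx[of A "1 / real (Suc i)"] by simp
    qed
    then obtain x where x: "\<And>i. x i \<in> vecs X" "\<And>i. vnorm X (x i) \<le> r + 1" "\<And>i. ndist Y (x i) (f i) < 1 / real (Suc i)"
      by metis
    have xY: "x i \<in> vecs Y" for i using x(1) subset by blast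
    obtain \<sigma> u where \<sigma>: "strict_mono (\<sigma> :: nat \<Rightarrow> nat)" and u: "ylim (x \<circ> \<sigma>) u"
    proof -
      have "\<exists>\<sigma> u. strict_mono (\<sigma> :: nat \<Rightarrow> nat) \<and> ylim (x \<circ> \<sigma>) u" by (rule comp[OF x(1,2)])
      then show ?thesis using that by blast
    qed
    have lim: "(\<lambda>i. 1 / real (Suc (\<sigma> i)) + ndist Y (x (\<sigma> i)) u) \<longlonglongrightarrow> 0"
    proof -
      have "(\<lambda>i. 1 / real (Suc i)) \<longlonglongrightarrow> 0" by (rule LIMSEQ_Suc[OF lim_1_over_n])
      from LIMSEQ_subseq_LIMSEQ[OF this \<sigma>] have "(\<lambda>i. 1 / real (Suc (\<sigma> i))) \<longlonglongrightarrow> 0" by (simp add: o_def)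
      from tendsto_add[OF this conjunct2[OF u]] show ?thesis by (simp add: o_def)
    qed
    have fu: "(\<lambda>i. ndist Y (f (\<sigma> i)) u) \<longlonglongrightarrow> 0"
    proof (rule Lim_null_comparison[OF always_eventually[OF allI] lim])
      fix i
      have "ndist Y (f (\<sigma> i)) u \<le> ndist Y (f (\<sigma> i)) (x (\<sigma> i)) + ndist Y (x (\<sigma> i)) u"
        by (rule Y.M.triangle) (use fY xY u in auto)
      then show "norm (ndist Y (f (\<sigma> i)) u) \<le> 1 / real (Suc (\<sigma> i)) + ndist Y (x (\<sigma> i)) u"
        using x(3)[of "\<sigma> i"] by (simp add: Y.M.commute)
    qed
    have "u \<in> ntopology Y derived_set_of S"
      unfolding in_derived_set_of
    proof (intro conjI allI impI)
      show "u \<in> topspace (ntopology Y)" using u by simp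
      fix U assume U: "u \<in> U \<and> openin (ntopology Y) U"
      then obtain e where e: "e > 0" "Y.M.mball u e \<subseteq> U" by (meson Y.M.openin_mtopology)
      obtain N where N: "\<And>i. i \<ge> N \<Longrightarrow> ndist Y (f (\<sigma> i)) u < e"
        using LIMSEQ_D[OF fu e(1)] by auto
      have inU: "f (\<sigma> i) \<in> U" if "i \<ge> N" for i
        using N[OF that] e(2) fY u by (auto simp: Y.M.mball_def Y.M.commute[of u])
      \<comment> \<open>An accumulation point requires a member of the neighbourhood other than
        \<open>u\<close>; of two distinct members at most one equals \<open>u\<close>.\<close>
      have "f (\<sigma> N) \<noteq> f (\<sigma> (Suc N))" using f(1) \<sigma> by (metis inj_eq lessI less_irrefl strict_monoD)
      then show "\<exists>y. y \<noteq> u \<and> y \<in> S \<and> y \<in> U"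
        using inU[of N] inU[of "Suc N"] f(2) by (metis lessI less_imp_le_nat order_refl rangeI subsetD)
    qed
    then show "ntopology Y derived_set_of S \<noteq> {}" by blast
  qed
qed

end

end

section \<open>Differentiable maps between manifolds\<close>

text \<open>The part of \<open>smooth_atlas\<close> without the condition on transitions.
  Composition and gluing of \<open>Ck_map_on\<close> rest on it alone, and it passes easily to
  product atlases.\<close>

definition top_atlas :: "('m::topological_space, 'e::euclidean_space) charts \<Rightarrow> bool" where
  "top_atlas A \<longleftrightarrow> (\<Union>(U, f)\<in>A. U) = UNIV \<and>
     (\<forall>(U, f)\<in>A. open U \<and> open (f ` U) \<and> (\<exists>g. homeomorphism U (f ` U) f g))"

lemma smooth_atlas_imp_top: "smooth_atlas A \<Longrightarrow> top_atlas A"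
  by (simp add: smooth_atlas_def top_atlas_def)

lemma top_atlas_cover:
  assumes "top_atlas A" obtains U f where "(U, f) \<in> A" "x \<in> U"
proof -
  have "x \<in> (\<Union>(U, f)\<in>A. U)" using assms by (simp add: top_atlas_def)
  then show ?thesis using that by blast
qed

lemma top_atlas_chart:
  assumes "top_atlas A" "(U, f) \<in> A"
  shows "open U" "inj_on f U" "continuous_on U f" "V \<subseteq> U \<Longrightarrow> open V \<Longrightarrow> open (f ` V)"
    "continuous_on (f ` U) (inv_into U f)"
proof -
  have *: "open U" "open (f ` U)" "\<exists>g. homeomorphism U (f ` U) f g" using assms by (auto simp: top_atlas_def)
  then obtain g where g: "homeomorphism U (f ` U) f g" by blast
  show "open U" by fact
  show inj: "inj_on f U" by (rule inj_on_inverseI[of U g]) (use g in \<open>auto simp: homeomorphism_def\<close>)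
  show "continuous_on U f" using g by (simp add: homeomorphism_def)
  have eq: "inv_into U f y = g y" if "y \<in> f ` U" for y
    using that inj g by (auto simp: homeomorphism_def)
  show "continuous_on (f ` U) (inv_into U f)"
    using g eq by (auto simp: homeomorphism_def cong: continuous_on_cong)
  show "open (f ` V)" if "V \<subseteq> U" "open V"
  proof -
    have "openin (top_of_set (f ` U)) (f ` V)"
      by (rule homeomorphism_imp_open_map[OF g]) (use that *(1) in \<open>simp add: openin_open_eq\<close>)
    then show ?thesis using *(2) openin_open_trans by blast
  qed
qed

lemma inv_into_std [simp]: "inv_into UNIV id = id"
  by (rule ext) (metis UNIV_I id_apply image_id f_inv_into_f)

lemma top_atlas_std: "top_atlas std_atlas"
  by (auto simp: top_atlas_def std_atlas_def homeomorphism_def intro!: exI[of _ id])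

lemma prod_chart_inv:
  assumes "inj_on g W" "y \<in> g ` W"
  shows "inv_into (W \<times> UNIV) (\<lambda>(x, a). (g x, a)) (y, a) = (inv_into W g y, a)"
  by (rule inv_into_f_eq) (use assms in \<open>auto simp: inj_on_def f_inv_into_f inv_into_into\<close>)

lemma top_atlas_prod:
  assumes "top_atlas B"
  shows "top_atlas (prod_atlas B :: ('m::topological_space \<times> 'f::euclidean_space, 'e::euclidean_space \<times> 'f) charts)"
  unfolding top_atlas_def
proof (intro conjI)
  show "(\<Union>(U, f)\<in>(prod_atlas B :: ('m \<times> 'f, 'e \<times> 'f) charts). U) = UNIV"
  proof safe
    fix x :: 'm and a :: 'f
    obtain U f where "(U, f) \<in> B" "x \<in> U" using top_atlas_cover[OF assms] by blast
    then show "(x, a) \<in> (\<Union>(U, f)\<in>prod_atlas B. U)"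
      by (auto simp: prod_atlas_def intro!: bexI[of _ "(U, f)"])
  qed auto
  show "\<forall>(U, f)\<in>(prod_atlas B :: ('m \<times> 'f, 'e \<times> 'f) charts). open U \<and> open (f ` U) \<and> (\<exists>g. homeomorphism U (f ` U) f g)"
  proof safe
    fix UU :: "('m \<times> 'f) set" and ff assume "(UU, ff) \<in> (prod_atlas B :: ('m \<times> 'f, 'e \<times> 'f) charts)"
    then obtain U f where Uf: "(U, f) \<in> B" "UU = U \<times> UNIV" "ff = (\<lambda>(x, a). (f x, a))" by (auto simp: prod_atlas_def)
    note c = top_atlas_chart[OF assms Uf(1)]
    have im: "ff ` UU = (f ` U) \<times> UNIV" by (force simp: Uf)
    show "open UU" using c(1) by (simp add: Uf open_Times)
    show "open (ff ` UU)" unfolding im using c(4)[of U] c(1) by (simp add: open_Times)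
    show "\<exists>g. homeomorphism UU (ff ` UU) ff g"
    proof (intro exI homeomorphismI)
      show "continuous_on UU ff" unfolding Uf case_prod_unfold
        by (intro continuous_intros continuous_on_compose2[OF c(3)]) auto
      show "continuous_on (ff ` UU) (\<lambda>(y, a). (inv_into U f y, a))" unfolding im case_prod_unfold
        by (intro continuous_intros continuous_on_compose2[OF c(5)]) auto
    qed (auto simp: Uf c(2) f_inv_into_f)
  qed
qed

lemma Ck_map_onD:
  assumes "Ck_map_on k A B S h"
  shows "continuous_on S h"
    "(U, f) \<in> A \<Longrightarrow> (W, g) \<in> B \<Longrightarrow> Ck_on k (f ` (S \<inter> U \<inter> h -` W)) (g \<circ> h \<circ> inv_into U f)"
  using assms by (auto simp: Ck_map_on_def)

lemma open_vimage_Int: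
  assumes "open S" "continuous_on S h" "open W"
  shows "open (S \<inter> h -` W)"
  using continuous_open_preimage[OF assms(2,1,3)] .

lemma open_chart_domain:
  assumes "top_atlas A" "top_atlas B" "(U, f) \<in> A" "(W, g) \<in> B" "open S" "continuous_on S h"
  shows "open (f ` (S \<inter> U \<inter> h -` W))"
proof (rule top_atlas_chart(4)[OF assms(1,3)])
  have "S \<inter> U \<inter> h -` W = (S \<inter> h -` W) \<inter> U" by auto
  then show "open (S \<inter> U \<inter> h -` W)"
    using open_vimage_Int[OF assms(5,6) top_atlas_chart(1)[OF assms(2,4)]] top_atlas_chart(1)[OF assms(1,3)] by auto
qed auto

lemma Ck_map_on_subset:
  assumes "Ck_map_on k A B S h" "T \<subseteq> S"
  shows "Ck_map_on k A B T h"
  unfolding Ck_map_on_def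
proof safe
  show "continuous_on T h" using Ck_map_onD(1)[OF assms(1)] assms(2) continuous_on_subset by blast
  fix U f W g assume "(U, f) \<in> A" "(W, g) \<in> B"
  then show "Ck_on k (f ` (T \<inter> U \<inter> h -` W)) (g \<circ> h \<circ> inv_into U f)"
    using Ck_on_subset[OF Ck_map_onD(2)[OF assms(1)]] assms(2) by (metis (no_types, lifting) Int_mono image_mono order_refl)
qed

lemma Ck_map_on_cong:
  assumes A: "top_atlas A" and B: "top_atlas B" and S: "open S" and eq: "\<And>x. x \<in> S \<Longrightarrow> h x = h' x"
    and h: "Ck_map_on k A B S h"
  shows "Ck_map_on k A B S h'"
  unfolding Ck_map_on_def
proof safe
  show c': "continuous_on S h'" using Ck_map_onD(1)[OF h] eq by (simp cong: continuous_on_cong)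
  fix U f W g assume Uf: "(U, f) \<in> A" and Wg: "(W, g) \<in> B"
  have set: "S \<inter> U \<inter> h' -` W = S \<inter> U \<inter> h -` W" using eq by auto
  show "Ck_on k (f ` (S \<inter> U \<inter> h' -` W)) (g \<circ> h' \<circ> inv_into U f)"
    unfolding set
  proof (rule Ck_on_cong_imp[OF _ _ Ck_map_onD(2)[OF h Uf Wg]])
    show "open (f ` (S \<inter> U \<inter> h -` W))" by (rule open_chart_domain[OF A B Uf Wg S Ck_map_onD(1)[OF h]])
    show "(g \<circ> h \<circ> inv_into U f) y = (g \<circ> h' \<circ> inv_into U f) y" if "y \<in> f ` (S \<inter> U \<inter> h -` W)" for y
      using that eq top_atlas_chart(2)[OF A Uf] by auto
  qed
qed

lemma Ck_map_on_local:
  assumes A: "top_atlas A" and B: "top_atlas B"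
    and loc: "\<And>x. x \<in> S \<Longrightarrow> \<exists>N. open N \<and> x \<in> N \<and> Ck_map_on k A B N h"
  shows "Ck_map_on k A B S h"
  unfolding Ck_map_on_def
proof safe
  show "continuous_on S h"
  proof (rule continuous_on_subset)
    show "continuous_on (\<Union>{N. open N \<and> continuous_on N h}) h"
      by (rule continuous_on_open_Union) auto
    show "S \<subseteq> \<Union>{N. open N \<and> continuous_on N h}"
      using loc Ck_map_onD(1) by blast
  qed
  fix U f W g assume Uf: "(U, f) \<in> A" and Wg: "(W, g) \<in> B"
  show "Ck_on k (f ` (S \<inter> U \<inter> h -` W)) (g \<circ> h \<circ> inv_into U f)"
  proof (rule Ck_on_local)
    fix y assume "y \<in> f ` (S \<inter> U \<inter> h -` W)"
    then obtain x where x: "x \<in> S" "x \<in> U" "h x \<in> W" "y = f x" by auto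
    obtain N where N: "open N" "x \<in> N" "Ck_map_on k A B N h" using loc[OF x(1)] by blast
    show "\<exists>T. open T \<and> y \<in> T \<and> Ck_on k T (g \<circ> h \<circ> inv_into U f)"
      using open_chart_domain[OF A B Uf Wg N(1) Ck_map_onD(1)[OF N(3)]] Ck_map_onD(2)[OF N(3) Uf Wg] x N(2)
      by (intro exI[of _ "f ` (N \<inter> U \<inter> h -` W)"]) auto
  qed
qed

text \<open>\<open>Ck_map_on\<close> speaks of all pairs of charts, so near each point one chart of
  the middle manifold can be inserted between the two coordinate expressions. The neighbourhood is
  shrunk until all three charts apply, and the local criterion finishes.\<close>

lemma Ck_map_on_compose:
  assumes A: "top_atlas A" and B: "top_atlas B" and C: "top_atlas C"
    and S: "open S" and T: "open T" and sub: "\<And>x. x \<in> S \<Longrightarrow> h x \<in> T"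
    and h: "Ck_map_on k A B S h" and h': "Ck_map_on k B C T h'"
  shows "Ck_map_on k A C S (\<lambda>x. h' (h x))"
  unfolding Ck_map_on_def
proof safe
  show "continuous_on S (\<lambda>x. h' (h x))"
    by (rule continuous_on_compose2[OF Ck_map_onD(1)[OF h'] Ck_map_onD(1)[OF h]]) (use sub in auto)
  fix U f Z g assume Uf: "(U, f) \<in> A" and Zg: "(Z, g) \<in> C"
  show "Ck_on k (f ` (S \<inter> U \<inter> (\<lambda>x. h' (h x)) -` Z)) (g \<circ> (\<lambda>x. h' (h x)) \<circ> inv_into U f)"
  proof (rule Ck_on_local)
    fix y assume "y \<in> f ` (S \<inter> U \<inter> (\<lambda>x. h' (h x)) -` Z)"
    then obtain x where x: "x \<in> S" "x \<in> U" "h' (h x) \<in> Z" "y = f x" by auto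
    obtain W w where Ww: "(W, w) \<in> B" "h x \<in> W" using top_atlas_cover[OF B] by blast
    note ic = top_atlas_chart(2)[OF A Uf] and iw = top_atlas_chart(2)[OF B Ww(1)]
    define P where "P = T \<inter> W \<inter> h' -` Z"
    define N where "N = S \<inter> U \<inter> h -` P"
    have P: "open P"
    proof -
      have "P = (T \<inter> h' -` Z) \<inter> W" by (auto simp: P_def)
      then show ?thesis using open_vimage_Int[OF T Ck_map_onD(1)[OF h'] top_atlas_chart(1)[OF C Zg]]
        top_atlas_chart(1)[OF B Ww(1)] by auto
    qed
    have N: "open N"
    proof -
      have "N = (S \<inter> h -` P) \<inter> U" by (auto simp: N_def)
      then show ?thesis using open_vimage_Int[OF S Ck_map_onD(1)[OF h] P] top_atlas_chart(1)[OF A Uf] by auto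
    qed
    have oN: "open (f ` N)" by (rule top_atlas_chart(4)[OF A Uf _ N]) (auto simp: N_def)
    have oP: "open (w ` P)" by (rule top_atlas_chart(4)[OF B Ww(1) _ P]) (auto simp: P_def)
    have 1: "Ck_on k (f ` N) (w \<circ> h \<circ> inv_into U f)"
      by (rule Ck_on_subset[OF Ck_map_onD(2)[OF h Uf Ww(1)]]) (auto simp: N_def P_def)
    have 2: "Ck_on k (w ` P) (g \<circ> h' \<circ> inv_into W w)"
      by (rule Ck_on_subset[OF Ck_map_onD(2)[OF h' Ww(1) Zg]]) (auto simp: P_def)
    have sub': "(w \<circ> h \<circ> inv_into U f) ` (f ` N) \<subseteq> w ` P" using ic by (auto simp: N_def)
    have "Ck_on k (f ` N) (\<lambda>y. (g \<circ> h' \<circ> inv_into W w) ((w \<circ> h \<circ> inv_into U f) y))"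
      by (rule Ck_on_compose[OF oN oP sub' 1 2])
    then have "Ck_on k (f ` N) (g \<circ> (\<lambda>x. h' (h x)) \<circ> inv_into U f)"
      by (rule Ck_on_cong_imp[OF oN, rotated]) (use ic iw in \<open>auto simp: N_def P_def\<close>)
    moreover have "y \<in> f ` N" using x Ww(2) sub by (auto simp: N_def P_def)
    ultimately show "\<exists>T. open T \<and> y \<in> T \<and> Ck_on k T (g \<circ> (\<lambda>x. h' (h x)) \<circ> inv_into U f)" using oN by blast
  qed
qed

lemma Ck_map_on_std: "Ck_map_on k std_atlas std_atlas S h \<longleftrightarrow> Ck_on k S h"
  by (auto simp: Ck_map_on_def std_atlas_def Ck_on_imp_continuous_on)

lemma Ck_map_on_Pair:
  fixes B :: "('l::topological_space, 'f::euclidean_space) charts" and h2 :: "'m::topological_space \<Rightarrow> 'g::euclidean_space"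
  assumes A: "top_atlas A" and B: "top_atlas B" and S: "open S"
    and h1: "Ck_map_on k A B S h1" and h2: "Ck_map_on k A std_atlas S h2"
  shows "Ck_map_on k A (prod_atlas B) S (\<lambda>x. (h1 x, h2 x))"
  unfolding Ck_map_on_def
proof safe
  show "continuous_on S (\<lambda>x. (h1 x, h2 x))"
    by (intro continuous_on_Pair Ck_map_onD(1)[OF h1] Ck_map_onD(1)[OF h2])
  fix U f WW gg assume Uf: "(U, f) \<in> A" and "(WW, gg) \<in> (prod_atlas B :: ('l \<times> 'g, 'f \<times> 'g) charts)"
  then obtain W g where Wg: "(W, g) \<in> B" "WW = W \<times> UNIV" "gg = (\<lambda>(x, a). (g x, a))" by (auto simp: prod_atlas_def)
  have set: "S \<inter> U \<inter> (\<lambda>x. (h1 x, h2 x)) -` WW = S \<inter> U \<inter> h1 -` W" by (auto simp: Wg)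
  have o: "open (f ` (S \<inter> U \<inter> h1 -` W))" by (rule open_chart_domain[OF A B Uf Wg(1) S Ck_map_onD(1)[OF h1]])
  have 2: "Ck_on k (f ` (S \<inter> U \<inter> h2 -` UNIV)) (id \<circ> h2 \<circ> inv_into U f)"
    by (rule Ck_map_onD(2)[OF h2 Uf]) (simp add: std_atlas_def)
  have "Ck_on k (f ` (S \<inter> U \<inter> h1 -` W)) (\<lambda>y. ((g \<circ> h1 \<circ> inv_into U f) y, (id \<circ> h2 \<circ> inv_into U f) y))"
    by (rule Ck_on_Pair[OF o Ck_map_onD(2)[OF h1 Uf Wg(1)] Ck_on_subset[OF 2]]) auto
  then show "Ck_on k (f ` (S \<inter> U \<inter> (\<lambda>x. (h1 x, h2 x)) -` WW)) (gg \<circ> (\<lambda>x. (h1 x, h2 x)) \<circ> inv_into U f)"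
    unfolding set by (simp add: Wg(3) o_def)
qed

lemma Ck_map_on_snd:
  assumes B: "top_atlas B"
  shows "Ck_map_on k (prod_atlas B) std_atlas UNIV snd"
  unfolding Ck_map_on_def
proof safe
  show "continuous_on UNIV (snd :: 'a \<times> 'c \<Rightarrow> 'c)" by (intro continuous_intros)
  fix UU ff W and g :: "'c \<Rightarrow> 'c" assume "(UU, ff) \<in> (prod_atlas B :: ('a \<times> 'c, 'b \<times> 'c) charts)" "(W, g) \<in> std_atlas"
  then obtain U f where Uf: "(U, f) \<in> B" "UU = U \<times> UNIV" "ff = (\<lambda>(x, a). (f x, a))" and Wg: "W = UNIV" "g = id"
    by (auto simp: prod_atlas_def std_atlas_def)
  note c = top_atlas_chart[OF B Uf(1)]
  have im: "ff ` (UNIV \<inter> UU \<inter> snd -` W) = (f ` U) \<times> UNIV" by (force simp: Uf Wg)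
  have o: "open ((f ` U) \<times> (UNIV :: 'c set))" using c(4)[of U] c(1) by (simp add: open_Times)
  have "Ck_on k ((f ` U) \<times> (UNIV :: 'c set)) snd" by (rule Ck_on_bounded_linear[OF o bounded_linear_snd])
  then show "Ck_on k (ff ` (UNIV \<inter> UU \<inter> snd -` W)) (g \<circ> snd \<circ> inv_into UU ff)"
    unfolding im
    by (rule Ck_on_cong_imp[OF o, rotated]) (auto simp: Uf Wg prod_chart_inv[OF c(2)])
qed

lemma Ck_map_on_const:
  assumes A: "top_atlas A"
  shows "Ck_map_on k A std_atlas S (\<lambda>x. c)"
  by (auto simp: Ck_map_on_def std_atlas_def o_def)

lemma smooth_map_on_imp_Ck: "smooth_map_on A B S h \<Longrightarrow> Ck_map_on k A B S h"
  by (simp add: smooth_map_on_def)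

text \<open>The coordinate expressions of the identity are the transition maps, so here the
  smoothness condition of the atlas is used.\<close>

lemma Ck_map_on_id:
  assumes A: "smooth_atlas A" and S: "open S"
  shows "Ck_map_on k A A S (\<lambda>x. x)"
  unfolding Ck_map_on_def
proof safe
  fix U f W g assume UW: "(U, f) \<in> A" "(W, g) \<in> A"
  then have "smooth_on (f ` (U \<inter> W)) (g \<circ> inv_into U f)" using A by (auto simp: smooth_atlas_def)
  then have "Ck_on k (f ` (U \<inter> W)) (g \<circ> inv_into U f)" by (rule smooth_on_imp_Ck)
  then have "Ck_on k (f ` (S \<inter> U \<inter> (\<lambda>x. x) -` W)) (g \<circ> inv_into U f)"
    by (rule Ck_on_subset) auto
  moreover have "g \<circ> (\<lambda>x. x) \<circ> inv_into U f = g \<circ> inv_into U f" by auto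
  ultimately show "Ck_on k (f ` (S \<inter> U \<inter> (\<lambda>x. x) -` W)) (g \<circ> (\<lambda>x. x) \<circ> inv_into U f)" by simp
qed (rule continuous_on_id)

text \<open>The completeness of C^q in concrete form. The induction hypothesis is applied to the
  functions and to their first derivatives, and the theorem on differentiating a uniformly
  convergent sequence identifies the limits of the latter as the derivatives of the limit
  function.\<close>

lemma uniform_limit_Ck:
  fixes f :: "nat \<Rightarrow> real^'n::finite \<Rightarrow> complex"
  assumes "\<And>i. Ck_on q UNIV (f i)"
    and "\<And>is e. length is \<le> q \<Longrightarrow> e > 0 \<Longrightarrow> \<exists>N. \<forall>i\<ge>N. \<forall>j\<ge>N. \<forall>x. cmod (pderivs is (f i) x - pderivs is (f j) x) < e"
  shows "\<exists>w. Ck_on q UNIV w \<and> (\<forall>is e. length is \<le> q \<longrightarrow> e > 0 \<longrightarrow>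
    (\<exists>N. \<forall>i\<ge>N. \<forall>x. cmod (pderivs is (f i) x - pderivs is w x) \<le> e))"
  using assms
proof (induction q arbitrary: f)
  case 0
  have C: "\<exists>N. \<forall>i\<ge>N. \<forall>j\<ge>N. \<forall>x. cmod (f i x - f j x) < e" if "e > 0" for e
    using 0(2)[of "[]" e] that by simp
  have "Cauchy (\<lambda>i. f i x)" for x
  proof (rule CauchyI)
    fix e :: real assume "e > 0"
    then show "\<exists>M. \<forall>m\<ge>M. \<forall>n\<ge>M. norm (f m x - f n x) < e" using C[of e] by blast
  qed
  then have "\<exists>l. (\<lambda>i. f i x) \<longlonglongrightarrow> l" for x by (simp add: convergent_eq_Cauchy)
  then obtain w where w: "\<And>x. (\<lambda>i. f i x) \<longlonglongrightarrow> w x" by metis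
  have U: "\<exists>N. \<forall>i\<ge>N. \<forall>x. cmod (f i x - w x) \<le> e" if e: "e > 0" for e
  proof -
    obtain N where N: "\<And>i j x. i \<ge> N \<Longrightarrow> j \<ge> N \<Longrightarrow> cmod (f i x - f j x) < e" using C[OF e] by blast
    have "cmod (f i x - w x) \<le> e" if "i \<ge> N" for i x
      by (rule LIMSEQ_le_const2[OF tendsto_norm[OF tendsto_diff[OF tendsto_const w]]])
        (use N that in \<open>auto intro!: exI[of _ N] less_imp_le\<close>)
    then show ?thesis by blast
  qed
  have "uniform_limit UNIV f w sequentially"
  proof (rule uniform_limitI)
    fix e :: real assume "e > 0"
    then obtain N where "\<forall>i\<ge>N. \<forall>x. cmod (f i x - w x) \<le> e / 2" using U[of "e / 2"] by auto
    then show "\<forall>\<^sub>F i in sequentially. \<forall>x\<in>UNIV. dist (f i x) (w x) < e"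
      using \<open>e > 0\<close> unfolding eventually_sequentially dist_norm
      by (intro exI[of _ N]) (smt (verit, best) field_sum_of_halves)
  qed
  then have "continuous_on UNIV w"
    by (rule uniform_limit_theorem[rotated]) (use 0(1) in \<open>auto\<close>)
  then show ?case using U by (intro exI[of _ w]) auto
next
  case (Suc q)
  obtain w where w: "\<And>is e. length is \<le> q \<Longrightarrow> e > 0 \<Longrightarrow>
      \<exists>N. \<forall>i\<ge>N. \<forall>x. cmod (pderivs is (f i) x - pderivs is w x) \<le> e"
    using Suc.IH[of f] Ck_on_SucD[OF Suc.prems(1)] Suc.prems(2) by (metis le_SucI)
  have "\<exists>g. Ck_on q UNIV g \<and> (\<forall>is e. length is \<le> q \<longrightarrow> e > 0 \<longrightarrow>
      (\<exists>N. \<forall>i\<ge>N. \<forall>x. cmod (pderivs is (pderivs [a] (f i)) x - pderivs is g x) \<le> e))" for a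
  proof (rule Suc.IH)
    show "Ck_on q UNIV (pderivs [a] (f i))" for i by (rule Ck_on_pderivs) (use Suc.prems(1) in simp)
    fix "is" :: "'n list" and e :: real assume "length is \<le> q" "e > 0"
    then show "\<exists>N. \<forall>i\<ge>N. \<forall>j\<ge>N. \<forall>x. cmod (pderivs is (pderivs [a] (f i)) x - pderivs is (pderivs [a] (f j)) x) < e"
      using Suc.prems(2)[of "is @ [a]" e] by (simp only: pderivs_append[symmetric]) simp
  qed
  then obtain g where g: "\<And>a. Ck_on q UNIV (g a)"
    "\<And>a is e. length is \<le> q \<Longrightarrow> e > 0 \<Longrightarrow> \<exists>N. \<forall>i\<ge>N. \<forall>x. cmod (pderivs is (pderivs [a] (f i)) x - pderivs is (g a) x) \<le> e"
    by metis
  let ?f' = "\<lambda>n x v. \<Sum>a\<in>UNIV. v $ a *\<^sub>R pderivs [a] (f n) x"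
  let ?g' = "\<lambda>x v. \<Sum>a\<in>UNIV. v $ a *\<^sub>R g a x"
  have fd: "f n differentiable (at x)" for n x using Suc.prems(1)[of n] by simp
  have lim0: "(\<lambda>n. f n x) \<longlonglongrightarrow> w x" for x
  proof (rule LIMSEQ_I)
    fix r :: real assume "r > 0"
    then obtain N where "\<forall>i\<ge>N. \<forall>x. cmod (f i x - w x) \<le> r / 2" using w[of "[]" "r / 2"] by auto
    then show "\<exists>no. \<forall>n\<ge>no. norm (f n x - w x) < r" using \<open>r > 0\<close>
      by (intro exI[of _ N]) (smt (verit, best) field_sum_of_halves)
  qed
  have "\<exists>h. \<forall>x\<in>UNIV. (\<lambda>n. f n x) \<longlonglongrightarrow> h x \<and> (h has_derivative ?g' x) (at x within UNIV)"
  proof (rule has_derivative_sequence[where f="f" and f'="?f'"])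
    show "(f n has_derivative ?f' n x) (at x within UNIV)" for n x
      using fd[of n x] frechet_eq_sum_pderivs[OF fd] unfolding frechet_derivative_works
      by (metis (no_types, lifting) ext)
    fix e :: real assume "e > 0"
    \<comment> \<open>The derivative in direction h is a sum over n coordinates, each of which gets
      an equal share of the error.\<close>
    then have e: "e / real CARD('n) > 0" by simp
    have "\<forall>a. \<forall>\<^sub>F n in sequentially. \<forall>x. cmod (pderivs [a] (f n) x - g a x) \<le> e / real CARD('n)"
      using g(2)[of "[]", OF _ e] by (auto simp: eventually_sequentially)
    then have "\<forall>\<^sub>F n in sequentially. \<forall>a\<in>UNIV. \<forall>x. cmod (pderivs [a] (f n) x - g a x) \<le> e / real CARD('n)"
      by (intro eventually_ball_finite) auto
    then show "\<forall>\<^sub>F n in sequentially. \<forall>x\<in>UNIV. \<forall>h. norm (?f' n x h - ?g' x h) \<le> e * norm h"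
    proof (rule eventually_mono, intro ballI allI)
      fix n x h assume *: "\<forall>a\<in>UNIV. \<forall>x. cmod (pderivs [a] (f n) x - g a x) \<le> e / real CARD('n)"
      have "?f' n x h - ?g' x h = (\<Sum>a\<in>UNIV. h $ a *\<^sub>R (pderivs [a] (f n) x - g a x))"
        by (simp only: scaleR_diff_right sum_subtractf)
      also have "norm \<dots> \<le> (\<Sum>a\<in>(UNIV::'n set). norm h * (e / real CARD('n)))"
      proof (rule sum_norm_le)
        fix a
        have "\<bar>h $ a\<bar> * cmod (pderivs [a] (f n) x - g a x) \<le> norm h * (e / real CARD('n))"
          using *[rule_format, of a x] component_le_norm_cart[of h a] by (intro mult_mono) auto
        then show "norm (h $ a *\<^sub>R (pderivs [a] (f n) x - g a x)) \<le> norm h * (e / real CARD('n))"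
          by (simp only: norm_scaleR)
      qed
      also have "\<dots> = e * norm h" by simp
      finally show "norm (?f' n x h - ?g' x h) \<le> e * norm h" .
    qed
  qed (use lim0 in auto)
  then obtain h where h: "\<And>x. (\<lambda>n. f n x) \<longlonglongrightarrow> h x" "\<And>x. (h has_derivative ?g' x) (at x)" by auto
  have "h x = w x" for x by (rule LIMSEQ_unique[OF h(1) lim0])
  then have hw: "h = w" by auto
  have dw: "pderivs [a] w = g a" for a
    using has_derivative_imp_frechet[OF h(2)] unfolding hw
    by (auto simp: axis_def if_distrib[of "\<lambda>c. c *\<^sub>R _"] cong: if_cong)
  have "Ck_on (Suc q) UNIV w"
  proof (rule Ck_on_Suc_pderivI)
    show "w differentiable (at x)" for x using h(2) unfolding hw by (auto simp: differentiable_def)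
    show "Ck_on q UNIV (pderivs [a] w)" for a unfolding dw by (rule g(1))
  qed simp
  moreover have "\<exists>N. \<forall>i\<ge>N. \<forall>x. cmod (pderivs is (f i) x - pderivs is w x) \<le> e" if l: "length is \<le> Suc q" and e: "e > 0" for "is" e
  proof (cases "length is \<le> q")
    case True
    then show ?thesis using w e by blast
  next
    case False
    then have "is \<noteq> []" by auto
    \<comment> \<open>The last entry of the list is the innermost derivative, so it is split off at
      the end: the remaining list acts on \<open>pderivs [a]\<close>.\<close>
    then obtain js a where js: "is = js @ [a]" by (metis rev_exhaust)
    then have "length js \<le> q" using l by simp
    then show ?thesis using g(2)[of js e a] e unfolding js pderivs_append dw by blast
  qed
  ultimately show ?case by blast
qed

section \<open>Sections of a localized bundle\<close>

lemma sum_vec_axis: "(\<Sum>m\<in>UNIV. a $ m *s axis m 1) = (a :: complex^'p::finite)"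
  by (simp add: vec_eq_iff axis_def if_distrib sum.delta cong: if_cong)

locale localized_bundle =
  fixes E :: "('m::{t2_space, second_countable_topology},
               'v::{t2_space, second_countable_topology}, 'n::finite, 'p::finite) vbundle"
    and L :: "('m, 'v, 'n, 'p) localization"
  assumes compact_base: "compact (UNIV :: 'm set)"
    and bundle_E: "smooth_vector_bundle E"
    and admissible: "admissible_localization E L"
begin

definition "indices = {1..num L}"
definition "\<Gamma> j = range (chart L j)"
definition "chart_inv j = inv_into UNIV (chart L j)"
definition "inv_triv j = inv_into (proj E -` \<Gamma> j) (triv L j)"

lemma atlases: "top_atlas (base_atlas E)" "top_atlas (total_atlas E)" "smooth_atlas (base_atlas E)"
    "top_atlas (prod_atlas (base_atlas E) :: ('m \<times> (complex^'p), (real^'n) \<times> (complex^'p)) charts)"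
    "top_atlas (std_atlas :: (real^'n, real^'n) charts)"
    "top_atlas (std_atlas :: (complex^'p, complex^'p) charts)" "top_atlas (std_atlas :: (real, real) charts)"
  using bundle_E by (auto simp: smooth_vector_bundle_def intro: smooth_atlas_imp_top top_atlas_prod top_atlas_std)

lemma proj_props: "proj E v = proj E w \<Longrightarrow> proj E (fadd E v w) = proj E v" "proj E (fscale E c v) = proj E v"
  using bundle_E by (auto simp: smooth_vector_bundle_def)

lemma chart_props:
  assumes "j \<in> indices"
  shows "open (\<Gamma> j)" "inj (chart L j)" "Ck_map_on k std_atlas (base_atlas E) UNIV (chart L j)"
    "Ck_map_on k (base_atlas E) std_atlas (\<Gamma> j) (chart_inv j)" "x \<in> \<Gamma> j \<Longrightarrow> chart L j (chart_inv j x) = x"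
    "chart_inv j (chart L j y) = y" "chart L j y \<in> \<Gamma> j"
proof -
  have d: "diffeo std_atlas (base_atlas E) UNIV (\<Gamma> j) (chart L j)"
    using admissible assms by (auto simp: admissible_localization_def indices_def \<Gamma>_def)
  show "open (\<Gamma> j)" "Ck_map_on k std_atlas (base_atlas E) UNIV (chart L j)"
    "Ck_map_on k (base_atlas E) std_atlas (\<Gamma> j) (chart_inv j)"
    using d unfolding diffeo_def chart_inv_def by (auto intro: smooth_map_on_imp_Ck)
  show inj: "inj (chart L j)" using d by (auto simp: diffeo_def bij_betw_def)
  show "x \<in> \<Gamma> j \<Longrightarrow> chart L j (chart_inv j x) = x" by (simp add: \<Gamma>_def chart_inv_def f_inv_into_f)
  show "chart_inv j (chart L j y) = y" by (simp add: chart_inv_def inj)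
  show "chart L j y \<in> \<Gamma> j" by (simp add: \<Gamma>_def)
qed

lemma triv_local: "j \<in> indices \<Longrightarrow> local_trivialization E (\<Gamma> j) (triv L j)"
  using admissible by (auto simp: admissible_localization_def indices_def \<Gamma>_def)

lemma triv_props:
  assumes "j \<in> indices"
  shows "open (proj E -` \<Gamma> j)" "Ck_map_on k (total_atlas E) (prod_atlas (base_atlas E)) (proj E -` \<Gamma> j) (triv L j)"
    "Ck_map_on k (prod_atlas (base_atlas E)) (total_atlas E) (\<Gamma> j \<times> UNIV) (inv_triv j)"
    "open (\<Gamma> j \<times> (UNIV :: (complex^'p) set))"
    "proj E v \<in> \<Gamma> j \<Longrightarrow> fst (triv L j v) = proj E v"
    "proj E v \<in> \<Gamma> j \<Longrightarrow> proj E v = proj E w \<Longrightarrow> snd (triv L j (fadd E v w)) = snd (triv L j v) + snd (triv L j w)"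
    "proj E v \<in> \<Gamma> j \<Longrightarrow> snd (triv L j (fscale E c v)) = c *s snd (triv L j v)"
    "x \<in> \<Gamma> j \<Longrightarrow> triv L j (inv_triv j (x, a)) = (x, a)" "x \<in> \<Gamma> j \<Longrightarrow> proj E (inv_triv j (x, a)) = x"
    "proj E v \<in> \<Gamma> j \<Longrightarrow> inv_triv j (proj E v, snd (triv L j v)) = v"
proof -
  have d: "diffeo (total_atlas E) (prod_atlas (base_atlas E)) (proj E -` \<Gamma> j) (\<Gamma> j \<times> UNIV) (triv L j)"
    and p: "\<And>v. proj E v \<in> \<Gamma> j \<Longrightarrow> fst (triv L j v) = proj E v"
    and a: "\<And>v w. proj E v \<in> \<Gamma> j \<Longrightarrow> proj E w \<in> \<Gamma> j \<Longrightarrow> proj E v = proj E w \<Longrightarrow> snd (triv L j (fadd E v w)) = snd (triv L j v) + snd (triv L j w)"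
    and s: "\<And>c v. proj E v \<in> \<Gamma> j \<Longrightarrow> snd (triv L j (fscale E c v)) = c *s snd (triv L j v)"
    using triv_local[OF assms] by (auto simp: local_trivialization_def)
  have bij: "bij_betw (triv L j) (proj E -` \<Gamma> j) (\<Gamma> j \<times> UNIV)" using d by (simp add: diffeo_def)
  show "open (proj E -` \<Gamma> j)" "Ck_map_on k (total_atlas E) (prod_atlas (base_atlas E)) (proj E -` \<Gamma> j) (triv L j)"
    "Ck_map_on k (prod_atlas (base_atlas E)) (total_atlas E) (\<Gamma> j \<times> UNIV) (inv_triv j)"
    "open (\<Gamma> j \<times> (UNIV :: (complex^'p) set))"
    using d unfolding diffeo_def inv_triv_def by (auto intro: smooth_map_on_imp_Ck)
  show "proj E v \<in> \<Gamma> j \<Longrightarrow> fst (triv L j v) = proj E v" by (rule p)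
  show "proj E v \<in> \<Gamma> j \<Longrightarrow> proj E v = proj E w \<Longrightarrow> snd (triv L j (fadd E v w)) = snd (triv L j v) + snd (triv L j w)"
    using a by metis
  show "proj E v \<in> \<Gamma> j \<Longrightarrow> snd (triv L j (fscale E c v)) = c *s snd (triv L j v)" by (rule s)
  have t: "triv L j (inv_triv j (x, a)) = (x, a)" "inv_triv j (x, a) \<in> proj E -` \<Gamma> j" if "x \<in> \<Gamma> j" for x a
  proof -
    have "(x, a) \<in> triv L j ` (proj E -` \<Gamma> j)" using bij that by (auto simp: bij_betw_def)
    then show "triv L j (inv_triv j (x, a)) = (x, a)" "inv_triv j (x, a) \<in> proj E -` \<Gamma> j"
      unfolding inv_triv_def by (rule f_inv_into_f, rule inv_into_into)
  qed
  show "x \<in> \<Gamma> j \<Longrightarrow> triv L j (inv_triv j (x, a)) = (x, a)" by (rule t)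
  show "x \<in> \<Gamma> j \<Longrightarrow> proj E (inv_triv j (x, a)) = x" using t p by (metis fst_conv vimageD)
  show "inv_triv j (proj E v, snd (triv L j v)) = v" if "proj E v \<in> \<Gamma> j"
  proof -
    have "(proj E v, snd (triv L j v)) = triv L j v" using p[OF that] by (metis prod.collapse)
    then show ?thesis unfolding inv_triv_def using bij that by (simp add: bij_betw_def)
  qed
qed

lemma cutoff_props:
  assumes "j \<in> indices"
  shows "Ck_map_on k (base_atlas E) std_atlas UNIV (cutoff L j)" "0 \<le> cutoff L j x"
    "closure {x. cutoff L j x \<noteq> 0} \<subseteq> \<Gamma> j" "x \<notin> \<Gamma> j \<Longrightarrow> cutoff L j x = 0"
proof -
  have *: "smooth_map_on (base_atlas E) std_atlas UNIV (cutoff L j)" "0 \<le> cutoff L j x"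
    "closure {x. cutoff L j x \<noteq> 0} \<subseteq> \<Gamma> j"
    using admissible assms by (auto simp: admissible_localization_def indices_def \<Gamma>_def)
  show "Ck_map_on k (base_atlas E) std_atlas UNIV (cutoff L j)" "0 \<le> cutoff L j x"
    "closure {x. cutoff L j x \<noteq> 0} \<subseteq> \<Gamma> j" using * by (auto intro: smooth_map_on_imp_Ck)
  show "x \<notin> \<Gamma> j \<Longrightarrow> cutoff L j x = 0" using *(3) closure_subset[of "{x. cutoff L j x \<noteq> 0}"] by blast
qed

lemma cutoff_sum: "(\<Sum>j\<in>indices. cutoff L j x) = 1"
  using admissible by (simp add: admissible_localization_def indices_def)

lemma finite_indices: "finite indices" by (simp add: indices_def)

lemma cutoff_cover: obtains j where "j \<in> indices" "x \<in> \<Gamma> j" "cutoff L j x \<noteq> 0"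
proof -
  have "\<exists>j\<in>indices. cutoff L j x \<noteq> 0" using cutoff_sum[of x] by (metis sum.neutral zero_neq_one)
  then show ?thesis using that cutoff_props(4) by blast
qed

text \<open>The component vector of the section in the j-th chart before the cut-off is applied. It
  determines the section on the patch, whereas the local parts do so only where the cut-off is
  nonzero.\<close>

definition coord :: "nat \<Rightarrow> ('m \<Rightarrow> 'v) \<Rightarrow> real^'n \<Rightarrow> complex^'p" where
  "coord j u y = snd (triv L j (u (chart L j y)))"

definition is_section :: "('m \<Rightarrow> 'v) \<Rightarrow> bool" where
  "is_section u \<longleftrightarrow> (\<forall>x. proj E (u x) = x)"

lemma is_sectionD: "is_section u \<Longrightarrow> proj E (u x) = x" by (simp add: is_section_def)

lemma section_from_coord:
  assumes "is_section u" "j \<in> indices" "x \<in> \<Gamma> j"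
  shows "u x = inv_triv j (x, coord j u (chart_inv j x))"
  using triv_props(10)[OF assms(2), of "u x"] chart_props(5)[OF assms(2,3)] assms
  by (simp add: coord_def is_sectionD)

lemma coord_add:
  assumes "is_section u" "is_section v" "j \<in> indices"
  shows "coord j (\<lambda>x. fadd E (u x) (v x)) y = coord j u y + coord j v y"
  unfolding coord_def by (rule triv_props(6)[OF assms(3)]) (use assms chart_props(7) in \<open>auto simp: is_sectionD\<close>)

lemma coord_scale:
  assumes "is_section u" "j \<in> indices"
  shows "coord j (\<lambda>x. fscale E (c x) (u x)) y = c (chart L j y) *s coord j u y"
  unfolding coord_def by (rule triv_props(7)[OF assms(2)]) (use assms chart_props(7) in \<open>auto simp: is_sectionD\<close>)

lemma section_add: "is_section u \<Longrightarrow> is_section v \<Longrightarrow> is_section (\<lambda>x. fadd E (u x) (v x))"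
  using proj_props by (simp add: is_section_def)

lemma section_scale: "is_section u \<Longrightarrow> is_section (\<lambda>x. fscale E (c x) (u x))"
  using proj_props by (simp add: is_section_def)

lemma section_eqI:
  assumes "is_section u" "is_section v" "\<And>j y. j \<in> indices \<Longrightarrow> cutoff L j (chart L j y) \<noteq> 0 \<Longrightarrow> coord j u y = coord j v y"
  shows "u = v"
proof
  fix x
  obtain j where j: "j \<in> indices" "x \<in> \<Gamma> j" "cutoff L j x \<noteq> 0" by (rule cutoff_cover)
  show "u x = v x"
    using section_from_coord[OF assms(1) j(1,2)] section_from_coord[OF assms(2) j(1,2)] assms(3)[OF j(1), of "chart_inv j x"]
      chart_props(5)[OF j(1,2)] j(3) by simp
qed

lemma Ck_coord:
  assumes u: "u \<in> Ck_sections E k" and j: "j \<in> indices"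
  shows "Ck_on k UNIV (coord j u)"
proof -
  have sec: "is_section u" and uk: "Ck_map_on k (base_atlas E) (total_atlas E) UNIV u"
    using u by (auto simp: Ck_sections_def is_section_def)
  have 1: "Ck_map_on k std_atlas (total_atlas E) UNIV (\<lambda>y. u (chart L j y))"
    by (rule Ck_map_on_compose[OF atlases(5,1,2) open_UNIV open_UNIV _ chart_props(3)[OF j] uk]) simp
  have 2: "Ck_map_on k std_atlas (prod_atlas (base_atlas E)) UNIV (\<lambda>y. triv L j (u (chart L j y)))"
    by (rule Ck_map_on_compose[OF atlases(5,2,4) open_UNIV triv_props(1)[OF j] _ 1 triv_props(2)[OF j]])
      (use chart_props(7)[OF j] sec in \<open>auto simp: is_sectionD\<close>)
  have "Ck_map_on k std_atlas std_atlas UNIV (\<lambda>y. snd (triv L j (u (chart L j y))))"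
    by (rule Ck_map_on_compose[OF atlases(5,4,6) open_UNIV open_UNIV _ 2 Ck_map_on_snd[OF atlases(1)]]) simp
  then show ?thesis by (simp add: Ck_map_on_std coord_def[abs_def])
qed

text \<open>On a patch the section is recovered from its components through the inverse
  trivialization, a smooth map. Differentiability of the components near each point, in one patch
  containing it, is therefore enough.\<close>

lemma Ck_sectionsI:
  assumes sec: "is_section u"
    and loc: "\<And>x. \<exists>j\<in>indices. x \<in> \<Gamma> j \<and> (\<exists>N. open N \<and> chart_inv j x \<in> N \<and> Ck_on k N (coord j u))"
  shows "u \<in> Ck_sections E k"
proof -
  have "Ck_map_on k (base_atlas E) (total_atlas E) UNIV u"
  proof (rule Ck_map_on_local[OF atlases(1,2)])
    fix x
    obtain j N where j: "j \<in> indices" "x \<in> \<Gamma> j" and N: "open N" "chart_inv j x \<in> N" "Ck_on k N (coord j u)"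
      using loc[of x] by blast
    define M where "M = \<Gamma> j \<inter> chart_inv j -` N"
    have M: "open M" unfolding M_def
      by (rule open_vimage_Int[OF chart_props(1)[OF j(1)] Ck_map_onD(1)[OF chart_props(4)[OF j(1)]] N(1)])
    have c: "Ck_map_on k (base_atlas E) std_atlas M (chart_inv j)"
      by (rule Ck_map_on_subset[OF chart_props(4)[OF j(1)]]) (simp add: M_def)
    have cu: "Ck_map_on k std_atlas std_atlas N (coord j u)" using N(3) by (simp add: Ck_map_on_std)
    have 1: "Ck_map_on k (base_atlas E) std_atlas M (\<lambda>x. coord j u (chart_inv j x))"
      by (rule Ck_map_on_compose[OF atlases(1,5,6) M N(1) _ c cu]) (simp add: M_def)
    have 2: "Ck_map_on k (base_atlas E) (prod_atlas (base_atlas E)) M (\<lambda>x. (x, coord j u (chart_inv j x)))"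
      by (rule Ck_map_on_Pair[OF atlases(1,1) M Ck_map_on_id[OF atlases(3) M] 1])
    have 3: "Ck_map_on k (base_atlas E) (total_atlas E) M (\<lambda>x. inv_triv j (x, coord j u (chart_inv j x)))"
      by (rule Ck_map_on_compose[OF atlases(1,4,2) M triv_props(4)[OF j(1)] _ 2 triv_props(3)[OF j(1)]])
        (simp add: M_def)
    have "Ck_map_on k (base_atlas E) (total_atlas E) M u"
      by (rule Ck_map_on_cong[OF atlases(1,2) M _ 3])
        (use section_from_coord[OF sec j(1)] in \<open>auto simp: M_def\<close>)
    then show "\<exists>N. open N \<and> x \<in> N \<and> Ck_map_on k (base_atlas E) (total_atlas E) N u"
      using M j N by (intro exI[of _ M]) (auto simp: M_def)
  qed
  then show ?thesis using sec by (simp add: Ck_sections_def is_section_def)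
qed

lemma Ck_sectionsI_coord:
  assumes sec: "is_section u" and "\<And>j. j \<in> indices \<Longrightarrow> Ck_on k UNIV (coord j u)"
  shows "u \<in> Ck_sections E k"
proof (rule Ck_sectionsI[OF sec])
  fix x
  obtain j where "j \<in> indices" "x \<in> \<Gamma> j" by (rule cutoff_cover)
  then show "\<exists>j\<in>indices. x \<in> \<Gamma> j \<and> (\<exists>N. open N \<and> chart_inv j x \<in> N \<and> Ck_on k N (coord j u))"
    using assms(2) by (intro bexI[of _ j] conjI exI[of _ UNIV]) auto
qed

lemma Ck_sections_section: "u \<in> Ck_sections E k \<Longrightarrow> is_section u"
  by (simp add: Ck_sections_def is_section_def)

lemma smooth_sections_iff: "u \<in> smooth_sections E \<longleftrightarrow> (\<forall>k. u \<in> Ck_sections E k)"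
  by (auto simp: smooth_sections_def Ck_sections_def smooth_map_on_def)

lemma Ck_sections_add:
  assumes "u \<in> Ck_sections E k" "v \<in> Ck_sections E k"
  shows "(\<lambda>x. fadd E (u x) (v x)) \<in> Ck_sections E k"
proof (rule Ck_sectionsI_coord)
  note sec = Ck_sections_section[OF assms(1)] Ck_sections_section[OF assms(2)]
  show "is_section (\<lambda>x. fadd E (u x) (v x))" by (rule section_add[OF sec])
  show "Ck_on k UNIV (coord j (\<lambda>x. fadd E (u x) (v x)))" if "j \<in> indices" for j
    by (rule Ck_on_cong_imp[OF open_UNIV _ Ck_on_add[OF open_UNIV Ck_coord[OF assms(1) that] Ck_coord[OF assms(2) that]]])
      (simp add: coord_add[OF sec that])
qed

lemma bounded_linear_vector_scale: "bounded_linear (\<lambda>a::complex^'p. c *s a)"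
  by (intro linear_conv_bounded_linear[THEN iffD1] linearI) (auto simp: vec_eq_iff algebra_simps)

lemma Ck_sections_scale:
  assumes "u \<in> Ck_sections E k"
  shows "(\<lambda>x. fscale E c (u x)) \<in> Ck_sections E k"
proof (rule Ck_sectionsI_coord)
  note sec = Ck_sections_section[OF assms(1)]
  show "is_section (\<lambda>x. fscale E c (u x))" by (rule section_scale[OF sec])
  show "Ck_on k UNIV (coord j (\<lambda>x. fscale E c (u x)))" if "j \<in> indices" for j
    by (rule Ck_on_cong_imp[OF open_UNIV _
          Ck_on_bounded_linear_compose[OF open_UNIV bounded_linear_vector_scale Ck_coord[OF assms(1) that]], of c])
      (simp add: coord_scale[OF sec that, of "\<lambda>_. c"])
qed

section \<open>Local parts of a section\<close>

abbreviation "lp j k u \<equiv> local_part E L j k u"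

lemma lp_eq:
  assumes "is_section u" "j \<in> indices"
  shows "lp j k u y = complex_of_real (cutoff L j (chart L j y)) * coord j u y $ k"
  using coord_scale[OF assms, of "\<lambda>x. complex_of_real (cutoff L j x)" y]
  by (simp add: local_part_def coord_def)

lemma lp_add:
  assumes "is_section u" "is_section v" "j \<in> indices"
  shows "lp j k (\<lambda>x. fadd E (u x) (v x)) y = lp j k u y + lp j k v y"
  by (simp add: lp_eq assms section_add coord_add distrib_left)

lemma lp_scale:
  assumes "is_section u" "j \<in> indices"
  shows "lp j k (\<lambda>x. fscale E c (u x)) y = c * lp j k u y"
  using coord_scale[OF assms, of "\<lambda>_. c" y] section_scale[OF assms(1), of "\<lambda>_. c"]
  by (simp add: lp_eq assms)

lemma section_eq_lpI:
  assumes "is_section u" "is_section v" "\<And>j k y. j \<in> indices \<Longrightarrow> lp j k u y = lp j k v y"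
  shows "u = v"
proof (rule section_eqI[OF assms(1,2)])
  fix j y assume "j \<in> indices" "cutoff L j (chart L j y) \<noteq> 0"
  then show "coord j u y = coord j v y" using assms(3)[of j _ y]
    by (simp add: lp_eq assms(1,2) vec_eq_iff)
qed

text \<open>The support of the cut-off read in coordinates. It is compact because the base is
  compact and the support lies inside the patch; hence local parts of smooth sections are test
  functions with common supports.\<close>

definition "cutoff_support j = chart_inv j ` closure {x. cutoff L j x \<noteq> 0}"

lemma cutoff_support_compact: "j \<in> indices \<Longrightarrow> compact (cutoff_support j)"
  unfolding cutoff_support_def
proof (rule compact_continuous_image)
  assume j: "j \<in> indices"
  show "continuous_on (closure {x. cutoff L j x \<noteq> 0}) (chart_inv j)"
    using Ck_map_onD(1)[OF chart_props(4)[OF j]] cutoff_props(3)[OF j] continuous_on_subset by blast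
  have "compact (UNIV \<inter> closure {x. cutoff L j x \<noteq> 0})"
    by (rule compact_Int_closed[OF compact_base closed_closure])
  then show "compact (closure {x. cutoff L j x \<noteq> 0})" by simp
qed

lemma cutoff_support_iff: "j \<in> indices \<Longrightarrow> y \<in> cutoff_support j \<longleftrightarrow> chart L j y \<in> closure {x. cutoff L j x \<noteq> 0}"
  using cutoff_props(3)[of j] chart_props(5,6)[of j] unfolding cutoff_support_def by (metis (no_types, lifting) image_iff subsetD)

lemma cutoff_outside_support: "j \<in> indices \<Longrightarrow> y \<notin> cutoff_support j \<Longrightarrow> cutoff L j (chart L j y) = 0"
  using cutoff_support_iff closure_subset[of "{x. cutoff L j x \<noteq> 0}"] by blast

lemma lp_outside: "is_section u \<Longrightarrow> j \<in> indices \<Longrightarrow> y \<notin> cutoff_support j \<Longrightarrow> lp j k u y = 0"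
  by (simp add: lp_eq cutoff_outside_support)

lemma cutoff_chart_Ck: "j \<in> indices \<Longrightarrow> Ck_on k UNIV (\<lambda>y. cutoff L j (chart L j y))"
  using Ck_map_on_compose[OF atlases(5,1,7) open_UNIV open_UNIV _ chart_props(3) cutoff_props(1)]
  by (simp add: Ck_map_on_std)

lemma lp_Ck:
  assumes "u \<in> Ck_sections E k" "j \<in> indices"
  shows "Ck_on k UNIV (lp j m u)"
proof -
  have "Ck_on k UNIV (\<lambda>y. complex_of_real (cutoff L j (chart L j y)) * coord j u y $ m)"
    by (intro Ck_on_mult open_UNIV Ck_on_bounded_linear_compose[OF open_UNIV bounded_linear_of_real]
        cutoff_chart_Ck Ck_on_bounded_linear_compose[OF open_UNIV bounded_linear_vec_nth] Ck_coord assms)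
  then show ?thesis
    by (rule Ck_on_cong_imp[OF open_UNIV, rotated]) (simp add: lp_eq[OF Ck_sections_section[OF assms(1)] assms(2)])
qed

lemma lp_test:
  assumes "u \<in> smooth_sections E" "j \<in> indices"
  shows "lp j m u \<in> test_functions"
proof (rule test_functionsI[OF _ cutoff_support_compact[OF assms(2)]])
  show "smooth_on UNIV (lp j m u)"
    unfolding smooth_on_def using lp_Ck assms by (simp add: smooth_sections_iff)
  have "is_section u" using assms(1) Ck_sections_section by (auto simp: smooth_sections_iff)
  then show "lp j m u x = 0" if "x \<notin> cutoff_support j" for x using lp_outside that assms(2) by blast
qed

section \<open>Change of chart and of frame\<close>

definition "overlap j l = chart L j -` \<Gamma> l"
definition "chart_change j l y = chart_inv l (chart L j y)"
text \<open>The m-th column of the transition matrix from frame l to frame j, as a function of the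
  coordinates of chart j.\<close>

definition "frame_change j l m y = snd (triv L j (inv_triv l (chart L j y, axis m 1)))"

lemma open_overlap: "j \<in> indices \<Longrightarrow> l \<in> indices \<Longrightarrow> open (overlap j l)"
  using open_vimage_Int[OF open_UNIV Ck_map_onD(1)[OF chart_props(3)] chart_props(1)] by (simp add: overlap_def)

lemma chart_change_Ck:
  assumes "j \<in> indices" "l \<in> indices"
  shows "Ck_on k (overlap j l) (chart_change j l)"
proof -
  have "Ck_map_on k std_atlas std_atlas (overlap j l) (\<lambda>y. chart_inv l (chart L j y))"
    by (rule Ck_map_on_compose[OF atlases(5,1,5) open_overlap[OF assms] chart_props(1)[OF assms(2)] _
          Ck_map_on_subset[OF chart_props(3)[OF assms(1)]] chart_props(4)[OF assms(2)]]) (auto simp: overlap_def)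
  then show ?thesis by (simp add: Ck_map_on_std chart_change_def[abs_def])
qed

lemma frame_change_Ck:
  assumes "j \<in> indices" "l \<in> indices"
  shows "Ck_on k (overlap j l) (frame_change j l m)"
proof -
  note o = open_overlap[OF assms]
  have 0: "Ck_map_on k std_atlas (base_atlas E) (overlap j l) (chart L j)"
    by (rule Ck_map_on_subset[OF chart_props(3)[OF assms(1)]]) simp
  have 1: "Ck_map_on k std_atlas (prod_atlas (base_atlas E)) (overlap j l) (\<lambda>y. (chart L j y, axis m (1::complex)))"
    by (rule Ck_map_on_Pair[OF atlases(5,1) o 0 Ck_map_on_const[OF atlases(5)]])
  have 2: "Ck_map_on k std_atlas (total_atlas E) (overlap j l) (\<lambda>y. inv_triv l (chart L j y, axis m 1))"
    by (rule Ck_map_on_compose[OF atlases(5,4,2) o triv_props(4)[OF assms(2)] _ 1 triv_props(3)[OF assms(2)]])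
      (auto simp: overlap_def)
  have 3: "Ck_map_on k std_atlas (prod_atlas (base_atlas E)) (overlap j l) (\<lambda>y. triv L j (inv_triv l (chart L j y, axis m 1)))"
    by (rule Ck_map_on_compose[OF atlases(5,2,4) o triv_props(1)[OF assms(1)] _ 2 triv_props(2)[OF assms(1)]])
      (use triv_props(9)[OF assms(2)] chart_props(7)[OF assms(1)] in \<open>auto simp: overlap_def\<close>)
  have "Ck_map_on k std_atlas std_atlas (overlap j l) (\<lambda>y. snd (triv L j (inv_triv l (chart L j y, axis m 1))))"
    by (rule Ck_map_on_compose[OF atlases(5,4,6) o open_UNIV _ 3 Ck_map_on_snd[OF atlases(1)]]) simp
  then show ?thesis by (simp add: Ck_map_on_std frame_change_def[abs_def])
qed

text \<open>Trivializations respect the fibre operations. Hence the vector with components a + b in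
  frame l is the fibre sum of the vectors with components a and b, and reading it in frame j gives
  additivity; homogeneity is similar.\<close>

lemma transition_linear:
  assumes "j \<in> indices" "l \<in> indices" "y \<in> overlap j l"
  shows "snd (triv L j (inv_triv l (chart L j y, a))) = (\<Sum>m\<in>UNIV. a $ m *s frame_change j l m y)"
proof -
  let ?x = "chart L j y"
  let ?G = "\<lambda>a. snd (triv L j (inv_triv l (?x, a)))"
  have xl: "?x \<in> \<Gamma> l" using assms(3) by (simp add: overlap_def)
  have xj: "?x \<in> \<Gamma> j" by (rule chart_props(7)[OF assms(1)])
  note t = triv_props(8)[OF assms(2) xl] triv_props(9)[OF assms(2) xl]
  have add: "?G (a + b) = ?G a + ?G b" for a b
  proof -
    let ?v = "inv_triv l (?x, a)" and ?w = "inv_triv l (?x, b)"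
    have p: "proj E (fadd E ?v ?w) = ?x" using proj_props(1)[of ?v ?w] t by simp
    have "snd (triv L l (fadd E ?v ?w)) = a + b"
      using triv_props(6)[OF assms(2), of ?v ?w] t xl by simp
    then have "fadd E ?v ?w = inv_triv l (?x, a + b)"
      using triv_props(10)[OF assms(2), of "fadd E ?v ?w"] p xl by simp
    then show ?thesis using triv_props(6)[OF assms(1), of ?v ?w] t xj by metis
  qed
  have scale: "?G (c *s a) = c *s ?G a" for c a
  proof -
    let ?v = "inv_triv l (?x, a)"
    have p: "proj E (fscale E c ?v) = ?x" using proj_props(2)[of c ?v] t by simp
    have "snd (triv L l (fscale E c ?v)) = c *s a"
      using triv_props(7)[OF assms(2), of ?v] t xl by simp
    then have "fscale E c ?v = inv_triv l (?x, c *s a)"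
      using triv_props(10)[OF assms(2), of "fscale E c ?v"] p xl by simp
    then show ?thesis using triv_props(7)[OF assms(1), of ?v] t xj by metis
  qed
  have zero: "?G 0 = 0" using scale[of 0 0] by simp
  have sum: "?G (\<Sum>m\<in>S. f m) = (\<Sum>m\<in>S. ?G (f m))" if "finite S" for f and S :: "'p set"
    using that by induction (simp_all add: zero add)
  have "?G a = ?G (\<Sum>m\<in>UNIV. a $ m *s axis m 1)" by (simp add: sum_vec_axis)
  also have "\<dots> = (\<Sum>m\<in>UNIV. a $ m *s frame_change j l m y)"
    by (subst sum) (simp_all add: scale frame_change_def)
  finally show ?thesis .
qed

lemma coord_transition:
  assumes "is_section u" "j \<in> indices" "l \<in> indices" "y \<in> overlap j l"
  shows "coord j u y = (\<Sum>m\<in>UNIV. coord l u (chart_change j l y) $ m *s frame_change j l m y)"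
proof -
  let ?x = "chart L j y"
  have xl: "?x \<in> \<Gamma> l" using assms(4) by (simp add: overlap_def)
  have "u ?x = inv_triv l (?x, coord l u (chart_inv l ?x))" by (rule section_from_coord[OF assms(1,3) xl])
  then have "coord j u y = snd (triv L j (inv_triv l (?x, coord l u (chart_inv l ?x))))" by (simp add: coord_def)
  then show ?thesis by (simp add: transition_linear[OF assms(2-4)] chart_change_def)
qed

lemma chart_chart_change: "j \<in> indices \<Longrightarrow> l \<in> indices \<Longrightarrow> y \<in> overlap j l \<Longrightarrow> chart L l (chart_change j l y) = chart L j y"
  by (simp add: chart_change_def overlap_def chart_props(5))

text \<open>The identity that u is the sum of its cut-off pieces, read in chart j, with an arbitrary
  family W in place of the local parts. For local parts it returns \<open>coord\<close>, and for
  limits of local parts it produces the components of the limit.\<close>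

definition "glue W j y = (\<Sum>l\<in>indices. if y \<in> overlap j l then \<Sum>m\<in>UNIV. W l m (chart_change j l y) *s frame_change j l m y else 0)"

lemma coord_eq_glue:
  assumes "is_section u" "j \<in> indices"
  shows "coord j u y = glue (\<lambda>l m. lp l m u) j y"
proof -
  have "coord j u y = (\<Sum>l\<in>indices. complex_of_real (cutoff L l (chart L j y)) *s coord j u y)"
  proof -
    have "(\<Sum>l\<in>indices. complex_of_real (cutoff L l (chart L j y)) *s coord j u y) =
        (\<Sum>l\<in>indices. complex_of_real (cutoff L l (chart L j y))) *s coord j u y"
      by (simp add: vec_eq_iff sum_distrib_right)
    also have "(\<Sum>l\<in>indices. complex_of_real (cutoff L l (chart L j y))) = 1"
      using cutoff_sum by (simp only: of_real_sum[symmetric]) simp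
    finally show ?thesis by simp
  qed
  also have "\<dots> = glue (\<lambda>l m. lp l m u) j y"
    unfolding glue_def
  proof (rule sum.cong[OF refl])
    fix l assume l: "l \<in> indices"
    show "complex_of_real (cutoff L l (chart L j y)) *s coord j u y =
      (if y \<in> overlap j l then \<Sum>m\<in>UNIV. lp l m u (chart_change j l y) *s frame_change j l m y else 0)"
    proof (cases "y \<in> overlap j l")
      case True
      then show ?thesis
        by (simp add: coord_transition[OF assms(1,2) l True] lp_eq[OF assms(1) l] chart_chart_change[OF assms(2) l True]
            vec_eq_iff sum_distrib_left mult.assoc)
    next
      case False
      then show ?thesis using cutoff_props(4)[OF l, of "chart L j y"] by (simp add: overlap_def)
    qed
  qed
  finally show ?thesis .
qed

text \<open>A transported piece is of class k on the overlap and vanishes off the closed support of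
  the cut-off. These two open sets cover the space because the support lies inside the
  patch.\<close>

lemma glue_Ck:
  assumes W: "\<And>l m. l \<in> indices \<Longrightarrow> Ck_on k UNIV (W l m)" and supp: "\<And>l m y. l \<in> indices \<Longrightarrow> y \<notin> cutoff_support l \<Longrightarrow> W l m y = 0"
    and j: "j \<in> indices"
  shows "Ck_on k UNIV (glue W j)"
  unfolding glue_def[abs_def]
proof (rule Ck_on_sum[OF open_UNIV])
  fix l assume l: "l \<in> indices"
  let ?F = "\<lambda>y. if y \<in> overlap j l then \<Sum>m\<in>UNIV. W l m (chart_change j l y) *s frame_change j l m y else 0"
  note o = open_overlap[OF j l]
  have 1: "Ck_on k (overlap j l) ?F"
  proof (rule Ck_on_cong_imp[OF o])
    have bil: "bounded_bilinear (\<lambda>(c::complex) (a::complex^'p). c *s a)"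
    proof (rule bounded_bilinear.intro)
      show "\<exists>K. \<forall>(a::complex) (b::complex^'p). norm (a *s b) \<le> norm a * norm b * K"
      proof (intro exI allI)
        fix a :: complex and b :: "complex^'p"
        show "norm (a *s b) \<le> norm a * norm b * 1"
          by (simp add: norm_vec_def L2_set_def norm_mult power_mult_distrib sum_distrib_left[symmetric] real_sqrt_mult)
      qed
    qed (auto simp: vec_eq_iff algebra_simps)
    show "Ck_on k (overlap j l) (\<lambda>y. \<Sum>m\<in>UNIV. W l m (chart_change j l y) *s frame_change j l m y)"
      by (intro Ck_on_sum[OF o] Ck_on_bilinear[OF o bil] frame_change_Ck j l
          Ck_on_compose[OF o open_UNIV _ chart_change_Ck[OF j l] W[OF l]]) simp
  qed simp
  define M where "M = chart L j -` (- closure {x. cutoff L l x \<noteq> 0})"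
  have oM: "open M" unfolding M_def
    using open_vimage_Int[OF open_UNIV Ck_map_onD(1)[OF chart_props(3)[OF j]] open_Compl[OF closed_closure]] by simp
  have 2: "Ck_on k M ?F"
  proof (rule Ck_on_cong_imp[OF oM])
    show "Ck_on k M (\<lambda>y. 0 :: complex^'p)" by simp
    fix y assume "y \<in> M"
    then have "chart_change j l y \<notin> cutoff_support l" if "y \<in> overlap j l"
      using cutoff_support_iff[OF l] chart_chart_change[OF j l that] by (simp add: M_def)
    then show "0 = ?F y" using supp[OF l] by simp
  qed
  show "Ck_on k UNIV ?F"
  proof (rule Ck_on_local)
    fix y :: "real^'n"
    have "y \<in> overlap j l \<or> y \<in> M" using cutoff_props(3)[OF l] by (auto simp: overlap_def M_def)
    then show "\<exists>T. open T \<and> y \<in> T \<and> Ck_on k T ?F" using 1 2 o oM by blast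
  qed
qed

text \<open>A family W comes from a section only if its members are compatible across charts.
  Compatibility is a closed condition: both the reconstruction formula and the transition law are
  finite sums, and pass to pointwise limits.\<close>

lemma section_limit:
  assumes a: "\<And>i. is_section (a i)"
    and W: "\<And>l m. l \<in> indices \<Longrightarrow> Ck_on k UNIV (W l m)"
    and lim: "\<And>l m y. l \<in> indices \<Longrightarrow> (\<lambda>i. lp l m (a i) y) \<longlonglongrightarrow> W l m y"
  obtains u where "u \<in> Ck_sections E k" "\<And>l m y. l \<in> indices \<Longrightarrow> lp l m u y = W l m y"
proof -
  have supp: "W l m y = 0" if "l \<in> indices" "y \<notin> cutoff_support l" for l m y
    using lim[OF that(1), of m y] lp_outside[OF a that] by (simp add: LIMSEQ_const_iff)
  have glim: "(\<lambda>i. coord j (a i) y) \<longlonglongrightarrow> glue W j y" if j: "j \<in> indices" for j y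
    unfolding coord_eq_glue[OF a j] glue_def
  proof (intro tendsto_sum)
    fix l assume l: "l \<in> indices"
    show "(\<lambda>i. if y \<in> overlap j l then \<Sum>m\<in>UNIV. lp l m (a i) (chart_change j l y) *s frame_change j l m y else 0) \<longlonglongrightarrow>
      (if y \<in> overlap j l then \<Sum>m\<in>UNIV. W l m (chart_change j l y) *s frame_change j l m y else 0)"
    proof (cases "y \<in> overlap j l")
      case True
      have "(\<lambda>i. \<Sum>m\<in>UNIV. lp l m (a i) (chart_change j l y) *s frame_change j l m y) \<longlonglongrightarrow> (\<Sum>m\<in>UNIV. W l m (chart_change j l y) *s frame_change j l m y)"
        by (rule vec_tendstoI) (auto intro!: tendsto_intros lim l)
      then show ?thesis using True by simp
    qed simp
  qed
  \<comment> \<open>The section is defined pointwise in an arbitrarily chosen patch; the transition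
    law, passed to the limit, then shows that the choice is immaterial.\<close>
  define pick where "pick x = (SOME j. j \<in> indices \<and> x \<in> \<Gamma> j)" for x
  have pick: "pick x \<in> indices \<and> x \<in> \<Gamma> (pick x)" for x
    unfolding pick_def by (rule someI_ex) (metis cutoff_cover)
  define u where "u x = inv_triv (pick x) (x, glue W (pick x) (chart_inv (pick x) x))" for x
  have sec: "is_section u"
    unfolding is_section_def u_def using pick triv_props(9) by metis
  have cu: "coord j u y = glue W j y" if j: "j \<in> indices" for j y
  proof -
    let ?x = "chart L j y" and ?l = "pick (chart L j y)"
    have l: "?l \<in> indices" and yd: "y \<in> overlap j ?l" using pick[of ?x] by (auto simp: overlap_def)
    have "coord j u y = (\<Sum>m\<in>UNIV. glue W ?l (chart_change j ?l y) $ m *s frame_change j ?l m y)"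
      using transition_linear[OF j l yd] by (simp add: coord_def u_def chart_change_def)
    moreover have "(\<lambda>i. \<Sum>m\<in>UNIV. coord ?l (a i) (chart_change j ?l y) $ m *s frame_change j ?l m y) \<longlonglongrightarrow>
        (\<Sum>m\<in>UNIV. glue W ?l (chart_change j ?l y) $ m *s frame_change j ?l m y)"
      by (rule vec_tendstoI) (auto intro!: tendsto_intros glim[OF l])
    ultimately have "(\<lambda>i. coord j (a i) y) \<longlonglongrightarrow> coord j u y"
      using coord_transition[OF a j l yd] by simp
    then show ?thesis using glim[OF j] LIMSEQ_unique by blast
  qed
  show ?thesis
  proof (rule that)
    show "u \<in> Ck_sections E k"
    proof (rule Ck_sectionsI_coord[OF sec])
      fix j assume j: "j \<in> indices"
      have "Ck_on k UNIV (glue W j)" by (rule glue_Ck[OF W supp j])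
      then show "Ck_on k UNIV (coord j u)"
        by (rule Ck_on_cong_imp[OF open_UNIV, rotated]) (simp add: cu[OF j])
    qed
    fix l m y assume l: "l \<in> indices"
    have "(\<lambda>i. complex_of_real (cutoff L l (chart L l y)) * coord l (a i) y $ m) \<longlonglongrightarrow>
        complex_of_real (cutoff L l (chart L l y)) * glue W l y $ m"
      by (intro tendsto_intros glim l)
    then have "(\<lambda>i. lp l m (a i) y) \<longlonglongrightarrow> lp l m u y"
      by (simp add: lp_eq[OF a l] lp_eq[OF sec l] cu[OF l])
    then show "lp l m u y = W l m y" using lim[OF l] LIMSEQ_unique by blast
  qed
qed

text \<open>Every coordinate patch is a copy of the whole Euclidean space, so that a test function in it
  extends by zero.\<close>

lemma section_of_test:
  assumes j: "j \<in> indices" and f: "f \<in> test_functions"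
  obtains u where "u \<in> smooth_sections E"
    "\<And>l y. l \<in> indices \<Longrightarrow> coord l u y = (if y \<in> overlap l j then f (chart_change l j y) *s frame_change l j m y else 0)"
proof -
  obtain K where K: "compact K" "\<And>y. y \<notin> K \<Longrightarrow> f y = 0" using test_support[OF f] by blast
  define pick where "pick x = (SOME j. j \<in> indices \<and> x \<in> \<Gamma> j)" for x
  have pick: "pick x \<in> indices \<and> x \<in> \<Gamma> (pick x)" for x
    unfolding pick_def by (rule someI_ex) (metis cutoff_cover)
  \<comment> \<open>Off the patch the value is the zero of the fibre, which has no name in the
    bundle record and is expressed through the trivialization of some other patch.\<close>
  define u where "u x = (if x \<in> \<Gamma> j then inv_triv j (x, f (chart_inv j x) *s axis m 1) else inv_triv (pick x) (x, 0))" for x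
  have sec: "is_section u"
    unfolding is_section_def
  proof
    fix x
    show "proj E (u x) = x"
      using pick[of x] triv_props(9)[OF j, of x] triv_props(9)[of "pick x" x 0] by (auto simp: u_def)
  qed
  have cu: "coord l u y = (if y \<in> overlap l j then f (chart_change l j y) *s frame_change l j m y else 0)" if l: "l \<in> indices" for l y
  proof (cases "y \<in> overlap l j")
    case True
    have "(\<Sum>k\<in>UNIV. (f (chart_change l j y) *s axis m 1) $ k *s frame_change l j k y) = f (chart_change l j y) *s frame_change l j m y"
      by (simp add: vec_eq_iff axis_def if_distrib if_distribR sum.delta cong: if_cong)
    then show ?thesis using True transition_linear[OF l j True, of "f (chart_change l j y) *s axis m 1"]
      by (simp add: coord_def u_def overlap_def chart_change_def)
  next
    case False
    let ?l = "pick (chart L l y)"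
    have "?l \<in> indices" "y \<in> overlap l ?l" using pick[of "chart L l y"] by (auto simp: overlap_def)
    then show ?thesis using False transition_linear[OF l, of ?l y 0] by (simp add: coord_def u_def overlap_def)
  qed
  have "u \<in> Ck_sections E k" for k
  proof (rule Ck_sectionsI_coord[OF sec])
    fix l assume l: "l \<in> indices"
    note o = open_overlap[OF l j]
    have 1: "Ck_on k (overlap l j) (coord l u)"
    proof (rule Ck_on_cong_imp[OF o])
      have "Ck_on k (overlap l j) (\<lambda>y. (f (chart_change l j y) * frame_change l j m y $ i))" for i
        by (intro Ck_on_mult[OF o] Ck_on_bounded_linear_compose[OF o bounded_linear_vec_nth] frame_change_Ck l j
          Ck_on_compose[OF o open_UNIV _ chart_change_Ck[OF l j] smooth_on_imp_Ck[OF test_smooth[OF f]]]) simp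
      then show "Ck_on k (overlap l j) (\<lambda>y. f (chart_change l j y) *s frame_change l j m y)"
        by (subst Ck_on_vec_iff[OF o]) simp
    qed (simp add: cu[OF l])
    define M where "M = chart L l -` (- chart L j ` K)"
    \<comment> \<open>The base is Hausdorff, so this compact image of the support is closed, and its
      complement together with the patch covers the base.\<close>
    have "compact (chart L j ` K)"
      by (rule compact_continuous_image[OF continuous_on_subset[OF Ck_map_onD(1)[OF chart_props(3)[OF j]]] K(1)]) simp
    then have "open (- chart L j ` K)" by (simp add: compact_imp_closed open_Compl)
    then have oM: "open M" unfolding M_def
      using open_vimage_Int[OF open_UNIV Ck_map_onD(1)[OF chart_props(3)[OF l]], of "- chart L j ` K"] by simp
    have 2: "Ck_on k M (coord l u)"
    proof (rule Ck_on_cong_imp[OF oM])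
      show "Ck_on k M (\<lambda>y. 0 :: complex^'p)" by simp
      fix y assume "y \<in> M"
      have "chart_change l j y \<notin> K" if "y \<in> overlap l j"
        using chart_chart_change[OF l j that] imageI[of "chart_change l j y" K "chart L j"] \<open>y \<in> M\<close>
        by (auto simp: M_def)
      then show "0 = coord l u y" using K(2) by (simp add: cu[OF l])
    qed
    show "Ck_on k UNIV (coord l u)"
    proof (rule Ck_on_local)
      fix y :: "real^'n"
      have "y \<in> overlap l j \<or> y \<in> M" using chart_props(7)[OF j] by (auto simp: overlap_def M_def)
      then show "\<exists>T. open T \<and> y \<in> T \<and> Ck_on k T (coord l u)" using 1 2 o oM by blast
    qed
  qed
  then have "u \<in> smooth_sections E" by (simp add: smooth_sections_iff)
  then show ?thesis by (rule that[OF _ cu])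
qed

end

section \<open>Sufficiency of the integral condition\<close>

lemma pderivs_diff:
  assumes "open S" "Ck_on (length is) S f" "Ck_on (length is) S g" "x \<in> S"
  shows "pderivs is (\<lambda>x. f x - g x) x = pderivs is f x - pderivs is g x"
  using pderivs_add[OF assms(1,2) Ck_on_bounded_linear_compose[OF assms(1) bounded_linear_minus[OF bounded_linear_ident] assms(3)] assms(4)]
    pderivs_bounded_linear[OF assms(1) bounded_linear_minus[OF bounded_linear_ident] assms(3,4)]
  by simp

text \<open>Compact support bounds the derivatives, so that the suprema in \<open>Cq_norm_Rn\<close>
  are over bounded sets and behave like a norm.\<close>

definition Cq_compact :: "nat \<Rightarrow> (real^'n::finite \<Rightarrow> complex) \<Rightarrow> bool" where
  "Cq_compact q f \<longleftrightarrow> Ck_on q UNIV f \<and> (\<exists>K. compact K \<and> (\<forall>x. x \<notin> K \<longrightarrow> f x = 0))"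

lemma Cq_compact_Ck: "Cq_compact q f \<Longrightarrow> l \<le> q \<Longrightarrow> Ck_on l UNIV f"
  by (auto simp: Cq_compact_def intro: Ck_on_mono)

lemma Cq_compact_cmult:
  assumes "Cq_compact q f"
  shows "Cq_compact q (\<lambda>x. c * f x)"
  unfolding Cq_compact_def
proof
  show "Ck_on q UNIV (\<lambda>x. c * f x)"
    using assms by (intro Ck_on_mult open_UNIV Ck_on_const) (auto simp: Cq_compact_def)
  show "\<exists>K. compact K \<and> (\<forall>x. x \<notin> K \<longrightarrow> c * f x = 0)"
    using assms by (force simp: Cq_compact_def)
qed

lemma Cq_compact_pderivs_bounded:
  assumes "Cq_compact q f" "length is \<le> q"
  shows "bdd_above (range (\<lambda>x. cmod (pderivs is f x)))"
proof -
  obtain K where K: "compact K" "\<And>x. x \<notin> K \<Longrightarrow> f x = 0" using assms by (auto simp: Cq_compact_def)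
  have "Ck_on (0 + length is) UNIV f" using Cq_compact_Ck[OF assms] by simp
  then have "continuous_on UNIV (pderivs is f)" using Ck_on_pderivs Ck_on_imp_continuous_on by blast
  then have "compact (pderivs is f ` K)" using compact_continuous_image continuous_on_subset K(1) by (metis subset_UNIV)
  then obtain B where B: "\<And>y. y \<in> pderivs is f ` K \<Longrightarrow> norm y \<le> B" "0 < B"
    using compact_imp_bounded bounded_pos by metis
  have "closure {x. f x \<noteq> 0} \<subseteq> K" using K by (intro closure_minimal compact_imp_closed) auto
  then have "cmod (pderivs is f x) \<le> B" for x
  proof (cases "x \<in> K")
    case False
    then have "x \<notin> closure {x. f x \<noteq> 0}" using \<open>closure {x. f x \<noteq> 0} \<subseteq> K\<close> by blast
    then show ?thesis using pderivs_eq_0_outside_closure[of x f "is"] B(2) by simp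
  qed (use B(1) in auto)
  then show ?thesis by (intro bdd_aboveI[of _ B]) auto
qed

lemma Cq_norm_ge:
  assumes "Cq_compact q f" "size \<mu> \<le> q"
  shows "cmod (pderiv_multi \<mu> f x) \<le> Cq_norm_Rn q f"
proof -
  have le: "cmod (pderiv_multi \<nu> f x) \<le> (SUP x. cmod (pderiv_multi \<nu> f x))" if "size \<nu> \<le> q" for \<nu> x
  proof -
    obtain "is" where i: "length is = size \<nu>" "\<And>f :: real^'a \<Rightarrow> complex. pderiv_multi \<nu> f = pderivs is f" using pderiv_multi_eq_pderivs by metis
    show ?thesis unfolding i(2)
      by (rule cSUP_upper[OF UNIV_I Cq_compact_pderivs_bounded[OF assms(1)]]) (use i(1) that in simp)
  qed
  have "(SUP x. cmod (pderiv_multi \<mu> f x)) \<le> Cq_norm_Rn q f"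
    unfolding Cq_norm_Rn_def
  proof (rule member_le_sum[OF _ _ finite_multisets_le])
    show "\<mu> \<in> {\<mu>. size \<mu> \<le> q}" using assms(2) by simp
    fix \<nu> assume "\<nu> \<in> {\<mu>. size \<mu> \<le> q} - {\<mu>}"
    then show "0 \<le> (SUP x. cmod (pderiv_multi \<nu> f x))"
      using order_trans[OF norm_ge_zero le[of \<nu> 0]] by simp
  qed
  then show ?thesis using le[OF assms(2), of x] by linarith
qed

lemma Cq_norm_ge_sup: "Cq_compact q f \<Longrightarrow> cmod (f x) \<le> Cq_norm_Rn q f"
  using Cq_norm_ge[of q f "{#}" x] pderiv_multi_replicate[of 0 undefined f] by simp

lemma Cq_norm_nonneg: "Cq_compact q f \<Longrightarrow> 0 \<le> Cq_norm_Rn q f"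
  using order_trans[OF norm_ge_zero Cq_norm_ge_sup[of q f 0]] .

lemma Cq_norm_le:
  fixes f :: "real^'n::finite \<Rightarrow> complex"
  assumes "\<And>is x. length is \<le> q \<Longrightarrow> cmod (pderivs is f x) \<le> e"
  shows "Cq_norm_Rn q f \<le> real (card {\<mu> :: 'n multiset. size \<mu> \<le> q}) * e"
  unfolding Cq_norm_Rn_def
proof (rule sum_bounded_above)
  fix \<mu> :: "'n multiset" assume "\<mu> \<in> {\<mu>. size \<mu> \<le> q}"
  moreover obtain "is" where i: "length is = size \<mu>" "\<And>f :: real^'n \<Rightarrow> complex. pderiv_multi \<mu> f = pderivs is f"
    using pderiv_multi_eq_pderivs by metis
  ultimately show "(SUP x. cmod (pderiv_multi \<mu> f x)) \<le> e"
    unfolding i(2) by (intro cSUP_least assms) auto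
qed

lemma Cq_norm_add_le:
  assumes f: "Cq_compact q f" and g: "Cq_compact q g"
  shows "Cq_norm_Rn q (\<lambda>x. f x + g x) \<le> Cq_norm_Rn q f + Cq_norm_Rn q g"
  unfolding Cq_norm_Rn_def sum.distrib[symmetric]
proof (rule sum_mono)
  fix \<mu> assume m: "\<mu> \<in> {\<mu>::'a multiset. size \<mu> \<le> q}"
  obtain "is" where i: "length is = size \<mu>" "\<And>f :: real^'a \<Rightarrow> complex. pderiv_multi \<mu> f = pderivs is f" using pderiv_multi_eq_pderivs by metis
  have l: "length is \<le> q" using m i(1) by simp
  show "(SUP x. cmod (pderiv_multi \<mu> (\<lambda>x. f x + g x) x)) \<le> (SUP x. cmod (pderiv_multi \<mu> f x)) + (SUP x. cmod (pderiv_multi \<mu> g x))"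
    unfolding i(2)
  proof (rule cSUP_least)
    fix x
    have "pderivs is (\<lambda>x. f x + g x) x = pderivs is f x + pderivs is g x"
      by (rule pderivs_add[OF open_UNIV Cq_compact_Ck[OF f l] Cq_compact_Ck[OF g l]]) simp
    then have "cmod (pderivs is (\<lambda>x. f x + g x) x) \<le> cmod (pderivs is f x) + cmod (pderivs is g x)"
      using norm_triangle_ineq by metis
    also have "\<dots> \<le> (SUP x. cmod (pderivs is f x)) + (SUP x. cmod (pderivs is g x))"
      by (intro add_mono cSUP_upper UNIV_I Cq_compact_pderivs_bounded[OF f l] Cq_compact_pderivs_bounded[OF g l])
    finally show "cmod (pderivs is (\<lambda>x. f x + g x) x) \<le> (SUP x. cmod (pderivs is f x)) + (SUP x. cmod (pderivs is g x))" .
  qed simp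
qed

lemma Cq_norm_cmult:
  assumes f: "Cq_compact q f"
  shows "Cq_norm_Rn q (\<lambda>x. c * f x) = cmod c * Cq_norm_Rn q f"
  unfolding Cq_norm_Rn_def sum_distrib_left
proof (rule sum.cong[OF refl])
  fix \<mu> assume m: "\<mu> \<in> {\<mu>::'a multiset. size \<mu> \<le> q}"
  obtain "is" where i: "length is = size \<mu>" "\<And>f :: real^'a \<Rightarrow> complex. pderiv_multi \<mu> f = pderivs is f" using pderiv_multi_eq_pderivs by metis
  have l: "length is \<le> q" using m i(1) by simp
  have eq: "cmod (pderivs is (\<lambda>x. c * f x) x) = cmod c * cmod (pderivs is f x)" for x
    using pderivs_cmult[OF open_UNIV Cq_compact_Ck[OF f l], of x c] by (simp add: norm_mult)
  show "(SUP x. cmod (pderiv_multi \<mu> (\<lambda>x. c * f x) x)) = cmod c * (SUP x. cmod (pderiv_multi \<mu> f x))"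
    unfolding i(2) eq
  proof (rule antisym)
    show "(SUP x. cmod c * cmod (pderivs is f x)) \<le> cmod c * (SUP x. cmod (pderivs is f x))"
      by (intro cSUP_least mult_left_mono cSUP_upper UNIV_I Cq_compact_pderivs_bounded[OF f l]) auto
    show "cmod c * (SUP x. cmod (pderivs is f x)) \<le> (SUP x. cmod c * cmod (pderivs is f x))"
    proof (cases "c = 0")
      case False
      have bdd: "bdd_above (range (\<lambda>x. cmod c * cmod (pderivs is f x)))"
        using Cq_compact_pderivs_bounded[OF Cq_compact_cmult[OF f, of c] l] by (simp add: eq)
      have "(SUP x. cmod (pderivs is f x)) \<le> (SUP x. cmod c * cmod (pderivs is f x)) / cmod c"
        using False by (intro cSUP_least) (auto simp: pos_le_divide_eq mult.commute intro!: cSUP_upper2[OF bdd UNIV_I])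
      then show ?thesis using False by (simp add: pos_le_divide_eq mult.commute)
    qed simp
  qed
qed

locale embedding_setup = localized_bundle E L + weight \<phi> q s "TYPE('n)"
  for E :: "('m::{t2_space, second_countable_topology}, 'v::{t2_space, second_countable_topology},
      'n::finite, 'p::finite) vbundle"
    and L :: "('m, 'v, 'n, 'p) localization" and \<phi> q s
begin

section \<open>The two normed spaces of sections\<close>

abbreviation "HX \<equiv> smooth_sections_H E L s \<phi>"
abbreviation "CY \<equiv> Cq_bundle E L q"

text \<open>The injective linear map required by \<open>cnorm_space\<close>: all local parts at
  once, with the value 0 at indices that number no patch. Injectivity holds because the cut-offs sum
  to 1.\<close>

definition parts :: "('m \<Rightarrow> 'v) \<Rightarrow> nat \<times> 'p \<times> (real^'n) \<Rightarrow> complex" where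
  "parts u = (\<lambda>(j, k, y). if j \<in> indices then lp j k u y else 0)"

lemma HX_simps: "vecs HX = smooth_sections E" "vadd HX u v = (\<lambda>x. fadd E (u x) (v x))"
    "vscale HX c u = (\<lambda>x. fscale E c (u x))"
  by (simp_all add: smooth_sections_H_def)

lemma CY_simps: "vecs CY = Ck_sections E q" "vadd CY u v = (\<lambda>x. fadd E (u x) (v x))"
    "vscale CY c u = (\<lambda>x. fscale E c (u x))"
    "vnorm CY u = (\<Sum>j\<in>indices. \<Sum>k\<in>UNIV. Cq_norm_Rn q (lp j k u))"
  by (simp_all add: Cq_bundle_def indices_def)

lemma smooth_imp_Ck_section: "u \<in> smooth_sections E \<Longrightarrow> u \<in> Ck_sections E q"
  by (simp add: smooth_sections_iff)

lemma smooth_section: "u \<in> smooth_sections E \<Longrightarrow> is_section u"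
  using Ck_sections_section smooth_imp_Ck_section by blast

lemma lp_add_eq:
  assumes "is_section u" "is_section v" "j \<in> indices"
  shows "lp j k (\<lambda>x. fadd E (u x) (v x)) = (\<lambda>y. lp j k u y + lp j k v y)"
  by (rule ext) (rule lp_add[OF assms])

lemma lp_scale_eq:
  assumes "is_section u" "j \<in> indices"
  shows "lp j k (\<lambda>x. fscale E c (u x)) = (\<lambda>y. c * lp j k u y)"
  by (rule ext) (rule lp_scale[OF assms])

lemma lp_sub_eq:
  assumes "is_section u" "is_section v" "j \<in> indices"
  shows "lp j k (\<lambda>x. fadd E (u x) (fscale E (- 1) (v x))) = (\<lambda>y. lp j k u y - lp j k v y)"
  using lp_add_eq[OF assms(1) section_scale[OF assms(2), of "\<lambda>_. - 1"] assms(3)] lp_scale_eq[OF assms(2,3), of k "- 1"]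
  by simp

lemma HX_norm:
  assumes "u \<in> smooth_sections E"
  shows "vnorm HX u = sqrt (\<Sum>j\<in>indices. \<Sum>k\<in>UNIV. Hsq s \<phi> (lp j k u))"
proof -
  have "vnorm HX u = sqrt (\<Sum>j\<in>indices. \<Sum>k\<in>UNIV. (vnorm (H_Rn s \<phi>) (regular_distribution (lp j k u)))\<^sup>2)"
    by (simp add: smooth_sections_H_def indices_def)
  also have "\<dots> = sqrt (\<Sum>j\<in>indices. \<Sum>k\<in>UNIV. Hsq s \<phi> (lp j k u))"
    by (intro arg_cong[where f=sqrt] sum.cong refl vnorm_eq_Hsq lp_test assms)
  finally show ?thesis .
qed

lemma HX_sum_nonneg: "0 \<le> (\<Sum>j\<in>indices. \<Sum>k\<in>UNIV. Hsq s \<phi> (lp j k u))"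
  by (intro sum_nonneg Hsq_nonneg)

lemma Hsq_le_HX_norm:
  assumes "u \<in> smooth_sections E" "j \<in> indices"
  shows "Hsq s \<phi> (lp j k u) \<le> (vnorm HX u)\<^sup>2"
proof -
  have "Hsq s \<phi> (lp j k u) \<le> (\<Sum>k\<in>UNIV. Hsq s \<phi> (lp j k u))"
    by (rule member_le_sum) (auto simp: Hsq_nonneg)
  also have "\<dots> \<le> (\<Sum>j\<in>indices. \<Sum>k\<in>UNIV. Hsq s \<phi> (lp j k u))"
    by (rule member_le_sum[OF assms(2) _ finite_indices]) (intro sum_nonneg Hsq_nonneg)
  finally show ?thesis by (simp add: HX_norm[OF assms(1)] HX_sum_nonneg)
qed

lemma lp_Cq_compact:
  assumes "u \<in> Ck_sections E q" "j \<in> indices"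
  shows "Cq_compact q (lp j k u)"
  unfolding Cq_compact_def
  using lp_Ck[OF assms] cutoff_support_compact[OF assms(2)] lp_outside[OF Ck_sections_section[OF assms(1)] assms(2)] by blast

lemma smooth_add: "u \<in> smooth_sections E \<Longrightarrow> v \<in> smooth_sections E \<Longrightarrow> (\<lambda>x. fadd E (u x) (v x)) \<in> smooth_sections E"
  by (simp add: smooth_sections_iff Ck_sections_add)

lemma smooth_scale: "u \<in> smooth_sections E \<Longrightarrow> (\<lambda>x. fscale E c (u x)) \<in> smooth_sections E"
  by (simp add: smooth_sections_iff Ck_sections_scale)

lemma HX_cnorm_space: "cnorm_space HX parts"
proof (unfold_locales, unfold HX_simps)
  fix u v :: "'m \<Rightarrow> 'v" and c and i :: "nat \<times> 'p \<times> (real^'n)"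
  assume u: "u \<in> smooth_sections E"
  note su = smooth_section[OF u]
  show "(\<lambda>x. fscale E c (u x)) \<in> smooth_sections E" by (rule smooth_scale[OF u])
  show "parts (\<lambda>x. fscale E c (u x)) i = c * parts u i"
    by (cases i) (simp add: parts_def lp_scale[OF su])
  show "vnorm HX (\<lambda>x. fscale E c (u x)) = cmod c * vnorm HX u"
    by (simp add: HX_norm[OF u] HX_norm[OF smooth_scale[OF u]] lp_scale_eq[OF su] Hsq_cmult
        sum_distrib_left[symmetric] real_sqrt_mult cong: sum.cong)
  show "parts u i = 0" if z: "vnorm HX u = 0"
  proof (cases i)
    case (fields j k y)
    have "lp j k u y = 0" if j: "j \<in> indices"
    proof (rule Hsq_eq_0_imp[OF lp_test[OF u j]])
      have "Hsq s \<phi> (lp j k u) \<le> 0" using Hsq_le_HX_norm[OF u j, of k] z by simp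
      then show "Hsq s \<phi> (lp j k u) = 0" using Hsq_nonneg[of s \<phi> "lp j k u"] by simp
    qed
    then show ?thesis by (simp add: fields parts_def)
  qed
  assume v: "v \<in> smooth_sections E"
  note sv = smooth_section[OF v]
  show "(\<lambda>x. fadd E (u x) (v x)) \<in> smooth_sections E" by (rule smooth_add[OF u v])
  show "parts (\<lambda>x. fadd E (u x) (v x)) i = parts u i + parts v i"
    by (cases i) (simp add: parts_def lp_add[OF su sv])
  show "u = v" if "\<And>i. parts u i = parts v i"
    by (rule section_eq_lpI[OF su sv]) (use that in \<open>force simp: parts_def split: prod.splits if_splits\<close>)
  show "vnorm HX (\<lambda>x. fadd E (u x) (v x)) \<le> vnorm HX u + vnorm HX v"
    unfolding HX_norm[OF u] HX_norm[OF v] HX_norm[OF smooth_add[OF u v]]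
  proof (rule sqrt_le_add_if_quadratic[OF _ HX_sum_nonneg HX_sum_nonneg])
    fix t :: real assume t: "t > 0"
    have "(\<Sum>j\<in>indices. \<Sum>k\<in>UNIV. Hsq s \<phi> (lp j k (\<lambda>x. fadd E (u x) (v x))))
      \<le> (\<Sum>j\<in>indices. \<Sum>k\<in>UNIV. (1 + t) * Hsq s \<phi> (lp j k u) + (1 + 1 / t) * Hsq s \<phi> (lp j k v))"
    proof (intro sum_mono)
      fix j k assume "j \<in> indices"
      then show "Hsq s \<phi> (lp j k (\<lambda>x. fadd E (u x) (v x))) \<le> (1 + t) * Hsq s \<phi> (lp j k u) + (1 + 1 / t) * Hsq s \<phi> (lp j k v)"
        using Hsq_add_le[OF lp_test[OF u] lp_test[OF v] t] by (simp add: lp_add_eq[OF su sv])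
    qed
    also have "\<dots> = (1 + t) * (\<Sum>j\<in>indices. \<Sum>k\<in>UNIV. Hsq s \<phi> (lp j k u)) + (1 + 1 / t) * (\<Sum>j\<in>indices. \<Sum>k\<in>UNIV. Hsq s \<phi> (lp j k v))"
      by (simp only: sum.distrib sum_distrib_left)
    finally show "(\<Sum>j\<in>indices. \<Sum>k\<in>UNIV. Hsq s \<phi> (lp j k (\<lambda>x. fadd E (u x) (v x)))) \<le> \<dots>" .
  qed
qed

lemma CY_cnorm_space: "cnorm_space CY parts"
proof (unfold_locales, unfold CY_simps)
  fix u v :: "'m \<Rightarrow> 'v" and c and i :: "nat \<times> 'p \<times> (real^'n)"
  assume u: "u \<in> Ck_sections E q"
  note su = Ck_sections_section[OF u]
  show "(\<lambda>x. fscale E c (u x)) \<in> Ck_sections E q" by (rule Ck_sections_scale[OF u])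
  show "parts (\<lambda>x. fscale E c (u x)) i = c * parts u i"
    by (cases i) (simp add: parts_def lp_scale[OF su])
  show "(\<Sum>j\<in>indices. \<Sum>k\<in>UNIV. Cq_norm_Rn q (lp j k (\<lambda>x. fscale E c (u x)))) = cmod c * (\<Sum>j\<in>indices. \<Sum>k\<in>UNIV. Cq_norm_Rn q (lp j k u))"
    by (simp add: lp_scale_eq[OF su] Cq_norm_cmult[OF lp_Cq_compact[OF u]] sum_distrib_left cong: sum.cong)
  show "parts u i = 0" if z: "(\<Sum>j\<in>indices. \<Sum>k\<in>UNIV. Cq_norm_Rn q (lp j k u)) = 0"
  proof (cases i)
    case (fields j k y)
    have "lp j k u y = 0" if j: "j \<in> indices"
    proof -
      have "(\<Sum>k\<in>UNIV. Cq_norm_Rn q (lp j k u)) = 0"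
        using z j finite_indices by (subst (asm) sum_nonneg_eq_0_iff)
          (auto intro!: sum_nonneg Cq_norm_nonneg lp_Cq_compact[OF u])
      then have "Cq_norm_Rn q (lp j k u) = 0"
        by (subst (asm) sum_nonneg_eq_0_iff) (auto intro!: Cq_norm_nonneg lp_Cq_compact[OF u j])
      then show ?thesis using Cq_norm_ge_sup[OF lp_Cq_compact[OF u j], of k y] by simp
    qed
    then show ?thesis by (simp add: fields parts_def)
  qed
  assume v: "v \<in> Ck_sections E q"
  note sv = Ck_sections_section[OF v]
  show "(\<lambda>x. fadd E (u x) (v x)) \<in> Ck_sections E q" by (rule Ck_sections_add[OF u v])
  show "parts (\<lambda>x. fadd E (u x) (v x)) i = parts u i + parts v i"
    by (cases i) (simp add: parts_def lp_add[OF su sv])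
  show "u = v" if "\<And>i. parts u i = parts v i"
    by (rule section_eq_lpI[OF su sv]) (use that in \<open>force simp: parts_def split: prod.splits if_splits\<close>)
  show "(\<Sum>j\<in>indices. \<Sum>k\<in>UNIV. Cq_norm_Rn q (lp j k (\<lambda>x. fadd E (u x) (v x))))
    \<le> (\<Sum>j\<in>indices. \<Sum>k\<in>UNIV. Cq_norm_Rn q (lp j k u)) + (\<Sum>j\<in>indices. \<Sum>k\<in>UNIV. Cq_norm_Rn q (lp j k v))"
    unfolding sum.distrib[symmetric]
  proof (intro sum_mono)
    fix j k assume "j \<in> indices"
    then show "Cq_norm_Rn q (lp j k (\<lambda>x. fadd E (u x) (v x))) \<le> Cq_norm_Rn q (lp j k u) + Cq_norm_Rn q (lp j k v)"
      using Cq_norm_add_le[OF lp_Cq_compact[OF u] lp_Cq_compact[OF v]] by (simp add: lp_add_eq[OF su sv])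
  qed
qed

sublocale emb: cnorm_embedding HX CY parts
proof -
  interpret X: cnorm_space HX parts by (rule HX_cnorm_space)
  interpret Y: cnorm_space CY parts by (rule CY_cnorm_space)
  show "cnorm_embedding HX CY parts"
    by unfold_locales (auto simp: HX_simps CY_simps smooth_imp_Ck_section fun_eq_iff)
qed

lemma embedding_iff: "embedding_extending_identity E L s \<phi> q T \<longleftrightarrow> emb.extends_identity T"
  by (simp add: embedding_extending_identity_def emb.extends_identity_def H_bundle_def HX_simps)

lemma lp_uniform_support:
  obtains R where "\<And>j u k x. is_section u \<Longrightarrow> j \<in> indices \<Longrightarrow> norm x > R \<Longrightarrow> lp j k u x = 0"
proof -
  have "compact (\<Union>j\<in>indices. cutoff_support j)" using finite_indices cutoff_support_compact by (intro compact_UN) auto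
  then obtain R where "\<And>x. x \<in> (\<Union>j\<in>indices. cutoff_support j) \<Longrightarrow> norm x \<le> R"
    using compact_imp_bounded bounded_iff by metis
  then show ?thesis using that[of R] lp_outside by (metis UN_I not_le)
qed

context
  assumes sum: "summable (\<lambda>k. 1 / (\<phi> (2 ^ k))\<^sup>2)"
begin

lemma CY_norm_le_HX_norm: "\<exists>C. \<forall>u\<in>smooth_sections E. vnorm CY u \<le> C * vnorm HX u"
proof -
  obtain C where C: "C \<ge> 0" "\<And>(f :: real^'n \<Rightarrow> complex) is x. f \<in> test_functions \<Longrightarrow> length is \<le> q \<Longrightarrow>
    cmod (pderivs is f x) \<le> C * sqrt (Hsq s \<phi> f)" using pderivs_le_Hsq[OF sum] by blast
  define c where "c = real (card {\<mu> :: 'n multiset. size \<mu> \<le> q})"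
  have "vnorm CY u \<le> (real (card indices) * (real CARD('p) * (c * C))) * vnorm HX u" if u: "u \<in> smooth_sections E" for u
  proof -
    have nn: "0 \<le> vnorm HX u" by (simp add: HX_norm[OF u] HX_sum_nonneg)
    have "Cq_norm_Rn q (lp j k u) \<le> c * (C * vnorm HX u)" if j: "j \<in> indices" for j k
      unfolding c_def
    proof (rule Cq_norm_le)
      fix "is" :: "'n list" and x assume "length is \<le> q"
      then have "cmod (pderivs is (lp j k u) x) \<le> C * sqrt (Hsq s \<phi> (lp j k u))" by (rule C(2)[OF lp_test[OF u j]])
      also have "\<dots> \<le> C * vnorm HX u"
        using Hsq_le_HX_norm[OF u j, of k] nn C(1) by (intro mult_left_mono real_le_lsqrt) auto
      finally show "cmod (pderivs is (lp j k u) x) \<le> C * vnorm HX u" .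
    qed
    then have "vnorm CY u \<le> (\<Sum>j\<in>indices. \<Sum>k\<in>(UNIV::'p set). c * (C * vnorm HX u))"
      unfolding CY_simps by (intro sum_mono)
    also have "\<dots> = (real (card indices) * (real CARD('p) * (c * C))) * vnorm HX u" by simp
    finally show ?thesis .
  qed
  then show ?thesis by blast
qed

lemma HX_Cauchy_null:
  assumes a: "a \<in> cauchy_seqs HX" and null: "(\<lambda>i. vnorm CY (a i)) \<longlonglongrightarrow> 0"
  shows "(\<lambda>i. vnorm HX (a i)) \<longlonglongrightarrow> 0"
proof -
  obtain R where R: "\<And>j u k x. is_section u \<Longrightarrow> j \<in> indices \<Longrightarrow> norm x > R \<Longrightarrow> lp j k u x = 0"
    using lp_uniform_support by blast
  have aS: "a i \<in> smooth_sections E" for i using emb.X.cauchy_in[OF a] by (simp add: HX_simps)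
  note sec = smooth_section[OF aS]
  have "(\<lambda>i. Hsq s \<phi> (lp j k (a i))) \<longlonglongrightarrow> 0" if j: "j \<in> indices" for j k
  proof (rule LIMSEQ_I)
    fix r :: real assume r: "r > 0"
    \<comment> \<open>The metric is the norm and the target is its square, so the Cauchy condition
      is invoked at the square root.\<close>
    then have "sqrt (r / 2) > 0" by simp
    then obtain N where N: "\<And>i l. i \<ge> N \<Longrightarrow> l \<ge> N \<Longrightarrow> ndist HX (a i) (a l) < sqrt (r / 2)"
      using emb.X.cauchyD[OF a] by blast
    have le: "Hsq s \<phi> (lp j k (a i)) \<le> r / 2" if i: "i \<ge> N" for i
    proof (rule Hsq_Cauchy_null[where f="\<lambda>i. lp j k (a i)" and N=N and R=R])
      show "lp j k (a i) \<in> test_functions" for i by (rule lp_test[OF aS j])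
      show "lp j k (a i) x = 0" if "norm x > R" for i x by (rule R[OF sec j that])
      show "\<exists>N. \<forall>i\<ge>N. \<forall>x. cmod (lp j k (a i) x) \<le> e" if "e > 0" for e
      proof -
        obtain M where M: "\<And>i. i \<ge> M \<Longrightarrow> norm (vnorm CY (a i) - 0) < e" using LIMSEQ_D[OF null \<open>e > 0\<close>] by blast
        have "cmod (lp j k (a i) x) \<le> e" if "i \<ge> M" for i x
        proof -
          note cc = lp_Cq_compact[OF smooth_imp_Ck_section[OF aS]]
          have "cmod (lp j k (a i) x) \<le> Cq_norm_Rn q (lp j k (a i))" by (rule Cq_norm_ge_sup[OF cc[OF j]])
          also have "\<dots> \<le> (\<Sum>k\<in>UNIV. Cq_norm_Rn q (lp j k (a i)))"
            by (rule member_le_sum) (auto intro: Cq_norm_nonneg cc j)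
          also have "\<dots> \<le> vnorm CY (a i)" unfolding CY_simps
            by (rule member_le_sum[OF j _ finite_indices]) (auto intro!: sum_nonneg Cq_norm_nonneg cc)
          also have "\<dots> \<le> e" using M[OF that] by simp
          finally show ?thesis .
        qed
        then show ?thesis by blast
      qed
      show "Hsq s \<phi> (\<lambda>x. lp j k (a i) x - lp j k (a l) x) \<le> r / 2" if "l \<ge> N" for l
      proof -
        let ?d = "\<lambda>x. fadd E (a i x) (fscale E (- 1) (a l x))"
        have d: "?d \<in> smooth_sections E" by (intro smooth_add smooth_scale aS)
        have "Hsq s \<phi> (lp j k ?d) \<le> (vnorm HX ?d)\<^sup>2" by (rule Hsq_le_HX_norm[OF d j])
        also have "vnorm HX ?d = ndist HX (a i) (a l)" by (simp add: ndist_def HX_simps aS)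
        also have "(ndist HX (a i) (a l))\<^sup>2 \<le> (sqrt (r / 2))\<^sup>2"
          using N[OF i that] by (intro power_mono) auto
        finally show ?thesis using r by (simp add: lp_sub_eq[OF sec sec j])
      qed
    qed
    show "\<exists>no. \<forall>i\<ge>no. norm (Hsq s \<phi> (lp j k (a i)) - 0) < r"
    proof (intro exI allI impI)
      fix i assume "N \<le> i"
      show "norm (Hsq s \<phi> (lp j k (a i)) - 0) < r"
        using le[OF \<open>N \<le> i\<close>] r Hsq_nonneg[of s \<phi> "lp j k (a i)"] by simp
    qed
  qed
  then have "(\<lambda>i. \<Sum>j\<in>indices. \<Sum>k\<in>UNIV. Hsq s \<phi> (lp j k (a i))) \<longlonglongrightarrow> (\<Sum>j\<in>indices. \<Sum>k\<in>(UNIV::'p set). 0)"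
    by (intro tendsto_sum)
  then show ?thesis using tendsto_real_sqrt[of _ 0] by (simp add: HX_norm[OF aS])
qed

text \<open>Convergence of the moments makes all derivatives of the local parts uniformly Cauchy.
  Their limits are of class q and fit together to a section, whose own local parts are these limits,
  so the convergence holds in the norm of C^q.\<close>

lemma HX_bounded_subsequence:
  assumes a: "\<And>i. a i \<in> smooth_sections E" and B: "\<And>i. vnorm HX (a i) \<le> B"
  shows "\<exists>\<sigma> u. strict_mono (\<sigma> :: nat \<Rightarrow> nat) \<and> emb.ylim (a \<circ> \<sigma>) u"
proof -
  obtain R where R: "\<And>j u k x. is_section u \<Longrightarrow> j \<in> indices \<Longrightarrow> norm x > R \<Longrightarrow> lp j k u x = 0"
    using lp_uniform_support by blast
  note sec = smooth_section[OF a]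
  have nn: "0 \<le> vnorm HX (a i)" for i by (simp add: HX_norm[OF a] HX_sum_nonneg)
  obtain \<sigma> :: "nat \<Rightarrow> nat" where \<sigma>: "strict_mono \<sigma>" "\<And>p \<epsilon>. p \<in> indices \<times> (UNIV :: 'p set) \<Longrightarrow> \<epsilon> > 0 \<Longrightarrow>
    \<exists>N. \<forall>i\<ge>N. \<forall>l\<ge>N. fourier_moment (\<lambda>x. lp (fst p) (snd p) (a (\<sigma> i)) x - lp (fst p) (snd p) (a (\<sigma> l)) x) < \<epsilon>"
  proof (rule test_sequence_compact[OF sum, of "indices \<times> (UNIV :: 'p set)" "\<lambda>i p. lp (fst p) (snd p) (a i)" R "B\<^sup>2"])
    show "finite (indices \<times> (UNIV :: 'p set))" using finite_indices by simp
    fix i and p :: "nat \<times> 'p" assume p: "p \<in> indices \<times> UNIV"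
    then show "lp (fst p) (snd p) (a i) \<in> test_functions" using lp_test[OF a] by auto
    show "lp (fst p) (snd p) (a i) x = 0" if "norm x > R" for x using R[OF sec _ that] p by auto
    have "(vnorm HX (a i))\<^sup>2 \<le> B\<^sup>2" using B[of i] nn[of i] by (intro power_mono)
    then show "Hsq s \<phi> (lp (fst p) (snd p) (a i)) \<le> B\<^sup>2"
      using Hsq_le_HX_norm[OF a[of i], of "fst p" "snd p"] p by auto
  qed blast
  obtain C where C: "C \<ge> 0" "\<And>(f :: real^'n \<Rightarrow> complex) is x. f \<in> test_functions \<Longrightarrow> length is \<le> q \<Longrightarrow>
    cmod (pderivs is f x) \<le> C * fourier_moment f" using pderivs_le_moment by blast
  have "\<exists>w. Ck_on q UNIV w \<and> (\<forall>is e. length is \<le> q \<longrightarrow> e > 0 \<longrightarrow>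
    (\<exists>N. \<forall>i\<ge>N. \<forall>x. cmod (pderivs is (lp j k (a (\<sigma> i))) x - pderivs is w x) \<le> e))" if j: "j \<in> indices" for j k
  proof (rule uniform_limit_Ck)
    show ck: "Ck_on q UNIV (lp j k (a (\<sigma> i)))" for i by (rule lp_Ck[OF smooth_imp_Ck_section[OF a] j])
    fix "is" :: "'n list" and e :: real assume l: "length is \<le> q" and e: "e > 0"
    have ckl: "Ck_on (length is) UNIV (lp j k (a (\<sigma> i)))" for i by (rule Ck_on_mono[OF ck l])
    have "e / (C + 1) > 0" using e C(1) by simp
    then obtain N where N: "\<And>i l. i \<ge> N \<Longrightarrow> l \<ge> N \<Longrightarrow> fourier_moment (\<lambda>x. lp j k (a (\<sigma> i)) x - lp j k (a (\<sigma> l)) x) < e / (C + 1)"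
      using \<sigma>(2)[of "(j, k)" "e / (C + 1)"] j by auto
    show "\<exists>N. \<forall>i\<ge>N. \<forall>l\<ge>N. \<forall>x. cmod (pderivs is (lp j k (a (\<sigma> i))) x - pderivs is (lp j k (a (\<sigma> l))) x) < e"
    proof (intro exI allI impI)
      fix i l x assume il: "N \<le> i" "N \<le> l"
      let ?d = "\<lambda>x. lp j k (a (\<sigma> i)) x - lp j k (a (\<sigma> l)) x"
      have "pderivs is (lp j k (a (\<sigma> i))) x - pderivs is (lp j k (a (\<sigma> l))) x = pderivs is ?d x"
        by (rule pderivs_diff[OF open_UNIV ckl ckl, symmetric]) simp
      also have "cmod (pderivs is ?d x) \<le> C * fourier_moment ?d"
        by (rule C(2)[OF test_diff[OF lp_test[OF a j] lp_test[OF a j]] l])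
      also have "\<dots> \<le> C * (e / (C + 1))" using N[OF il] C(1) by (intro mult_left_mono) auto
      also have "\<dots> < e" using C(1) e by (simp add: pos_divide_less_eq)
      finally show "cmod (pderivs is (lp j k (a (\<sigma> i))) x - pderivs is (lp j k (a (\<sigma> l))) x) < e" .
    qed
  qed
  then have "\<exists>W. \<forall>j k. j \<in> indices \<longrightarrow> Ck_on q UNIV (W j k) \<and> (\<forall>is e. length is \<le> q \<longrightarrow> e > 0 \<longrightarrow>
    (\<exists>N. \<forall>i\<ge>N. \<forall>x. cmod (pderivs is (lp j k (a (\<sigma> i))) x - pderivs is (W j k) x) \<le> e))" by metis
  then obtain W where W: "\<And>j k. j \<in> indices \<Longrightarrow> Ck_on q UNIV (W j k)"
    "\<And>j k is e. j \<in> indices \<Longrightarrow> length is \<le> q \<Longrightarrow> e > 0 \<Longrightarrow>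
      \<exists>N. \<forall>i\<ge>N. \<forall>x. cmod (pderivs is (lp j k (a (\<sigma> i))) x - pderivs is (W j k) x) \<le> e" by blast
  have lim: "(\<lambda>i. lp j k (a (\<sigma> i)) y) \<longlonglongrightarrow> W j k y" if j: "j \<in> indices" for j k y
  proof (rule LIMSEQ_I)
    fix r :: real assume "r > 0"
    then obtain N where "\<forall>i\<ge>N. \<forall>x. cmod (lp j k (a (\<sigma> i)) x - W j k x) \<le> r / 2"
      using W(2)[OF j, of "[]" "r / 2" k] by auto
    then show "\<exists>no. \<forall>i\<ge>no. norm (lp j k (a (\<sigma> i)) y - W j k y) < r" using \<open>r > 0\<close>
      by (intro exI[of _ N]) (smt (verit, best) field_sum_of_halves)
  qed
  obtain u where u: "u \<in> Ck_sections E q" "\<And>j k y. j \<in> indices \<Longrightarrow> lp j k u y = W j k y"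
    using section_limit[where a="\<lambda>i. a (\<sigma> i)" and W=W and k=q, OF sec W(1) lim] by blast
  have uW: "lp j k u = W j k" if "j \<in> indices" for j k using u(2)[OF that] by auto
  note su = Ck_sections_section[OF u(1)]
  define c where "c = real (card {\<mu> :: 'n multiset. size \<mu> \<le> q})"
  have nd: "ndist CY (a (\<sigma> i)) u = (\<Sum>j\<in>indices. \<Sum>k\<in>UNIV. Cq_norm_Rn q (\<lambda>y. lp j k (a (\<sigma> i)) y - lp j k u y))" for i
    using smooth_imp_Ck_section[OF a] u(1) by (simp add: ndist_def CY_simps lp_sub_eq[OF sec su] cong: sum.cong)
  have "(\<lambda>i. Cq_norm_Rn q (\<lambda>y. lp j k (a (\<sigma> i)) y - lp j k u y)) \<longlonglongrightarrow> 0" if j: "j \<in> indices" for j k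
  proof (rule LIMSEQ_I)
    fix r :: real assume r: "r > 0"
    define e where "e = r / (2 * (c + 1))"
    have c0: "c \<ge> 0" by (simp add: c_def)
    have e: "e > 0" using r c0 by (simp add: e_def)
    \<comment> \<open>Only finitely many derivatives have order at most q, which gives one threshold
      for all of them.\<close>
    have fin: "finite {is :: 'n list. set is \<subseteq> UNIV \<and> length is \<le> q}" by (rule finite_lists_length_le) simp
    have "\<forall>is\<in>{is :: 'n list. set is \<subseteq> UNIV \<and> length is \<le> q}. \<forall>\<^sub>F i in sequentially.
        \<forall>x. cmod (pderivs is (lp j k (a (\<sigma> i))) x - pderivs is (W j k) x) \<le> e"
      using W(2)[OF j _ e] by (auto simp: eventually_sequentially)
    then have "\<forall>\<^sub>F i in sequentially. \<forall>is\<in>{is :: 'n list. set is \<subseteq> UNIV \<and> length is \<le> q}.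
        \<forall>x. cmod (pderivs is (lp j k (a (\<sigma> i))) x - pderivs is (W j k) x) \<le> e"
      by (rule eventually_ball_finite[OF fin])
    then obtain N where N: "\<And>i is x. i \<ge> N \<Longrightarrow> length is \<le> q \<Longrightarrow> cmod (pderivs is (lp j k (a (\<sigma> i))) x - pderivs is (W j k) x) \<le> e"
      by (auto simp: eventually_sequentially)
    have "norm (Cq_norm_Rn q (\<lambda>y. lp j k (a (\<sigma> i)) y - lp j k u y) - 0) < r" if i: "i \<ge> N" for i
    proof -
      have ck: "Ck_on q UNIV (lp j k (a (\<sigma> i)))" by (rule lp_Ck[OF smooth_imp_Ck_section[OF a] j])
      have "Cq_norm_Rn q (\<lambda>y. lp j k (a (\<sigma> i)) y - lp j k u y) \<le> c * e"
        unfolding c_def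
      proof (rule Cq_norm_le)
        fix "is" :: "'n list" and x assume l: "length is \<le> q"
        show "cmod (pderivs is (\<lambda>y. lp j k (a (\<sigma> i)) y - lp j k u y) x) \<le> e"
          using N[OF i l, of x] pderivs_diff[OF open_UNIV Ck_on_mono[OF ck l] Ck_on_mono[OF W(1)[OF j] l], of x k]
          by (simp add: uW[OF j])
      qed
      also have "c * e < (c + 1) * e" using e by simp
      also have "(c + 1) * e = r / 2"
      proof -
        have "v \<noteq> 0 \<Longrightarrow> v * (r / (2 * v)) = r / 2" for v :: real by simp
        from this[of "c + 1"] show ?thesis unfolding e_def using c0 by linarith
      qed
      finally have "Cq_norm_Rn q (\<lambda>y. lp j k (a (\<sigma> i)) y - lp j k u y) < r" using r by simp
      moreover have "0 \<le> Cq_norm_Rn q (\<lambda>y. lp j k (a (\<sigma> i)) y - lp j k u y)"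
        using Cq_norm_nonneg[OF lp_Cq_compact[OF Ck_sections_add[OF smooth_imp_Ck_section[OF a] Ck_sections_scale[OF u(1), of "- 1"]] j]]
        by (simp add: lp_sub_eq[OF sec su j])
      ultimately show ?thesis by simp
    qed
    then show "\<exists>no. \<forall>i\<ge>no. norm (Cq_norm_Rn q (\<lambda>y. lp j k (a (\<sigma> i)) y - lp j k u y) - 0) < r" by blast
  qed
  then have "(\<lambda>i. ndist CY (a (\<sigma> i)) u) \<longlonglongrightarrow> (\<Sum>j\<in>indices. \<Sum>k\<in>(UNIV::'p set). 0)"
    unfolding nd by (intro tendsto_sum)
  then show ?thesis using \<sigma>(1) u(1) by (intro exI[of _ \<sigma>] exI[of _ u]) (simp add: CY_simps o_def)
qed

lemma sufficiency:
  shows "\<exists>!T. embedding_extending_identity E L s \<phi> q T"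
    "embedding_extending_identity E L s \<phi> q T \<Longrightarrow> compact_operator (H_bundle E L s \<phi>) CY T"
proof -
  obtain C where C: "\<And>u. u \<in> vecs HX \<Longrightarrow> vnorm CY u \<le> C * vnorm HX u"
    using CY_norm_le_HX_norm by (auto simp: HX_simps)
  have comp: "\<exists>\<sigma> u. strict_mono (\<sigma> :: nat \<Rightarrow> nat) \<and> emb.ylim (a \<circ> \<sigma>) u"
    if "\<And>i. a i \<in> vecs HX" "\<And>i. vnorm HX (a i) \<le> B" for a B
    by (rule HX_bounded_subsequence[OF _ that(2)]) (use that(1) in \<open>simp add: HX_simps\<close>)
  show "\<exists>!T. embedding_extending_identity E L s \<phi> q T"
    unfolding embedding_iff by (rule emb.extends_identity_ex1[OF C HX_Cauchy_null comp])
  show "compact_operator (H_bundle E L s \<phi>) CY T" if T: "embedding_extending_identity E L s \<phi> q T"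
    unfolding H_bundle_def
  proof (rule emb.extends_identity_compact[OF C HX_Cauchy_null])
    show "emb.extends_identity T" using T by (simp add: embedding_iff)
  qed (assumption | rule comp)+
qed

end

end

section \<open>Necessity of the integral condition\<close>

text \<open>The indices on either side of k form a geometric series each; counting k twice costs
  nothing in an upper bound.\<close>

lemma sum_absdiff_powers_le:
  fixes r :: real
  assumes r: "0 \<le> r" "r < 1"
  shows "(\<Sum>l<m. r ^ absdiff k l) \<le> 2 / (1 - r)"
proof -
  have geo: "(\<Sum>i<n. r ^ i) \<le> 1 / (1 - r)" for n
  proof -
    have "(\<Sum>i<n. r ^ i) = (1 - r ^ n) / (1 - r)" using geometric_sum[of r n] r by (simp add: field_simps)
    also have "\<dots> \<le> 1 / (1 - r)" using r by (intro divide_right_mono) auto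
    finally show ?thesis .
  qed
  have "(\<Sum>l<m. r ^ absdiff k l) \<le> (\<Sum>l\<in>{..<Suc k} \<union> {k..<k + m}. r ^ absdiff k l)"
    by (rule sum_mono2) (use r in auto)
  also have "\<dots> \<le> (\<Sum>l<Suc k. r ^ absdiff k l) + (\<Sum>l\<in>{k..<k + m}. r ^ absdiff k l)"
    using r by (subst sum_Un_nat[symmetric] sum.union_inter[symmetric]) (auto intro!: sum_nonneg)
  also have "(\<Sum>l<Suc k. r ^ absdiff k l) = (\<Sum>l<Suc k. r ^ (Suc k - Suc l))"
    by (rule sum.cong) (auto simp: absdiff_def)
  also have "\<dots> = (\<Sum>l<Suc k. r ^ l)" by (rule sum.nat_diff_reindex)
  also have "(\<Sum>l\<in>{k..<k + m}. r ^ absdiff k l) = (\<Sum>l<m. r ^ l)"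
    by (rule sum.reindex_bij_witness[of _ "\<lambda>l. l + k" "\<lambda>l. l - k"]) (auto simp: absdiff_def)
  finally show ?thesis using geo[of "Suc k"] geo[of m] by (simp add: field_simps)
qed

lemma absdiff_commute: "absdiff k l = absdiff l k"
  by (simp add: absdiff_def)

text \<open>Cauchy-Schwarz with each weight split into two square roots: the row estimate of the
  Schur test.\<close>

lemma weighted_square_sum_le:
  fixes x r :: "nat \<Rightarrow> real"
  assumes "\<And>k. k \<in> I \<Longrightarrow> 0 \<le> r k"
  shows "(\<Sum>k\<in>I. x k * r k)\<^sup>2 \<le> (\<Sum>k\<in>I. r k) * (\<Sum>k\<in>I. (x k)\<^sup>2 * r k)"
proof -
  have "(\<Sum>k\<in>I. x k * r k) = (\<Sum>k\<in>I. sqrt (r k) * (x k * sqrt (r k)))"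
    by (rule sum.cong) (auto simp: assms mult.left_commute)
  then have "(\<Sum>k\<in>I. x k * r k)\<^sup>2 \<le> (\<Sum>k\<in>I. (sqrt (r k))\<^sup>2) * (\<Sum>k\<in>I. (x k * sqrt (r k))\<^sup>2)"
    using Cauchy_Schwarz_ineq_sum[of "\<lambda>k. sqrt (r k)" "\<lambda>k. x k * sqrt (r k)" I] by simp
  also have "\<dots> = (\<Sum>k\<in>I. r k) * (\<Sum>k\<in>I. (x k)\<^sup>2 * r k)"
    by (simp add: assms power_mult_distrib cong: sum.cong)
  finally show ?thesis .
qed

lemma suminf_ennreal_le:
  fixes g :: "nat \<Rightarrow> real"
  assumes "\<And>l. 0 \<le> g l" "\<And>m. (\<Sum>l<m. g l) \<le> B"
  shows "(\<Sum>l. ennreal (g l)) \<le> ennreal B"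
  unfolding suminf_eq_SUP
  by (rule SUP_least) (use assms in \<open>simp add: sum_ennreal ennreal_leI\<close>)

context weight
begin

definition wt :: "nat \<Rightarrow> real" where "wt k = 1 / (\<phi> (2 ^ k))\<^sup>2"

lemma wt_pos: "0 < wt k"
  using class_M_pos[OF \<phi>, of "2 ^ k"] by (simp add: wt_def)

text \<open>The pieces, of frequency about \<open>2\<^sup>k\<close>, are almost orthogonal: a discrete Schur test.\<close>

lemma Hsq_dyadic_sum_le:
  obtains C where "C \<ge> 0" "\<And>D N (h :: nat \<Rightarrow> real^'n \<Rightarrow> complex). 0 \<le> D \<Longrightarrow> (\<And>k. h k \<in> test_functions) \<Longrightarrow>
    (\<And>k \<xi>. cmod (fourier (h k) \<xi>) \<le> D * (1 / 2 ^ k) ^ CARD('n)) \<Longrightarrow>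
    (\<And>k \<xi>. (1 + norm \<xi>) ^ Suc (q + CARD('n)) * cmod (fourier (h k) \<xi>) \<le> D * (2 ^ k) ^ Suc (q + CARD('n)) * (1 / 2 ^ k) ^ CARD('n)) \<Longrightarrow>
    Hsq s \<phi> (\<lambda>x. \<Sum>k\<le>N. of_real (wt k * (1 / 2 ^ k) ^ q) * h k x) \<le> C * D\<^sup>2 * (\<Sum>k\<le>N. wt k)"
proof -
  let ?n = "CARD('n)"
  have n1: "1 \<le> ?n" by (simp add: Suc_leI)
  \<comment> \<open>One more power than q + n: in the shells beyond the frequency 2^k of a piece it
    leaves exactly one factor of decay.\<close>
  let ?M = "Suc (q + ?n)"
  let ?V = "unit_ball_vol (real ?n) * 2 ^ ?n"
  obtain A where A: "A \<ge> 1" "\<And>k t. 2 ^ k \<le> t \<Longrightarrow> t \<le> 2 ^ Suc k \<Longrightarrow> (\<phi> t)\<^sup>2 \<le> A * (\<phi> (2 ^ k))\<^sup>2"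
    using class_M_dyadic_comparison[OF \<phi>] by metis
  obtain B where B: "B \<ge> 1" "\<And>k l. (\<phi> (2 ^ l))\<^sup>2 \<le> B * (3 / 2) ^ absdiff k l * (\<phi> (2 ^ k))\<^sup>2"
    using class_M_dyadic_growth[OF \<phi>] by blast
  define C1 where "C1 = ?V * 2 ^ (2 * q + ?n) * A"
  have C1: "C1 \<ge> 0" using A(1) by (simp add: C1_def)
  show ?thesis
  proof (rule that[of "C1 * (32 * B)"])
    show "0 \<le> C1 * (32 * B)" using C1 B(1) by simp
    fix D N and h :: "nat \<Rightarrow> real^'n \<Rightarrow> complex"
    assume D: "0 \<le> D" and ht: "\<And>k. h k \<in> test_functions"
      and h1: "\<And>k \<xi>. cmod (fourier (h k) \<xi>) \<le> D * (1 / 2 ^ k) ^ ?n"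
      and h2: "\<And>k \<xi>. (1 + norm \<xi>) ^ ?M * cmod (fourier (h k) \<xi>) \<le> D * (2 ^ k) ^ ?M * (1 / 2 ^ k) ^ ?n"
    define f where "f x = (\<Sum>k\<le>N. of_real (wt k * (1 / 2 ^ k) ^ q) * h k x)" for x
    have ft: "f \<in> test_functions" unfolding f_def[abs_def] by (intro test_sum test_cmult ht)
    have ff: "fourier f \<xi> = (\<Sum>k\<le>N. of_real (wt k * (1 / 2 ^ k) ^ q) * fourier (h k) \<xi>)" for \<xi>
      unfolding f_def[abs_def] by (subst fourier_sum) (auto intro!: test_integrable test_cmult ht simp only: fourier_cmult)
    define S where "S l = (\<Sum>k\<le>N. wt k * (1 / 2) ^ absdiff k l)" for l
    have S0: "0 \<le> S l" for l unfolding S_def by (intro sum_nonneg mult_nonneg_nonneg less_imp_le[OF wt_pos]) auto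
    \<comment> \<open>For l at most k the uniform bound gives 2^((l-k)(q+n)), and q + n is at least
      1; for l beyond k the moment bound of order q + n + 1 gives 2^(k-l). Either way the piece
      decays like 2^(-|k-l|) away from its own shell.\<close>
    have piece: "(2 ^ l) ^ (q + ?n) * ((1 / 2 ^ k) ^ q * cmod (fourier (h k) \<xi>)) \<le> D * (1 / 2) ^ absdiff k l"
      if \<xi>: "\<xi> \<in> shell l" for k l and \<xi> :: "real^'n"
    proof (cases "l \<le> k")
      case True
      have "(2 ^ l) ^ (q + ?n) * ((1 / 2 ^ k) ^ q * cmod (fourier (h k) \<xi>)) \<le>
          (2 ^ l) ^ (q + ?n) * ((1 / 2 ^ k) ^ q * (D * (1 / 2 ^ k) ^ ?n))"
        by (intro mult_left_mono h1) auto
      also have "\<dots> = D * ((2 ^ l) * (1 / 2 ^ k)) ^ (q + ?n)"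
        by (simp only: power_mult_distrib power_add mult_ac)
      also have "(2::real) ^ l * (1 / 2 ^ k) = (1 / 2) ^ (k - l)"
        using True by (simp add: power_diff power_one_over divide_simps)
      also have "((1 / 2 :: real) ^ (k - l)) ^ (q + ?n) \<le> ((1 / 2) ^ (k - l)) ^ 1"
        by (rule power_decreasing) (use n1 in \<open>linarith, simp_all add: power_le_one\<close>)
      finally show ?thesis using True D by (simp add: absdiff_def mult_left_mono)
    next
      case False
      have br: "2 ^ l \<le> 1 + norm \<xi>" using \<xi> bracket_le[of \<xi>] by (simp add: shell_def)
      have "(2 ^ l) ^ ?M * cmod (fourier (h k) \<xi>) \<le> (1 + norm \<xi>) ^ ?M * cmod (fourier (h k) \<xi>)"
        by (intro mult_right_mono power_mono br) auto
      also note h2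
      finally have "(2 ^ l) ^ ?M * cmod (fourier (h k) \<xi>) \<le> D * (2 ^ k) ^ ?M * (1 / 2 ^ k) ^ ?n" .
      then have "(1 / 2 ^ l) * (1 / 2 ^ k) ^ q * ((2 ^ l) ^ ?M * cmod (fourier (h k) \<xi>)) \<le>
          (1 / 2 ^ l) * (1 / 2 ^ k) ^ q * (D * (2 ^ k) ^ ?M * (1 / 2 ^ k) ^ ?n)"
        by (intro mult_left_mono) auto
      also have "(1 / 2 ^ l) * (1 / 2 ^ k) ^ q * ((2 ^ l) ^ ?M * cmod (fourier (h k) \<xi>)) =
          (2 ^ l) ^ (q + ?n) * ((1 / 2 ^ k) ^ q * cmod (fourier (h k) \<xi>))" by simp
      also have "(1 / 2 ^ l) * (1 / 2 ^ k) ^ q * (D * (2 ^ k) ^ ?M * (1 / 2 ^ k) ^ ?n) = D * (2 ^ k / 2 ^ l)"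
        by (simp add: power_add power_divide)
      also have "(2::real) ^ k / 2 ^ l = (1 / 2) ^ (l - k)"
        using False by (simp add: power_diff power_one_over divide_simps)
      finally show ?thesis using False by (simp add: absdiff_def)
    qed
    have fS: "(2 ^ l) ^ (q + ?n) * cmod (fourier f \<xi>) \<le> D * S l" if \<xi>: "\<xi> \<in> shell l" for l and \<xi> :: "real^'n"
    proof -
      have "cmod (fourier f \<xi>) \<le> (\<Sum>k\<le>N. wt k * ((1 / 2 ^ k) ^ q * cmod (fourier (h k) \<xi>)))"
        unfolding ff using less_imp_le[OF wt_pos]
        by (intro order_trans[OF norm_sum] sum_mono) (simp add: norm_mult norm_power norm_divide)
      then have "(2 ^ l) ^ (q + ?n) * cmod (fourier f \<xi>) \<le>
          (2 ^ l) ^ (q + ?n) * (\<Sum>k\<le>N. wt k * ((1 / 2 ^ k) ^ q * cmod (fourier (h k) \<xi>)))"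
        by (rule mult_left_mono) simp
      also have "\<dots> = (\<Sum>k\<le>N. wt k * ((2 ^ l) ^ (q + ?n) * ((1 / 2 ^ k) ^ q * cmod (fourier (h k) \<xi>))))"
        by (simp only: sum_distrib_left mult.left_commute)
      also have "\<dots> \<le> (\<Sum>k\<le>N. wt k * (D * (1 / 2) ^ absdiff k l))"
        using less_imp_le[OF wt_pos] by (intro sum_mono mult_left_mono piece \<xi>)
      also have "\<dots> = D * S l" by (simp only: S_def sum_distrib_left mult.left_commute)
      finally show ?thesis .
    qed
    define w where "w l = (\<phi> (2 ^ l))\<^sup>2" for l
    have w: "0 < w l" "wt l = 1 / w l" for l using class_M_pos[OF \<phi>, of "2 ^ l"] by (auto simp: w_def wt_def)
    define g where "g l = C1 * D\<^sup>2 * (w l * (S l)\<^sup>2)" for l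
    have g0: "0 \<le> g l" for l using C1 w(1)[of l] by (simp add: g_def)
    have shell_le: "(\<integral>\<^sup>+\<xi>. ennreal (sobolev_integrand s \<phi> (fourier f) \<xi>) * indicator (shell l) \<xi> \<partial>lborel) \<le> ennreal (g l)" for l
    proof -
      \<comment> \<open>The supremum of the integrand on the l-th shell. All powers of 2^l cancel
        against the volume 2^(ln) of the shell, because s is exactly q + n/2.\<close>
      define c where "c = (2 ^ Suc l) ^ (2 * q + ?n) * (A * w l) * (D * S l / (2 ^ l) ^ (q + ?n))\<^sup>2"
      have "(\<integral>\<^sup>+\<xi>. ennreal (sobolev_integrand s \<phi> (fourier f) \<xi>) * indicator (shell l) \<xi> \<partial>lborel)
          \<le> ennreal (?V * (c * (2 ^ l) ^ ?n))"
      proof (rule nn_integral_shell_le)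
        show "0 \<le> c" using A(1) w(1)[of l] by (simp add: c_def)
        fix \<xi> :: "real^'n" assume \<xi>: "\<xi> \<in> shell l"
        then have k: "2 ^ l \<le> bracket \<xi>" "bracket \<xi> \<le> 2 ^ Suc l" by (auto simp: shell_def)
        have "cmod (fourier f \<xi>) \<le> D * S l / (2 ^ l) ^ (q + ?n)"
          using fS[OF \<xi>] by (simp add: pos_le_divide_eq mult.commute)
        then have "sobolev_integrand s \<phi> (fourier f) \<xi> \<le> c"
          unfolding integrand_eq c_def w_def using k A bracket_ge_1[of \<xi>]
          by (intro mult_mono power_mono A(2)) auto
        then show "ennreal (sobolev_integrand s \<phi> (fourier f) \<xi>) \<le> ennreal c" by (rule ennreal_leI)
      qed
      also have "?V * (c * (2 ^ l) ^ ?n) = g l"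
      proof -
        have p: "((2::real) ^ Suc l) ^ (2 * q + ?n) * (2 ^ l) ^ ?n = 2 ^ (2 * q + ?n) * ((2 ^ l) ^ (q + ?n))\<^sup>2"
        proof -
          have "((2::real) ^ Suc l) ^ (2 * q + ?n) = 2 ^ (2 * q + ?n) * (2 ^ l) ^ (2 * q + ?n)"
            by (simp add: power_mult_distrib)
          moreover have "((2::real) ^ l) ^ (2 * q + ?n) * (2 ^ l) ^ ?n = ((2 ^ l) ^ (q + ?n))\<^sup>2"
            by (simp add: power_add power_mult power2_eq_square power_mult_distrib)
          ultimately show ?thesis by (simp only: mult.assoc)
        qed
        have "c * (2 ^ l) ^ ?n = (((2::real) ^ Suc l) ^ (2 * q + ?n) * (2 ^ l) ^ ?n) * (A * w l) * (D * S l / (2 ^ l) ^ (q + ?n))\<^sup>2"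
          by (simp only: c_def mult_ac)
        also have "\<dots> = 2 ^ (2 * q + ?n) * A * D\<^sup>2 * (w l * (S l)\<^sup>2)"
          unfolding p by (simp add: power_divide power_mult_distrib)
        finally show ?thesis by (simp only: g_def C1_def mult_ac)
      qed
      finally show ?thesis .
    qed
    \<comment> \<open>Dyadic growth bounds \<open>w l * wt k\<close> by a multiple of (3/2)^|k-l|,
      which the off-diagonal factor (1/2)^|k-l| turns into (3/4)^|k-l|. The factor 4 is the row sum
      2 / (1 - 1/2).\<close>
    have S2: "w l * (S l)\<^sup>2 \<le> 4 * B * (\<Sum>k\<le>N. wt k * (3 / 4) ^ absdiff k l)" for l
    proof -
      have "(S l)\<^sup>2 \<le> (\<Sum>k\<le>N. (1 / 2) ^ absdiff k l) * (\<Sum>k\<le>N. (wt k)\<^sup>2 * (1 / 2) ^ absdiff k l)"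
        unfolding S_def by (rule weighted_square_sum_le) simp
      also have "\<dots> \<le> 4 * (\<Sum>k\<le>N. (wt k)\<^sup>2 * (1 / 2) ^ absdiff k l)"
      proof (rule mult_right_mono)
        show "(\<Sum>k\<le>N. (1 / 2) ^ absdiff k l) \<le> (4::real)"
          using sum_absdiff_powers_le[of "1 / 2" l "Suc N"] by (simp add: absdiff_commute lessThan_Suc_atMost)
      qed (auto intro!: sum_nonneg)
      finally have "w l * (S l)\<^sup>2 \<le> w l * (4 * (\<Sum>k\<le>N. (wt k)\<^sup>2 * (1 / 2) ^ absdiff k l))"
        using w(1)[of l] by (intro mult_left_mono) auto
      also have "\<dots> = 4 * (\<Sum>k\<le>N. (w l * wt k) * (wt k * (1 / 2) ^ absdiff k l))"
        by (simp only: sum_distrib_left power2_eq_square mult_ac)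
      also have "\<dots> \<le> 4 * (\<Sum>k\<le>N. (B * (3 / 2) ^ absdiff k l) * (wt k * (1 / 2) ^ absdiff k l))"
      proof (intro mult_left_mono sum_mono mult_right_mono)
        fix k
        show "w l * wt k \<le> B * (3 / 2) ^ absdiff k l"
          using B(2)[of l k] w(1)[of k] by (simp add: w(2) w_def[symmetric] pos_divide_le_eq)
      qed (use less_imp_le[OF wt_pos] in auto)
      also have "\<dots> = 4 * B * (\<Sum>k\<le>N. wt k * ((3 / 2) ^ absdiff k l * (1 / 2) ^ absdiff k l))"
        by (simp only: sum_distrib_left mult_ac)
      also have "\<dots> = 4 * B * (\<Sum>k\<le>N. wt k * (3 / 4) ^ absdiff k l)"
        by (simp only: power_mult_distrib[symmetric]) simp
      finally show ?thesis .
    qed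
    \<comment> \<open>After exchanging the sums the inner one is at most 2 / (1 - 3/4) = 8; with the
      previous factor 4 this makes 32.\<close>
    have part: "(\<Sum>l<m. g l) \<le> C1 * (32 * B) * D\<^sup>2 * (\<Sum>k\<le>N. wt k)" for m
    proof -
      have "(\<Sum>l<m. w l * (S l)\<^sup>2) \<le> (\<Sum>l<m. 4 * B * (\<Sum>k\<le>N. wt k * (3 / 4) ^ absdiff k l))"
        by (rule sum_mono) (rule S2)
      also have "\<dots> = 4 * B * (\<Sum>k\<le>N. wt k * (\<Sum>l<m. (3 / 4) ^ absdiff k l))"
        unfolding sum_distrib_left[symmetric] by (subst sum.swap) (simp only: sum_distrib_left)
      also have "\<dots> \<le> 4 * B * (\<Sum>k\<le>N. wt k * 8)"
        using sum_absdiff_powers_le[of "3 / 4"] B(1) less_imp_le[OF wt_pos]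
        by (intro mult_left_mono sum_mono) auto
      also have "\<dots> = 32 * B * (\<Sum>k\<le>N. wt k)" by (simp add: sum_distrib_right[symmetric])
      finally have "C1 * D\<^sup>2 * (\<Sum>l<m. w l * (S l)\<^sup>2) \<le> C1 * D\<^sup>2 * (32 * B * (\<Sum>k\<le>N. wt k))"
        using C1 by (intro mult_left_mono) auto
      moreover have "(\<Sum>l<m. g l) = C1 * D\<^sup>2 * (\<Sum>l<m. w l * (S l)\<^sup>2)" by (simp only: g_def sum_distrib_left)
      ultimately show ?thesis by (simp only: mult_ac)
    qed
    have "ennreal (Hsq s \<phi> f) = (\<integral>\<^sup>+\<xi>. ennreal (sobolev_integrand s \<phi> (fourier f) \<xi>) \<partial>lborel)"
      unfolding Hsq_def by (rule nn_integral_eq_integral[symmetric, OF integrand_integrable[OF ft]]) (simp add: sobolev_integrand_def)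
    also have "\<dots> = (\<Sum>l. \<integral>\<^sup>+\<xi>. ennreal (sobolev_integrand s \<phi> (fourier f) \<xi>) * indicator (shell l) \<xi> \<partial>lborel)"
      by (rule nn_integral_shells) (use sobolev_integrand_borel[OF \<phi> fourier_borel[OF ft]] in simp)
    also have "\<dots> \<le> (\<Sum>l. ennreal (g l))" by (intro suminf_le shell_le) auto
    also have "\<dots> \<le> ennreal (C1 * (32 * B) * D\<^sup>2 * (\<Sum>k\<le>N. wt k))" by (rule suminf_ennreal_le[OF g0 part])
    finally have "Hsq s \<phi> f \<le> C1 * (32 * B) * D\<^sup>2 * (\<Sum>k\<le>N. wt k)"
      using C1 B(1) less_imp_le[OF wt_pos] by (subst (asm) ennreal_le_iff) (auto intro!: mult_nonneg_nonneg sum_nonneg)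
    then show "Hsq s \<phi> (\<lambda>x. \<Sum>k\<le>N. of_real (wt k * (1 / 2 ^ k) ^ q) * h k x) \<le> C1 * (32 * B) * D\<^sup>2 * (\<Sum>k\<le>N. wt k)"
      by (simp only: f_def[abs_def])
  qed
qed

end

text \<open>Every derivative of \<open>c \<cdot> \<psi>(\<rho>(\<kappa> - y\<^sub>0))\<close> is a sum of terms of the same shape, each
  differentiation producing at most one factor \<open>\<rho>\<close>.\<close>

lemma scaled_pderivs_bound:
  fixes c :: "real^'n::finite \<Rightarrow> complex" and \<kappa> :: "real^'n \<Rightarrow> real^'n"
  assumes \<Omega>: "open \<Omega>" and Q: "compact Q" "Q \<subseteq> \<Omega>" and c: "smooth_on \<Omega> c" and \<kappa>: "smooth_on \<Omega> \<kappa>"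
    and \<psi>: "\<psi> \<in> test_functions"
  shows "\<exists>C\<ge>0. \<forall>\<rho>\<ge>1. \<forall>y\<in>Q. cmod (pderivs is (\<lambda>y. c y * \<psi> (\<rho> *\<^sub>R (\<kappa> y - y0))) y) \<le> C * \<rho> ^ length is"
  using c \<psi>
\<comment> \<open>Induction from the end of the list: that entry is differentiated at the outset,
  and yields functions of the same shape with other coefficients and profiles, to which the
  hypothesis for the shorter list applies.\<close>
proof (induction "is" arbitrary: c \<psi> rule: rev_induct)
  case Nil
  have "compact (c ` Q)"
    by (rule compact_continuous_image[OF continuous_on_subset[OF Ck_on_imp_continuous_on[OF smooth_on_imp_Ck[OF Nil(1)]] Q(2)] Q(1)])
  then obtain B where B: "B > 0" "\<And>z. z \<in> c ` Q \<Longrightarrow> cmod z \<le> B" using compact_imp_bounded bounded_pos by metis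
  obtain B' where B': "B' > 0" "\<And>z. cmod (\<psi> z) \<le> B'" using test_bounded[OF Nil(2)] by blast
  show ?case
    by (rule exI[of _ "B * B'"]) (use B B' in \<open>auto simp: norm_mult intro!: mult_mono\<close>)
next
  case (snoc i "is")
  note c = snoc.prems(1) and \<psi> = snoc.prems(2)
  define c' where "c' = pderivs [i] c"
  define cm where "cm m y = c y * of_real (pderivs [i] \<kappa> y $ m)" for m y
  have c': "smooth_on \<Omega> c'" unfolding c'_def by (rule smooth_on_pderivs[OF c])
  have cm: "smooth_on \<Omega> (cm m)" for m unfolding cm_def[abs_def]
    by (intro smooth_on_mult[OF \<Omega>] c smooth_on_bounded_linear_compose[OF \<Omega> bounded_linear_of_real]
      smooth_on_bounded_linear_compose[OF \<Omega> bounded_linear_vec_nth] smooth_on_pderivs \<kappa>)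
  have arg: "smooth_on \<Omega> (\<lambda>y. \<rho> *\<^sub>R (\<kappa> y - y0))" for \<rho>
    using smooth_on_bounded_linear_compose[OF \<Omega> bounded_linear_scaleR_right smooth_on_add[OF \<Omega> \<kappa> smooth_on_const], of \<rho> "- y0"]
    by simp
  have sm: "smooth_on \<Omega> (\<lambda>y. d y * \<theta> (\<rho> *\<^sub>R (\<kappa> y - y0)))" if "smooth_on \<Omega> d" "\<theta> \<in> test_functions" for d \<theta> \<rho>
    by (intro smooth_on_mult[OF \<Omega>] that smooth_on_compose[OF \<Omega> open_UNIV _ arg test_smooth]) simp
  have der: "pderivs [i] (\<lambda>y. c y * \<psi> (\<rho> *\<^sub>R (\<kappa> y - y0))) y = c' y * \<psi> (\<rho> *\<^sub>R (\<kappa> y - y0)) +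
      (\<Sum>m\<in>UNIV. of_real \<rho> * (cm m y * pderivs [m] \<psi> (\<rho> *\<^sub>R (\<kappa> y - y0))))" if y: "y \<in> \<Omega>" for \<rho> y
  proof -
    let ?z = "\<rho> *\<^sub>R (\<kappa> y - y0)"
    have k: "((\<lambda>y. \<rho> *\<^sub>R (\<kappa> y - y0)) has_derivative (\<lambda>v. \<rho> *\<^sub>R frechet_derivative \<kappa> (at y) v)) (at y)"
      using smooth_on_has_derivative[OF \<kappa> y] by (auto intro!: derivative_eq_intros)
    have p: "(\<psi> has_derivative frechet_derivative \<psi> (at ?z)) (at ?z)"
      by (rule smooth_on_has_derivative[OF test_smooth[OF \<psi>]]) simp
    have pv: "frechet_derivative \<psi> (at ?z) v = (\<Sum>m\<in>UNIV. v $ m *\<^sub>R pderivs [m] \<psi> ?z)" for v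
      by (rule frechet_eq_sum_pderivs) (use p in \<open>auto simp: differentiable_def\<close>)
    have "((\<lambda>y. c y * \<psi> (\<rho> *\<^sub>R (\<kappa> y - y0))) has_derivative
      (\<lambda>v. c y * frechet_derivative \<psi> (at ?z) (\<rho> *\<^sub>R frechet_derivative \<kappa> (at y) v) + frechet_derivative c (at y) v * \<psi> ?z)) (at y)"
      by (rule has_derivative_mult[OF smooth_on_has_derivative[OF c y] has_derivative_compose[OF k p]])
    from has_derivative_imp_frechet[OF this]
    have "pderivs [i] (\<lambda>y. c y * \<psi> (\<rho> *\<^sub>R (\<kappa> y - y0))) y =
        c y * frechet_derivative \<psi> (at ?z) (\<rho> *\<^sub>R pderivs [i] \<kappa> y) + c' y * \<psi> ?z"
      by (simp add: c'_def)
    also have "c y * frechet_derivative \<psi> (at ?z) (\<rho> *\<^sub>R pderivs [i] \<kappa> y) =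
        (\<Sum>m\<in>UNIV. of_real \<rho> * (cm m y * pderivs [m] \<psi> ?z))"
      unfolding pv cm_def sum_distrib_left
      by (rule sum.cong[OF refl]) (simp only: vector_scaleR_component scaleR_conv_of_real[where 'a=complex] of_real_mult real_scaleR_def mult_ac)
    finally show ?thesis by (simp only: add.commute)
  qed
  obtain C0 where C0: "C0 \<ge> 0" "\<And>\<rho> y. \<rho> \<ge> 1 \<Longrightarrow> y \<in> Q \<Longrightarrow>
      cmod (pderivs is (\<lambda>y. c' y * \<psi> (\<rho> *\<^sub>R (\<kappa> y - y0))) y) \<le> C0 * \<rho> ^ length is"
    using snoc.IH[OF c' \<psi>] by blast
  have "\<forall>m. \<exists>C\<ge>0. \<forall>\<rho>\<ge>1. \<forall>y\<in>Q. cmod (pderivs is (\<lambda>y. cm m y * pderivs [m] \<psi> (\<rho> *\<^sub>R (\<kappa> y - y0))) y) \<le> C * \<rho> ^ length is"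
    using snoc.IH[OF cm test_pderivs[OF \<psi>]] by blast
  from choice[OF this] obtain Cm where "\<forall>m. 0 \<le> Cm m \<and> (\<forall>\<rho>\<ge>1. \<forall>y\<in>Q.
      cmod (pderivs is (\<lambda>y. cm m y * pderivs [m] \<psi> (\<rho> *\<^sub>R (\<kappa> y - y0))) y) \<le> Cm m * \<rho> ^ length is)"
    by blast
  then have Cm: "Cm m \<ge> 0" "\<rho> \<ge> 1 \<Longrightarrow> y \<in> Q \<Longrightarrow>
      cmod (pderivs is (\<lambda>y. cm m y * pderivs [m] \<psi> (\<rho> *\<^sub>R (\<kappa> y - y0))) y) \<le> Cm m * \<rho> ^ length is" for m \<rho> y
    by blast+
  show ?case
  proof (intro exI[of _ "C0 + (\<Sum>m\<in>UNIV. Cm m)"] conjI allI impI ballI)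
    show "0 \<le> C0 + (\<Sum>m\<in>UNIV. Cm m)" using C0(1) Cm(1) by (intro add_nonneg_nonneg sum_nonneg) auto
    fix \<rho> :: real and y assume l: "1 \<le> \<rho>" and y: "y \<in> Q"
    have y\<Omega>: "y \<in> \<Omega>" using y Q by auto
    let ?U = "\<lambda>y. c' y * \<psi> (\<rho> *\<^sub>R (\<kappa> y - y0))"
    let ?T = "\<lambda>m y. cm m y * pderivs [m] \<psi> (\<rho> *\<^sub>R (\<kappa> y - y0))"
    have s0: "smooth_on \<Omega> ?U" by (rule sm[OF c' \<psi>])
    have s1: "smooth_on \<Omega> (?T m)" for m by (rule sm[OF cm test_pderivs[OF \<psi>]])
    have s2: "smooth_on \<Omega> (\<lambda>y. of_real \<rho> * ?T m y)" for m by (intro smooth_on_mult[OF \<Omega>] smooth_on_const s1)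
    have "pderivs (is @ [i]) (\<lambda>y. c y * \<psi> (\<rho> *\<^sub>R (\<kappa> y - y0))) y
        = pderivs is (\<lambda>y. ?U y + (\<Sum>m\<in>UNIV. of_real \<rho> * ?T m y)) y"
      unfolding pderivs_append by (rule pderivs_cong_open[OF \<Omega> y\<Omega> der])
    also have "\<dots> = pderivs is ?U y + pderivs is (\<lambda>y. \<Sum>m\<in>UNIV. of_real \<rho> * ?T m y) y"
      by (rule pderivs_add[OF \<Omega> smooth_on_imp_Ck[OF s0] smooth_on_imp_Ck[OF smooth_on_sum[OF \<Omega> s2]] y\<Omega>])
    also have "pderivs is (\<lambda>y. \<Sum>m\<in>UNIV. of_real \<rho> * ?T m y) y = (\<Sum>m\<in>UNIV. pderivs is (\<lambda>y. of_real \<rho> * ?T m y) y)"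
      by (rule pderivs_sum[OF \<Omega> smooth_on_imp_Ck[OF s2] y\<Omega>])
    also have "\<dots> = (\<Sum>m\<in>UNIV. of_real \<rho> * pderivs is (?T m) y)"
      by (rule sum.cong[OF refl]) (rule pderivs_cmult[OF \<Omega> smooth_on_imp_Ck[OF s1] y\<Omega>])
    finally have "cmod (pderivs (is @ [i]) (\<lambda>y. c y * \<psi> (\<rho> *\<^sub>R (\<kappa> y - y0))) y) \<le>
        cmod (pderivs is ?U y) + (\<Sum>m\<in>UNIV. \<rho> * cmod (pderivs is (?T m) y))"
      using l by (auto intro!: order_trans[OF norm_triangle_ineq] add_left_mono sum_norm_le simp: norm_mult)
    also have "\<dots> \<le> \<rho> * (C0 * \<rho> ^ length is) + (\<Sum>m\<in>UNIV. \<rho> * (Cm m * \<rho> ^ length is))"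
    proof (intro add_mono sum_mono mult_left_mono Cm(2)[OF l y])
      have "cmod (pderivs is ?U y) \<le> 1 * (C0 * \<rho> ^ length is)" using C0(2)[OF l y] by simp
      also have "\<dots> \<le> \<rho> * (C0 * \<rho> ^ length is)" using l C0(1) by (intro mult_right_mono) auto
      finally show "cmod (pderivs is ?U y) \<le> \<rho> * (C0 * \<rho> ^ length is)" .
    qed (use l in auto)
    also have "\<dots> = (C0 + (\<Sum>m\<in>UNIV. Cm m)) * \<rho> ^ length (is @ [i])"
      by (simp add: sum_distrib_left sum_distrib_right algebra_simps)
    finally show "cmod (pderivs (is @ [i]) (\<lambda>y. c y * \<psi> (\<rho> *\<^sub>R (\<kappa> y - y0))) y) \<le> (C0 + (\<Sum>m\<in>UNIV. Cm m)) * \<rho> ^ length (is @ [i])" .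
  qed
qed

text \<open>Each derivative costs a factor 2^k, and the support has volume of order 2^(-kn);
  integrating bounds the L^1 norms of the derivatives, and \<open>fourier_decay\<close> converts
  them into decay of the transforms.\<close>

lemma concentrated_fourier_decay:
  fixes h :: "nat \<Rightarrow> real^'n::finite \<Rightarrow> complex"
  assumes h: "\<And>k. h k \<in> test_functions"
    and b: "\<And>is. \<exists>C\<ge>0. \<forall>k x. cmod (pderivs is (h k) x) \<le> C * (2 ^ k) ^ length is"
    and supp: "\<And>k x. x \<notin> cball x0 (r / 2 ^ k) \<Longrightarrow> h k x = 0" and r: "r \<ge> 0"
  shows "\<exists>D\<ge>0. (\<forall>k \<xi>. cmod (fourier (h k) \<xi>) \<le> D * (1 / 2 ^ k) ^ CARD('n)) \<and>
    (\<forall>k \<xi>. (1 + norm \<xi>) ^ M * cmod (fourier (h k) \<xi>) \<le> D * (2 ^ k) ^ M * (1 / 2 ^ k) ^ CARD('n))"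
proof -
  let ?n = "CARD('n)"
  define V where "V = unit_ball_vol (real ?n) * r ^ ?n"
  have V: "V \<ge> 0" using r by (simp add: V_def)
  have L1: "\<exists>C\<ge>0. \<forall>k. (LINT x|lborel. cmod (pderivs is (h k) x)) \<le> C * (2 ^ k) ^ length is * (1 / 2 ^ k) ^ ?n" for "is"
  proof -
    obtain C where C: "C \<ge> 0" "\<And>k x. cmod (pderivs is (h k) x) \<le> C * (2 ^ k) ^ length is" using b[of "is"] by blast
    have "(LINT x|lborel. cmod (pderivs is (h k) x)) \<le> C * V * (2 ^ k) ^ length is * (1 / 2 ^ k) ^ ?n" for k
    proof -
      have z: "pderivs is (h k) x = 0" if "x \<notin> cball x0 (r / 2 ^ k)" for x
      proof (rule pderivs_eq_0_outside_closure)
        have "closure {x. h k x \<noteq> 0} \<subseteq> cball x0 (r / 2 ^ k)"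
          by (rule closure_minimal) (use supp in \<open>blast, simp\<close>)
        then show "x \<notin> closure {x. h k x \<noteq> 0}" using that by blast
      qed
      have "(LINT x|lborel. cmod (pderivs is (h k) x)) \<le>
          (LINT x|lborel. (C * (2 ^ k) ^ length is) * indicator (cball x0 (r / 2 ^ k)) x)"
      proof (rule integral_mono)
        show "integrable lborel (\<lambda>x. cmod (pderivs is (h k) x))"
          by (rule integrable_norm[OF test_integrable[OF test_pderivs[OF h]]])
        show "integrable lborel (\<lambda>x. (C * (2 ^ k) ^ length is) * indicator (cball x0 (r / 2 ^ k)) x)"
          by (intro integrable_mult_right integrable_real_indicator emeasure_bounded_finite) auto
        show "cmod (pderivs is (h k) x) \<le> (C * (2 ^ k) ^ length is) * indicator (cball x0 (r / 2 ^ k)) x" for x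
          using C(2)[of k x] z[of x] by (cases "x \<in> cball x0 (r / 2 ^ k)") auto
      qed
      also have "\<dots> = (C * (2 ^ k) ^ length is) * measure lborel (cball x0 (r / 2 ^ k))" by simp
      also have "measure lborel (cball x0 (r / 2 ^ k)) = V * (1 / 2 ^ k) ^ ?n"
        using r by (simp add: content_cball V_def power_divide)
      finally show ?thesis by (simp only: mult_ac)
    qed
    then show ?thesis using C(1) V by (intro exI[of _ "C * V"]) auto
  qed
  obtain C0 where C0: "C0 \<ge> 0" "\<And>k. (LINT x|lborel. cmod (h k x)) \<le> C0 * (1 / 2 ^ k) ^ ?n"
    using L1[of "[]"] by auto
  have "\<forall>i. \<exists>C\<ge>0. \<forall>k. (LINT x|lborel. cmod (pderivs (replicate M i) (h k) x)) \<le> C * (2 ^ k) ^ M * (1 / 2 ^ k) ^ ?n"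
    using L1[of "replicate M _"] by simp
  then obtain Ci where Ci: "\<And>i. Ci i \<ge> 0"
    "\<And>i k. (LINT x|lborel. cmod (pderivs (replicate M i) (h k) x)) \<le> Ci i * (2 ^ k) ^ M * (1 / 2 ^ k) ^ ?n" by metis
  define D where "D = C0 + 2 ^ M * (C0 + real ?n ^ M * (\<Sum>i\<in>UNIV. Ci i))"
  have sC: "0 \<le> (\<Sum>i\<in>UNIV. Ci i)" using Ci(1) by (intro sum_nonneg) auto
  show ?thesis
  proof (intro exI[of _ D] conjI allI)
    show "0 \<le> D" using C0(1) sC by (simp add: D_def)
    fix k and \<xi> :: "real^'n"
    have "cmod (fourier (h k) \<xi>) \<le> C0 * (1 / 2 ^ k) ^ ?n"
      using norm_fourier_le[OF test_integrable[OF h], of k \<xi>] C0(2)[of k] by linarith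
    also have "\<dots> \<le> D * (1 / 2 ^ k) ^ ?n"
      using C0(1) sC by (intro mult_right_mono) (auto simp: D_def)
    finally show "cmod (fourier (h k) \<xi>) \<le> D * (1 / 2 ^ k) ^ ?n" .
    have one: "1 \<le> ((2::real) ^ k) ^ M" by (intro one_le_power) simp
    have "(1 + norm \<xi>) ^ M * cmod (fourier (h k) \<xi>) \<le> 2 ^ M * ((LINT x|lborel. cmod (h k x)) +
        real ?n ^ M * (\<Sum>i\<in>UNIV. LINT x|lborel. cmod (pderivs (replicate M i) (h k) x)))"
      by (rule fourier_decay[OF h])
    also have "\<dots> \<le> 2 ^ M * (C0 * (2 ^ k) ^ M * (1 / 2 ^ k) ^ ?n + real ?n ^ M * (\<Sum>i\<in>UNIV. Ci i * (2 ^ k) ^ M * (1 / 2 ^ k) ^ ?n))"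
    proof (intro mult_left_mono add_mono sum_mono Ci(2))
      have "C0 * 1 * (1 / 2 ^ k) ^ ?n \<le> C0 * (2 ^ k) ^ M * (1 / 2 ^ k) ^ ?n"
        using one C0(1) by (intro mult_right_mono mult_left_mono) auto
      then show "(LINT x|lborel. cmod (h k x)) \<le> C0 * (2 ^ k) ^ M * (1 / 2 ^ k) ^ ?n" using C0(2)[of k] by simp
    qed auto
    also have "\<dots> = (2 ^ M * (C0 + real ?n ^ M * (\<Sum>i\<in>UNIV. Ci i))) * ((2 ^ k) ^ M * (1 / 2 ^ k) ^ ?n)"
      by (simp only: sum_distrib_right[symmetric] mult.assoc distrib_left distrib_right)
    also have "\<dots> \<le> D * ((2 ^ k) ^ M * (1 / 2 ^ k) ^ ?n)"
      using C0(1) by (intro mult_right_mono) (auto simp: D_def)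
    finally show "(1 + norm \<xi>) ^ M * cmod (fourier (h k) \<xi>) \<le> D * (2 ^ k) ^ M * (1 / 2 ^ k) ^ ?n" by (simp only: mult.assoc)
  qed
qed

text \<open>One differentiation of g x^(q+1) gives x^q times (x g' + (q+1) g), the same shape with
  one power fewer. At the centre the terms that keep a factor x drop out, and the integers collected
  multiply to q!.\<close>

lemma pderivs_replicate_monomial:
  fixes g :: "real^'n::finite \<Rightarrow> complex"
  assumes "smooth_on UNIV g"
  shows "pderivs (replicate q i) (\<lambda>y. g y * of_real ((y - y0) $ i) ^ q) y0 = fact q * g y0"
  using assms
proof (induction q arbitrary: g)
  case (Suc q)
  let ?x = "\<lambda>y. complex_of_real ((y - y0) $ i)"
  define g' where "g' y = pderivs [i] g y * ?x y + of_nat (Suc q) * g y" for y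
  have "smooth_on UNIV (\<lambda>y. of_real (y $ i) + - of_real (y0 $ i) :: complex)"
    by (intro smooth_on_add smooth_on_const open_UNIV smooth_on_bounded_linear
        bounded_linear_compose[OF bounded_linear_of_real bounded_linear_vec_nth])
  then have sx: "smooth_on UNIV ?x" by simp
  have sg': "smooth_on UNIV g'" unfolding g'_def[abs_def]
    by (intro smooth_on_add[OF open_UNIV smooth_on_mult[OF open_UNIV smooth_on_pderivs[OF Suc.prems] sx]
      smooth_on_mult[OF open_UNIV smooth_on_const Suc.prems]])
  have "pderivs [i] (\<lambda>y. g y * ?x y ^ Suc q) y = g' y * ?x y ^ q" for y
  proof -
    have x': "(?x has_derivative (\<lambda>v. of_real (v $ i))) (at y)"
      by (auto intro!: derivative_eq_intros bounded_linear_imp_has_derivative bounded_linear_vec_nth)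
    have "((\<lambda>y. g y * ?x y ^ Suc q) has_derivative
      (\<lambda>v. g y * (of_nat (Suc q) * of_real (v $ i) * ?x y ^ q) + frechet_derivative g (at y) v * ?x y ^ Suc q)) (at y)"
      using has_derivative_mult[OF smooth_on_has_derivative[OF Suc.prems UNIV_I] has_derivative_power[OF x', of "Suc q"]]
      by (simp del: power_Suc of_nat_Suc add: diff_Suc_1)
    from has_derivative_imp_frechet[OF this] show ?thesis
      by (simp add: g'_def algebra_simps)
  qed
  then have "pderivs [i] (\<lambda>y. g y * ?x y ^ Suc q) = (\<lambda>y. g' y * ?x y ^ q)" by auto
  moreover have "replicate (Suc q) i = replicate q i @ [i]" by (simp add: replicate_append_same)
  ultimately have "pderivs (replicate (Suc q) i) (\<lambda>y. g y * ?x y ^ Suc q) y0 = pderivs (replicate q i) (\<lambda>y. g' y * ?x y ^ q) y0"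
    by (simp only: pderivs_append)
  also have "\<dots> = fact q * g' y0" by (rule Suc.IH[OF sg'])
  also have "\<dots> = fact (Suc q) * g y0" by (simp add: g'_def algebra_simps)
  finally show ?case .
qed simp

text \<open>Continuous partial derivatives are bounded on the compact set, and convexity permits the
  mean value inequality. It serves to keep the shrinking supports inside shrinking balls after a
  change of chart.\<close>

lemma C1_lipschitz_on_compact:
  fixes f :: "real^'n::finite \<Rightarrow> real^'n"
  assumes f: "Ck_on 1 \<Omega> f" and K: "compact K" "convex K" "K \<subseteq> \<Omega>"
  obtains B where "B \<ge> 0" "\<And>x y. x \<in> K \<Longrightarrow> y \<in> K \<Longrightarrow> norm (f x - f y) \<le> B * norm (x - y)"
proof -
  have "\<exists>B. \<forall>x\<in>K. norm (pderivs [i] f x) \<le> B" for i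
  proof -
    have "Ck_on 0 \<Omega> (pderivs [i] f)" by (rule Ck_on_pderivs) (use f in simp)
    then have "continuous_on K (pderivs [i] f)" using K(3) continuous_on_subset by (metis Ck_on.simps(1))
    then have "bounded (pderivs [i] f ` K)" by (intro compact_imp_bounded compact_continuous_image K(1))
    then show ?thesis unfolding bounded_iff by blast
  qed
  then obtain B where B: "\<And>i x. x \<in> K \<Longrightarrow> norm (pderivs [i] f x) \<le> B i" by metis
  have Bn: "norm (pderivs [i] f x) \<le> \<bar>B i\<bar>" if "x \<in> K" for i x using B[OF that, of i] by linarith
  show ?thesis
  proof (rule that[of "\<Sum>i\<in>UNIV. \<bar>B i\<bar>"])
    fix x y assume xy: "x \<in> K" "y \<in> K"
    show "norm (f x - f y) \<le> (\<Sum>i\<in>UNIV. \<bar>B i\<bar>) * norm (x - y)"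
    proof (rule differentiable_bound[OF K(2) _ _ xy(1,2)])
      fix z assume z: "z \<in> K"
      then have z\<Omega>: "z \<in> \<Omega>" using K by auto
      have d: "(f has_derivative frechet_derivative f (at z)) (at z)"
        using Ck_on_Suc_has_derivative[of 0 \<Omega> f z] f z\<Omega> by simp
      then show "(f has_derivative frechet_derivative f (at z)) (at z within K)" by (rule has_derivative_at_withinI)
      show "onorm (frechet_derivative f (at z)) \<le> (\<Sum>i\<in>UNIV. \<bar>B i\<bar>)"
      proof (rule onorm_bound)
        fix v
        have "frechet_derivative f (at z) v = (\<Sum>i\<in>UNIV. v $ i *\<^sub>R pderivs [i] f z)"
          by (rule frechet_eq_sum_pderivs) (use d in \<open>auto simp: differentiable_def\<close>)
        also have "norm \<dots> \<le> (\<Sum>i\<in>UNIV. norm v * \<bar>B i\<bar>)"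
        proof (rule sum_norm_le)
          fix i
          have "\<bar>v $ i\<bar> * norm (pderivs [i] f z) \<le> norm v * \<bar>B i\<bar>"
            by (intro mult_mono component_le_norm_cart Bn z) auto
          then show "norm (v $ i *\<^sub>R pderivs [i] f z) \<le> norm v * \<bar>B i\<bar>" by (simp only: norm_scaleR)
        qed
        finally show "norm (frechet_derivative f (at z) v) \<le> (\<Sum>i\<in>UNIV. \<bar>B i\<bar>) * norm v"
          by (simp add: sum_distrib_left mult.commute)
      qed (simp add: sum_nonneg)
    qed
  qed (simp add: sum_nonneg)
qed

section \<open>Concentrated pieces seen in another chart\<close>

context localized_bundle
begin

text \<open>If the point lies in the l-th patch, so does a neighbourhood; otherwise it lies off the
  support of the l-th cut-off, which is closed and contained in that patch. Finitely many patches
  admit a common radius.\<close>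

lemma small_ball:
  assumes j: "j \<in> indices"
  obtains r where "r > 0" "\<And>l. l \<in> indices \<Longrightarrow> cball y0 r \<subseteq> overlap j l \<or>
    (\<forall>y\<in>cball y0 r. chart L j y \<notin> closure {x. cutoff L l x \<noteq> 0})"
proof -
  have "\<exists>r>0. cball y0 r \<subseteq> overlap j l \<or> (\<forall>y\<in>cball y0 r. chart L j y \<notin> closure {x. cutoff L l x \<noteq> 0})"
    if l: "l \<in> indices" for l
  proof (cases "y0 \<in> overlap j l")
    case True
    then show ?thesis using open_overlap[OF j l] open_contains_cball by blast
  next
    case False
    define M where "M = chart L j -` (- closure {x. cutoff L l x \<noteq> 0})"
    have "open M" unfolding M_def
      using open_vimage_Int[OF open_UNIV Ck_map_onD(1)[OF chart_props(3)[OF j]] open_Compl[OF closed_closure]] by simp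
    moreover have "y0 \<in> M" using False cutoff_props(3)[OF l] by (auto simp: overlap_def M_def)
    ultimately obtain r where "r > 0" "cball y0 r \<subseteq> M" using open_contains_cball by blast
    then show ?thesis by (intro exI[of _ r]) (auto simp: M_def)
  qed
  then obtain R where R: "\<And>l. l \<in> indices \<Longrightarrow> R l > 0" "\<And>l. l \<in> indices \<Longrightarrow> cball y0 (R l) \<subseteq> overlap j l \<or>
      (\<forall>y\<in>cball y0 (R l). chart L j y \<notin> closure {x. cutoff L l x \<noteq> 0})"
    by metis
  define r where "r = Min (R ` indices)"
  have ne: "R ` indices \<noteq> {}" "finite (R ` indices)" using j finite_indices by auto
  show ?thesis
  proof (rule that)
    show "r > 0" using R(1) ne by (simp add: r_def)
    fix l assume l: "l \<in> indices"
    have "r \<le> R l" using ne l by (simp add: r_def)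
    then have "cball y0 r \<subseteq> cball y0 (R l)" by (rule subset_cball)
    then show "cball y0 r \<subseteq> overlap j l \<or> (\<forall>y\<in>cball y0 r. chart L j y \<notin> closure {x. cutoff L l x \<noteq> 0})"
      using R(2)[OF l] by blast
  qed
qed

lemma chart_change_inverse:
  assumes "j \<in> indices" "l \<in> indices" "y \<in> overlap j l"
  shows "chart_change j l y \<in> overlap l j" "chart_change l j (chart_change j l y) = y"
proof -
  show "chart_change j l y \<in> overlap l j"
    using chart_chart_change[OF assms] chart_props(7)[OF assms(1), of y] by (simp add: overlap_def)
  show "chart_change l j (chart_change j l y) = y"
    using chart_chart_change[OF assms] chart_props(6)[OF assms(1)] by (simp add: chart_change_def)
qed

text \<open>In chart l the k-th piece is a smooth coefficient, made of cut-off and frame, times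
  \<psi>(2^k (\<kappa> - y0)) with \<kappa> the change of chart. If the ball avoids the support of
  the cut-off, the piece is invisible there; otherwise it is a concentrated family with the same
  scaling.\<close>

lemma concentrated_section_decay:
  assumes j: "j \<in> indices" and l: "l \<in> indices" and r: "r > 0"
    and alt: "cball y0 r \<subseteq> overlap j l \<or> (\<forall>y\<in>cball y0 r. chart L j y \<notin> closure {x. cutoff L l x \<noteq> 0})"
    and \<psi>: "\<psi> \<in> test_functions" and \<psi>0: "\<And>z. z \<notin> cball 0 r \<Longrightarrow> \<psi> z = 0"
    and S: "\<And>k. S k \<in> smooth_sections E"
    and co: "\<And>k y. coord l (S k) y = (if y \<in> overlap l j then \<psi> (2 ^ k *\<^sub>R (chart_change l j y - y0)) *s frame_change l j m0 y else 0)"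
  shows "\<exists>D\<ge>0. (\<forall>k \<xi>. cmod (fourier (lp l m (S k)) \<xi>) \<le> D * (1 / 2 ^ k) ^ CARD('n)) \<and>
    (\<forall>k \<xi>. (1 + norm \<xi>) ^ M * cmod (fourier (lp l m (S k)) \<xi>) \<le> D * (2 ^ k) ^ M * (1 / 2 ^ k) ^ CARD('n))"
proof -
  let ?\<kappa> = "chart_change l j"
  define c where "c y = complex_of_real (cutoff L l (chart L l y)) * frame_change l j m0 y $ m" for y
  have sec: "is_section (S k)" for k using S Ck_sections_section by (auto simp: smooth_sections_iff)
  have lpS: "lp l m (S k) y = (if y \<in> overlap l j then c y * \<psi> (2 ^ k *\<^sub>R (?\<kappa> y - y0)) else 0)" for k y
    by (simp add: lp_eq[OF sec l] co c_def)
  have near: "dist y0 (?\<kappa> y) \<le> r / 2 ^ k" if "\<psi> (2 ^ k *\<^sub>R (?\<kappa> y - y0)) \<noteq> 0" for k y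
  proof -
    have "norm (2 ^ k *\<^sub>R (?\<kappa> y - y0)) \<le> r" using that \<psi>0 by force
    then have "2 ^ k * dist y0 (?\<kappa> y) \<le> r" by (simp add: dist_norm norm_minus_commute)
    then show ?thesis by (simp add: pos_le_divide_eq mult.commute)
  qed
  have near': "?\<kappa> y \<in> cball y0 r" if "\<psi> (2 ^ k *\<^sub>R (?\<kappa> y - y0)) \<noteq> 0" for k y
  proof -
    have "r / 2 ^ k \<le> r / 1" using r by (intro divide_left_mono) auto
    then show ?thesis using near[OF that] by simp
  qed
  have test: "\<And>k. lp l m (S k) \<in> test_functions" using lp_test S l by blast
  have "\<exists>x0 R. R \<ge> 0 \<and> (\<forall>k x. x \<notin> cball x0 (R / 2 ^ k) \<longrightarrow> lp l m (S k) x = 0) \<and>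
      (\<forall>is. \<exists>C\<ge>0. \<forall>k x. cmod (pderivs is (lp l m (S k)) x) \<le> C * (2 ^ k) ^ length is)"
    using alt
  proof
    assume disj: "\<forall>y\<in>cball y0 r. chart L j y \<notin> closure {x. cutoff L l x \<noteq> 0}"
    have z: "lp l m (S k) y = 0" for k y
    proof (cases "y \<in> overlap l j \<and> \<psi> (2 ^ k *\<^sub>R (?\<kappa> y - y0)) \<noteq> 0")
      case True
      then have "chart L l y \<notin> closure {x. cutoff L l x \<noteq> 0}"
        using bspec[OF disj near'[of k y]] chart_chart_change[OF l j, of y] by simp
      then have "cutoff L l (chart L l y) = 0" using closure_subset[of "{x. cutoff L l x \<noteq> 0}"] by blast
      then show ?thesis by (simp add: lpS c_def)
    qed (auto simp: lpS)
    then have "pderivs is (lp l m (S k)) x = 0" for "is" k x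
      by (intro pderivs_eq_0_outside_closure) simp
    then show ?thesis using z by (intro exI[of _ 0]) auto
  next
    assume sub: "cball y0 r \<subseteq> overlap j l"
    let ?\<Omega> = "overlap l j"
    define Q where "Q = chart_change j l ` cball y0 r"
    have \<Omega>: "open ?\<Omega>" by (rule open_overlap[OF l j])
    have Q: "compact Q" unfolding Q_def
      by (rule compact_continuous_image[OF continuous_on_subset[OF Ck_on_imp_continuous_on[OF chart_change_Ck[OF j l, of 0]] sub] compact_cball])
    have Q\<Omega>: "Q \<subseteq> ?\<Omega>" using sub chart_change_inverse(1)[OF j l] by (auto simp: Q_def)
    have inQ: "y \<in> Q" if "lp l m (S k) y \<noteq> 0" for k y
    proof -
      have "y \<in> ?\<Omega>" and n: "\<psi> (2 ^ k *\<^sub>R (?\<kappa> y - y0)) \<noteq> 0" using that by (auto simp: lpS split: if_splits)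
      then have "y = chart_change j l (?\<kappa> y)" using chart_change_inverse(2)[OF l j] by simp
      then show ?thesis using near'[OF n] by (auto simp: Q_def)
    qed
    have sc: "smooth_on ?\<Omega> c" unfolding c_def[abs_def]
    proof (intro smooth_on_mult[OF \<Omega>])
      have "smooth_on UNIV (\<lambda>y. cutoff L l (chart L l y))" by (simp add: smooth_on_def cutoff_chart_Ck[OF l])
      then have "smooth_on ?\<Omega> (\<lambda>y. cutoff L l (chart L l y))" by (rule smooth_on_subset) simp
      then show "smooth_on ?\<Omega> (\<lambda>y. complex_of_real (cutoff L l (chart L l y)))"
        by (rule smooth_on_bounded_linear_compose[OF \<Omega> bounded_linear_of_real])
      have "smooth_on ?\<Omega> (frame_change l j m0)" by (simp add: smooth_on_def frame_change_Ck[OF l j])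
      then show "smooth_on ?\<Omega> (\<lambda>y. frame_change l j m0 y $ m)"
        by (rule smooth_on_bounded_linear_compose[OF \<Omega> bounded_linear_vec_nth])
    qed
    have s\<kappa>: "smooth_on ?\<Omega> ?\<kappa>" by (simp add: smooth_on_def chart_change_Ck[OF l j])
    \<comment> \<open>The support of the k-th piece lies in a ball of radius r/2^k in chart j; the
      Lipschitz bound carries it into a ball of radius B r/2^k in chart l.\<close>
    obtain B where B: "B \<ge> 0" "\<And>x y. x \<in> cball y0 r \<Longrightarrow> y \<in> cball y0 r \<Longrightarrow>
        norm (chart_change j l x - chart_change j l y) \<le> B * norm (x - y)"
      using C1_lipschitz_on_compact[OF chart_change_Ck[OF j l] compact_cball convex_cball sub] by blast
    have sup: "lp l m (S k) x = 0" if "x \<notin> cball (chart_change j l y0) (B * r / 2 ^ k)" for k x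
    proof (rule ccontr)
      assume n: "lp l m (S k) x \<noteq> 0"
      then have x: "x \<in> ?\<Omega>" and n': "\<psi> (2 ^ k *\<^sub>R (?\<kappa> x - y0)) \<noteq> 0" by (auto simp: lpS split: if_splits)
      have "norm (chart_change j l y0 - chart_change j l (?\<kappa> x)) \<le> B * norm (y0 - ?\<kappa> x)"
        using near'[OF n'] r by (intro B(2)) auto
      also have "\<dots> \<le> B * (r / 2 ^ k)" using near[OF n'] B(1) by (intro mult_left_mono) (auto simp: dist_norm)
      finally show False using that chart_change_inverse(2)[OF l j x] by (simp add: dist_norm)
    qed
    have "\<exists>C\<ge>0. \<forall>k x. cmod (pderivs is (lp l m (S k)) x) \<le> C * (2 ^ k) ^ length is" for "is"
    proof -
      obtain C where C: "C \<ge> 0" "\<forall>\<rho>\<ge>1. \<forall>y\<in>Q. cmod (pderivs is (\<lambda>y. c y * \<psi> (\<rho> *\<^sub>R (?\<kappa> y - y0))) y) \<le> C * \<rho> ^ length is"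
        using scaled_pderivs_bound[OF \<Omega> Q Q\<Omega> sc s\<kappa> \<psi>, of "is" y0] by blast
      have "cmod (pderivs is (lp l m (S k)) x) \<le> C * (2 ^ k) ^ length is" for k x
      proof (cases "x \<in> Q")
        case True
        then have "pderivs is (lp l m (S k)) x = pderivs is (\<lambda>y. c y * \<psi> (2 ^ k *\<^sub>R (?\<kappa> y - y0))) x"
          using Q\<Omega> by (intro pderivs_cong_open[OF \<Omega>]) (auto simp: lpS)
        then show ?thesis using C(2)[rule_format, of "2 ^ k" x] True by simp
      next
        case False
        have "closure {x. lp l m (S k) x \<noteq> 0} \<subseteq> Q"
          by (rule closure_minimal) (use inQ compact_imp_closed[OF Q] in auto)
        then have "pderivs is (lp l m (S k)) x = 0" using False by (intro pderivs_eq_0_outside_closure) auto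
        then show ?thesis using C(1) by simp
      qed
      then show ?thesis using C(1) by blast
    qed
    then show ?thesis using sup B(1) r
      by (intro exI[of _ "chart_change j l y0"] exI[of _ "B * r"]) auto
  qed
  then obtain x0 R where R: "R \<ge> 0 \<and> (\<forall>k x. x \<notin> cball x0 (R / 2 ^ k) \<longrightarrow> lp l m (S k) x = 0) \<and>
      (\<forall>is. \<exists>C\<ge>0. \<forall>k x. cmod (pderivs is (lp l m (S k)) x) \<le> C * (2 ^ k) ^ length is)" by (elim exE)
  show ?thesis
    by (rule concentrated_fourier_decay[OF test R[THEN conjunct2, THEN conjunct2, rule_format]
          R[THEN conjunct2, THEN conjunct1, rule_format] R[THEN conjunct1]])
qed

lemma coord_own_chart:
  assumes j: "j \<in> indices"
  shows "overlap j j = UNIV" "chart_change j j y = y" "frame_change j j m y = axis m 1"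
  using chart_props(6,7)[OF j] triv_props(8)[OF j chart_props(7)[OF j]]
  by (auto simp: overlap_def chart_change_def frame_change_def)

end

context embedding_setup
begin

lemma necessity:
  assumes C: "\<And>u. u \<in> smooth_sections E \<Longrightarrow> vnorm CY u \<le> C * vnorm HX u"
  shows "summable (\<lambda>k. 1 / (\<phi> (2 ^ k))\<^sup>2)"
proof -
  let ?n = "CARD('n)"
  \<comment> \<open>The type is inhabited, so \<open>undefined\<close> names an arbitrary point of
    the base; a patch whose cut-off is nonzero there is fixed.\<close>
  obtain j where j: "j \<in> indices" "undefined \<in> \<Gamma> j" "cutoff L j undefined \<noteq> 0" by (rule cutoff_cover)
  define y0 where "y0 = chart_inv j undefined"
  have cy0: "cutoff L j (chart L j y0) > 0"
    using j cutoff_props(2)[OF j(1), of "undefined"] chart_props(5)[OF j(1,2)] by (simp add: y0_def less_le)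
  obtain r where r: "r > 0" "\<And>l. l \<in> indices \<Longrightarrow> cball y0 r \<subseteq> overlap j l \<or>
      (\<forall>y\<in>cball y0 r. chart L j y \<notin> closure {x. cutoff L l x \<noteq> 0})"
    using small_ball[OF j(1), of y0] by blast
  define i0 :: 'n where "i0 = undefined"
  define k0 :: 'p where "k0 = undefined"
  \<comment> \<open>A cube of half-width r/n lies in the ball of radius r, since the norm is at most
    the sum of the moduli of the n coordinates.\<close>
  define \<rho> where "\<rho> = r / real ?n"
  have \<rho>: "\<rho> > 0" using r(1) by (simp add: \<rho>_def)
  define bb :: "real^'n \<Rightarrow> real" where "bb = box_bump (\<chi> i. - \<rho>) (\<chi> i. \<rho>)"
  define \<psi> :: "real^'n \<Rightarrow> complex" where "\<psi> x = of_real (x $ i0) ^ q * of_real (bb x)" for x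
  have bb0: "bb 0 > 0" unfolding bb_def box_bump_pos_iff using \<rho> by (simp add: mem_box_cart)
  have spow: "smooth_on UNIV (\<lambda>x. complex_of_real (x $ i0) ^ p)" for p
  proof (induction p)
    case (Suc p)
    have "smooth_on UNIV (\<lambda>x::real^'n. complex_of_real (x $ i0))"
      by (intro open_UNIV smooth_on_bounded_linear bounded_linear_compose[OF bounded_linear_of_real bounded_linear_vec_nth])
    then show ?case using smooth_on_mult[OF open_UNIV _ Suc] by simp
  qed (simp add: smooth_on_const)
  have \<psi>: "\<psi> \<in> test_functions"
    unfolding \<psi>_def[abs_def] bb_def by (rule test_smooth_mult[OF test_box_bump spow])
  have \<psi>0: "\<psi> z = 0" if "z \<notin> cball 0 r" for z
  proof (rule ccontr)
    assume "\<psi> z \<noteq> 0"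
    then have "z \<in> box (\<chi> i. - \<rho>) (\<chi> i. \<rho>)" using box_bump_eq_0 by (auto simp: \<psi>_def bb_def)
    then have "\<bar>z $ i\<bar> \<le> \<rho>" for i by (auto simp: mem_box_cart abs_le_iff less_imp_le minus_le_iff)
    then have "(\<Sum>i\<in>UNIV. \<bar>z $ i\<bar>) \<le> (\<Sum>i\<in>(UNIV::'n set). \<rho>)" by (intro sum_mono)
    then have "norm z \<le> r" using norm_le_l1_cart[of z] by (simp add: \<rho>_def)
    then show False using that by simp
  qed
  define F where "F k y = \<psi> (2 ^ k *\<^sub>R (y - y0))" for k :: nat and y
  have F: "F k \<in> test_functions" for k
    using test_affine[OF \<psi>, of "2 ^ k" "- (2 ^ k *\<^sub>R y0)"] by (simp add: F_def[abs_def] scaleR_diff_right)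
  \<comment> \<open>The factor (1/2^k)^q cancels the power 2^(kq) that q differentiations of the
    dilated profile produce, so every piece has a q-th derivative of size
    \<open>wt k\<close>.\<close>
  define a where "a k = wt k * (1 / 2 ^ k) ^ q" for k
  define f where "f N y = (\<Sum>k\<le>N. of_real (a k) * F k y)" for N y
  have f: "f N \<in> test_functions" for N unfolding f_def[abs_def] by (intro test_sum test_cmult F)
  have ext: "\<exists>u. u \<in> smooth_sections E \<and> (\<forall>l\<in>indices. \<forall>y. coord l u y =
      (if y \<in> overlap l j then g (chart_change l j y) *s frame_change l j k0 y else 0))" if "g \<in> test_functions" for g
    using section_of_test[OF j(1) that, of k0] by metis
  obtain S where S: "\<And>k. S k \<in> smooth_sections E" "\<And>k l y. l \<in> indices \<Longrightarrow> coord l (S k) y =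
      (if y \<in> overlap l j then F k (chart_change l j y) *s frame_change l j k0 y else 0)"
    using ext[OF F] by metis
  obtain U where U: "\<And>N. U N \<in> smooth_sections E" "\<And>N l y. l \<in> indices \<Longrightarrow> coord l (U N) y =
      (if y \<in> overlap l j then f N (chart_change l j y) *s frame_change l j k0 y else 0)"
    using ext[OF f] by metis
  \<comment> \<open>The extension by zero was applied to each piece and to the sum separately;
    equality of the components makes the local parts add up in every chart.\<close>
  have lpU: "lp l m (U N) = (\<lambda>y. \<Sum>k\<le>N. of_real (wt k * (1 / 2 ^ k) ^ q) * lp l m (S k) y)" if l: "l \<in> indices" for l m N
    by (simp add: fun_eq_iff lp_eq[OF smooth_section[OF U(1)] l] lp_eq[OF smooth_section[OF S(1)] l] U(2)[OF l] S(2)[OF l]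
        f_def a_def sum_distrib_left sum_distrib_right mult_ac)
  define A where "A N = (\<Sum>k\<le>N. wt k)" for N
  have A: "A N > 0" for N unfolding A_def using wt_pos by (intro sum_pos) auto
  obtain C0 where C0: "C0 \<ge> 0" "\<And>D N (h :: nat \<Rightarrow> real^'n \<Rightarrow> complex). 0 \<le> D \<Longrightarrow> (\<And>k. h k \<in> test_functions) \<Longrightarrow>
    (\<And>k \<xi>. cmod (fourier (h k) \<xi>) \<le> D * (1 / 2 ^ k) ^ ?n) \<Longrightarrow>
    (\<And>k \<xi>. (1 + norm \<xi>) ^ Suc (q + ?n) * cmod (fourier (h k) \<xi>) \<le> D * (2 ^ k) ^ Suc (q + ?n) * (1 / 2 ^ k) ^ ?n) \<Longrightarrow>
    Hsq s \<phi> (\<lambda>x. \<Sum>k\<le>N. of_real (wt k * (1 / 2 ^ k) ^ q) * h k x) \<le> C0 * D\<^sup>2 * (\<Sum>k\<le>N. wt k)"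
    using Hsq_dyadic_sum_le by blast
  have "\<exists>B. \<forall>N. Hsq s \<phi> (lp l m (U N)) \<le> B * A N" if l: "l \<in> indices" for l m
  proof -
    obtain D where D: "D \<ge> 0" "\<And>k \<xi>. cmod (fourier (lp l m (S k)) \<xi>) \<le> D * (1 / 2 ^ k) ^ ?n"
      "\<And>k \<xi>. (1 + norm \<xi>) ^ Suc (q + ?n) * cmod (fourier (lp l m (S k)) \<xi>) \<le> D * (2 ^ k) ^ Suc (q + ?n) * (1 / 2 ^ k) ^ ?n"
      using concentrated_section_decay[OF j(1) l r(1) r(2)[OF l] \<psi> \<psi>0 S(1) S(2)[OF l, unfolded F_def], of m "Suc (q + ?n)"]
      by blast
    have "Hsq s \<phi> (lp l m (U N)) \<le> C0 * D\<^sup>2 * A N" for N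
      unfolding lpU[OF l] A_def by (rule C0(2)[OF D(1) lp_test[OF S(1) l] D(2,3)])
    then show ?thesis by blast
  qed
  then obtain B where B: "\<And>l m N. l \<in> indices \<Longrightarrow> Hsq s \<phi> (lp l m (U N)) \<le> B l m * A N" by metis
  define P where "P = (\<Sum>l\<in>indices. \<Sum>m\<in>UNIV. B l m)"
  have up: "vnorm HX (U N) \<le> sqrt (P * A N)" for N
    unfolding HX_norm[OF U(1)] P_def sum_distrib_right by (intro real_sqrt_le_mono sum_mono B)
  define g where "g N y = complex_of_real (cutoff L j (chart L j y)) * (\<Sum>k\<le>N. of_real (wt k) * of_real (bb (2 ^ k *\<^sub>R (y - y0))))" for N y
  \<comment> \<open>The q-th derivative at y0 per unit of \<open>A N\<close>. All pieces contribute
    with the same positive sign there, since each has the value \<open>bb 0\<close> at the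
    centre.\<close>
  define d where "d = fact q * cutoff L j (chart L j y0) * bb 0"
  have d: "d > 0" using cy0 bb0 by (simp add: d_def)
  have low: "d * A N \<le> vnorm CY (U N)" for N
  proof -
    have Fk: "of_real (a k) * F k y = of_real (wt k) * of_real (bb (2 ^ k *\<^sub>R (y - y0))) * of_real ((y - y0) $ i0) ^ q" for k y
    proof -
      have "complex_of_real (a k) * of_real (2 ^ k) ^ q = of_real (wt k * ((1 / 2 ^ k) * 2 ^ k) ^ q)"
        by (simp only: a_def of_real_mult of_real_power power_mult_distrib mult.assoc)
      then have "complex_of_real (a k) * of_real (2 ^ k) ^ q = of_real (wt k)" by simp
      moreover have "of_real (a k) * F k y = (complex_of_real (a k) * of_real (2 ^ k) ^ q) *
          of_real (bb (2 ^ k *\<^sub>R (y - y0))) * of_real ((y - y0) $ i0) ^ q"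
        by (simp only: F_def \<psi>_def vector_scaleR_component real_scaleR_def of_real_mult power_mult_distrib mult_ac)
      ultimately show ?thesis by simp
    qed
    have eq: "lp j k0 (U N) = (\<lambda>y. g N y * of_real ((y - y0) $ i0) ^ q)"
      by (simp only: fun_eq_iff lp_eq[OF smooth_section[OF U(1)] j(1)] U(2)[OF j(1)] coord_own_chart[OF j(1)] f_def Fk g_def)
        (simp add: sum_distrib_right mult.assoc)
    have sg: "smooth_on UNIV (g N)" unfolding g_def[abs_def]
    proof (intro smooth_on_mult[OF open_UNIV] smooth_on_sum[OF open_UNIV] smooth_on_const)
      have "smooth_on UNIV (\<lambda>y. cutoff L j (chart L j y))" by (simp add: smooth_on_def cutoff_chart_Ck[OF j(1)])
      then show "smooth_on UNIV (\<lambda>y. complex_of_real (cutoff L j (chart L j y)))"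
        by (rule smooth_on_bounded_linear_compose[OF open_UNIV bounded_linear_of_real])
      fix k :: nat
      show "smooth_on UNIV (\<lambda>y. complex_of_real (bb (2 ^ k *\<^sub>R (y - y0))))"
        using test_smooth[OF test_affine[OF test_box_bump, of "2 ^ k" _ _ "- (2 ^ k *\<^sub>R y0)"]]
        by (simp add: bb_def scaleR_diff_right)
    qed
    have "pderiv_multi (replicate_mset q i0) (lp j k0 (U N)) y0 = fact q * g N y0"
      unfolding pderiv_multi_replicate eq by (rule pderivs_replicate_monomial[OF sg])
    also have "\<dots> = of_real (d * A N)"
      by (simp add: g_def d_def A_def sum_distrib_right sum_distrib_left mult_ac)
    finally have "cmod (pderiv_multi (replicate_mset q i0) (lp j k0 (U N)) y0) = d * A N"
      using d A[of N] by (simp del: of_real_mult)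
    moreover have "cmod (pderiv_multi (replicate_mset q i0) (lp j k0 (U N)) y0) \<le> Cq_norm_Rn q (lp j k0 (U N))"
      by (intro Cq_norm_ge lp_Cq_compact smooth_imp_Ck_section U(1) j(1)) simp
    ultimately have "d * A N \<le> Cq_norm_Rn q (lp j k0 (U N))" by simp
    also have "\<dots> \<le> (\<Sum>m\<in>UNIV. Cq_norm_Rn q (lp j m (U N)))"
      by (rule member_le_sum) (auto intro!: Cq_norm_nonneg lp_Cq_compact smooth_imp_Ck_section U(1) j(1))
    also have "\<dots> \<le> vnorm CY (U N)" unfolding CY_simps
      by (rule member_le_sum[OF j(1)])
        (auto intro!: sum_nonneg Cq_norm_nonneg lp_Cq_compact smooth_imp_Ck_section U(1) simp: finite_indices)
    finally show ?thesis .
  qed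
  \<comment> \<open>The lower bound is linear in \<open>A N\<close> and the upper bound is its
    square root; squaring and dividing by the positive number \<open>A N\<close> leaves a bound
    uniform in N. Absolute values guard against constants of unknown sign.\<close>
  have "A N \<le> C\<^sup>2 * \<bar>P\<bar> / d\<^sup>2" for N
  proof -
    have "d * A N \<le> \<bar>C\<bar> * vnorm HX (U N)"
      using low[of N] C[OF U(1), of N] abs_ge_self[of C] HX_norm[OF U(1), of N] HX_sum_nonneg[of "U N"]
      by (metis (no_types, lifting) mult_right_mono order_trans real_sqrt_ge_zero)
    also have "\<dots> \<le> \<bar>C\<bar> * sqrt (P * A N)" by (intro mult_left_mono up) simp
    finally have "(d * A N)\<^sup>2 \<le> (\<bar>C\<bar> * sqrt (P * A N))\<^sup>2"
      using d A[of N] by (intro power_mono) auto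
    also have "\<dots> \<le> C\<^sup>2 * (\<bar>P\<bar> * A N)"
    proof -
      have "(sqrt (P * A N))\<^sup>2 \<le> \<bar>P * A N\<bar>" by (cases "0 \<le> P * A N") (auto simp: real_sqrt_lt_0_iff power2_eq_square real_sqrt_mult_self)
      also have "\<bar>P * A N\<bar> = \<bar>P\<bar> * A N" using A[of N] by (simp add: abs_mult)
      finally show ?thesis unfolding power_mult_distrib power2_abs by (intro mult_left_mono) auto
    qed
    finally have "(d\<^sup>2 * A N) * A N \<le> (C\<^sup>2 * \<bar>P\<bar>) * A N" by (simp only: power2_eq_square mult_ac)
    then have "d\<^sup>2 * A N \<le> C\<^sup>2 * \<bar>P\<bar>" using A[of N] by simp
    then show ?thesis using d by (simp add: pos_le_divide_eq mult.commute)
  qed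
  then have "(\<Sum>k\<le>N. wt k) \<le> C\<^sup>2 * \<bar>P\<bar> / d\<^sup>2" for N unfolding A_def .
  then have "summable wt" using wt_pos by (intro bounded_imp_summable[of wt]) (auto simp: less_imp_le)
  then show ?thesis by (simp add: wt_def[abs_def])
qed

end

theorem theorem4p5:
  fixes E :: "('m::{t2_space, second_countable_topology},
               'v::{t2_space, second_countable_topology}, 'n::finite, 'p::finite) vbundle"
    and L :: "('m, 'v, 'n, 'p) localization"
    and dx :: "'m measure"
    and \<phi> :: "real \<Rightarrow> real"
    and q :: nat
  assumes "compact (UNIV :: 'm set)"
    and "smooth_vector_bundle E"
    and "smooth_density (base_atlas E) dx"
    and "admissible_localization E L"
    and "\<phi> \<in> class_M"
  defines "s \<equiv> real q + real CARD('n) / 2"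
  shows "((\<integral>\<^sup>+ t\<in>{1..}. ennreal (1 / (t * (\<phi> t)\<^sup>2)) \<partial>lborel) < \<infinity> \<longleftrightarrow>
            (\<exists>!T. embedding_extending_identity E L s \<phi> q T)) \<and>
         (\<forall>T. embedding_extending_identity E L s \<phi> q T \<longrightarrow>
            compact_operator (H_bundle E L s \<phi>) (Cq_bundle E L q) T)"
proof -
  interpret embedding_setup E L \<phi> q s
    by unfold_locales (use assms in \<open>simp_all add: s_def\<close>)
  \<comment> \<open>The existence of a single embedding already gives summability. This serves the
    converse implication and also the compactness claim, which concerns every such embedding and has
    the integral condition only through this step.\<close>
  have nec: "summable (\<lambda>k. 1 / (\<phi> (2 ^ k))\<^sup>2)" if T: "embedding_extending_identity E L s \<phi> q T" for T
  proof -
    obtain C where "\<And>u. u \<in> vecs HX \<Longrightarrow> vnorm CY u \<le> C * vnorm HX u"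
      using emb.extends_identity_bound[OF T[unfolded embedding_iff]] by metis
    then show ?thesis by (intro necessity[of C]) (simp add: HX_simps)
  qed
  show ?thesis
    unfolding integral_condition_iff_summable[OF \<open>\<phi> \<in> class_M\<close>]
  proof (intro conjI iffI allI impI)
    show "\<exists>!T. embedding_extending_identity E L s \<phi> q T" if "summable (\<lambda>k. 1 / (\<phi> (2 ^ k))\<^sup>2)"
      by (rule sufficiency(1)[OF that])
    show "summable (\<lambda>k. 1 / (\<phi> (2 ^ k))\<^sup>2)" if "\<exists>!T. embedding_extending_identity E L s \<phi> q T"
      using nec ex1_implies_ex[OF that] by (elim exE)
    show "compact_operator (H_bundle E L s \<phi>) CY T" if "embedding_extending_identity E L s \<phi> q T" for T
      by (rule sufficiency(2)[OF nec[OF that] that])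
  qed
qed

end
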